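(* Let $p\ge5$ be a prime. (a) There are modular forms $b_{ij}\in B_i(\mathbb{Z}_p)$, for $i,j\in\mathbb{Z}_{\ge0}$, with the following property. For every $\kappa\in\mathcal{B}\setminus\{1\}$, the Katz expansion of $E^\ast_\kappa/V(E^\ast_\kappa)$ is $$\frac{E^\ast_\kappa}{V(E^\ast_\kappa)}=\sum_{i\ge0}\frac{\beta_i(w(\kappa))}{E_{p-1}^i},\qquad \beta_i(w(\kappa)):=\sum_{j\ge0}b_{ij}\,w(\kappa)^j .$$ (b) Put $c_p=\frac{2}{3}\left(1-\frac{p}{(p-1)^2}\right)\frac{1}{p+1}$, so that $0<c_p<1$. Then the forms $b_{ij}$ in (a) satisfy $v_p(b_{ij})\ge c_p\, i-j$ for all $i,j\ge0$.
   Context: $v_p$ is the $p$-adic valuation on $\mathbb{C}_p$ with $v_p(p)=1$. For a modular form, $v_p$ denotes the minimum of the valuations of its $q$-expansion coefficients. $\mathcal{W}$ is the group of continuous characters $\mathbb{Z}_p^\times\to\mathbb{C}_p^\times$. $\mathcal{B}$ is the subgroup of characters trivial on the $(p-1)$st roots of unity. $w(\kappa)=\kappa(1+p)-1$. For $\kappa\in\mathcal{B}\setminus\{1\}$, $E^\ast_\kappa=1+\frac{2}{\zeta^\ast(\kappa)}\sum_{n\ge1}\bigl(\sum_{d\mid n,\,p\nmid d}\kappa(d)d^{-1}\bigr)q^n$, where $\zeta^\ast$ is the $p$-adic zeta function. This is an overconvergent modular function over the ring of integers $O$ of the field generated by the values of $\kappa$. $V$ is the operator $q\mapsto q^p$.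 $E_{p-1}$ is the level-one normalized Eisenstein series of weight $p-1$. Let $d_k=\dim M_k(\mathbb{Q}_p)$ for level-one forms $M_k$. For $i\ge1$, $B_i(\mathbb{Z}_p)$ is a fixed complement with $M_{i(p-1)}(\mathbb{Z}_p)=E_{p-1}M_{(i-1)(p-1)}(\mathbb{Z}_p)\oplus B_i(\mathbb{Z}_p)$. It is the free $\mathbb{Z}_p$-module with basis forms $g_{i,j}\in M_{i(p-1)}(\mathbb{Z}_p)$, $d_{(i-1)(p-1)}\le j\le d_{i(p-1)}-1$, whose $q$-expansion begins $q^j+O(q^{j+1})$. Put $B_0(\mathbb{Z}_p)=\mathbb{Z}_p$ and $B_i(O)=B_i(\mathbb{Z}_p)\otimes O$. The Katz expansion of an overconvergent modular function $f$ of tame level $1$ over $O$ is its unique expression $f=\sum_{i\ge0}b_i/E_{p-1}^i$ with $b_i\in B_i(O)$. *)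

theory Defs
  imports "HOL-Analysis.Analysis" "HOL-Number_Theory.Modular_Inverse"
begin

section \<open>The field of \<open>p\<close>-adic complex numbers\<close>

definition Zp :: "'c :: {field_char_0, metric_space} set" where
  "Zp = closure \<int>"

definition Qp :: "'c :: {field_char_0, metric_space} set" where
  "Qp = closure \<rat>"

definition Zp_units :: "'c :: {field_char_0, metric_space} set" where
  "Zp_units = {x \<in> Zp. \<exists>y\<in>Zp. x * y = 1}"

definition Qp_bar :: "'c :: {field_char_0, metric_space} set" where
  "Qp_bar = {x. \<exists>P :: 'c poly. P \<noteq> 0 \<and> (\<forall>i. coeff P i \<in> Qp) \<and> poly P x = 0}"

text \<open>
  A type of class \<^class>\<open>complete_space\<close> is a model of \<open>\<complex>\<^sub>p\<close> if its metric is induced by a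
  multiplicative non-archimedean absolute value, here \<open>x \<mapsto> dist x 0\<close>, with \<open>|p| = 1/p\<close>, and if the
  algebraic closure of \<open>\<rat>\<^sub>p\<close> in it is algebraically closed and dense. Multiplicativity, the strong
  triangle inequality and \<open>|p| = 1/p\<close> force the absolute value to be the \<open>p\<close>-adic one on \<open>\<rat>\<close>, so by
  completeness \<^const>\<open>Qp\<close> and \<^const>\<open>Zp\<close> are \<open>\<rat>\<^sub>p\<close> and \<open>\<int>\<^sub>p\<close>, and the whole type is the completion
  of an algebraic closure of \<open>\<rat>\<^sub>p\<close>.
\<close>

definition padic_complex :: "nat \<Rightarrow> 'c :: {field_char_0, complete_space} itself \<Rightarrow> bool" where
  "padic_complex p _ \<longleftrightarrow>
     (\<forall>x y z :: 'c. dist (x + z) (y + z) = dist x y) \<and>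
     (\<forall>x y :: 'c. dist (x * y) 0 = dist x 0 * dist y 0) \<and>
     (\<forall>x y z :: 'c. dist x z \<le> max (dist x y) (dist y z)) \<and>
     dist (of_nat p :: 'c) 0 = 1 / real p \<and>
     (\<forall>P :: 'c poly. degree P > 0 \<and> (\<forall>i. coeff P i \<in> Qp_bar) \<longrightarrow> (\<exists>x\<in>Qp_bar. poly P x = 0)) \<and>
     closure (Qp_bar :: 'c set) = UNIV"

definition vp :: "nat \<Rightarrow> 'c :: {field_char_0, metric_space} \<Rightarrow> ereal" where
  "vp p x = (if x = 0 then \<infinity> else ereal (- log (real p) (dist x 0)))"

definition vp_fps :: "nat \<Rightarrow> 'c :: {field_char_0, metric_space} fps \<Rightarrow> ereal" where
  "vp_fps p f = (INF n. vp p (fps_nth f n))"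


section \<open>Weight characters\<close>

definition weight_chars :: "('c :: {field_char_0, metric_space} \<Rightarrow> 'c) set" where
  "weight_chars = {\<kappa> \<in> Zp_units \<rightarrow>\<^sub>E (- {0}).
     (\<forall>x\<in>Zp_units. \<forall>y\<in>Zp_units. \<kappa> (x * y) = \<kappa> x * \<kappa> y) \<and> continuous_on Zp_units \<kappa>}"

definition trivial_char :: "'c :: {field_char_0, metric_space} \<Rightarrow> 'c" where
  "trivial_char = (\<lambda>x\<in>Zp_units. 1)"

definition weight_chars_B :: "nat \<Rightarrow> ('c :: {field_char_0, metric_space} \<Rightarrow> 'c) set" where
  "weight_chars_B p = {\<kappa> \<in> weight_chars. \<forall>x\<in>Zp_units. x ^ (p - 1) = 1 \<longrightarrow> \<kappa> x = 1}"

definition wt :: "nat \<Rightarrow> ('c :: field_char_0 \<Rightarrow> 'c) \<Rightarrow> 'c" where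
  "wt p \<kappa> = \<kappa> (1 + of_nat p) - 1"

definition is_subfield :: "'c :: field set \<Rightarrow> bool" where
  "is_subfield K \<longleftrightarrow> 1 \<in> K \<and> (\<forall>x\<in>K. \<forall>y\<in>K. x - y \<in> K \<and> x * y \<in> K) \<and> (\<forall>x\<in>K. inverse x \<in> K)"

text \<open>
  The field generated by the values of \<open>\<kappa>\<close> is taken as a complete field: it is the closure of the
  algebraically generated one. The closure only matters if \<open>\<kappa>\<close> has values that are transcendental
  over \<open>\<rat>\<^sub>p\<close>; otherwise the generated field is a finite extension of \<open>\<rat>\<^sub>p\<close>.
\<close>

definition value_field :: "('c :: {field_char_0, metric_space} \<Rightarrow> 'c) \<Rightarrow> 'c set" where
  "value_field \<kappa> = closure (\<Inter>{K. is_subfield K \<and> Qp \<subseteq> K \<and> \<kappa> ` Zp_units \<subseteq> K})"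

definition value_ring :: "nat \<Rightarrow> ('c :: {field_char_0, metric_space} \<Rightarrow> 'c) \<Rightarrow> 'c set" where
  "value_ring p \<kappa> = {x \<in> value_field \<kappa>. vp p x \<ge> 0}"


section \<open>The \<open>p\<close>-adic zeta function and the Eisenstein family\<close>

text \<open>
  The regularized Bernoulli distribution \<open>E\<^sub>1\<^sub>,\<^sub>c(a + p\<^sup>n\<int>\<^sub>p) = B\<^sub>1({a/p\<^sup>n}) - c B\<^sub>1({c\<^sup>-\<^sup>1a/p\<^sup>n})\<close> with
  \<open>B\<^sub>1(x) = x - 1/2\<close>, where \<open>c\<close> is an integer prime to \<open>p\<close>; it is a \<open>\<int>\<^sub>p\<close>-valued measure.
\<close>

definition bernoulli_measure :: "nat \<Rightarrow> int \<Rightarrow> nat \<Rightarrow> int \<Rightarrow> 'c :: field_char_0" where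
  "bernoulli_measure p c n a =
     (of_int (a mod int p ^ n) / of_nat p ^ n - 1 / 2) -
     of_int c * (of_int ((modular_inverse (int p ^ n) c * a) mod int p ^ n) / of_nat p ^ n - 1 / 2)"

text \<open>
  \<open>\<zeta>\<^sup>*(\<kappa>) = (\<kappa>(c) - 1)\<^sup>-\<^sup>1 \<integral> \<kappa>(a) a\<^sup>-\<^sup>1 dE\<^sub>1\<^sub>,\<^sub>c(a)\<close>, the integral being over \<open>\<int>\<^sub>p\<^sup>\<times>\<close> and a limit of Riemann
  sums. The value does not depend on \<open>c\<close> as long as \<open>\<kappa>(c) \<noteq> 1\<close>; the choice \<open>c = 1 + p\<close> works for all
  nontrivial \<open>\<kappa>\<close> that are trivial on the \<open>(p-1)\<close>st roots of unity. For \<open>\<kappa>(x) = x\<^sup>k\<close> with \<open>k \<ge> 1\<close> divisible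
  by \<open>p - 1\<close> one gets \<open>\<zeta>\<^sup>*(\<kappa>) = (1 - p\<^sup>k\<^sup>-\<^sup>1) \<zeta>(1 - k)\<close>.
\<close>

definition padic_zeta :: "nat \<Rightarrow> ('c :: {field_char_0, metric_space} \<Rightarrow> 'c) \<Rightarrow> 'c" where
  "padic_zeta p \<kappa> =
     lim (\<lambda>n. \<Sum>a \<in> {a \<in> {0..<int p ^ n}. \<not> int p dvd a}.
                \<kappa> (of_int a) / of_int a * bernoulli_measure p (1 + int p) n a) /
     (\<kappa> (1 + of_nat p) - 1)"

definition Eis_star :: "nat \<Rightarrow> ('c :: {field_char_0, metric_space} \<Rightarrow> 'c) \<Rightarrow> 'c fps" where
  "Eis_star p \<kappa> = Abs_fps (\<lambda>n. if n = 0 then 1 else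
     2 / padic_zeta p \<kappa> * (\<Sum>d | d dvd n \<and> \<not> p dvd d. \<kappa> (of_nat d) / of_nat d))"

definition V_op :: "nat \<Rightarrow> 'c :: field fps \<Rightarrow> 'c fps" where
  "V_op p f = fps_compose f (fps_X ^ p)"


section \<open>Level one modular forms\<close>

definition modular_form :: "nat \<Rightarrow> (complex \<Rightarrow> complex) \<Rightarrow> bool" where
  "modular_form k f \<longleftrightarrow>
     f holomorphic_on {z. Im z > 0} \<and>
     (\<forall>a b c d :: int. a * d - b * c = 1 \<longrightarrow> (\<forall>z. Im z > 0 \<longrightarrow>
        f ((of_int a * z + of_int b) / (of_int c * z + of_int d)) =
          (of_int c * z + of_int d) ^ k * f z)) \<and>
     (\<exists>C>0. bounded (f ` {z. Im z \<ge> C}))"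

definition int_modular_forms :: "nat \<Rightarrow> int fps set" where
  "int_modular_forms k = {F. \<exists>f. modular_form k f \<and> (\<forall>z. Im z > 0 \<longrightarrow>
     (\<lambda>n. of_int (fps_nth F n) * exp (2 * of_real pi * \<i> * z) ^ n) sums f z)}"

definition lin_span :: "'c :: field set \<Rightarrow> 'c fps set \<Rightarrow> 'c fps set" where
  "lin_span R S =
     {(\<Sum>f\<in>T. fps_const (c f) * f) | T c. finite T \<and> T \<subseteq> S \<and> (\<forall>f\<in>T. c f \<in> R)}"

text \<open>
  \<open>M\<^sub>k(R) = M\<^sub>k(\<int>) \<otimes> R\<close>, identified with its set of \<open>q\<close>-expansions, for subrings \<open>R\<close> of \<open>\<complex>\<^sub>p\<close>.
\<close>

definition modular_forms :: "'c :: field_char_0 set \<Rightarrow> nat \<Rightarrow> 'c fps set" where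
  "modular_forms R k = lin_span R ((\<lambda>F. Abs_fps (\<lambda>n. of_int (fps_nth F n))) ` int_modular_forms k)"

definition lin_indep :: "'c :: field set \<Rightarrow> 'c fps set \<Rightarrow> bool" where
  "lin_indep K T \<longleftrightarrow>
     (\<forall>c. (\<forall>f\<in>T. c f \<in> K) \<and> (\<Sum>f\<in>T. fps_const (c f) * f) = 0 \<longrightarrow> (\<forall>f\<in>T. c f = 0))"

definition dim_over :: "'c :: field set \<Rightarrow> 'c fps set \<Rightarrow> nat" where
  "dim_over K S = (THE n. \<exists>T. finite T \<and> card T = n \<and> lin_indep K T \<and> lin_span K T = S)"

definition dim_M :: "'c :: {field_char_0, metric_space} itself \<Rightarrow> nat \<Rightarrow> nat" where
  "dim_M _ k = dim_over (Qp :: 'c set) (modular_forms Qp k)"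

definition bernoulli_num :: "nat \<Rightarrow> 'c :: field_char_0" where
  "bernoulli_num n = fact n * fps_nth (fps_X / (fps_exp 1 - 1)) n"

definition Eis :: "nat \<Rightarrow> 'c :: field_char_0 fps" where
  "Eis k = Abs_fps (\<lambda>n. if n = 0 then 1 else
     - (2 * of_nat k / bernoulli_num k) * (\<Sum>d | d dvd n. of_nat d ^ (k - 1)))"


section \<open>Katz expansions\<close>

text \<open>
  The family \<open>g\<close> holds the basis forms \<open>g\<^sub>i\<^sub>,\<^sub>j\<close>; only the entries with \<open>i \<ge> 1\<close> and
  \<open>j \<in> katz_index TYPE('c) p i\<close> are used. \<open>katz_B p g R i\<close> is \<open>B\<^sub>i(R)\<close>.
\<close>

definition katz_index :: "'c :: {field_char_0, metric_space} itself \<Rightarrow> nat \<Rightarrow> nat \<Rightarrow> nat set" where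
  "katz_index T p i = {dim_M T ((i - 1) * (p - 1)) ..< dim_M T (i * (p - 1))}"

definition katz_B ::
  "nat \<Rightarrow> (nat \<Rightarrow> nat \<Rightarrow> 'c :: {field_char_0, metric_space} fps) \<Rightarrow> 'c set \<Rightarrow> nat \<Rightarrow> 'c fps set" where
  "katz_B p g R i =
     (if i = 0 then fps_const ` R else lin_span R (g i ` katz_index TYPE('c) p i))"

definition katz_basis :: "nat \<Rightarrow> (nat \<Rightarrow> nat \<Rightarrow> 'c :: {field_char_0, metric_space} fps) \<Rightarrow> bool" where
  "katz_basis p g \<longleftrightarrow> (\<forall>i\<ge>1.
     (\<forall>j \<in> katz_index TYPE('c) p i. g i j \<in> modular_forms Zp (i * (p - 1)) \<and>
        (\<forall>n<j. fps_nth (g i j) n = 0) \<and> fps_nth (g i j) j = 1) \<and>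
     modular_forms Zp (i * (p - 1)) =
       {Eis (p - 1) * f + h | f h. f \<in> modular_forms Zp ((i - 1) * (p - 1)) \<and> h \<in> katz_B p g Zp i} \<and>
     (\<lambda>f. Eis (p - 1) * f) ` modular_forms Zp ((i - 1) * (p - 1)) \<inter> katz_B p g Zp i = {0})"

text \<open>
  \<open>b\<close> is the Katz expansion over \<open>R\<close> of the overconvergent modular function with \<open>q\<close>-expansion \<open>f\<close>.
  The growth condition is overconvergence: by Katz, \<open>\<Sum> b\<^sub>i / E\<^sub>p\<^sub>-\<^sub>1\<^sup>i\<close> is overconvergent of radius \<open>\<rho>\<close>
  iff \<open>v\<^sub>p(b\<^sub>i) - \<rho> i \<rightarrow> \<infinity>\<close>. Since \<open>v\<^sub>p(b\<^sub>i) \<rightarrow> \<infinity>\<close>, the coefficientwise convergence below is uniform.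
\<close>

definition is_katz_expansion ::
  "nat \<Rightarrow> (nat \<Rightarrow> nat \<Rightarrow> 'c :: {field_char_0, metric_space} fps) \<Rightarrow> 'c set \<Rightarrow> 'c fps \<Rightarrow>
     (nat \<Rightarrow> 'c fps) \<Rightarrow> bool" where
  "is_katz_expansion p g R f b \<longleftrightarrow>
     (\<forall>i. b i \<in> katz_B p g R i) \<and>
     (\<exists>\<rho>>0. (\<lambda>i. vp_fps p (b i) - ereal (\<rho> * real i)) \<longlonglongrightarrow> \<infinity>) \<and>
     (\<forall>n. (\<lambda>i. fps_nth (b i / Eis (p - 1) ^ i) n) sums fps_nth f n)"

definition katz_beta :: "(nat \<Rightarrow> 'c :: {field_char_0, metric_space} fps) \<Rightarrow> 'c \<Rightarrow> 'c fps" where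
  "katz_beta b w = Abs_fps (\<lambda>n. \<Sum>j. fps_nth (b j) n * w ^ j)"

definition eis_katz_family ::
  "nat \<Rightarrow> (nat \<Rightarrow> nat \<Rightarrow> 'c :: {field_char_0, metric_space} fps) \<Rightarrow> (nat \<Rightarrow> nat \<Rightarrow> 'c fps) \<Rightarrow> bool" where
  "eis_katz_family p g b \<longleftrightarrow>
     (\<forall>i j. b i j \<in> katz_B p g Zp i) \<and>
     (\<forall>\<kappa> \<in> weight_chars_B p - {trivial_char}.
        is_katz_expansion p g (value_ring p \<kappa>) (Eis_star p \<kappa> / V_op p (Eis_star p \<kappa>))
          (\<lambda>i. katz_beta (b i) (wt p \<kappa>)))"

definition c_const :: "nat \<Rightarrow> real" where
  "c_const p = 2 / 3 * (1 - real p / (real p - 1)\<^sup>2) * (1 / (real p + 1))"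

end

theory Submission
  imports Defs "HOL-Complex_Analysis.Complex_Analysis" "HOL-Number_Theory.Residues"
begin

hide_const (open) UnivPoly.up_ring.coeff UnivPoly.up_ring.monom Module.module.smult

text \<open>
  Write \<open>E\<close> for \<open>E\<^sub>p\<^sub>-\<^sub>1\<close> and \<open>Fil\<^sub>i\<close> for the quotients by \<open>E\<^sup>i\<close> of the forms of weight \<open>i(p-1)\<close> over \<open>\<int>\<^sub>p\<close>, and let
  \<open>A(\<rho>)\<close> be the \<open>p\<close>-adic closure of the sum of the \<open>p\<^sup>e Fil\<^sub>i\<close> with \<open>e \<ge> \<rho> i\<close>. This is a ring, and its elements
  are the sums of Katz expansions with \<open>v\<^sub>p(b\<^sub>i) \<ge> \<rho> i\<close>. For a form \<open>f\<close> of weight \<open>i(p-1)\<close>, applying the Hecke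
  operator \<open>T\<^sub>p\<close> to the forms \<open>f E\<^sup>l\<close> and combining them so that the \<open>U\<^sub>p\<close>-parts cancel modulo a power of \<open>p\<close>
  places \<open>V f / E\<^sup>i\<close> modulo \<open>p\<^sup>K\<close> in a \<open>Fil\<close> whose index exceeds \<open>p i\<close> by at most \<open>2 K\<close>. So \<open>V\<close> worsens the rate
  of overconvergence roughly by the factor \<open>p\<close>, and \<open>V E / E\<close> lies in \<open>A(1/(p+2))\<close>; no geometry of
  modular curves is needed.

  At the classical characters \<open>x \<mapsto> x\<^sup>(\<^sup>p\<^sup>-\<^sup>1\<^sup>)\<^sup>m\<close> the series \<open>E\<^sup>*\<close> is the \<open>p\<close>-stabilised Eisenstein series \<open>E\<^sup>*\<^sub>m\<close>. The
  \<open>n\<close>-th differences of \<open>m \<mapsto> E\<^sup>*\<^sub>m / E\<^sup>m\<close> are divisible by \<open>p\<^sup>n\<close>, so its Mahler expansion, in which the \<open>n!\<close> cost a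
  factor \<open>(p-2)/(p-1)\<close> in the rate, turns the quotient \<open>E\<^sup>*\<^sub>m / V E\<^sup>*\<^sub>m\<close> into a convergent power series in \<open>w/p\<close> with
  coefficients in \<open>A(c\<^sub>p)\<close>. On the other hand it is a power series in \<open>w\<close> with integral coefficients \<open>F\<^sub>j\<close>,
  because \<open>\<kappa>(d)\<close> and \<open>w \<zeta>\<^sup>*(\<kappa>)\<close> are. Comparing the two gives \<open>p\<^sup>j F\<^sub>j \<in> A(c\<^sub>p)\<close>, which is the bound on \<open>b\<^sub>i\<^sub>j\<close>. Uniqueness
  of Katz expansions at infinitely many classical characters forces every family to be this one.
\<close>

section \<open>Finite differences and the filtration by powers of \<open>E\<close>\<close>

text \<open>The rate is the worse of two losses. With h_m = E*_m / E^m, the quotient is h_m (V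
  h_m)^(-1) (E / V E)^m. Here h_m has rate (p-2)/p, reduced by the n! to (p-2)^2 / (p (p-1)), and V
  divides this by p; the power of E / V E has rate 1/(p+2), reduced by the n! to (p-2) /
  ((p+2)(p-1)). Beyond 0 < c_p < 1, all that is used of c_p is that it lies below both numbers.

  The obstacle is that classical characters reach only parameters w divisible by p, where the
  quotient is a series in tau = w / p with coefficients p^j F_j. Overconvergence is therefore
  visible for p^j F_j only, and this is the origin of the term -j. Reading coefficients off values
  needs a quantitative identity principle: the points tau(p^N) have exact valuation N, so a
  polynomial that is small at all of them has small coefficients.

  The growth argument runs in the abstract locale \<open>katz_algebra\<close>, whose key assumption
  is saturation: a form with q-expansion divisible by p is p times a form.\<close>

lemma sum_closed:
  fixes f :: "'b \<Rightarrow> 'a :: comm_monoid_add"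
  assumes "0 \<in> X" "\<And>x y. x \<in> X \<Longrightarrow> y \<in> X \<Longrightarrow> x + y \<in> X" "\<And>i. i \<in> A \<Longrightarrow> f i \<in> X"
  shows "sum f A \<in> X"
  using assms(3) by (induction A rule: infinite_finite_induct) (auto intro: assms)

lemma coeff_mult_closed:
  fixes P Q :: "'a :: comm_ring_1 poly"
  assumes "0 \<in> X" "\<And>x y. x \<in> X \<Longrightarrow> y \<in> X \<Longrightarrow> x + y \<in> X" "\<And>x y. x \<in> X \<Longrightarrow> y \<in> X \<Longrightarrow> x * y \<in> X"
    and "\<And>i. coeff P i \<in> X" "\<And>i. coeff Q i \<in> X"
  shows "coeff (P * Q) i \<in> X"
  unfolding coeff_mult by (rule sum_closed) (use assms in auto)

lemma coeff_power_closed: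
  fixes P :: "'a :: comm_ring_1 poly"
  assumes "0 \<in> X" "1 \<in> X" "\<And>x y. x \<in> X \<Longrightarrow> y \<in> X \<Longrightarrow> x + y \<in> X"
    "\<And>x y. x \<in> X \<Longrightarrow> y \<in> X \<Longrightarrow> x * y \<in> X"
    and "\<And>i. coeff P i \<in> X"
  shows "coeff (P ^ n) i \<in> X"
proof (induction n arbitrary: i)
  case (Suc n)
  then show ?case unfolding power_Suc by (intro coeff_mult_closed) (use assms in auto)
qed (use assms in \<open>auto simp: one_pCons coeff_pCons split: nat.splits\<close>)

lemma fact_add_prod: "fact (m + r) = fact m * (\<Prod>i=1..r. m + i)" for m r :: nat
  by (induction r) (auto simp: algebra_simps)

text \<open>In each block of p consecutive factors of (pq)! one is a multiple of p and the other p -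
  1 are prime to p; the multiples together contribute p^q q!.\<close>

lemma fact_mult_prime:
  fixes p q :: nat
  assumes "prime p"
  shows "\<exists>k. \<not> p dvd k \<and> fact (p * q) = p ^ q * fact q * k"
proof (induction q)
  case 0
  then show ?case using assms by (intro exI[of _ 1]) (auto simp: prime_nat_iff)
next
  case (Suc q)
  then obtain k where k: "\<not> p dvd k" "fact (p * q) = p ^ q * fact q * k" by blast
  have "p > 0" using assms prime_gt_0_nat by blast
  then obtain p' where p': "p = Suc p'" using gr0_implies_Suc by blast
  have "fact (p * Suc q) = (fact (p * q + p) :: nat)" by (simp add: algebra_simps)
  also have "\<dots> = fact (p * q) * ((\<Prod>i=1..p'. p * q + i) * (p * q + p))"
    by (subst fact_add_prod) (simp add: p')
  also have "\<dots> = p ^ Suc q * fact (Suc q) * (k * (\<Prod>i=1..p'. p * q + i))"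
    by (simp add: k algebra_simps)
  finally have 1: "fact (p * Suc q) = p ^ Suc q * fact (Suc q) * (k * (\<Prod>i=1..p'. p * q + i))" .
  have "\<not> p dvd p * q + i" if "i \<in> {1..p'}" for i
  proof
    assume "p dvd p * q + i"
    hence "p dvd i" by (simp add: dvd_add_right_iff)
    thus False using that p' by (auto dest: dvd_imp_le)
  qed
  hence "\<not> p dvd (\<Prod>i=1..p'. p * q + i)" using assms
    by (subst prime_dvd_prod_iff) auto
  hence "\<not> p dvd k * (\<Prod>i=1..p'. p * q + i)" using k assms by (simp add: prime_dvd_mult_iff)
  then show ?case using 1 by blast
qed

text \<open>Legendre's bound v_p(n!) \<le> n / (p-1), by recursion from n to n div p. It measures
  what the n! cost in Mahler expansions.\<close>

lemma fact_prime_part: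
  fixes p n :: nat
  assumes "prime p"
  shows "\<exists>v k. fact n = p ^ v * k \<and> \<not> p dvd k \<and> v * (p - 1) \<le> n"
proof (induction n rule: less_induct)
  case (less n)
  define q r where "q = n div p" and "r = n mod p"
  have n: "n = p * q + r" by (simp add: q_def r_def)
  have p1: "p > 1" using assms prime_gt_1_nat by blast
  show ?case
  proof (cases "n = 0")
    case True
    then show ?thesis using p1 by (intro exI[of _ 0] exI[of _ 1]) auto
  next
    case False
    hence "q < n" using p1 by (simp add: q_def)
    from less[OF this] obtain v k where vk: "fact q = p ^ v * k" "\<not> p dvd k" "v * (p - 1) \<le> q" by blast
    obtain l where l: "\<not> p dvd l" "fact (p * q) = p ^ q * fact q * l" using fact_mult_prime[OF assms] by blast
    have "\<not> p dvd p * q + i" if "i \<in> {1..r}" for i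
    proof -
      have "r < p" using p1 by (simp add: r_def)
      thus ?thesis using that by (auto simp: dvd_add_right_iff dest: dvd_imp_le)
    qed
    hence nd: "\<not> p dvd (\<Prod>i=1..r. p * q + i)" using assms
      by (subst prime_dvd_prod_iff) auto
    have "fact n = p ^ (q + v) * (k * l * (\<Prod>i=1..r. p * q + i))"
      unfolding n fact_add_prod l vk by (simp add: power_add algebra_simps)
    moreover have "\<not> p dvd k * l * (\<Prod>i=1..r. p * q + i)"
      using nd vk l assms by (simp add: prime_dvd_mult_iff)
    moreover have "(q + v) * (p - 1) \<le> n"
    proof -
      have "(q + v) * (p - 1) \<le> q * (p - 1) + q" using vk by (simp add: algebra_simps)
      also have "\<dots> = p * q" using p1 by (cases p) auto
      finally show ?thesis using n by simp
    qed
    ultimately show ?thesis by blast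
  qed
qed

text \<open>The n-th forward difference. The recursion differences the function and not the result,
  which suits the induction for the Leibniz rule; \<open>fdiff_Suc'\<close> gives the other
  recursion.\<close>

primrec fdiff :: "nat \<Rightarrow> (nat \<Rightarrow> 'a :: ab_group_add) \<Rightarrow> nat \<Rightarrow> 'a" where
  "fdiff 0 f = f"
| "fdiff (Suc n) f = fdiff n (\<lambda>x. f (x + 1) - f x)"

lemma fdiff_add: "fdiff n (\<lambda>x. f x + g x) x = fdiff n f x + fdiff n g x"
proof (induction n arbitrary: f g)
  case (Suc n)
  have "(\<lambda>x. f (x + 1) + g (x + 1) - (f x + g x)) = (\<lambda>x. (f (x + 1) - f x) + (g (x + 1) - g x))"
    by (auto simp: algebra_simps)
  then show ?case by (simp only: fdiff.simps Suc)
qed auto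

lemma fdiff_Suc': "fdiff (Suc n) f x = fdiff n f (x + 1) - fdiff n f x"
proof (induction n arbitrary: f)
  case (Suc n)
  then show ?case by (simp only: fdiff.simps(2)[of "Suc n"]) simp
qed auto

lemma fdiff_closed:
  assumes "\<And>x y. x \<in> X \<Longrightarrow> y \<in> X \<Longrightarrow> x - y \<in> X" "\<And>m. x \<le> m \<Longrightarrow> m \<le> x + n \<Longrightarrow> f m \<in> X"
  shows "fdiff n f x \<in> X"
  using assms(2)
proof (induction n arbitrary: x)
  case (Suc n)
  show ?case unfolding fdiff_Suc' by (intro assms(1) Suc) (use Suc.prems in auto)
qed auto

text \<open>Newton's interpolation formula; at x = 0 it is the Mahler expansion with the differences
  as coefficients.\<close>

lemma newton_forward: "f (m + x) = (\<Sum>n\<le>m. of_nat (m choose n) * fdiff n f x)"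
  for f :: "nat \<Rightarrow> 'a :: comm_ring_1"
proof (induction m arbitrary: x)
  case (Suc m)
  let ?d = "\<lambda>n. fdiff n f x"
  have "f (Suc m + x) = f (m + Suc x)" by simp
  also have "\<dots> = (\<Sum>n\<le>m. of_nat (m choose n) * (?d n + ?d (Suc n)))"
    unfolding Suc fdiff_Suc' by simp
  also have "\<dots> = (\<Sum>n\<le>m. of_nat (m choose n) * ?d n) + (\<Sum>n\<le>m. of_nat (m choose n) * ?d (Suc n))"
    by (simp add: algebra_simps sum.distrib)
  also have "(\<Sum>n\<le>m. of_nat (m choose n) * ?d n) = (\<Sum>n\<le>Suc m. of_nat (m choose n) * ?d n)"
    by (simp add: binomial_eq_0)
  also have "\<dots> = ?d 0 + (\<Sum>n\<le>m. of_nat (m choose Suc n) * ?d (Suc n))"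
    by (subst sum.atMost_Suc_shift) (simp del: sum.atMost_Suc)
  also have "\<dots> + (\<Sum>n\<le>m. of_nat (m choose n) * ?d (Suc n)) =
     ?d 0 + (\<Sum>n\<le>m. of_nat (Suc m choose Suc n) * ?d (Suc n))"
    by (simp add: algebra_simps sum.distrib)
  also have "\<dots> = (\<Sum>n\<le>Suc m. of_nat (Suc m choose n) * ?d n)"
    by (subst sum.atMost_Suc_shift) simp
  finally show ?case .
qed auto

lemma fdiff_shift: "fdiff n (\<lambda>x. f (x + 1)) x = fdiff n f (x + 1)"
  by (induction n arbitrary: f) auto

lemma fdiff_scale: "fdiff n (\<lambda>x. c * f x) x = c * fdiff n f x" for c :: "'a :: comm_ring_1"
proof (induction n arbitrary: f)
  case (Suc n)
  show ?case by (simp add: right_diff_distrib[symmetric] Suc)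
qed auto

lemma fdiff_power: "fdiff n (\<lambda>x. v ^ x) x = v ^ x * (v - 1) ^ n" for v :: "'a :: comm_ring_1"
proof (induction n arbitrary: x)
  case (Suc n)
  show ?case unfolding fdiff_Suc' Suc by (simp add: algebra_simps)
qed auto

text \<open>Congruences modulo p^n in a subring of an integral domain. The locale is used twice: for
  Z_p itself and, through \<open>katz_algebra\<close>, for power series in q over Z_p.\<close>

locale padic_ring =
  fixes p :: nat
    and Z :: "'a :: {idom, ring_char_0} set"
  assumes prime_p: "prime p" and p_ge_5: "p \<ge> 5"
    and Z_one: "1 \<in> Z"
    and Z_diff: "x \<in> Z \<Longrightarrow> y \<in> Z \<Longrightarrow> x - y \<in> Z"
    and Z_mult: "x \<in> Z \<Longrightarrow> y \<in> Z \<Longrightarrow> x * y \<in> Z"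
begin

abbreviation pp :: 'a where "pp \<equiv> of_nat p"

lemma p_nz [simp]: "p \<noteq> 0" and pp_nz: "pp \<noteq> 0" using prime_p by auto

lemma odd_p: "odd p" using prime_p p_ge_5 prime_odd_nat by auto

lemma Z_zero: "0 \<in> Z" using Z_diff[OF Z_one Z_one] by simp
lemma Z_uminus: "x \<in> Z \<Longrightarrow> -x \<in> Z" using Z_diff[OF Z_zero, of x] by simp
lemma Z_add: "x \<in> Z \<Longrightarrow> y \<in> Z \<Longrightarrow> x + y \<in> Z" using Z_diff[of x "-y"] Z_uminus[of y] by simp
lemma Z_of_nat: "of_nat n \<in> Z" by (induction n) (auto intro: Z_zero Z_add Z_one)
lemma Z_power: "x \<in> Z \<Longrightarrow> x ^ n \<in> Z" by (induction n) (auto intro: Z_one Z_mult)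
lemma Z_sum: "(\<And>i. i \<in> A \<Longrightarrow> f i \<in> Z) \<Longrightarrow> sum f A \<in> Z"
  by (rule sum_closed) (auto intro: Z_zero Z_add)
lemmas Z_ring_intros = Z_zero Z_uminus Z_add Z_of_nat Z_power Z_sum Z_one Z_diff Z_mult

definition pI :: "nat \<Rightarrow> 'a set" where "pI n = {pp ^ n * z | z. z \<in> Z}"

lemma pI_I: "z \<in> Z \<Longrightarrow> pp ^ n * z \<in> pI n" by (auto simp: pI_def)
lemma pI_Z: "x \<in> pI n \<Longrightarrow> x \<in> Z" by (auto simp: pI_def intro: Z_ring_intros)
lemma pI_0: "pI 0 = Z" by (auto simp: pI_def)
lemma pI_zero: "0 \<in> pI n" using pI_I[OF Z_zero] by simp
lemma pI_diff: "x \<in> pI n \<Longrightarrow> y \<in> pI n \<Longrightarrow> x - y \<in> pI n"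
  unfolding pI_def by clarify (metis Z_diff right_diff_distrib)
lemma pI_uminus: "x \<in> pI n \<Longrightarrow> -x \<in> pI n" using pI_diff[OF pI_zero, of x] by simp
lemma pI_add: "x \<in> pI n \<Longrightarrow> y \<in> pI n \<Longrightarrow> x + y \<in> pI n"
  using pI_diff[of x n "-y"] pI_uminus[of y n] by simp
lemma pI_sum: "(\<And>i. i \<in> A \<Longrightarrow> f i \<in> pI n) \<Longrightarrow> sum f A \<in> pI n"
  by (rule sum_closed) (auto intro: pI_zero pI_add)
lemma pI_mult: "x \<in> pI m \<Longrightarrow> y \<in> pI n \<Longrightarrow> x * y \<in> pI (m + n)"
proof -
  assume "x \<in> pI m" "y \<in> pI n"
  then obtain a b where "a \<in> Z" "b \<in> Z" "x = pp ^ m * a" "y = pp ^ n * b" by (auto simp: pI_def)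
  thus ?thesis using pI_I[OF Z_mult[of a b], of "m + n"] by (simp add: power_add algebra_simps)
qed
lemma pI_mult_left: "x \<in> pI n \<Longrightarrow> y \<in> Z \<Longrightarrow> y * x \<in> pI n"
  using pI_mult[of y 0 x n] pI_0 by simp
lemma pI_mult_right: "x \<in> pI n \<Longrightarrow> y \<in> Z \<Longrightarrow> x * y \<in> pI n"
  using pI_mult_left[of x n y] by (simp add: mult.commute)
lemma pI_mono: "x \<in> pI m \<Longrightarrow> n \<le> m \<Longrightarrow> x \<in> pI n"
proof -
  assume "x \<in> pI m" "n \<le> m"
  then obtain a where "a \<in> Z" "x = pp ^ m * a" by (auto simp: pI_def)
  thus ?thesis using pI_I[of "pp ^ (m - n) * a" n] \<open>n \<le> m\<close> 
    by (simp add: mult.assoc[symmetric] power_add[symmetric] Z_ring_intros)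
qed
lemma pI_power: "x \<in> pI n \<Longrightarrow> x ^ k \<in> pI (n * k)"
  by (induction k) (auto simp: pI_0 Z_one dest: pI_mult)
lemma pI_power1: "x \<in> pI 1 \<Longrightarrow> x ^ k \<in> pI k" using pI_power[of x 1 k] by simp
lemma pI_pow: "pp ^ n \<in> pI n" using pI_I[OF Z_one] by simp
lemma pI_cancel: "pp ^ m * x \<in> pI (m + n) \<Longrightarrow> x \<in> pI n"
  by (auto simp: pI_def power_add mult.assoc)
lemma pI_trans: "x - y \<in> pI n \<Longrightarrow> y - z \<in> pI n \<Longrightarrow> x - z \<in> pI n"
  using pI_add[of "x - y" n "y - z"] by simp
lemma pI_sym: "x - y \<in> pI n \<Longrightarrow> y - x \<in> pI n" using pI_uminus[of "x - y" n] by simp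
lemma pI_prod_cong: "x - x' \<in> pI n \<Longrightarrow> y - y' \<in> pI n \<Longrightarrow> y \<in> Z \<Longrightarrow> x' \<in> Z \<Longrightarrow> x * y - x' * y' \<in> pI n"
  using pI_add[OF pI_mult_right[of "x - x'" n y] pI_mult_left[of "y - y'" n x']] by (simp add: algebra_simps)

text \<open>The discrete Leibniz rule, with a gain of one factor p at each difference. The offsets
  \<open>d\<close> and \<open>e\<close> serve the induction: replacing \<open>f\<close> by its
  difference raises \<open>d\<close> by one while \<open>n\<close> drops by one.\<close>

lemma fdiff_mult:
  assumes "\<And>n x. fdiff n f x \<in> pI (n + d)" "\<And>n x. fdiff n g x \<in> pI (n + e)"
  shows "fdiff n (\<lambda>x. f x * g x) x \<in> pI (n + d + e)"
  using assms
proof (induction n arbitrary: f g d e x)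
  case 0
  then show ?case using pI_mult[of "f x" d "g x" e] "0.prems"(1)[of 0 x] "0.prems"(2)[of 0 x] by simp
next
  case (Suc n)
  have "fdiff (Suc n) (\<lambda>x. f x * g x) x =
     fdiff n (\<lambda>x. (f (x + 1) - f x) * g (x + 1) + f x * (g (x + 1) - g x)) x"
    by (simp add: algebra_simps)
  also have "\<dots> = fdiff n (\<lambda>x. (f (x + 1) - f x) * g (x + 1)) x + fdiff n (\<lambda>x. f x * (g (x + 1) - g x)) x"
    by (rule fdiff_add)
  also have "\<dots> \<in> pI (Suc n + d + e)"
  proof (rule pI_add)
    have 1: "fdiff n (\<lambda>x. f (x + 1) - f x) x \<in> pI (n + Suc d)" for n x
      using Suc.prems(1)[of "Suc n" x] by simp
    have 2: "fdiff n (\<lambda>x. g (x + 1)) x \<in> pI (n + e)" for n x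
      unfolding fdiff_shift by (rule Suc.prems)
    show "fdiff n (\<lambda>x. (f (x + 1) - f x) * g (x + 1)) x \<in> pI (Suc n + d + e)"
      using Suc.IH[OF 1 2, of x] by simp
    have 3: "fdiff n (\<lambda>x. g (x + 1) - g x) x \<in> pI (n + Suc e)" for n x
      using Suc.prems(2)[of "Suc n" x] by simp
    show "fdiff n (\<lambda>x. f x * (g (x + 1) - g x)) x \<in> pI (Suc n + d + e)"
      using Suc.IH[OF Suc.prems(1) 3, of x] by simp
  qed
  finally show ?case .
qed

end

text \<open>Intended reading: \<open>Z\<close> is the ring of power series in q over Z_p,
  \<open>S\<close> its constants, \<open>M i\<close> the forms of weight i(p-1), \<open>E\<close>
  and \<open>Ei\<close> are E_{p-1} and its inverse, \<open>Ek m\<close> and \<open>Es m\<close> the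
  Eisenstein series of weight (p-1)m and its p-stabilisation. \<open>M_sat\<close> is the
  q-expansion principle, \<open>T_M\<close> the stability under T_p = p^{k-1} V + U,
  \<open>U_V\<close> the projection formula, and \<open>Es_fdiff\<close> is of the type of Kummer
  congruences.\<close>

locale katz_algebra = padic_ring p Z
  for p :: nat and Z :: "'a :: {idom, ring_char_0} set" +
  fixes S :: "'a set"
    and M :: "nat \<Rightarrow> 'a set"
    and E Ei :: 'a
    and V U :: "'a \<Rightarrow> 'a"
    and Ek Es :: "nat \<Rightarrow> 'a"
  assumes S_sub: "S \<subseteq> Z"
    and S_one: "1 \<in> S"
    and S_diff: "x \<in> S \<Longrightarrow> y \<in> S \<Longrightarrow> x - y \<in> S"
    and S_mult: "x \<in> S \<Longrightarrow> y \<in> S \<Longrightarrow> x * y \<in> S"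
    and S_inv: "\<not> p dvd n \<Longrightarrow> \<exists>z\<in>S. of_nat n * z = 1"
    and M_sub: "M i \<subseteq> Z"
    and M_zero: "0 \<in> M i"
    and M_diff: "x \<in> M i \<Longrightarrow> y \<in> M i \<Longrightarrow> x - y \<in> M i"
    and M_scale: "s \<in> S \<Longrightarrow> x \<in> M i \<Longrightarrow> s * x \<in> M i"
    and M_mult: "x \<in> M i \<Longrightarrow> y \<in> M j \<Longrightarrow> x * y \<in> M (i + j)"
    and M_one: "1 \<in> M 0"
    and M_sat: "x \<in> Z \<Longrightarrow> of_nat p * x \<in> M i \<Longrightarrow> x \<in> M i"
    and E_in: "E \<in> M 1"
    and Ei_in: "Ei \<in> Z"
    and E_Ei: "E * Ei = 1"
    and E_cong: "\<exists>z\<in>Z. E = 1 + of_nat p * z"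
    and V_add: "V (x + y) = V x + V y"
    and V_mult: "V (x * y) = V x * V y"
    and V_one: "V 1 = 1"
    and V_Z: "x \<in> Z \<Longrightarrow> V x \<in> Z"
    and V_M0: "x \<in> M 0 \<Longrightarrow> V x = x"
    and U_add: "U (x + y) = U x + U y"
    and U_Z: "x \<in> Z \<Longrightarrow> U x \<in> Z"
    and U_V: "U (V x * y) = x * U y"
    and T_M: "i \<ge> 1 \<Longrightarrow> x \<in> M i \<Longrightarrow> of_nat p ^ ((p - 1) * i - 1) * V x + U x \<in> M i"
    and Ek_in: "i \<ge> 1 \<Longrightarrow> Ek i \<in> M i"
    and Es_0: "Es 0 = 1"
    and Es_Z: "Es m \<in> Z"
    and Es_eq: "m \<ge> 1 \<Longrightarrow> (1 - of_nat p ^ ((p - 1) * m - 1)) * Es m =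
                  Ek m - of_nat p ^ ((p - 1) * m - 1) * V (Ek m)"
    and Es_fdiff: "\<exists>z\<in>Z. fdiff n Es k = of_nat p ^ n * z"
begin

lemmas Z_intros = Z_ring_intros V_Z U_Z Ei_in Es_Z

lemma S_zero: "0 \<in> S" using S_diff[OF S_one S_one] by simp
lemma S_uminus: "x \<in> S \<Longrightarrow> -x \<in> S" using S_diff[OF S_zero, of x] by simp
lemma S_add: "x \<in> S \<Longrightarrow> y \<in> S \<Longrightarrow> x + y \<in> S" using S_diff[of x "-y"] S_uminus[of y] by simp
lemma S_of_nat: "of_nat n \<in> S" by (induction n) (auto intro: S_zero S_add S_one)
lemma S_power: "x \<in> S \<Longrightarrow> x ^ n \<in> S" by (induction n) (auto intro: S_one S_mult)

lemma M_uminus: "x \<in> M i \<Longrightarrow> -x \<in> M i" using M_diff[OF M_zero, of x] by simp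
lemma M_add: "x \<in> M i \<Longrightarrow> y \<in> M i \<Longrightarrow> x + y \<in> M i" using M_diff[of x i "-y"] M_uminus[of y i] by simp
lemma M_sum: "(\<And>i. i \<in> A \<Longrightarrow> f i \<in> M j) \<Longrightarrow> sum f A \<in> M j"
  by (rule sum_closed) (auto intro: M_zero M_add)
lemma E_Z: "E \<in> Z" using E_in M_sub by auto
lemma E_power: "E ^ n \<in> M n"
  by (induction n) (auto intro: M_one dest: M_mult[OF E_in])
lemma Ei_E: "Ei * E = 1" using E_Ei by (simp add: mult.commute)
lemma E_pow_Ei: "E ^ n * Ei ^ n = 1" by (simp add: E_Ei flip: power_mult_distrib)
lemma Ei_pow_E: "Ei ^ n * E ^ n = 1" by (simp add: Ei_E flip: power_mult_distrib)
lemma V_zero: "V 0 = 0" using V_add[of 0 0] by simp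
lemma V_uminus: "V (-x) = - V x" using V_add[of x "-x"] V_zero by (simp add: eq_neg_iff_add_eq_0 add.commute)
lemma V_diff: "V (x - y) = V x - V y" using V_add[of x "-y"] V_uminus by simp
lemma V_of_nat: "V (of_nat n) = of_nat n" by (induction n) (auto simp: V_zero V_add V_one)
lemma V_power: "V (x ^ n) = V x ^ n" by (induction n) (auto simp: V_one V_mult)
lemma V_sum: "V (sum f A) = (\<Sum>i\<in>A. V (f i))"
  by (induction A rule: infinite_finite_induct) (auto simp: V_zero V_add)
lemma U_zero: "U 0 = 0" using U_add[of 0 0] by simp
lemma U_sum: "U (sum f A) = (\<Sum>i\<in>A. U (f i))"
  by (induction A rule: infinite_finite_induct) (auto simp: U_zero U_add)
lemma VE_VEi: "V E * V Ei = 1" by (metis E_Ei V_mult V_one)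

lemma pI_V: "x \<in> pI n \<Longrightarrow> V x \<in> pI n"
  by (auto simp: pI_def V_mult V_power V_of_nat intro: V_Z)
lemma pI_U: "x \<in> pI n \<Longrightarrow> U x \<in> pI n"
proof -
  assume "x \<in> pI n"
  then obtain a where "a \<in> Z" "x = pp ^ n * a" by (auto simp: pI_def)
  moreover have "U (pp ^ n * a) = pp ^ n * U a"
    using U_V[of "pp ^ n" a] by (simp add: V_power V_of_nat)
  ultimately show ?thesis by (auto intro: pI_I U_Z)
qed
lemma E_1: "E - 1 \<in> pI 1" using E_cong by (auto simp: pI_def)
lemma VE_1: "V E - 1 \<in> pI 1" using pI_V[OF E_1] by (simp add: V_diff V_one)

definition Fil :: "nat \<Rightarrow> 'a set" where "Fil i = {x \<in> Z. x * E ^ i \<in> M i}"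

lemma Fil_Z: "x \<in> Fil i \<Longrightarrow> x \<in> Z" by (auto simp: Fil_def)
lemma Fil_zero: "0 \<in> Fil i" by (auto simp: Fil_def Z_zero M_zero)
lemma Fil_diff: "x \<in> Fil i \<Longrightarrow> y \<in> Fil i \<Longrightarrow> x - y \<in> Fil i"
  by (auto simp: Fil_def Z_diff M_diff left_diff_distrib)
lemma Fil_uminus: "x \<in> Fil i \<Longrightarrow> -x \<in> Fil i" using Fil_diff[OF Fil_zero, of x] by simp
lemma Fil_add: "x \<in> Fil i \<Longrightarrow> y \<in> Fil i \<Longrightarrow> x + y \<in> Fil i"
  using Fil_diff[of x i "-y"] Fil_uminus[of y i] by simp
lemma Fil_mono: "x \<in> Fil i \<Longrightarrow> i \<le> j \<Longrightarrow> x \<in> Fil j"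
  using M_mult[of "x * E ^ i" i "E ^ (j - i)" "j - i"] E_power[of "j - i"]
  by (auto simp: Fil_def mult.assoc power_add[symmetric])
lemma Fil_mult: "x \<in> Fil i \<Longrightarrow> y \<in> Fil j \<Longrightarrow> x * y \<in> Fil (i + j)"
  using M_mult[of "x * E ^ i" i "y * E ^ j" j] by (auto simp: Fil_def Z_mult power_add algebra_simps)
lemma Fil_scale: "s \<in> S \<Longrightarrow> x \<in> Fil i \<Longrightarrow> s * x \<in> Fil i"
  using M_scale[of s "x * E ^ i" i] S_sub by (auto simp: Fil_def Z_mult algebra_simps)
lemma Fil_I: "x \<in> M i \<Longrightarrow> x * Ei ^ i \<in> Fil i"
  using M_sub Ei_pow_E[of i] by (auto simp: Fil_def mult.assoc intro!: Z_intros)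
lemma Fil_one: "1 \<in> Fil 0" by (auto simp: Fil_def Z_one M_one)
lemma S_Fil: "s \<in> S \<Longrightarrow> s \<in> Fil i" using Fil_mono[OF Fil_scale[OF _ Fil_one, of s], of i] by simp

lemma M_sat_power: "x \<in> Z \<Longrightarrow> pp ^ n * x \<in> M i \<Longrightarrow> x \<in> M i"
proof (induction n)
  case (Suc n)
  then show ?case using M_sat[of "pp ^ n * x" i] by (auto simp: mult.assoc Z_intros)
qed auto

text \<open>By saturation of the spaces of forms, dividing by p^n in the ring of power series does
  not leave the step of the filtration.\<close>

lemma Fil_sat: "x \<in> Fil i \<Longrightarrow> x \<in> pI n \<Longrightarrow> \<exists>y\<in>Fil i. x = pp ^ n * y"
proof -
  assume "x \<in> Fil i" "x \<in> pI n"
  then obtain z where z: "z \<in> Z" "x = pp ^ n * z" by (auto simp: pI_def)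
  have "z * E ^ i \<in> M i" using \<open>x \<in> Fil i\<close> z M_sat_power[of "z * E ^ i" n i]
    by (auto simp: Fil_def mult.assoc intro: Z_intros E_Z)
  thus ?thesis using z by (auto simp: Fil_def)
qed

text \<open>The finite sums behind A(rho). The parameter \<open>n\<close> demands that every single
  exponent e be at least n; this is more than divisibility of the sum by p^n and allows a division
  by n! term by term.\<close>

inductive_set A0 :: "real \<Rightarrow> nat \<Rightarrow> 'a set" for \<rho> :: real and n :: nat where
  A0_zero: "0 \<in> A0 \<rho> n"
| A0_step: "x \<in> A0 \<rho> n \<Longrightarrow> y \<in> Fil i \<Longrightarrow> n \<le> e \<Longrightarrow> \<rho> * real i \<le> real e \<Longrightarrow> x + pp ^ e * y \<in> A0 \<rho> n"

lemma A0_single: "y \<in> Fil i \<Longrightarrow> n \<le> e \<Longrightarrow> \<rho> * real i \<le> real e \<Longrightarrow> pp ^ e * y \<in> A0 \<rho> n"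
  using A0_step[OF A0_zero] by simp
lemma A0_add: "y \<in> A0 \<rho> n \<Longrightarrow> x \<in> A0 \<rho> n \<Longrightarrow> x + y \<in> A0 \<rho> n"
proof (induction y rule: A0.induct)
  case (A0_step y z i e)
  then show ?case using A0.A0_step[of "x + y" \<rho> n z i e] by (simp add: add.assoc)
qed auto
lemma A0_uminus: "x \<in> A0 \<rho> n \<Longrightarrow> -x \<in> A0 \<rho> n"
proof (induction x rule: A0.induct)
  case (A0_step x y i e)
  then show ?case using A0.A0_step[of "-x" \<rho> n "-y" i e] by (simp add: Fil_uminus)
qed (auto intro: A0_zero)
lemma A0_diff: "x \<in> A0 \<rho> n \<Longrightarrow> y \<in> A0 \<rho> n \<Longrightarrow> x - y \<in> A0 \<rho> n"
  using A0_add[of "-y" \<rho> n x] A0_uminus[of y] by simp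
lemma A0_Z: "x \<in> A0 \<rho> n \<Longrightarrow> x \<in> Z"
  by (induction x rule: A0.induct) (auto intro!: Z_zero Z_add Z_mult Z_power Z_of_nat intro: Fil_Z)
lemma A0_pI: "x \<in> A0 \<rho> n \<Longrightarrow> x \<in> pI n"
proof (induction x rule: A0.induct)
  case (A0_step x y i e)
  then show ?case by (auto intro!: pI_add pI_mult_right intro: pI_mono[OF pI_pow] Fil_Z)
qed (auto intro: pI_zero)
lemma A0_mono: "x \<in> A0 \<rho> n \<Longrightarrow> \<rho>' \<le> \<rho> \<Longrightarrow> n' \<le> n \<Longrightarrow> x \<in> A0 \<rho>' n'"
proof (induction x rule: A0.induct)
  case (A0_step x y i e)
  have "\<rho>' * real i \<le> \<rho> * real i" using A0_step.prems by (intro mult_right_mono) auto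
  then show ?case using A0_step by (intro A0.A0_step) auto
qed (auto intro: A0_zero)
lemma A0_S: "s \<in> S \<Longrightarrow> s \<in> A0 \<rho> 0"
  using A0_single[of s 0 0 0 \<rho>] S_Fil by simp

lemma A0_mult_single: "x \<in> A0 \<rho> n \<Longrightarrow> y \<in> Fil i \<Longrightarrow> m \<le> e \<Longrightarrow> \<rho> * real i \<le> real e \<Longrightarrow> x * (pp ^ e * y) \<in> A0 \<rho> (n + m)"
proof (induction x rule: A0.induct)
  case (A0_step x z j f)
  have "x * (pp ^ e * y) + pp ^ (f + e) * (z * y) \<in> A0 \<rho> (n + m)"
    by (rule A0.A0_step[where i = "j + i"]) (use A0_step in \<open>auto intro: Fil_mult simp: algebra_simps\<close>)
  thus ?case by (simp add: power_add algebra_simps)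
qed (auto intro: A0_zero)
lemma A0_mult: "y \<in> A0 \<rho> m \<Longrightarrow> x \<in> A0 \<rho> n \<Longrightarrow> x * y \<in> A0 \<rho> (n + m)"
proof (induction y rule: A0.induct)
  case (A0_step y z i e)
  then show ?case using A0_mult_single[of x \<rho> n z i m e] by (auto simp: distrib_left intro: A0_add)
qed (auto intro: A0_zero)

text \<open>Terms with exponent e < n have rho i \<le> n, so all of them lie in one common
  \<open>Fil i\<close>; the other terms form the part in \<open>A0 \<rho> n\<close>.\<close>

lemma A0_split: "x \<in> A0 \<rho> 0 \<Longrightarrow> \<exists>s t i. x = s + t \<and> s \<in> Fil i \<and> \<rho> * real i \<le> real n \<and> t \<in> A0 \<rho> n"
proof (induction x rule: A0.induct)
  case A0_zero
  show ?case by (rule exI[of _ 0], rule exI[of _ 0], rule exI[of _ 0]) (auto intro: Fil_zero A0.A0_zero)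
next
  case (A0_step x y i e)
  then obtain s t j where st: "x = s + t" "s \<in> Fil j" "\<rho> * real j \<le> real n" "t \<in> A0 \<rho> n" by blast
  show ?case
  proof (cases "n \<le> e")
    case True
    then have "t + pp ^ e * y \<in> A0 \<rho> n" using A0_step st by (intro A0.A0_step) auto
    thus ?thesis using st by (intro exI[of _ s] exI[of _ "t + pp ^ e * y"] exI[of _ j]) auto
  next
    case False
    have "s + pp ^ e * y \<in> Fil (max i j)"
      by (intro Fil_add Fil_scale S_power S_of_nat) (use A0_step st in \<open>auto intro: Fil_mono\<close>)
    moreover have "\<rho> * real (max i j) \<le> real n" using st A0_step False by (auto simp: max_def)
    ultimately show ?thesis using st
      by (intro exI[of _ "s + pp ^ e * y"] exI[of _ "t"] exI[of _ "max i j"]) auto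
  qed
qed

text \<open>Divisibility of a sum says nothing about its terms, so the sum is regrouped: the terms
  of small exponent are collected with \<open>P\<close> in one \<open>Fil\<close>, their sum is
  divisible by p^n, and saturation rewrites it as p^n times an element there.
  \<open>\<rho> \<le> 1\<close> makes the index n admissible for the exponent n.\<close>

lemma A0_refine:
  assumes "x \<in> A0 \<rho> 0" "P \<in> Fil n" "\<rho> \<le> 1" "P + x \<in> pI n"
  shows "P + x \<in> A0 \<rho> n"
proof -
  obtain s t i where st: "x = s + t" "s \<in> Fil i" "\<rho> * real i \<le> real n" "t \<in> A0 \<rho> n"
    using A0_split[OF assms(1)] by blast
  have "P + s \<in> Fil (max n i)" using assms st by (intro Fil_add) (auto intro: Fil_mono)
  moreover have "P + s \<in> pI n" using pI_diff[OF assms(4) A0_pI[OF st(4)]] st by simp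
  ultimately obtain y where y: "y \<in> Fil (max n i)" "P + s = pp ^ n * y" using Fil_sat by blast
  have "\<rho> * real n \<le> real n" using mult_right_mono[OF assms(3), of "real n"] by simp
  hence "\<rho> * real (max n i) \<le> real n" using st by (auto simp: max_def)
  hence "t + pp ^ n * y \<in> A0 \<rho> n" using st y by (intro A0_step) auto
  moreover have "P + x = t + (P + s)" by (simp add: st algebra_simps)
  ultimately show ?thesis by (simp only: y)
qed

text \<open>The rate left after division by n!: an exponent e \<ge> n loses v_p(n!) \<le> e / (p-1),
  so the fraction (p-2)/(p-1) of it survives.\<close>

definition drate :: "real \<Rightarrow> real" where "drate \<rho> = \<rho> * (real p - 2) / (real p - 1)"

lemma fact_unit:
  obtains v k z where "fact n = p ^ v * k" "z \<in> S" "of_nat k * z = 1" "v * (p - 1) \<le> n" "v \<le> n"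
proof -
  obtain v k where vk: "fact n = p ^ v * k" "\<not> p dvd k" "v * (p - 1) \<le> n"
    using fact_prime_part[OF prime_p] by blast
  moreover have "1 \<le> p - 1" using p_ge_5 by linarith
  hence "v \<le> v * (p - 1)" using mult_le_mono2[of 1 "p - 1" v] by simp
  hence "v \<le> n" using vk(3) by linarith
  ultimately show ?thesis using S_inv[OF vk(2)] that by blast
qed

lemma A0_div_fact: "x \<in> A0 \<rho> n \<Longrightarrow> \<exists>x'\<in>A0 (drate \<rho>) 0. x = of_nat (fact n) * x'"
proof (induction x rule: A0.induct)
  case A0_zero
  then show ?case by (intro bexI[of _ 0]) (auto intro: A0.A0_zero)
next
  case (A0_step x y i e)
  then obtain x' where x': "x' \<in> A0 (drate \<rho>) 0" "x = of_nat (fact n) * x'" by blast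
  obtain v k z where vk: "fact n = p ^ v * k" "z \<in> S" "of_nat k * z = 1" "v * (p - 1) \<le> n" "v \<le> n"
    using fact_unit .
  have "real v * (real p - 1) \<le> real e"
  proof -
    have "real (v * (p - 1)) \<le> real e" using vk(4) A0_step by (subst of_nat_le_iff) linarith
    thus ?thesis using p_ge_5 by (simp add: of_nat_diff)
  qed
  hence "real v \<le> real e / (real p - 1)" using p_ge_5 by (simp add: field_simps)
  hence "real e - real v \<ge> real e * (real p - 2) / (real p - 1)" using p_ge_5 by (simp add: field_simps)
  moreover have "drate \<rho> * real i \<le> real e * (real p - 2) / (real p - 1)"
    using mult_right_mono[OF A0_step(4), of "(real p - 2) / (real p - 1)"] p_ge_5
    by (simp add: drate_def field_simps)
  ultimately have "drate \<rho> * real i \<le> real (e - v)" using vk A0_step by (simp add: of_nat_diff)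
  hence "x' + pp ^ (e - v) * (z * y) \<in> A0 (drate \<rho>) 0"
    using x' A0_step vk by (intro A0.A0_step Fil_scale) auto
  moreover have "x + pp ^ e * y = of_nat (fact n) * (x' + pp ^ (e - v) * (z * y))"
  proof -
    have "of_nat (fact n) * (pp ^ (e - v) * (z * y)) = (pp ^ v * pp ^ (e - v)) * ((of_nat k * z) * y)"
      unfolding vk(1) of_nat_mult of_nat_power by (simp only: ac_simps)
    also have "\<dots> = pp ^ e * y" using vk A0_step by (simp flip: power_add)
    finally have 1: "of_nat (fact n) * (pp ^ (e - v) * (z * y)) = pp ^ e * y" .
    show ?thesis by (simp only: distrib_left 1 x'(2))
  qed
  ultimately show ?case by blast
qed

definition A :: "real \<Rightarrow> 'a set" where
  "A \<rho> = {x \<in> Z. \<forall>N. \<exists>y\<in>A0 \<rho> 0. x - y \<in> pI N}"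

lemma A_Z: "x \<in> A \<rho> \<Longrightarrow> x \<in> Z" by (simp add: A_def)
lemma A_ex: "x \<in> A \<rho> \<Longrightarrow> \<exists>y\<in>A0 \<rho> 0. x - y \<in> pI N" by (simp add: A_def)
lemma A0_A: "x \<in> A0 \<rho> 0 \<Longrightarrow> x \<in> A \<rho>" by (auto simp: A_def A0_Z pI_zero intro!: bexI[of _ x])
lemma A_mono: "x \<in> A \<rho> \<Longrightarrow> \<rho>' \<le> \<rho> \<Longrightarrow> x \<in> A \<rho>'" using A0_mono[of _ \<rho> 0 \<rho>' 0] by (fastforce simp: A_def)
lemma A_diff: "x \<in> A \<rho> \<Longrightarrow> y \<in> A \<rho> \<Longrightarrow> x - y \<in> A \<rho>"
proof -
  assume a: "x \<in> A \<rho>" "y \<in> A \<rho>"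
  have "\<exists>z\<in>A0 \<rho> 0. x - y - z \<in> pI N" for N
  proof -
    obtain x' y' where "x' \<in> A0 \<rho> 0" "x - x' \<in> pI N" "y' \<in> A0 \<rho> 0" "y - y' \<in> pI N"
      using a A_ex by meson
    thus ?thesis using pI_diff[of "x - x'" N "y - y'"]
      by (intro bexI[of _ "x' - y'"] A0_diff) (auto simp: algebra_simps)
  qed
  thus ?thesis using a by (auto simp: A_def intro: Z_diff)
qed
lemma A_zero: "0 \<in> A \<rho>" using A0_A[OF A0_zero] .
lemma A_uminus: "x \<in> A \<rho> \<Longrightarrow> -x \<in> A \<rho>" using A_diff[OF A_zero, of x] by simp
lemma A_add: "x \<in> A \<rho> \<Longrightarrow> y \<in> A \<rho> \<Longrightarrow> x + y \<in> A \<rho>" using A_diff[of x \<rho> "-y"] A_uminus[of y] by simp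
lemma A_mult: "x \<in> A \<rho> \<Longrightarrow> y \<in> A \<rho> \<Longrightarrow> x * y \<in> A \<rho>"
proof -
  assume a: "x \<in> A \<rho>" "y \<in> A \<rho>"
  have "\<exists>z\<in>A0 \<rho> 0. x * y - z \<in> pI N" for N
  proof -
    obtain x' y' where "x' \<in> A0 \<rho> 0" "x - x' \<in> pI N" "y' \<in> A0 \<rho> 0" "y - y' \<in> pI N"
      using a A_ex by meson
    thus ?thesis using pI_prod_cong[of x x' N y y'] A0_mult[of y' \<rho> 0 x' 0] a
      by (intro bexI[of _ "x' * y'"]) (auto simp: A0_Z A_Z)
  qed
  thus ?thesis using a by (auto simp: A_def intro: Z_mult)
qed
lemma A_S: "s \<in> S \<Longrightarrow> s \<in> A \<rho>" using A0_A A0_S by blast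
lemma A_power: "x \<in> A \<rho> \<Longrightarrow> x ^ n \<in> A \<rho>"
  by (induction n) (auto intro: A_mult A_S S_one)
lemma A_sum: "(\<And>i. i \<in> I \<Longrightarrow> f i \<in> A \<rho>) \<Longrightarrow> sum f I \<in> A \<rho>"
  by (rule sum_closed) (auto intro: A_zero A_add)
lemma A_closed: "x \<in> Z \<Longrightarrow> (\<And>N. \<exists>y\<in>A \<rho>. x - y \<in> pI N) \<Longrightarrow> x \<in> A \<rho>"
  unfolding A_def using pI_trans by (auto simp: A_def) meson

text \<open>The truncated geometric series for 1 / (1 - (1 - f)) has the exact error g (1 - f)^N,
  and f \<equiv> 1 modulo p.\<close>

lemma geometric_inverse:
  assumes "f * g = 1" "f - 1 \<in> pI 1" "g \<in> Z"
  shows "g - (\<Sum>l<N. (1 - f) ^ l) \<in> pI N"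
proof -
  have "g - (\<Sum>l<N. (1 - f) ^ l) = g * (1 - f) ^ N"
  proof -
    have "f * (\<Sum>l<N. (1 - f) ^ l) = 1 - (1 - f) ^ N"
      using one_diff_power_eq[of "1 - f" N] by simp
    hence "g * (f * (\<Sum>l<N. (1 - f) ^ l)) = g - g * (1 - f) ^ N" by (simp only: right_diff_distrib mult_1_right)
    moreover have "g * (f * (\<Sum>l<N. (1 - f) ^ l)) = (\<Sum>l<N. (1 - f) ^ l)"
      using assms(1) by (metis mult.assoc mult.commute mult_1)
    ultimately show ?thesis by simp
  qed
  moreover have "(1 - f) ^ N \<in> pI N" using pI_power1[OF pI_sym[OF assms(2)]] .
  ultimately show ?thesis using assms by (auto intro: pI_mult_left)
qed

lemma A_inverse:
  assumes "f \<in> A \<rho>" "f * g = 1" "f - 1 \<in> pI 1" "g \<in> Z"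
  shows "g \<in> A \<rho>"
proof (rule A_closed[OF assms(4)])
  fix N
  show "\<exists>y\<in>A \<rho>. g - y \<in> pI N"
    using geometric_inverse[OF assms(2-4), of N] assms(1)
    by (intro bexI[of _ "\<Sum>l<N. (1 - f) ^ l"] A_sum A_power A_diff[OF A_S[OF S_one]])
qed

text \<open>Only \<open>d\<close> is known to be divisible by p^n, not \<open>P\<close> or
  \<open>d - P\<close>. Once \<open>d - P\<close> is approximated by a finite sum,
  \<open>A0_refine\<close> rewrites \<open>P\<close> plus that sum with all exponents at least n,
  and each term can be divided by n!.\<close>

lemma A_div_fact:
  assumes "d \<in> pI n" "P \<in> Fil n" "d - P \<in> A \<rho>" "\<rho> \<le> 1"
  shows "\<exists>x\<in>A (drate \<rho>). d = of_nat (fact n) * x"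
proof -
  obtain v k z where vk: "fact n = p ^ v * k" "z \<in> S" "of_nat k * z = 1" "v * (p - 1) \<le> n" "v \<le> n"
    using fact_unit .
  obtain d' where d': "d' \<in> Z" "d = pp ^ n * d'" using assms(1) by (auto simp: pI_def)
  define x where "x = pp ^ (n - v) * (z * d')"
  have zZ: "z \<in> Z" using vk S_sub by auto
  have xZ: "x \<in> Z" unfolding x_def by (intro Z_intros zZ d')
  have dx: "d = of_nat (fact n) * x"
  proof -
    have "of_nat (fact n) * x = (pp ^ v * pp ^ (n - v)) * ((of_nat k * z) * d')"
      unfolding x_def vk(1) of_nat_mult of_nat_power by (simp only: ac_simps)
    thus ?thesis using vk d' by (simp flip: power_add)
  qed
  have "\<exists>a\<in>A (drate \<rho>). x - a \<in> pI N" for N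
  proof -
    \<comment> \<open>Precision N + n, because cancelling n! afterwards loses v_p(n!) \<le> n
      digits.\<close>
    obtain a where a: "a \<in> A0 \<rho> 0" "d - P - a \<in> pI (N + n)" using A_ex[OF assms(3)] by blast
    have "P + a \<in> pI n" using pI_diff[OF assms(1) pI_mono[OF a(2), of n]] by simp
    hence "P + a \<in> A0 \<rho> n" using A0_refine[OF a(1) assms(2,4)] by simp
    then obtain a' where a': "a' \<in> A0 (drate \<rho>) 0" "P + a = of_nat (fact n) * a'" using A0_div_fact by blast
    have "of_nat (fact n) * (x - a') \<in> pI (N + n)" using a(2) a' dx by (simp add: algebra_simps)
    hence "z * (of_nat (fact n) * (x - a')) \<in> pI (N + n)" using zZ by (rule pI_mult_left)
    moreover have "z * (of_nat (fact n) * (x - a')) = pp ^ v * ((of_nat k * z) * (x - a'))"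
      unfolding vk(1) of_nat_mult of_nat_power by (simp only: ac_simps)
    ultimately have "pp ^ v * (x - a') \<in> pI (N + n)" by (simp only: vk(3) mult_1)
    hence "pp ^ v * (x - a') \<in> pI (v + (N + n - v))" using vk by simp
    hence "x - a' \<in> pI (N + n - v)" by (rule pI_cancel)
    hence "x - a' \<in> pI N" by (rule pI_mono) (use vk in simp)
    thus ?thesis using a' A0_A by blast
  qed
  thus ?thesis using dx A_closed[OF xZ] by blast
qed

text \<open>Telescoping: z(K+1) - z(K) lies in \<open>Fil (I (Suc K))\<close> and is divisible by
  p^K, so by saturation it is p^K times an element of that step. This is why the growth hypothesis
  pairs \<open>I (Suc K)\<close> with K; the factor \<open>pp ^ v\<close> adds v to every
  exponent.\<close>

lemma approx_A:
  assumes "x \<in> Z" "\<And>K. K \<ge> 1 \<Longrightarrow> \<exists>z\<in>Fil (I K). x - z \<in> pI K"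
    and "\<And>K. \<rho> * real (I (Suc K)) \<le> real (v + K)" "mono I"
  shows "pp ^ v * x \<in> A \<rho>"
proof -
  obtain z where z: "\<And>K. K \<ge> 1 \<Longrightarrow> z K \<in> Fil (I K)" "\<And>K. K \<ge> 1 \<Longrightarrow> x - z K \<in> pI K"
    using assms(2) by metis
  have "pp ^ v * z (Suc K) \<in> A0 \<rho> 0" for K
  proof (induction K)
    case 0
    then show ?case using z(1)[of 1] assms(3)[of 0] by (intro A0_single) auto
  next
    case (Suc K)
    have "z (Suc (Suc K)) - z (Suc K) \<in> Fil (I (Suc (Suc K)))"
      using z(1)[of "Suc K"] z(1)[of "Suc (Suc K)"] monoD[OF assms(4), of "Suc K" "Suc (Suc K)"]
      by (intro Fil_diff) (auto intro: Fil_mono)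
    moreover have "z (Suc (Suc K)) - z (Suc K) \<in> pI (Suc K)"
      using pI_diff[OF z(2)[of "Suc K"] pI_mono[OF z(2)[of "Suc (Suc K)"], of "Suc K"]] by simp
    ultimately obtain y where y: "y \<in> Fil (I (Suc (Suc K)))" "z (Suc (Suc K)) - z (Suc K) = pp ^ Suc K * y"
      using Fil_sat by blast
    have "pp ^ v * z (Suc K) + pp ^ (v + Suc K) * y \<in> A0 \<rho> 0"
      using Suc y assms(3)[of "Suc K"] by (intro A0_step) auto
    moreover have "pp ^ v * z (Suc K) + pp ^ (v + Suc K) * y = pp ^ v * z (Suc (Suc K))"
      using y(2) by (simp add: power_add algebra_simps flip: y(2))
    ultimately show ?case by simp
  qed
  note * = this
  show ?thesis
  proof (rule A_closed)
    show "pp ^ v * x \<in> Z" using assms by (auto intro: Z_intros)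
    fix N
    have "x - z (Suc N) \<in> pI N" using z(2)[of "Suc N"] by (auto intro: pI_mono)
    hence "pp ^ v * (x - z (Suc N)) \<in> pI N" by (intro pI_mult_left Z_intros)
    thus "\<exists>y\<in>A \<rho>. pp ^ v * x - y \<in> pI N" using A0_A[OF *[of N]]
      by (intro bexI[of _ "pp ^ v * z (Suc N)"]) (auto simp: algebra_simps)
  qed
qed

end

section \<open>The operator \<open>V\<close> on the filtration\<close>

lemma nat_pow_one_plus: "\<exists>s. (1 + p * z) ^ i = 1 + i * p * z + p\<^sup>2 * s" for p z i :: nat
proof (induction i)
  case (Suc i)
  then obtain s where "(1 + p * z) ^ i = 1 + i * p * z + p\<^sup>2 * s" by blast
  hence "(1 + p * z) ^ Suc i = (1 + p * z) * (1 + i * p * z + p\<^sup>2 * s)" by simp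
  also have "\<dots> = 1 + Suc i * p * z + p\<^sup>2 * (s + i * z * z + p * z * s)"
    by (simp add: algebra_simps power2_eq_square)
  finally show ?case by blast
qed auto

lemma sum_pow_one_plus:
  fixes p z :: nat
  assumes "odd p"
  shows "\<exists>s. (\<Sum>i<p. (1 + p * z) ^ i) = p * (1 + p * s)"
proof -
  obtain s where s: "\<And>i. (1 + p * z) ^ i = 1 + i * p * z + p\<^sup>2 * s i"
    using nat_pow_one_plus by metis
  have "(\<Sum>i<p. i) = p * ((p - 1) div 2)"
  proof -
    have "2 * (\<Sum>i<n. i) = n * (n - 1)" for n :: nat
      by (induction n) (auto simp: algebra_simps)
    from this[of p] have "2 * (\<Sum>i<p. i) = 2 * (p * ((p - 1) div 2))" using assms
      by (auto elim!: oddE)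
    thus ?thesis by simp
  qed
  note 1 = this
  have "(\<Sum>i<p. (1 + p * z) ^ i) = p + (\<Sum>i<p. i) * p * z + p\<^sup>2 * (\<Sum>i<p. s i)"
    unfolding s by (simp add: sum.distrib sum_distrib_left sum_distrib_right sum_Suc)
  also have "\<dots> = p * (1 + p * ((p - 1) div 2 * z + (\<Sum>i<p. s i)))"
    unfolding 1 by (simp add: algebra_simps power2_eq_square)
  finally show ?thesis by blast
qed

lemma power_eq_sum: "(1 + y) ^ n = 1 + y * (\<Sum>i<n. (1 + y) ^ i)" for y n :: nat
  by (induction n) (auto simp: algebra_simps)

text \<open>Each p-th power raises the valuation of x - 1 by exactly one: for x \<equiv> 1 modulo p
  and p odd, 1 + x + ... + x^(p-1) is p times a unit congruent to 1. The cofactor 1 + p s records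
  that the leading digit remains 1.\<close>

lemma one_plus_p_power:
  fixes p n :: nat
  assumes "odd p"
  shows "\<exists>s. (1 + p) ^ (p ^ n) = 1 + p ^ (n + 1) * (1 + p * s)"
proof (induction n)
  case 0
  show ?case by (intro exI[of _ 0]) auto
next
  case (Suc n)
  then obtain s where s: "(1 + p) ^ (p ^ n) = 1 + p ^ (n + 1) * (1 + p * s)" by blast
  obtain t where t: "(\<Sum>i<p. (1 + p * (p ^ n * (1 + p * s))) ^ i) = p * (1 + p * t)"
    using sum_pow_one_plus[OF assms] by blast
  have "(1 + p) ^ (p ^ Suc n) = ((1 + p) ^ (p ^ n)) ^ p" by (simp add: power_mult[symmetric] mult.commute)
  also have "\<dots> = (1 + p * (p ^ n * (1 + p * s))) ^ p" unfolding s by (simp add: algebra_simps)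
  also have "\<dots> = 1 + p * (p ^ n * (1 + p * s)) * (p * (1 + p * t))"
    unfolding power_eq_sum[of _ p] t ..
  also have "\<dots> = 1 + p ^ (Suc n + 1) * (1 + p * (s + t + p * s * t))" by (simp add: algebra_simps)
  finally show ?case by blast
qed

lemma unit_power_p_power:
  fixes p N :: nat
  assumes "prime p" "odd p"
  shows "\<exists>k. \<not> p dvd k \<and> ((1 + p) ^ (p - 1)) ^ (p ^ N) = 1 + p ^ (N + 1) * k"
proof -
  obtain s where s: "(1 + p) ^ (p ^ N) = 1 + p ^ (N + 1) * (1 + p * s)"
    using one_plus_p_power[OF assms(2)] by blast
  define z where "z = p ^ N * (1 + p * s)"
  obtain t where t: "\<And>i. (1 + p * z) ^ i = 1 + i * p * z + p\<^sup>2 * t i"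
    using nat_pow_one_plus by metis
  define w where "w = (\<Sum>i<p-1. (i * z + p * t i))"
  have sm: "(\<Sum>i<p-1. (1 + p * z) ^ i) = (p - 1) + p * w"
    unfolding t w_def by (simp add: sum.distrib sum_distrib_left power2_eq_square algebra_simps sum_Suc)
  have "((1 + p) ^ (p - 1)) ^ (p ^ N) = (1 + p * z) ^ (p - 1)"
  proof -
    have "((1 + p) ^ (p - 1)) ^ (p ^ N) = ((1 + p) ^ (p ^ N)) ^ (p - 1)"
      by (simp only: power_mult[symmetric] mult.commute)
    thus ?thesis unfolding s z_def by (simp only: power_add power_one_right ac_simps)
  qed
  also have "\<dots> = 1 + p * z * ((p - 1) + p * w)" unfolding power_eq_sum[of _ "p - 1"] sm ..
  also have "\<dots> = 1 + p ^ (N + 1) * ((1 + p * s) * ((p - 1) + p * w))"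
    unfolding z_def by (simp only: power_add power_one_right ac_simps)
  finally have "((1 + p) ^ (p - 1)) ^ (p ^ N) = 1 + p ^ (N + 1) * ((1 + p * s) * ((p - 1) + p * w))" .
  moreover have "\<not> p dvd (1 + p * s) * ((p - 1) + p * w)"
  proof -
    have p1: "p > 1" using assms prime_gt_1_nat by blast
    have "\<not> p dvd 1 + p * s" using p1 dvd_add_left_iff[of p "p * s" 1] by auto
    moreover have "\<not> p dvd p - 1" using p1 by (auto dest: dvd_imp_le)
    hence "\<not> p dvd (p - 1) + p * w" by (simp add: dvd_add_left_iff)
    ultimately show ?thesis using prime_dvd_multD[OF assms(1)] by blast
  qed
  ultimately show ?thesis by blast
qed

text \<open>From j C(p^N, j) = p^N C(p^N - 1, j - 1) the binomial coefficient has valuation at least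
  N - v_p(j), and v_p(j) < j leaves a further factor p of p^j.\<close>

lemma choose_p_power_dvd:
  fixes p N j :: nat
  assumes "prime p" "j \<ge> 1"
  shows "p ^ (N + 1) dvd (p ^ N choose j) * p ^ j"
proof -
  define v where "v = multiplicity p j"
  define X where "X = (p ^ N choose j) * p ^ j"
  have p1: "p > 1" using assms prime_gt_1_nat by blast
  obtain j' where j': "j = p ^ v * j'" and nd: "\<not> p dvd j'"
    using multiplicity_decompose'[of j p] assms p1 unfolding v_def
    by (metis not_one_le_zero not_prime_unit)
  have "j' \<ge> 1" using j' assms by (cases j') auto
  hence "p ^ v \<le> j" using j' by simp
  moreover have "v < p ^ v" using p1 by (simp add: power_gt_expt)
  ultimately have vj: "v < j" by linarith
  have "p ^ N \<noteq> 0" using p1 by simp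
  hence "j * (p ^ N choose j) = p ^ N * ((p ^ N - 1) choose (j - 1))"
    using assms binomial_absorption[of "j - 1" "p ^ N"] by simp
  hence "j * X = p ^ (N + j) * ((p ^ N - 1) choose (j - 1))"
    unfolding X_def by (simp add: power_add mult.assoc[symmetric])
  hence "p ^ (N + j) dvd (p ^ v * X) * j'" using j' by (metis dvd_triv_left mult.assoc mult.commute)
  moreover have "coprime (p ^ (N + j)) j'" using nd assms(1) by (simp add: prime_imp_coprime)
  ultimately have "p ^ (N + j) dvd p ^ v * X" by (simp add: coprime_dvd_mult_left_iff)
  moreover have "p ^ (N + j) = p ^ v * p ^ (N + j - v)" using vj by (simp flip: power_add)
  ultimately have "p ^ (N + j - v) dvd X" using p1 by simp
  moreover have "p ^ (N + 1) dvd p ^ (N + j - v)" using vj by (intro le_imp_power_dvd) auto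
  ultimately show ?thesis unfolding X_def using dvd_trans by blast
qed

lemma binomial_fact_prod:
  "of_nat (m choose n) * of_nat (fact n) = (\<Prod>i<n. of_nat m - of_nat i :: 'a :: comm_ring_1)"
proof (induction n)
  case (Suc n)
  have eq: "of_nat (m choose Suc n) * of_nat (Suc n) = of_nat (m choose n) * (of_nat m - of_nat n :: 'a)"
  proof (cases "n \<le> m")
    case True
    have "Suc n * (m choose Suc n) = (m - n) * (m choose n)"
    proof (cases m)
      case (Suc m')
      thus ?thesis using Suc_times_binomial[of n m'] binomial_absorb_comp[of m n] by simp
    qed (use True in auto)
    hence "of_nat (Suc n * (m choose Suc n)) = (of_nat ((m - n) * (m choose n)) :: 'a)" by simp
    thus ?thesis using True by (simp only: of_nat_mult of_nat_diff mult.commute)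
  qed (auto simp: binomial_eq_0)
  have "of_nat (m choose Suc n) * of_nat (fact (Suc n)) =
     (of_nat (m choose Suc n) * of_nat (Suc n)) * (of_nat (fact n) :: 'a)"
    unfolding fact_Suc of_nat_mult of_nat_id by (simp only: ac_simps)
  also have "\<dots> = (of_nat (m choose n) * of_nat (fact n)) * (of_nat m - of_nat n)"
    unfolding eq by (simp only: ac_simps)
  finally show ?case unfolding Suc by simp
qed auto

lemma poly_eq_sum:
  fixes P :: "'a :: comm_semiring_1 poly"
  assumes "\<And>i. i \<ge> n \<Longrightarrow> coeff P i = 0"
  shows "poly P x = (\<Sum>i<n. coeff P i * x ^ i)"
proof -
  have "poly P x = (\<Sum>i\<le>degree P. coeff P i * x ^ i)" by (rule poly_altdef)
  also have "\<dots> = (\<Sum>i\<in>{..degree P} \<inter> {..<n}. coeff P i * x ^ i)"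
    by (intro sum.mono_neutral_right) (auto, metis assms leI mult_zero_left)
  also have "\<dots> = (\<Sum>i<n. coeff P i * x ^ i)"
    by (intro sum.mono_neutral_left) (auto, metis le_degree mult_zero_left)
  finally show ?thesis .
qed

context katz_algebra
begin

lemma V_S: "s \<in> S \<Longrightarrow> V s = s" using V_M0[OF M_scale[OF _ M_one]] by simp

lemma S_coeff_one_minus: "coeff [:1, -1:] i \<in> S"
  by (auto simp: coeff_pCons S_zero S_one S_uminus split: nat.splits)

lemma S_coeff_one_minus_power: "coeff ([:1, -1:] ^ r) i \<in> S"
  by (rule coeff_power_closed) (auto intro: S_zero S_one S_add S_mult S_coeff_one_minus)

text \<open>\<open>\<psi>\<close> is the truncation of (1 - X)^(-r) modulo X^L, built one
  coefficient at a time: subtracting from \<open>R\<close> its constant term times (1 - X)^r leaves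
  a multiple of X. The product equals 1 to order L at 0 and vanishes to order r at 1.\<close>

lemma ex_truncated_inverse:
  "\<exists>\<psi> R :: 'a poly. [:1, -1:] ^ r * \<psi> = 1 + monom 1 L * R \<and> (\<forall>i\<ge>L. coeff \<psi> i = 0) \<and>
     (\<forall>i. coeff \<psi> i \<in> S) \<and> (\<forall>i. coeff R i \<in> S)"
proof (induction L)
  case 0
  show ?case
    by (rule exI[of _ 0], rule exI[of _ "-1"])
       (auto simp: S_zero one_pCons coeff_pCons S_uminus S_one split: nat.splits)
next
  case (Suc L)
  then obtain \<psi> R :: "'a poly" where *: "[:1, -1:] ^ r * \<psi> = 1 + monom 1 L * R"
    "\<And>i. i \<ge> L \<Longrightarrow> coeff \<psi> i = 0" "\<And>i. coeff \<psi> i \<in> S" "\<And>i. coeff R i \<in> S" by blast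
  define c where "c = coeff R 0"
  define W where "W = R - smult c ([:1, -1:] ^ r)"
  obtain a R' where W: "W = pCons a R'" by (cases W)
  have "coeff ([:1, -1:] ^ r :: 'a poly) 0 = 1" by (simp add: poly_0_coeff_0[symmetric])
  hence "coeff W 0 = 0" by (simp add: W_def c_def)
  hence a: "a = 0" by (simp add: W)
  have WS: "coeff W i \<in> S" for i
    unfolding W_def by (auto simp: c_def intro!: S_diff S_mult * S_coeff_one_minus_power)
  have "[:1, -1:] ^ r * (\<psi> - monom c L) = 1 + monom 1 L * R - [:1, -1:] ^ r * monom c L"
    by (simp add: right_diff_distrib *)
  also have "[:1, -1:] ^ r * monom c L = monom 1 L * smult c ([:1, -1:] ^ r)"
    by (metis mult.commute mult.right_neutral mult_smult_left mult_smult_right smult_monom)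
  also have "1 + monom 1 L * R - monom 1 L * smult c ([:1, -1:] ^ r) = 1 + monom 1 L * W"
    by (simp add: W_def right_diff_distrib del: mult_smult_right)
  also have "\<dots> = 1 + monom 1 (Suc L) * R'" by (simp add: W a monom_Suc)
  finally have "[:1, -1:] ^ r * (\<psi> - monom c L) = 1 + monom 1 (Suc L) * R'" .
  moreover have "\<forall>i\<ge>Suc L. coeff (\<psi> - monom c L) i = 0" using *(2) by auto
  moreover have "coeff (\<psi> - monom c L) i \<in> S" for i using * by (auto simp: c_def intro: S_diff S_zero S_uminus)
  moreover have "coeff R' i \<in> S" for i using WS[of "Suc i"] by (simp add: W)
  ultimately show ?case by blast
qed

lemma poly_Z: "(\<And>i. coeff P i \<in> Z) \<Longrightarrow> x \<in> Z \<Longrightarrow> poly P x \<in> Z"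
  unfolding poly_altdef by (intro Z_intros) auto

text \<open>
  With \<open>\<Phi> = (1 - X)\<^sup>r \<psi> \<equiv> 1\<close> modulo \<open>X\<^sup>L\<close>, the level one form \<open>\<Sum>\<^sub>l \<Phi>\<^sub>l E\<^sup>D\<^sup>-\<^sup>l T\<^sub>p(f E\<^sup>l)\<close> is
  \<open>p\<^sup>k\<^sup>-\<^sup>1 V f \<cdot> E\<^sup>D \<Phi>(p\<^sup>p\<^sup>-\<^sup>1 V E / E) + U(f \<cdot> V E\<^sup>D \<Phi>(E / V E))\<close>: the first value of \<open>\<Phi>\<close> is close to 1
  and the second is close to 0.
\<close>

lemma V_approx:
  assumes f: "f \<in> M i" and i: "i \<ge> 1" and K: "K \<ge> 1"
  shows "\<exists>z\<in>Fil (p * i + K + K div (p - 1) - 1). V f * Ei ^ i - z \<in> pI K"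
proof -
  \<comment> \<open>\<open>c\<close> is k - 1 for the weight k = (p-1) i, so V f occurs with the
    factor p^c. \<open>r\<close> makes the U-part vanish modulo p^(c+K), \<open>L\<close> satisfies
    (p-1) L \<ge> K, and \<open>D\<close> bounds the degree of Phi.\<close>
  define c r L D where "c = (p - 1) * i - 1" and "r = K + c" and "L = K div (p - 1) + 1" and "D = r + L - 1"
  have pi: "(p - 1) * i \<ge> 1" using i p_ge_5 by simp
  obtain \<psi> R :: "'a poly" where *: "[:1, -1:] ^ r * \<psi> = 1 + monom 1 L * R"
    "\<And>i. i \<ge> L \<Longrightarrow> coeff \<psi> i = 0" "\<And>i. coeff \<psi> i \<in> S" "\<And>i. coeff R i \<in> S"
    using ex_truncated_inverse by metis
  define \<Phi> where "\<Phi> = [:1, -1:] ^ r * \<psi>"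
  have \<Phi>S: "coeff \<Phi> l \<in> S" for l unfolding \<Phi>_def
    by (rule coeff_mult_closed) (auto intro: S_zero S_add S_mult S_coeff_one_minus_power *)
  have "degree ([:1, -1 :: 'a:] ^ r) \<le> r" using degree_power_le[of "[:1, -1 :: 'a:]" r] by simp
  moreover have "degree \<psi> \<le> L - 1" by (rule degree_le) (use *(2) L_def in auto)
  ultimately have "degree \<Phi> \<le> D" using degree_mult_le[of "[:1, -1:] ^ r" \<psi>]
    unfolding \<Phi>_def D_def L_def by linarith
  hence polyP: "poly \<Phi> x = (\<Sum>l<Suc D. coeff \<Phi> l * x ^ l)" for x
    by (intro poly_eq_sum coeff_eq_0) auto
  have fZ: "f \<in> Z" using f M_sub by auto
  define T where "T = (\<Sum>l<Suc D. coeff \<Phi> l * (E ^ (D - l) * (pp ^ ((p - 1) * (i + l) - 1) * V (f * E ^ l) + U (f * E ^ l))))"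
  have TM: "T \<in> M (i + D)" unfolding T_def
  proof (rule M_sum, rule M_scale[OF \<Phi>S])
    fix l assume "l \<in> {..<Suc D}"
    hence "i + D = (D - l) + (i + l)" by simp
    thus "E ^ (D - l) * (pp ^ ((p - 1) * (i + l) - 1) * V (f * E ^ l) + U (f * E ^ l)) \<in> M (i + D)"
      by (simp only:) (intro M_mult E_power T_M f, use i in simp)
  qed
  \<comment> \<open>The two arguments of Phi: \<open>x\<close> is divisible by p^(p-1), and
    \<open>x'\<close> is congruent to 1 modulo p.\<close>
  define x x' where "x = pp ^ (p - 1) * V E * Ei" and "x' = E * V Ei"
  have xZ: "x \<in> Z" "x' \<in> Z" unfolding x_def x'_def by (intro Z_intros E_Z)+
  have T_eq: "T = pp ^ c * V f * E ^ D * poly \<Phi> x + U (f * V E ^ D * poly \<Phi> x')"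
  proof -
    have "T = (\<Sum>l<Suc D. pp ^ c * V f * E ^ D * (coeff \<Phi> l * x ^ l) + U (f * V E ^ D * (coeff \<Phi> l * x' ^ l)))"
      unfolding T_def
    proof (rule sum.cong)
      fix l assume "l \<in> {..<Suc D}"
      hence l: "l \<le> D" by simp
      have ED: "E ^ (D - l) = E ^ D * Ei ^ l"
      proof -
        have "E ^ D = E ^ (D - l) * E ^ l" using l by (simp flip: power_add)
        thus ?thesis using E_pow_Ei[of l] by (simp add: mult.assoc)
      qed
      have VED: "V (E ^ (D - l)) = V E ^ D * V Ei ^ l" unfolding ED by (simp add: V_mult V_power)
      have e: "(p - 1) * (i + l) - 1 = c + (p - 1) * l" using pi unfolding c_def
        by (simp add: distrib_left)
      have 1: "coeff \<Phi> l * (E ^ (D - l) * (pp ^ ((p - 1) * (i + l) - 1) * V (f * E ^ l))) =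
         pp ^ c * V f * E ^ D * (coeff \<Phi> l * x ^ l)"
        unfolding e ED x_def power_mult_distrib V_mult V_power power_add power_mult by (simp only: ac_simps)
      have 2: "coeff \<Phi> l * (E ^ (D - l) * U (f * E ^ l)) = U (f * V E ^ D * (coeff \<Phi> l * x' ^ l))"
      proof -
        have "coeff \<Phi> l * (E ^ (D - l) * U (f * E ^ l)) = (coeff \<Phi> l * E ^ (D - l)) * U (f * E ^ l)"
          by (simp add: mult.assoc)
        also have "\<dots> = U (V (coeff \<Phi> l * E ^ (D - l)) * (f * E ^ l))" by (simp add: U_V)
        also have "V (coeff \<Phi> l * E ^ (D - l)) * (f * E ^ l) = f * V E ^ D * (coeff \<Phi> l * x' ^ l)"
          unfolding V_mult VED V_S[OF \<Phi>S] x'_def power_mult_distrib by (simp only: ac_simps)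
        finally show ?thesis .
      qed
      show "coeff \<Phi> l * (E ^ (D - l) * (pp ^ ((p - 1) * (i + l) - 1) * V (f * E ^ l) + U (f * E ^ l))) =
        pp ^ c * V f * E ^ D * (coeff \<Phi> l * x ^ l) + U (f * V E ^ D * (coeff \<Phi> l * x' ^ l))"
        unfolding distrib_left[of "E ^ (D - l)"] distrib_left[of "coeff \<Phi> l"] 1 2 ..
    qed auto
    thus ?thesis unfolding polyP sum.distrib sum_distrib_left U_sum .
  qed
  have 1: "poly \<Phi> x - 1 \<in> pI K"
  proof -
    have "poly \<Phi> x - 1 = x ^ L * poly R x" unfolding \<Phi>_def * by (simp add: poly_monom)
    moreover have "x \<in> pI (p - 1)" unfolding x_def by (intro pI_mult_right pI_pow Z_intros E_Z)
    hence "x ^ L \<in> pI ((p - 1) * L)" by (rule pI_power)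
    moreover have "K \<le> (p - 1) * L"
    proof -
      have "K mod (p - 1) < p - 1" using p_ge_5 by (intro mod_less_divisor) auto
      moreover have "K = (p - 1) * (K div (p - 1)) + K mod (p - 1)" by simp
      ultimately show ?thesis unfolding L_def distrib_left by linarith
    qed
    moreover have "poly R x \<in> Z" using *(4) S_sub xZ by (intro poly_Z) auto
    ultimately show ?thesis by (auto intro: pI_mult_right pI_mono)
  qed
  have 2: "poly \<Phi> x' \<in> pI r"
  proof -
    have P: "poly \<Phi> x' = (1 - x') ^ r * poly \<psi> x'" unfolding \<Phi>_def by simp
    have "1 - x' = V Ei * (V E - E)" using VE_VEi by (simp add: x'_def algebra_simps)
    moreover have "V E - E \<in> pI 1" using pI_diff[OF VE_1 E_1] by simp
    hence "V Ei * (V E - E) \<in> pI 1" by (rule pI_mult_left) (intro Z_intros)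
    ultimately have "(1 - x') ^ r \<in> pI r" using pI_power1[of "1 - x'" r] by simp
    moreover have "poly \<psi> x' \<in> Z" using *(3) S_sub xZ by (intro poly_Z) auto
    ultimately show ?thesis using P by (auto intro: pI_mult_right)
  qed
  have VfZ: "V f * E ^ D \<in> Z" by (intro Z_intros E_Z fZ)
  have 3: "pp ^ c * (V f * E ^ D) - T \<in> pI (c + K)"
  proof -
    have "pp ^ c * (V f * E ^ D) - T = - (pp ^ c * ((V f * E ^ D) * (poly \<Phi> x - 1))) - U (f * V E ^ D * poly \<Phi> x')"
      unfolding T_eq by (simp add: algebra_simps)
    moreover have "pp ^ c * ((V f * E ^ D) * (poly \<Phi> x - 1)) \<in> pI (c + K)"
      by (intro pI_mult pI_pow pI_mult_left VfZ 1)
    moreover have "U (f * V E ^ D * poly \<Phi> x') \<in> pI r"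
      by (intro pI_U pI_mult_left 2 Z_intros fZ E_Z)
    ultimately show ?thesis unfolding r_def by (auto simp: add.commute intro: pI_diff pI_uminus)
  qed
  \<comment> \<open>The form T agrees with p^c V f E^D modulo p^(c+K), so it is divisible by p^c;
    saturation divides it within the forms and leaves a congruence modulo p^K.\<close>
  have "T \<in> pI c" using pI_diff[OF pI_mult_right[OF pI_pow VfZ, of c] pI_mono[OF 3, of c]] by simp
  then obtain T' where T': "T' \<in> Z" "T = pp ^ c * T'" by (auto simp: pI_def)
  have T'M: "T' \<in> M (i + D)" using M_sat_power[of T' c] T' TM by simp
  have "pp ^ c * (V f * E ^ D - T') \<in> pI (c + K)" using 3 T' by (simp add: right_diff_distrib)
  hence "V f * E ^ D - T' \<in> pI K" by (rule pI_cancel)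
  hence "(V f * E ^ D - T') * Ei ^ (i + D) \<in> pI K" by (rule pI_mult_right) (intro Z_intros)
  moreover have "V f * E ^ D * Ei ^ (i + D) = V f * Ei ^ i"
    using E_pow_Ei[of D] by (simp add: power_add mult.assoc mult.left_commute)
  ultimately have "V f * Ei ^ i - T' * Ei ^ (i + D) \<in> pI K" by (simp add: left_diff_distrib)
  moreover have "i + D = p * i + K + K div (p - 1) - 1"
  proof -
    obtain p' where p': "p = Suc p'" using p_ge_5 by (cases p) auto
    define a b where "a = i * p'" and "b = K div p'"
    have "a \<ge> 1" using pi unfolding a_def p' by (simp add: mult.commute)
    hence "i + (K + (a - 1) + (b + 1) - 1) = (i + a) + K + b - 1" by linarith
    thus ?thesis unfolding D_def r_def L_def c_def p' a_def b_def by (simp add: mult.commute)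
  qed
  ultimately show ?thesis using Fil_I[OF T'M] by auto
qed

lemma div_pred_le: "Suc K div (p - 1) * (p - 2) \<le> K"
proof (cases "Suc K div (p - 1)")
  case (Suc j)
  have "(j + 1) * (p - 1) \<le> Suc K" using Suc div_times_less_eq_dividend[of "Suc K" "p - 1"] by simp
  moreover have "(j + 1) * (p - 1) = (j + 1) * (p - 2) + (j + 1)" 
  proof -
    have "p - 1 = (p - 2) + 1" using p_ge_5 by simp
    thus ?thesis by (metis distrib_left mult.right_neutral)
  qed
  ultimately show ?thesis using Suc by simp
qed auto

lemma div_pred_le': "Suc K div (p - 1) \<le> K"
proof -
  have "Suc K div (p - 1) * 1 \<le> Suc K div (p - 1) * (p - 2)" using p_ge_5 by (intro mult_le_mono2) simp
  thus ?thesis using div_pred_le[of K] by linarith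
qed

lemma mono_approx_index: "mono (\<lambda>K. p * i + K + K div (p - 1) - 1)"
  by (intro monoI diff_le_mono add_mono div_le_mono) auto

text \<open>In \<open>approx_A\<close> the exponent v + K has to pay for the index p i + K + (K+1)
  div (p-1): v pays for p i, and K pays for the rest as long as rho is at most (p-2)/(p-1).\<close>

lemma V_approx_A:
  assumes f: "f \<in> M i" and i: "i \<ge> 1" and v: "\<rho> * real (p * i) \<le> real v"
    and \<rho>: "0 \<le> \<rho>" "\<rho> \<le> (real p - 2) / (real p - 1)"
  shows "pp ^ v * (V f * Ei ^ i) \<in> A \<rho>"
proof (rule approx_A[OF _ V_approx[OF f i] _ mono_approx_index])
  show "V f * Ei ^ i \<in> Z" using f M_sub by (auto intro!: Z_intros)
  fix K
  have 1: "real (Suc K div (p - 1)) * (real p - 2) \<le> real K"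
  proof -
    have "real (Suc K div (p - 1) * (p - 2)) \<le> real K" using div_pred_le by (subst of_nat_le_iff)
    thus ?thesis using p_ge_5 by (simp add: of_nat_diff)
  qed
  have "real K + real (Suc K div (p - 1)) \<le> real K * ((real p - 1) / (real p - 2))"
    using 1 p_ge_5 by (simp add: field_simps)
  hence "\<rho> * (real K + real (Suc K div (p - 1))) \<le> (real p - 2) / (real p - 1) * (real K * ((real p - 1) / (real p - 2)))"
    using \<rho> p_ge_5 by (intro mult_mono) auto
  also have "\<dots> = real K" using p_ge_5 by simp
  finally have 2: "\<rho> * (real K + real (Suc K div (p - 1))) \<le> real K" .
  have "real (p * i + Suc K + Suc K div (p - 1) - 1) = real (p * i) + (real K + real (Suc K div (p - 1)))" by simp
  thus "\<rho> * real (p * i + Suc K + Suc K div (p - 1) - 1) \<le> real (v + K)"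
    using 2 v by (simp only: distrib_left of_nat_add)
qed

text \<open>Here no p^v is available to pay for the index p. Instead V E / E \<equiv> 1 modulo p, so
  the constant 1 serves as approximation for K = 1 and the index function starts at 0; from then on
  p + 2 K \<le> K (p + 2) gives the rate.\<close>

lemma VE_quot: "V E * Ei \<in> A (1 / (real p + 2))"
proof -
  define I where "I = (\<lambda>K. if K \<le> 1 then 0 else p * 1 + K + K div (p - 1) - 1)"
  have "pp ^ 0 * (V E * Ei) \<in> A (1 / (real p + 2))"
  proof (rule approx_A[where I = I])
    show "V E * Ei \<in> Z" by (intro Z_intros E_Z)
    show "mono I" unfolding I_def using monoD[OF mono_approx_index[of 1]] by (intro monoI) auto
    show "\<exists>z\<in>Fil (I K). V E * Ei - z \<in> pI K" if "K \<ge> 1" for K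
    proof (cases "K = 1")
      case True
      have "(V E - E) * Ei \<in> pI 1" by (rule pI_mult_right) (use pI_diff[OF VE_1 E_1] in \<open>auto intro: Z_intros\<close>)
      thus ?thesis using True Fil_one by (intro bexI[of _ 1]) (auto simp: I_def left_diff_distrib E_Ei)
    next
      case False
      thus ?thesis using V_approx[OF E_in, of K] that by (simp add: I_def)
    qed
    fix K
    show "1 / (real p + 2) * real (I (Suc K)) \<le> real (0 + K)"
    proof (cases "K = 0")
      case False
      have "I (Suc K) \<le> p + K + K" using False div_pred_le'[of K] by (simp add: I_def)
      also have "\<dots> \<le> K * (p + 2)" using False by (cases K) (auto simp: algebra_simps)
      finally have "real (I (Suc K)) \<le> real (K * (p + 2))" by (subst of_nat_le_iff)
      thus ?thesis by (simp add: field_simps)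
    qed (simp add: I_def)
  qed
  thus ?thesis by simp
qed

lemma VE_quot_cong: "V E * Ei - 1 \<in> pI 1"
proof -
  have "(V E - E) * Ei \<in> pI 1" by (rule pI_mult_right) (use pI_diff[OF VE_1 E_1] in \<open>auto intro: Z_intros\<close>)
  thus ?thesis by (simp add: left_diff_distrib E_Ei)
qed

lemma quot_Z: "E * V Ei \<in> Z" by (intro Z_intros E_Z)
lemma quot_mult: "(V E * Ei) * (E * V Ei) = 1"
proof -
  have "(V E * Ei) * (E * V Ei) = (V E * V Ei) * (E * Ei)" by (simp only: ac_simps)
  thus ?thesis by (simp add: VE_VEi E_Ei)
qed

lemma quot_A: "E * V Ei \<in> A (1 / (real p + 2))"
  using A_inverse[OF VE_quot quot_mult VE_quot_cong quot_Z] .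

lemma quot_cong: "E * V Ei - 1 \<in> pI 1"
proof -
  have "(E * V Ei) * (1 - V E * Ei) \<in> pI 1" by (intro pI_mult_left quot_Z pI_sym[OF VE_quot_cong])
  thus ?thesis using quot_mult by (simp add: right_diff_distrib mult.commute)
qed

text \<open>For y = f / E^i one has V y = (V f / E^i) (E / V E)^i; the first factor, with its power
  of p, falls under \<open>V_approx_A\<close>, the second lies in A(1/(p+2)). Index 0 is separate:
  forms of weight 0 are fixed by V.\<close>

lemma V_A0:
  assumes "x \<in> A0 (real p * \<rho>) 0" "0 \<le> \<rho>" "\<rho> \<le> 1 / (real p + 2)"
  shows "V x \<in> A \<rho>"
  using assms(1)
proof (induction x rule: A0.induct)
  case A0_zero
  then show ?case by (simp add: V_zero A_zero)
next
  case (A0_step x y i e)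
  have "V (pp ^ e * y) \<in> A \<rho>"
  proof (cases "i = 0")
    case True
    hence "y \<in> M 0" using A0_step by (auto simp: Fil_def)
    hence "V (pp ^ e * y) = pp ^ e * y" by (simp add: V_mult V_power V_of_nat V_M0)
    moreover have "pp ^ e * y \<in> A0 \<rho> 0" using A0_step True by (intro A0_single[of _ 0]) auto
    ultimately show ?thesis using A0_A by simp
  next
    case False
    define f where "f = y * E ^ i"
    have f: "f \<in> M i" using A0_step by (auto simp: f_def Fil_def)
    have "\<rho> * real (p * i) \<le> real e" using A0_step by (simp add: algebra_simps)
    moreover have "1 / (real p + 2) \<le> (real p - 2) / (real p - 1)"
    proof -
      have "real p - 1 \<le> (real p - 2) * (real p + 2)"
      proof -
        have "(real p - 2) * 5 \<le> (real p - 2) * (real p + 2)" using p_ge_5 by (intro mult_left_mono) auto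
        moreover have "real p \<ge> 5" using p_ge_5 by simp
        hence "real p - 1 \<le> (real p - 2) * 5" by (simp add: algebra_simps)
        ultimately show ?thesis by (rule order.trans[rotated])
      qed
      thus ?thesis using p_ge_5 by (simp add: divide_simps)
    qed
    ultimately have "pp ^ e * (V f * Ei ^ i) \<in> A \<rho>" using False f assms by (intro V_approx_A) auto
    moreover have "(E * V Ei) ^ i \<in> A \<rho>" using A_power[OF A_mono[OF quot_A assms(3)]] .
    ultimately have "pp ^ e * (V f * Ei ^ i) * (E * V Ei) ^ i \<in> A \<rho>" by (rule A_mult)
    moreover have "pp ^ e * (V f * Ei ^ i) * (E * V Ei) ^ i = V (pp ^ e * y)"
    proof -
      have "pp ^ e * (V f * Ei ^ i) * (E * V Ei) ^ i = pp ^ e * (V y * (V E * V Ei) ^ i * (E * Ei) ^ i)"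
        unfolding f_def V_mult V_power power_mult_distrib by (simp only: ac_simps)
      thus ?thesis by (simp add: VE_VEi E_Ei V_mult V_power V_of_nat)
    qed
    ultimately show ?thesis by simp
  qed
  thus ?case using A0_step by (simp only: V_add A_add)
qed

end

section \<open>Power series in the weight variable\<close>

context katz_algebra
begin

text \<open>\<open>p * tau m\<close> is the weight parameter w of the character x -> x^((p-1) m), so
  \<open>tau m\<close> is the variable w / p at the classical points.\<close>

definition tau :: "nat \<Rightarrow> nat" where "tau m = ((1 + p) ^ ((p - 1) * m) - 1) div p"

lemma tau_nat: "(1 + p) ^ ((p - 1) * m) = 1 + p * tau m"
proof -
  obtain s where s: "(1 + p * 1) ^ ((p - 1) * m) = 1 + ((p - 1) * m) * p * 1 + p\<^sup>2 * s"
    using nat_pow_one_plus by blast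
  hence "(1 + p) ^ ((p - 1) * m) - 1 = p * ((p - 1) * m + p * s)"
    by (simp add: algebra_simps power2_eq_square)
  moreover have "(1 + p) ^ ((p - 1) * m) \<ge> 1" by simp
  ultimately have "(1 + p) ^ ((p - 1) * m) = 1 + p * ((p - 1) * m + p * s)" by linarith
  thus ?thesis unfolding tau_def by simp
qed

lemma tau_eq: "of_nat ((1 + p) ^ (p - 1)) ^ m = 1 + pp * of_nat (tau m)"
proof -
  have "of_nat ((1 + p) ^ (p - 1)) ^ m = (of_nat ((1 + p) ^ ((p - 1) * m)) :: 'a)"
    by (simp add: power_mult)
  thus ?thesis unfolding tau_nat by simp
qed

lemma tau_0: "tau 0 = 0" by (simp add: tau_def)

lemma tau_p_power: "\<exists>k. \<not> p dvd k \<and> tau (p ^ N) = p ^ N * k"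
proof -
  obtain k where k: "\<not> p dvd k" "((1 + p) ^ (p - 1)) ^ (p ^ N) = 1 + p ^ (N + 1) * k"
    using unit_power_p_power[OF prime_p odd_p] by blast
  have "1 + p * tau (p ^ N) = 1 + p * (p ^ N * k)"
    unfolding tau_nat[symmetric] using k(2) by (simp add: power_mult mult.assoc)
  thus ?thesis using k p_nz by (metis add_left_cancel mult_cancel_left)
qed

text \<open>With u = (1+p)^(p-1), the identity m = log(1 + p tau) / log u is approximated by ((1 + p
  tau)^(p^N) - 1) / (u^(p^N) - 1). The denominator is p^(N+1) times a unit, and
  \<open>choose_p_power_dvd\<close> makes all coefficients of the numerator divisible by p^(N+1), so
  the quotient is an integral polynomial in tau.\<close>

lemma nat_poly: "\<exists>\<Lambda>. (\<forall>i. coeff \<Lambda> i \<in> S) \<and> (\<forall>m. poly \<Lambda> (of_nat (tau m)) - of_nat m \<in> pI N)"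
proof -
  define u where "u = (1 + p) ^ (p - 1)"
  obtain k where k: "\<not> p dvd k" "u ^ (p ^ N) = 1 + p ^ (N + 1) * k"
    using unit_power_p_power[OF prime_p odd_p] unfolding u_def by blast
  obtain z where z: "z \<in> S" "of_nat k * z = 1" using S_inv[OF k(1)] by blast
  have "\<exists>c. (p ^ N choose j) * p ^ j = p ^ (N + 1) * c" if "j \<ge> 1" for j
    using choose_p_power_dvd[OF prime_p that] by blast
  then obtain c where c: "\<And>j. j \<ge> 1 \<Longrightarrow> (p ^ N choose j) * p ^ j = p ^ (N + 1) * c j" by metis
  define \<Lambda> where "\<Lambda> = (\<Sum>j=1..p ^ N. monom (z * of_nat (c j)) j)"
  have "coeff \<Lambda> i \<in> S" for i unfolding \<Lambda>_def coeff_sum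
    by (rule sum_closed) (auto simp: S_zero S_add S_mult z S_of_nat)
  moreover have "poly \<Lambda> (of_nat (tau m)) - of_nat m \<in> pI N" for m
  proof -
    define t :: 'a where "t = of_nat (tau m)"
    have "pp ^ (N + 1) * poly \<Lambda> t = (\<Sum>j=1..p ^ N. pp ^ (N + 1) * (z * of_nat (c j) * t ^ j))"
      unfolding \<Lambda>_def by (simp add: poly_sum poly_monom sum_distrib_left)
    also have "\<dots> = (\<Sum>j=1..p ^ N. z * (of_nat (p ^ N choose j) * (pp * t) ^ j))"
    proof (rule sum.cong)
      fix j assume "j \<in> {1..p ^ N}"
      hence "of_nat ((p ^ N choose j) * p ^ j) = (of_nat (p ^ (N + 1) * c j) :: 'a)" using c by auto
      hence "of_nat (p ^ N choose j) * pp ^ j = pp ^ (N + 1) * of_nat (c j)"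
        by (simp only: of_nat_mult of_nat_power)
      hence "pp ^ (N + 1) * of_nat (c j) * (z * t ^ j) = of_nat (p ^ N choose j) * pp ^ j * (z * t ^ j)"
        by (simp only:)
      thus "pp ^ (N + 1) * (z * of_nat (c j) * t ^ j) = z * (of_nat (p ^ N choose j) * (pp * t) ^ j)"
        by (simp only: power_mult_distrib ac_simps)
    qed auto
    also have "\<dots> = z * (\<Sum>j=1..p ^ N. of_nat (p ^ N choose j) * (pp * t) ^ j)"
      by (simp only: sum_distrib_left)
    also have "(\<Sum>j=1..p ^ N. of_nat (p ^ N choose j) * (pp * t) ^ j) = (pp * t + 1) ^ (p ^ N) - 1"
    proof -
      have "(pp * t + 1) ^ (p ^ N) = (\<Sum>j\<le>p ^ N. of_nat (p ^ N choose j) * (pp * t) ^ j)"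
        unfolding binomial_ring by simp
      also have "{..p ^ N} = insert 0 {1..p ^ N}" by auto
      finally show ?thesis by simp
    qed
    also have "pp * t + 1 = of_nat u ^ m" using tau_eq[of m] by (simp add: t_def u_def add.commute)
    also have "(of_nat u ^ m) ^ (p ^ N) = (of_nat (u ^ (p ^ N)) :: 'a) ^ m"
      by (simp add: mult.commute flip: power_mult)
    also have "of_nat (u ^ (p ^ N)) ^ m - 1 = pp ^ (N + 1) * of_nat k * (\<Sum>i<m. of_nat (u ^ (p ^ N)) ^ i)"
      using power_diff_1_eq[of "of_nat (u ^ (p ^ N)) :: 'a" m] by (simp add: k)
    also have "z * \<dots> = pp ^ (N + 1) * ((of_nat k * z) * (\<Sum>i<m. of_nat (u ^ (p ^ N)) ^ i))"
      by (simp only: ac_simps)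
    also have "\<dots> = pp ^ (N + 1) * (\<Sum>i<m. of_nat (u ^ (p ^ N)) ^ i)" by (simp only: z mult_1)
    finally have "poly \<Lambda> t = (\<Sum>i<m. of_nat (u ^ (p ^ N)) ^ i)" by simp
    hence "poly \<Lambda> t - of_nat m = (\<Sum>i<m. of_nat (u ^ (p ^ N)) ^ i - 1)" by (simp add: sum_subtractf)
    moreover have "of_nat (u ^ (p ^ N)) ^ i - (1 :: 'a) \<in> pI N" for i
    proof -
      have "of_nat (u ^ (p ^ N)) ^ i - (1 :: 'a) = pp ^ (N + 1) * (of_nat k * (\<Sum>l<i. of_nat (u ^ (p ^ N)) ^ l))"
        using power_diff_1_eq[of "of_nat (u ^ (p ^ N)) :: 'a" i] by (simp add: k mult.assoc)
      also have "\<dots> \<in> pI (N + 1)" by (intro pI_I Z_intros)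
      finally show ?thesis by (rule pI_mono) simp
    qed
    ultimately show ?thesis unfolding t_def by (auto intro: pI_sum)
  qed
  ultimately show ?thesis by blast
qed

text \<open>Power series in w / p in disguise: functions of m that are p-adic limits, uniformly in
  m, of polynomials in \<open>tau m\<close> over \<open>A0\<close>. Keeping only polynomial
  approximations makes closure under products, V and limits immediate.\<close>

definition PP :: "real \<Rightarrow> (nat \<Rightarrow> 'a) set" where
  "PP \<rho> = {f. (\<forall>m. f m \<in> Z) \<and>
     (\<forall>N. \<exists>Q. (\<forall>i. coeff Q i \<in> A0 \<rho> 0) \<and> (\<forall>m. f m - poly Q (of_nat (tau m)) \<in> pI N))}"

lemma PP_Z: "f \<in> PP \<rho> \<Longrightarrow> f m \<in> Z" by (auto simp: PP_def)
lemma PP_ex: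
  assumes "f \<in> PP \<rho>"
  obtains Q where "\<And>i. coeff Q i \<in> A0 \<rho> 0" "\<And>m. f m - poly Q (of_nat (tau m)) \<in> pI N"
proof -
  from assms have "\<exists>Q. (\<forall>i. coeff Q i \<in> A0 \<rho> 0) \<and> (\<forall>m. f m - poly Q (of_nat (tau m)) \<in> pI N)"
    by (simp add: PP_def)
  thus ?thesis using that by blast
qed

lemma A0_0_mult: "x \<in> A0 \<rho> 0 \<Longrightarrow> y \<in> A0 \<rho> 0 \<Longrightarrow> x * y \<in> A0 \<rho> 0"
  using A0_mult[of y \<rho> 0 x 0] by simp

lemma PP_mono: "f \<in> PP \<rho> \<Longrightarrow> \<rho>' \<le> \<rho> \<Longrightarrow> f \<in> PP \<rho>'"
proof -
  assume f: "f \<in> PP \<rho>" and le: "\<rho>' \<le> \<rho>"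
  have "\<exists>Q. (\<forall>i. coeff Q i \<in> A0 \<rho>' 0) \<and> (\<forall>m. f m - poly Q (of_nat (tau m)) \<in> pI N)" for N
  proof -
    obtain Q where Q: "\<And>i. coeff Q i \<in> A0 \<rho> 0" "\<And>m. f m - poly Q (of_nat (tau m)) \<in> pI N"
      using PP_ex[OF f] by blast
    show ?thesis by (intro exI[of _ Q] conjI allI A0_mono[OF Q(1) le] Q(2)) simp
  qed
  thus ?thesis using PP_Z[OF f] by (simp add: PP_def)
qed

lemma PP_diff:
  assumes "f \<in> PP \<rho>" "g \<in> PP \<rho>"
  shows "(\<lambda>m. f m - g m) \<in> PP \<rho>"
  unfolding PP_def
proof (intro CollectI conjI allI)
  fix m show "f m - g m \<in> Z" using assms by (intro Z_diff PP_Z)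
next
  fix N
  obtain P Q where *: "\<And>i. coeff P i \<in> A0 \<rho> 0" "\<And>m. f m - poly P (of_nat (tau m)) \<in> pI N"
    "\<And>i. coeff Q i \<in> A0 \<rho> 0" "\<And>m. g m - poly Q (of_nat (tau m)) \<in> pI N"
    using PP_ex[OF assms(1)] PP_ex[OF assms(2)] by metis
  have "f m - g m - poly (P - Q) (of_nat (tau m)) \<in> pI N" for m
    using pI_diff[OF *(2,4)[of m]] by (simp add: algebra_simps)
  thus "\<exists>Q. (\<forall>i. coeff Q i \<in> A0 \<rho> 0) \<and> (\<forall>m. f m - g m - poly Q (of_nat (tau m)) \<in> pI N)"
    using * by (intro exI[of _ "P - Q"]) (auto intro: A0_diff)
qed

lemma A0_poly_Z: "(\<And>i. coeff P i \<in> A0 \<rho> 0) \<Longrightarrow> poly P (of_nat n) \<in> Z"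
  by (intro poly_Z Z_of_nat) (auto intro: A0_Z)

lemma PP_mult:
  assumes "f \<in> PP \<rho>" "g \<in> PP \<rho>"
  shows "(\<lambda>m. f m * g m) \<in> PP \<rho>"
  unfolding PP_def
proof (intro CollectI conjI allI)
  fix m show "f m * g m \<in> Z" using assms by (intro Z_mult PP_Z)
next
  fix N
  obtain P Q where *: "\<And>i. coeff P i \<in> A0 \<rho> 0" "\<And>m. f m - poly P (of_nat (tau m)) \<in> pI N"
    "\<And>i. coeff Q i \<in> A0 \<rho> 0" "\<And>m. g m - poly Q (of_nat (tau m)) \<in> pI N"
    using PP_ex[OF assms(1)] PP_ex[OF assms(2)] by metis
  have "f m * g m - poly (P * Q) (of_nat (tau m)) \<in> pI N" for m
    using pI_prod_cong[OF *(2,4)[of m]] PP_Z[OF assms(2)] A0_poly_Z[OF *(1)] by simp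
  moreover have "coeff (P * Q) i \<in> A0 \<rho> 0" for i
    by (rule coeff_mult_closed) (auto intro: A0_zero A0_add A0_0_mult *)
  ultimately show "\<exists>Q. (\<forall>i. coeff Q i \<in> A0 \<rho> 0) \<and> (\<forall>m. f m * g m - poly Q (of_nat (tau m)) \<in> pI N)"
    by blast
qed

lemma PP_const: "x \<in> A \<rho> \<Longrightarrow> (\<lambda>_. x) \<in> PP \<rho>"
  unfolding PP_def
proof (intro CollectI conjI allI)
  fix N
  assume x: "x \<in> A \<rho>"
  then obtain y where "y \<in> A0 \<rho> 0" "x - y \<in> pI N" using A_ex by blast
  thus "\<exists>Q. (\<forall>i. coeff Q i \<in> A0 \<rho> 0) \<and> (\<forall>m :: nat. x - poly Q (of_nat (tau m)) \<in> pI N)"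
    by (intro exI[of _ "[:y:]"]) (auto simp: coeff_pCons A0_zero split: nat.splits)
qed (auto intro: A_Z)

lemma PP_one: "(\<lambda>_. 1) \<in> PP \<rho>" by (intro PP_const A_S S_one)
lemma PP_zero: "(\<lambda>_. 0) \<in> PP \<rho>" by (intro PP_const A_zero)
lemma PP_add: "f \<in> PP \<rho> \<Longrightarrow> g \<in> PP \<rho> \<Longrightarrow> (\<lambda>m. f m + g m) \<in> PP \<rho>"
  using PP_diff[OF _ PP_diff[OF PP_zero], of f \<rho> g] by simp
lemma PP_sum: "(\<And>i. i \<in> I \<Longrightarrow> f i \<in> PP \<rho>) \<Longrightarrow> (\<lambda>m. \<Sum>i\<in>I. f i m) \<in> PP \<rho>"
  by (induction I rule: infinite_finite_induct) (auto intro: PP_zero PP_add)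
lemma PP_power: "f \<in> PP \<rho> \<Longrightarrow> (\<lambda>m. f m ^ n) \<in> PP \<rho>"
  by (induction n) (auto intro: PP_one PP_mult)
lemma PP_prod: "(\<And>i. i \<in> I \<Longrightarrow> f i \<in> PP \<rho>) \<Longrightarrow> (\<lambda>m. \<Prod>i\<in>I. f i m) \<in> PP \<rho>"
  by (induction I rule: infinite_finite_induct) (auto intro: PP_one PP_mult)

lemma PP_of_nat: "of_nat \<in> PP \<rho>"
proof -
  have "\<exists>Q. (\<forall>i. coeff Q i \<in> A0 \<rho> 0) \<and> (\<forall>m. of_nat m - poly Q (of_nat (tau m)) \<in> pI N)" for N
  proof -
    obtain Q where Q: "\<And>i. coeff Q i \<in> S" "\<And>m. poly Q (of_nat (tau m)) - of_nat m \<in> pI N"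
      using nat_poly by blast
    show ?thesis by (intro exI[of _ Q] conjI allI A0_S[OF Q(1)] pI_sym[OF Q(2)])
  qed
  thus ?thesis by (simp add: PP_def Z_of_nat)
qed

lemma PP_closed:
  assumes "\<And>m. f m \<in> Z" "\<And>N. \<exists>g\<in>PP \<rho>. \<forall>m. f m - g m \<in> pI N"
  shows "f \<in> PP \<rho>"
  unfolding PP_def
proof (intro CollectI conjI allI)
  fix N
  obtain g where g: "g \<in> PP \<rho>" "\<And>m. f m - g m \<in> pI N" using assms(2) by blast
  obtain Q where "\<And>i. coeff Q i \<in> A0 \<rho> 0" "\<And>m. g m - poly Q (of_nat (tau m)) \<in> pI N"
    using PP_ex[OF g(1)] by blast
  thus "\<exists>Q. (\<forall>i. coeff Q i \<in> A0 \<rho> 0) \<and> (\<forall>m. f m - poly Q (of_nat (tau m)) \<in> pI N)"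
    using pI_trans[OF g(2)] by blast
qed (use assms in auto)

lemma PP_inverse:
  assumes "f \<in> PP \<rho>" "\<And>m. f m * g m = 1" "\<And>m. f m - 1 \<in> pI 1" "\<And>m. g m \<in> Z"
  shows "g \<in> PP \<rho>"
proof (rule PP_closed[OF assms(4)])
  fix N
  have "(\<lambda>m. \<Sum>l<N. (1 - f m) ^ l) \<in> PP \<rho>" by (intro PP_sum PP_power PP_diff PP_one assms)
  thus "\<exists>h\<in>PP \<rho>. \<forall>m. g m - h m \<in> pI N"
    using geometric_inverse[OF assms(2-4)] by (intro bexI[of _ "\<lambda>m. \<Sum>l<N. (1 - f m) ^ l"]) auto
qed

text \<open>C(m,n) d_n is m (m-1) ... (m-n+1) times d_n / n!. The falling factorial is a polynomial
  in m, hence in \<open>PP\<close> by \<open>PP_of_nat\<close>, and d_n / n! lies in A at the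
  reduced rate. Terms with n \<ge> N vanish modulo p^N.\<close>

lemma PP_mahler:
  assumes d: "\<And>n. d n \<in> pI n" and P: "\<And>n. \<exists>P\<in>Fil n. d n - P \<in> A \<rho>" and \<rho>: "\<rho> \<le> 1"
    and f: "\<And>m. f m = (\<Sum>n\<le>m. of_nat (m choose n) * d n)"
  shows "f \<in> PP (drate \<rho>)"
proof (rule PP_closed)
  show "f m \<in> Z" for m unfolding f by (intro Z_intros pI_Z[OF d])
  fix N
  obtain x where x: "\<And>n. x n \<in> A (drate \<rho>)" "\<And>n. d n = of_nat (fact n) * x n"
  proof -
    have "\<forall>n. \<exists>x. x \<in> A (drate \<rho>) \<and> d n = of_nat (fact n) * x"
      using A_div_fact[OF d _ _ \<rho>] P by blast
    thus ?thesis using that by metis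
  qed
  define g where "g = (\<lambda>m. \<Sum>n<N. (\<Prod>i<n. of_nat m - of_nat i) * x n)"
  have "g \<in> PP (drate \<rho>)" unfolding g_def
    by (intro PP_sum PP_mult PP_prod PP_diff PP_of_nat PP_const x A_S S_of_nat)
  moreover have "f m - g m \<in> pI N" for m
  proof -
    have t: "(\<Prod>i<n. of_nat m - of_nat i) * x n = of_nat (m choose n) * d n" for n
      unfolding binomial_fact_prod[symmetric] x(2) by (simp only: mult.assoc)
    define K where "K = max N (Suc m)"
    have "f m = (\<Sum>n<K. of_nat (m choose n) * d n)" unfolding f
      by (intro sum.mono_neutral_left) (auto simp: K_def)
    also have "{..<K} = {..<N} \<union> {N..<K}" by (auto simp: K_def)
    also have "(\<Sum>n\<in>{..<N} \<union> {N..<K}. of_nat (m choose n) * d n) = g m + (\<Sum>n\<in>{N..<K}. of_nat (m choose n) * d n)"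
      unfolding g_def t by (intro sum.union_disjoint) auto
    finally have "f m - g m = (\<Sum>n\<in>{N..<K}. of_nat (m choose n) * d n)" by simp
    also have "\<dots> \<in> pI N" by (intro pI_sum pI_mult_left Z_of_nat pI_mono[OF d]) auto
    finally show ?thesis .
  qed
  ultimately show "\<exists>g\<in>PP (drate \<rho>). \<forall>m. f m - g m \<in> pI N" by blast
qed

lemma PP_power_index:
  assumes "y \<in> A \<rho>" "y - 1 \<in> pI 1" "\<rho> \<le> 1"
  shows "(\<lambda>m. y ^ m) \<in> PP (drate \<rho>)"
proof (rule PP_mahler[where d = "\<lambda>n. (y - 1) ^ n", OF _ _ assms(3)])
  show "(y - 1) ^ n \<in> pI n" for n using pI_power1[OF assms(2)] .
  show "\<exists>P\<in>Fil n. (y - 1) ^ n - P \<in> A \<rho>" for n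
    using assms by (intro bexI[of _ 0]) (auto intro!: A_power A_diff[OF _ A_S[OF S_one]] Fil_zero)
  show "y ^ m = (\<Sum>n\<le>m. of_nat (m choose n) * (y - 1) ^ n)" for m
    using binomial_ring[of "y - 1" 1 m] by simp
qed

lemma PP_V:
  assumes f: "f \<in> PP (real p * \<rho>)" and \<rho>: "0 \<le> \<rho>" "\<rho> \<le> 1 / (real p + 2)"
  shows "(\<lambda>m. V (f m)) \<in> PP \<rho>"
proof (rule PP_closed)
  show "V (f m) \<in> Z" for m using PP_Z[OF f] by (rule V_Z)
  fix N
  obtain Q where Q: "\<And>i. coeff Q i \<in> A0 (real p * \<rho>) 0" "\<And>m. f m - poly Q (of_nat (tau m)) \<in> pI N"
    using PP_ex[OF f] by blast
  define g where "g = (\<lambda>m. \<Sum>i\<le>degree Q. V (coeff Q i) * of_nat (tau m) ^ i)"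
  have tau_PP: "(\<lambda>m. of_nat (tau m)) \<in> PP \<rho>" unfolding PP_def
    by (auto intro!: Z_of_nat exI[of _ "[:0, 1:]"] simp: coeff_pCons A0_zero A0_S S_one pI_zero split: nat.splits)
  have "g \<in> PP \<rho>" unfolding g_def
    by (intro PP_sum PP_mult PP_power tau_PP PP_const V_A0[OF Q(1)] \<rho>)
  moreover have "V (f m) - g m \<in> pI N" for m
    using pI_V[OF Q(2)[of m]] unfolding g_def poly_altdef
    by (simp add: V_diff V_sum V_mult V_power V_of_nat)
  ultimately show "\<exists>g\<in>PP \<rho>. \<forall>m. V (f m) - g m \<in> pI N" by blast
qed

lemma Es_1: "Es m - 1 \<in> pI 1"
proof (induction m)
  case (Suc m)
  have "Es (Suc m) - Es m \<in> pI 1" using Es_fdiff[of 1 m] by (auto simp: pI_def)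
  from pI_trans[OF this Suc] show ?case .
qed (simp add: Es_0 pI_zero)

lemma Ei_1: "Ei - 1 \<in> pI 1"
proof -
  have "Ei * (1 - E) \<in> pI 1" by (intro pI_mult_left pI_sym[OF E_1] Z_intros)
  thus ?thesis by (simp add: right_diff_distrib Ei_E)
qed

definition hh :: "nat \<Rightarrow> 'a" where "hh m = Es m * Ei ^ m"

lemma fdiff_hh: "fdiff n hh x \<in> pI n"
proof -
  have "fdiff n Es x \<in> pI (n + 0)" for n x using Es_fdiff[of n x] by (auto simp: pI_def)
  moreover have "fdiff n (\<lambda>x. Ei ^ x) x \<in> pI (n + 0)" for n x
    unfolding fdiff_power using pI_power1[OF Ei_1, of n] by (auto intro!: pI_mult_left Z_intros)
  ultimately show ?thesis unfolding hh_def using fdiff_mult[of Es 0 "\<lambda>x. Ei ^ x" 0 n x] by simp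
qed

lemma one_minus_unit: "j \<ge> 1 \<Longrightarrow> \<exists>s\<in>S. (1 - pp ^ j) * s = 1"
proof -
  assume "j \<ge> 1"
  have "p dvd p ^ j" "p ^ j \<ge> 1" using \<open>j \<ge> 1\<close> p_nz by (auto simp: Suc_le_eq simp del: p_nz)
  hence "\<not> p dvd p ^ j - 1" using dvd_diffD1[of p "p ^ j" 1] p_ge_5 by auto
  then obtain z where z: "z \<in> S" "of_nat (p ^ j - 1) * z = 1" using S_inv by blast
  have "of_nat (p ^ j - 1) = pp ^ j - 1" using \<open>p ^ j \<ge> 1\<close> by (simp add: of_nat_diff)
  moreover have "(1 - pp ^ j) * (-z) = (pp ^ j - 1) * z" by (simp add: algebra_simps)
  ultimately have "(1 - pp ^ j) * (-z) = 1" using z by simp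
  thus ?thesis using z S_uminus by blast
qed

text \<open>With k = (p-1) m, \<open>Es m\<close> is (E_k - p^{k-1} V E_k) / (1 - p^{k-1}). After
  division by E^m the first term lies in \<open>Fil m\<close>; the second has rate (p-2)/p, since
  its exponent (p-1) m - 1 is at least (p-2) m, while V contributes the index p m.\<close>

lemma hh_split: "\<exists>P\<in>Fil m. hh m - P \<in> A ((real p - 2) / real p)"
proof (cases "m = 0")
  case True
  thus ?thesis by (intro bexI[of _ 1]) (auto simp: hh_def Es_0 A_zero Fil_one)
next
  case False
  define c where "c = (p - 1) * m - 1"
  have c1: "(p - 1) * m \<ge> 4" using False p_ge_5 mult_le_mono[of 4 "p - 1" 1 m] by simp
  hence "c \<ge> 1" unfolding c_def by linarith
  then obtain s where s: "s \<in> S" "(1 - pp ^ c) * s = 1" using one_minus_unit by blast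
  have "Es m = s * ((1 - pp ^ c) * Es m)" using s by (simp add: mult.assoc[symmetric] mult.commute[of s])
  also have "\<dots> = s * (Ek m - pp ^ c * V (Ek m))" using Es_eq[of m] False by (simp add: c_def)
  finally have Esm: "Es m = s * (Ek m - pp ^ c * V (Ek m))" .
  have e: "hh m - s * (Ek m * Ei ^ m) = - (s * (pp ^ c * (V (Ek m) * Ei ^ m)))"
    unfolding hh_def Esm by (simp add: algebra_simps)
  have Ekm: "Ek m \<in> M m" using False Ek_in by simp
  have "(real p - 2) / real p * real (p * m) \<le> real c"
  proof -
    have "(real p - 2) * real m \<le> (real p - 1) * real m - 1"
      using False by (simp add: algebra_simps)
    moreover have "real c = real ((p - 1) * m) - real 1"
      unfolding c_def by (rule of_nat_diff) (use c1 in linarith)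
    moreover have "real ((p - 1) * m) = (real p - 1) * real m" using p_ge_5 by (simp add: of_nat_diff)
    moreover have "(real p - 2) / real p * real (p * m) = (real p - 2) * real m" using p_ge_5 by simp
    ultimately show ?thesis by simp
  qed
  hence "pp ^ c * (V (Ek m) * Ei ^ m) \<in> A ((real p - 2) / real p)"
    using False p_ge_5 by (intro V_approx_A Ekm) (auto intro!: divide_left_mono)
  hence "hh m - s * (Ek m * Ei ^ m) \<in> A ((real p - 2) / real p)"
    unfolding e by (intro A_uminus A_mult[OF A_S[OF s(1)]])
  thus ?thesis using Fil_scale[OF s(1) Fil_I[OF Ekm]] by blast
qed

text \<open>The n-th difference at 0 involves only \<open>hh 0\<close>, ..., \<open>hh n\<close>,
  each in \<open>Fil n\<close> up to an element of A; this supplies the main terms for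
  \<open>PP_mahler\<close>.\<close>

lemma hh_PP: "hh \<in> PP (drate ((real p - 2) / real p))"
proof (rule PP_mahler)
  show "fdiff n hh 0 \<in> pI n" for n by (rule fdiff_hh)
  show "hh m = (\<Sum>n\<le>m. of_nat (m choose n) * fdiff n hh 0)" for m
    using newton_forward[of hh m 0] by simp
  show "(real p - 2) / real p \<le> 1" using p_ge_5 by simp
  fix n
  define X where "X = {x. \<exists>P\<in>Fil n. x - P \<in> A ((real p - 2) / real p)}"
  have "fdiff n hh 0 \<in> X"
  proof (rule fdiff_closed)
    fix x y assume "x \<in> X" "y \<in> X"
    then obtain P Q where "P \<in> Fil n" "x - P \<in> A ((real p - 2) / real p)" "Q \<in> Fil n" "y - Q \<in> A ((real p - 2) / real p)"
      by (auto simp: X_def)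
    thus "x - y \<in> X" using A_diff[of "x - P" _ "y - Q"] unfolding X_def
      by (auto intro!: bexI[of _ "P - Q"] Fil_diff simp: algebra_simps)
  next
    fix m assume "m \<le> 0 + n"
    thus "hh m \<in> X" using hh_split[of m] unfolding X_def by (auto intro: Fil_mono)
  qed
  thus "\<exists>P\<in>Fil n. fdiff n hh 0 - P \<in> A ((real p - 2) / real p)" by (simp add: X_def)
qed

text \<open>The factorisation is \<open>hh m\<close> times the inverse of \<open>V (hh m)\<close>
  times (E / V E)^m. The second condition on \<open>c\<close> is the loss of V on
  \<open>hh m\<close>, the third is the rate of the last factor.\<close>

theorem quotient_PP:
  assumes c: "0 \<le> c" "real p * c \<le> drate ((real p - 2) / real p)" "c \<le> drate (1 / (real p + 2))"
    and Esi: "\<And>m. Esi m \<in> Z" "\<And>m. Es m * Esi m = 1"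
  shows "(\<lambda>m. Es m * V (Esi m)) \<in> PP c"
proof -
  have "c \<le> 1 / (real p + 2)"
  proof -
    have "1 / (real p + 2) * ((real p - 2) / (real p - 1)) \<le> 1 / (real p + 2) * 1"
      using p_ge_5 by (intro mult_left_mono) auto
    thus ?thesis using c(3) unfolding drate_def by simp
  qed
  have h: "hh \<in> PP (real p * c)" using PP_mono[OF hh_PP c(2)] .
  have Vh: "(\<lambda>m. V (hh m)) \<in> PP c" by (rule PP_V[OF h c(1)]) fact
  have drate_le: "drate ((real p - 2) / real p) \<le> 1" 
    unfolding drate_def using p_ge_5 by (simp add: divide_simps mult_left_le mult_mono)
  have "c \<le> real p * c" using c(1) p_ge_5 mult_right_mono[of 1 "real p" c] by simp
  hence h': "hh \<in> PP c" using PP_mono[OF h] by simp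
  have Vhi: "(\<lambda>m. V (Esi m * E ^ m)) \<in> PP c"
  proof (rule PP_inverse[OF Vh])
    show "V (hh m) * V (Esi m * E ^ m) = 1" for m
    proof -
      have "hh m * (Esi m * E ^ m) = (Es m * Esi m) * (E ^ m * Ei ^ m)" unfolding hh_def by (simp only: ac_simps)
      thus ?thesis using Esi E_pow_Ei[of m] by (simp add: V_mult[symmetric] V_one)
    qed
    show "V (Esi m * E ^ m) \<in> Z" for m by (intro Z_intros Esi E_Z)
    show "V (hh m) - 1 \<in> pI 1" for m
    proof -
      have "Ei ^ m - 1 \<in> pI 1"
      proof (induction m)
        case (Suc m)
        have "Ei * Ei ^ m - 1 * 1 \<in> pI 1" by (intro pI_prod_cong Ei_1 Suc Z_intros)
        thus ?case by simp
      qed (simp add: pI_zero)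
      hence "Es m * Ei ^ m - 1 * 1 \<in> pI 1" by (intro pI_prod_cong Es_1 Z_intros)
      thus ?thesis using pI_V[of "hh m - 1" 1] by (simp add: hh_def V_diff V_one)
    qed
  qed
  have q: "(\<lambda>m. (E * V Ei) ^ m) \<in> PP c"
    by (rule PP_mono[OF PP_power_index[OF quot_A quot_cong] c(3)]) simp
  have "(\<lambda>m. hh m * V (Esi m * E ^ m) * (E * V Ei) ^ m) \<in> PP c" by (intro PP_mult h' Vhi q)
  moreover have "hh m * V (Esi m * E ^ m) * (E * V Ei) ^ m = Es m * V (Esi m)" for m
  proof -
    have "hh m * V (Esi m * E ^ m) * (E * V Ei) ^ m = Es m * V (Esi m) * (E ^ m * Ei ^ m) * (V E * V Ei) ^ m"
      unfolding hh_def V_mult V_power power_mult_distrib by (simp only: ac_simps)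
    thus ?thesis by (simp add: E_pow_Ei VE_VEi)
  qed
  ultimately show ?thesis by simp
qed

text \<open>Evaluate at t = tau(p^L), of exact valuation L, with L = K div (i+2). If the
  coefficients up to i are divisible by p^K, then all terms except the one of degree l = i + 1 are
  divisible by p^(L(i+2)): the lower ones by p^K, the higher ones by t^(l+1). Cancelling t^l leaves
  p^L. Dividing the precision by i + 2 at each step produces the factorial.\<close>

lemma small_coeffs:
  assumes r: "\<And>j. r j \<in> Z" and s: "\<And>m. (\<Sum>j<J. r j * of_nat (tau m) ^ j) \<in> pI N"
  shows "i < J \<Longrightarrow> l \<le> i \<Longrightarrow> r l \<in> pI (N div fact (i + 1))"
proof (induction i arbitrary: l)
  case 0
  have "(\<Sum>j<J. r j * of_nat (tau 0) ^ j) = (\<Sum>j\<in>{0}. r j * of_nat (tau 0) ^ j)"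
    using 0 by (intro sum.mono_neutral_right) (auto simp: tau_0)
  thus ?case using s[of 0] 0 by simp
next
  case (Suc i)
  define K L where "K = N div fact (i + 1)" and "L = N div fact (Suc i + 1)"
  have L: "L = K div (i + 2)" unfolding K_def L_def
    by (simp add: div_mult2_eq[symmetric] mult.commute)
  have IH: "r l \<in> pI K" if "l \<le> i" for l using Suc that unfolding K_def by simp
  have LK: "L * (i + 2) \<le> K" unfolding L by (rule div_times_less_eq_dividend)
  have KN: "K \<le> N" unfolding K_def by (rule div_le_dividend)
  show ?case
  proof (cases "l \<le> i")
    case True
    have "L \<le> K" unfolding L by (rule div_le_dividend)
    thus ?thesis using pI_mono[OF IH[OF True]] unfolding L_def by simp
  next
    case False
    hence l: "l = Suc i" using Suc by simp
    obtain k where k: "\<not> p dvd k" "tau (p ^ L) = p ^ L * k" using tau_p_power by blast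
    obtain z where z: "z \<in> S" "of_nat k * z = 1" using S_inv[OF k(1)] by blast
    define t :: 'a where "t = of_nat (tau (p ^ L))"
    have tpI: "t \<in> pI L" unfolding t_def k by (auto intro: pI_I Z_of_nat)
    have "{..<J} = {..i} \<union> insert l {Suc l..<J}" using l Suc by auto
    hence e: "r l * t ^ l = (\<Sum>j<J. r j * t ^ j) - (\<Sum>j\<le>i. r j * t ^ j) - (\<Sum>j=Suc l..<J. r j * t ^ j)"
    proof -
      have "(\<Sum>j<J. r j * t ^ j) = (\<Sum>j\<le>i. r j * t ^ j) + (\<Sum>j\<in>insert l {Suc l..<J}. r j * t ^ j)"
        unfolding \<open>{..<J} = _\<close> using l by (intro sum.union_disjoint) auto
      thus ?thesis by simp
    qed
    have "(\<Sum>j<J. r j * t ^ j) \<in> pI (L * (i + 2))"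
      using pI_mono[OF s[of "p ^ L"]] LK KN unfolding t_def by (meson order.trans)
    moreover have "(\<Sum>j\<le>i. r j * t ^ j) \<in> pI (L * (i + 2))"
    proof (intro pI_sum pI_mult_right)
      fix j assume "j \<in> {..i}"
      thus "r j \<in> pI (L * (i + 2))" using pI_mono[OF IH LK] by simp
    qed (auto simp: t_def intro: Z_intros)
    moreover have "(\<Sum>j=Suc l..<J. r j * t ^ j) \<in> pI (L * (i + 2))"
    proof (intro pI_sum pI_mult_left r)
      fix j assume "j \<in> {Suc l..<J}"
      hence "L * (i + 2) \<le> L * j" using l by (intro mult_le_mono2) auto
      thus "t ^ j \<in> pI (L * (i + 2))" using pI_mono[OF pI_power[OF tpI, of j]] by simp
    qed
    ultimately have "r l * t ^ l \<in> pI (L * (i + 2))"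
      unfolding e by (intro pI_diff)
    hence "r l * t ^ l * z ^ l \<in> pI (L * (i + 2))" by (rule pI_mult_right) (use z S_sub in \<open>auto intro: Z_power\<close>)
    moreover have "r l * t ^ l * z ^ l = pp ^ (L * l) * r l"
    proof -
      have "t * z = pp ^ L * (of_nat k * z)" unfolding t_def k by (simp add: mult.assoc)
      hence "t * z = pp ^ L" by (simp add: z)
      hence "(t * z) ^ l = pp ^ (L * l)" by (simp add: power_mult)
      thus ?thesis by (simp add: power_mult_distrib mult.assoc mult.commute)
    qed
    moreover have "L * (i + 2) = L * l + L" using l by simp
    ultimately have "pp ^ (L * l) * r l \<in> pI (L * l + L)" by (simp add: add.commute)
    hence "r l \<in> pI L" by (rule pI_cancel)
    thus ?thesis unfolding L_def by simp
  qed
qed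

text \<open>The function has an expansion in p tau with integral coefficients and a polynomial
  approximation in tau over \<open>A0\<close>. The two are close at every classical point, so
  \<open>small_coeffs\<close> makes their coefficients close.\<close>

theorem PP_coeff:
  assumes F: "F \<in> PP c" and Z: "\<And>j. Fj j \<in> Z"
    and s: "\<And>m J. F m - (\<Sum>j<J. Fj j * (pp * of_nat (tau m)) ^ j) \<in> pI J"
  shows "pp ^ i * Fj i \<in> A c"
proof (rule A_closed)
  show "pp ^ i * Fj i \<in> Z" by (intro Z_intros Z)
  fix K :: nat
  \<comment> \<open>Chosen so that the division by (i+1)! in \<open>small_coeffs\<close> leaves the
    precision K.\<close>
  define N where "N = K * fact (i + 1)"
  obtain Q where Q: "\<And>i. coeff Q i \<in> A0 c 0" "\<And>m. F m - poly Q (of_nat (tau m)) \<in> pI N"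
    using PP_ex[OF F] by blast
  define J where "J = Suc i + N + Suc (degree Q)"
  define r where "r = (\<lambda>j. pp ^ j * Fj j - coeff Q j)"
  have rZ: "r j \<in> Z" for j unfolding r_def by (intro Z_intros Z A0_Z[OF Q(1)])
  have "(\<Sum>j<J. r j * of_nat (tau m) ^ j) \<in> pI N" for m
  proof -
    have "poly Q (of_nat (tau m)) = (\<Sum>j<J. coeff Q j * of_nat (tau m) ^ j)"
      by (intro poly_eq_sum coeff_eq_0) (auto simp: J_def)
    hence "(\<Sum>j<J. r j * of_nat (tau m) ^ j) =
       (F m - poly Q (of_nat (tau m))) - (F m - (\<Sum>j<J. Fj j * (pp * of_nat (tau m)) ^ j))"
    proof -
      have "r j * t ^ j = Fj j * (pp * t) ^ j - coeff Q j * t ^ j" for j t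
        unfolding r_def by (simp add: power_mult_distrib algebra_simps)
      thus ?thesis using \<open>poly Q _ = _\<close> by (simp add: sum_subtractf)
    qed
    also have "\<dots> \<in> pI N" by (intro pI_diff Q pI_mono[OF s]) (auto simp: J_def)
    finally show ?thesis .
  qed
  from small_coeffs[OF rZ this, of i i] have "r i \<in> pI K" by (simp add: J_def N_def)
  thus "\<exists>y\<in>A c. pp ^ i * Fj i - y \<in> pI K" unfolding r_def using A0_A[OF Q(1)] by blast
qed

end

section \<open>Integral modular forms and Hecke operators\<close>

definition nome :: "complex \<Rightarrow> complex" where "nome z = exp (2 * of_real pi * \<i> * z)"

definition q_expands :: "(nat \<Rightarrow> complex) \<Rightarrow> (complex \<Rightarrow> complex) \<Rightarrow> bool" where
  "q_expands a f \<longleftrightarrow> (\<forall>z. Im z > 0 \<longrightarrow> (\<lambda>n. a n * nome z ^ n) sums f z)"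

lemma norm_nome: "norm (nome z) = exp (- 2 * pi * Im z)"
  by (simp add: nome_def norm_exp_eq_Re)

lemma nome_add_int: "nome (z + of_int n) = nome z"
proof -
  have "nome (z + of_int n) = nome z * exp (2 * of_int n * of_real pi * \<i>)"
    by (simp add: nome_def algebra_simps flip: exp_add)
  thus ?thesis using exp_integer_2pi[of "of_int n"] by simp
qed

lemma nome_of_nat_mult: "nome (of_nat n * z) = nome z ^ n"
  unfolding nome_def exp_of_nat_mult[symmetric] by (simp only: ac_simps)

lemma norm_nome_less: "Im z > 0 \<Longrightarrow> norm (nome z) < 1"
  by (simp add: norm_nome)

lemma nome_surj:
  assumes "x \<noteq> 0" "norm x < 1"
  shows "\<exists>z. Im z > 0 \<and> nome z = x"
proof -
  define z where "z = Ln x / (2 * of_real pi * \<i>)"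
  have "nome z = x" using assms by (simp add: nome_def z_def)
  moreover from this have "exp (- 2 * pi * Im z) < 1" using assms norm_nome[of z] by simp
  hence "Im z > 0" by (simp add: zero_less_mult_iff)
  ultimately show ?thesis by blast
qed

text \<open>z -> exp(2 pi i z) maps the upper half plane onto the punctured unit disc, so
  convergence of the q-expansion at all z is convergence of a power series on the whole
  disc.\<close>

lemma q_expands_powser:
  assumes "q_expands a f"
  obtains P where "P holomorphic_on ball 0 1" "\<And>x. norm x < 1 \<Longrightarrow> (\<lambda>n. a n * x ^ n) sums P x"
    "\<And>z. Im z > 0 \<Longrightarrow> f z = P (nome z)"
proof
  define P where "P = (\<lambda>x. suminf (\<lambda>n. a n * x ^ n))"
  show s: "(\<lambda>n. a n * x ^ n) sums P x" if "norm x < 1" for x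
  proof (cases "x = 0")
    case True
    thus ?thesis using powser_sums_zero[of a] by (simp add: P_def sums_iff)
  next
    case False
    then obtain z where "Im z > 0" "nome z = x" using nome_surj \<open>norm x < 1\<close> by blast
    hence "(\<lambda>n. a n * x ^ n) sums f z" using assms by (auto simp: q_expands_def)
    thus ?thesis by (simp add: P_def sums_iff)
  qed
  show "P holomorphic_on ball 0 1"
    by (rule power_series_holomorphic[where a = a]) (use s in simp)
  show "f z = P (nome z)" if "Im z > 0" for z
    using s[OF norm_nome_less[OF that]] assms that by (auto simp: q_expands_def intro: sums_unique2)
qed

lemma q_expands_abs_summable:
  assumes "q_expands a f" "Im z > 0"
  shows "summable (\<lambda>n. norm (a n * nome z ^ n))"
proof -
  obtain P where P: "\<And>x. norm x < 1 \<Longrightarrow> (\<lambda>n. a n * x ^ n) sums P x" using q_expands_powser[OF assms(1)] by metis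
  define x where "x = complex_of_real ((1 + norm (nome z)) / 2)"
  have n: "norm (nome z) < 1" using norm_nome_less assms by blast
  have nx: "norm x = (1 + norm (nome z)) / 2" unfolding x_def norm_of_real by simp
  have "summable (\<lambda>n. a n * x ^ n)" using P[of x] n nx by (auto simp: sums_iff)
  thus ?thesis by (rule powser_insidea) (use n nx in simp)
qed

lemma q_expands_translate: "q_expands a f \<Longrightarrow> Im z > 0 \<Longrightarrow> f (z + of_int n) = f z"
proof -
  assume q: "q_expands a f" and z: "Im z > 0"
  have "(\<lambda>m. a m * nome (z + of_int n) ^ m) sums f (z + of_int n)"
    using q z unfolding q_expands_def by simp
  moreover have "(\<lambda>m. a m * nome z ^ m) sums f z" using q z unfolding q_expands_def by simp
  ultimately show ?thesis unfolding nome_add_int by (rule sums_unique2)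
qed

text \<open>Euclid's algorithm on the lower row (c, d): a translation by d div c and the inversion S
  replace c by d mod c. The case c = 0 leaves a sign (-1)^k, which acts trivially on f because S
  applied twice fixes z.\<close>

lemma SL2_invariance:
  fixes f :: "complex \<Rightarrow> complex" and a b c d :: int
  assumes T: "\<And>z n. Im z > 0 \<Longrightarrow> f (z + of_int n) = f z"
    and S: "\<And>z. Im z > 0 \<Longrightarrow> f (-1 / z) = z ^ k * f z"
  shows "a * d - b * c = 1 \<Longrightarrow> Im z > 0 \<Longrightarrow>
     f ((of_int a * z + of_int b) / (of_int c * z + of_int d)) = (of_int c * z + of_int d) ^ k * f z"
proof (induction "nat \<bar>c\<bar>" arbitrary: a b c d z rule: less_induct)
  case less
  have ImS: "Im (-1 / z) > 0" if "Im z > 0" for z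
  proof -
    have "(Re z)\<^sup>2 + (Im z)\<^sup>2 > 0" using that by (intro add_nonneg_pos) auto
    moreover have "Im (-1 / z) = Im z / ((Re z)\<^sup>2 + (Im z)\<^sup>2)" by (simp add: Im_divide)
    ultimately show ?thesis using that by simp
  qed
  have sgn: "(-1) ^ k * f z = f z" if "Im z > 0" for z
  proof -
    have "z \<noteq> 0" using that by auto
    have "f z = f (-1 / (-1 / z))" using \<open>z \<noteq> 0\<close> by simp
    also have "\<dots> = (-1 / z) ^ k * (z ^ k * f z)" using S[OF ImS[OF that]] S[OF that] by simp
    also have "\<dots> = (-1 / z * z) ^ k * f z" by (simp only: power_mult_distrib mult.assoc)
    finally show ?thesis using \<open>z \<noteq> 0\<close> by simp
  qed
  show ?case
  proof (cases "c = 0")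
    case True
    hence "a * d = 1" using less.prems by simp
    hence "(a = 1 \<and> d = 1) \<or> (a = -1 \<and> d = -1)" by (simp add: zmult_eq_1_iff)
    thus ?thesis
    proof
      assume "a = 1 \<and> d = 1"
      thus ?thesis using True T[OF less.prems(2), of b] by simp
    next
      assume *: "a = -1 \<and> d = -1"
      have "(of_int a * z + of_int b) / (of_int c * z + of_int d) = z + of_int (-b)" using * True by simp
      thus ?thesis using True * T[OF less.prems(2), of "-b"] sgn[OF less.prems(2)] by simp
    qed
  next
    case False
    define q r b' where "q = d div c" and "r = d mod c" and "b' = b - a * q"
    have d: "d = q * c + r" by (simp add: q_def r_def)
    have lt: "nat \<bar>r\<bar> < nat \<bar>c\<bar>" using False abs_mod_less[of c d] by (simp add: r_def)
    have det: "b' * (-c) - (-a) * r = 1" using less.prems(1) unfolding d b'_def by (simp add: algebra_simps)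
    define z' where "z' = z + of_int q"
    have "Im z' > 0" using less.prems by (auto simp: z'_def)
    hence z': "Im z' > 0" "z' \<noteq> 0" by auto
    define w where "w = -1 / z'"
    have w: "Im w > 0" unfolding w_def by (rule ImS[OF z'(1)])
    have IH: "f ((of_int b' * w + of_int (-a)) / (of_int r * w + of_int (-c))) = (of_int r * w + of_int (-c)) ^ k * f w"
      by (rule less.hyps[OF lt det w])
    have e1: "of_int b' * w + of_int (-a) = - (of_int a * z + of_int b) / z'"
      using z' unfolding w_def b'_def by (simp add: field_simps) (simp add: z'_def algebra_simps)
    have e2: "of_int r * w + of_int (-c) = - (of_int c * z + of_int d) / z'"
      using z' unfolding w_def d by (simp add: field_simps) (simp add: z'_def algebra_simps)
    have "f ((of_int a * z + of_int b) / (of_int c * z + of_int d)) = f ((of_int b' * w + of_int (-a)) / (of_int r * w + of_int (-c)))"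
    proof -
      have "(- x / z') / (- y / z') = x / y" for x y using z' by simp
      thus ?thesis unfolding e1 e2 by (simp only:)
    qed
    also have "\<dots> = (- (of_int c * z + of_int d) / z') ^ k * (z' ^ k * f z')"
      unfolding IH using S[OF z'(1)] unfolding e2 by (simp only: w_def)
    also have "f z' = f z" unfolding z'_def by (rule T[OF less.prems(2)])
    also have "(- (of_int c * z + of_int d) / z') ^ k * (z' ^ k * f z) =
       (- (of_int c * z + of_int d) / z' * z') ^ k * f z" by (simp only: power_mult_distrib mult.assoc)
    also have "- (of_int c * z + of_int d) / z' * z' = (-1) * (of_int c * z + of_int d)" using z' by simp
    also have "((-1) * (of_int c * z + of_int d)) ^ k * f z = (of_int c * z + of_int d) ^ k * ((-1) ^ k * f z)"
      by (simp only: power_mult_distrib ac_simps)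
    also have "(-1) ^ k * f z = f z" by (rule sgn[OF less.prems(2)])
    finally show ?thesis .
  qed
qed

lemma modular_formI:
  assumes q: "q_expands a f" and S: "\<And>z. Im z > 0 \<Longrightarrow> f (-1 / z) = z ^ k * f z"
  shows "modular_form k f"
  unfolding modular_form_def
proof (intro conjI allI impI)
  obtain P where P: "P holomorphic_on ball 0 1" "\<And>z. Im z > 0 \<Longrightarrow> f z = P (nome z)"
    using q_expands_powser[OF q] by metis
  have "nome holomorphic_on {z. Im z > 0}" unfolding nome_def by (intro holomorphic_intros)
  hence "(P \<circ> nome) holomorphic_on {z. Im z > 0}"
    by (rule holomorphic_on_compose_gen[OF _ P(1)]) (auto intro: norm_nome_less)
  thus "f holomorphic_on {z. Im z > 0}" by (rule holomorphic_transform) (auto simp: P)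
  show "\<exists>C>0. bounded (f ` {z. C \<le> Im z})"
  proof (intro exI[of _ 1] conjI)
    have "f ` {z. 1 \<le> Im z} \<subseteq> P ` cball 0 (exp (- 2 * pi))"
    proof safe
      fix z assume "1 \<le> Im z"
      hence "norm (nome z) \<le> exp (- 2 * pi)" by (simp add: norm_nome)
      thus "f z \<in> P ` cball 0 (exp (- 2 * pi))" using P(2)[of z] \<open>1 \<le> Im z\<close> by auto
    qed
    moreover have "continuous_on (cball 0 (exp (- 2 * pi))) P"
    proof (rule continuous_on_subset[OF holomorphic_on_imp_continuous_on[OF P(1)]])
      have "exp (- 2 * pi) < 1" by simp
      thus "cball 0 (exp (- 2 * pi)) \<subseteq> (ball 0 1 :: complex set)" by (intro cball_subset_ball_iff[THEN iffD2]) auto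
    qed
    hence "bounded (P ` cball 0 (exp (- 2 * pi)))" by (intro compact_imp_bounded compact_continuous_image) auto
    ultimately show "bounded (f ` {z. 1 \<le> Im z})" by (rule bounded_subset[rotated])
  qed auto
  show "f ((of_int a * z + of_int b) / (of_int c * z + of_int d)) = (of_int c * z + of_int d) ^ k * f z"
    if "a * d - b * c = 1" "Im z > 0" for a b c d z
    by (rule SL2_invariance[OF q_expands_translate[OF q] S that])
qed

lemma modular_form_S:
  assumes "modular_form k f" "Im z > 0"
  shows "f (-1 / z) = z ^ k * f z"
  using assms unfolding modular_form_def by (elim conjE) (drule spec[of _ 0], drule spec[of _ "-1"], drule spec[of _ 1], drule spec[of _ 0], auto)

text \<open>Periodicity, holomorphy and boundedness at infinity are contained in the q-expansion, so
  for each construction below only the transformation under S remains to be checked.\<close>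

lemma int_modular_forms_iff:
  "F \<in> int_modular_forms k \<longleftrightarrow>
     (\<exists>f. q_expands (\<lambda>n. of_int (fps_nth F n)) f \<and> (\<forall>z. Im z > 0 \<longrightarrow> f (-1 / z) = z ^ k * f z))"
proof -
  have "(\<forall>z. Im z > 0 \<longrightarrow> (\<lambda>n. of_int (fps_nth F n) * exp (2 * of_real pi * \<i> * z) ^ n) sums f z) \<longleftrightarrow>
     q_expands (\<lambda>n. of_int (fps_nth F n)) f" for f
    by (simp add: q_expands_def nome_def)
  thus ?thesis unfolding int_modular_forms_def mem_Collect_eq using modular_formI modular_form_S by blast
qed

lemma int_modular_forms_diff:
  assumes "F \<in> int_modular_forms k" "G \<in> int_modular_forms k"
  shows "F - G \<in> int_modular_forms k"
proof -
  obtain f g where "q_expands (\<lambda>n. of_int (fps_nth F n)) f" "\<And>z. Im z > 0 \<Longrightarrow> f (-1 / z) = z ^ k * f z"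
    "q_expands (\<lambda>n. of_int (fps_nth G n)) g" "\<And>z. Im z > 0 \<Longrightarrow> g (-1 / z) = z ^ k * g z"
    using assms unfolding int_modular_forms_iff by blast
  thus ?thesis unfolding int_modular_forms_iff
    by (intro exI[of _ "\<lambda>z. f z - g z"]) (auto simp: q_expands_def algebra_simps intro!: sums_diff)
qed

lemma int_modular_forms_zero: "0 \<in> int_modular_forms k"
  unfolding int_modular_forms_iff by (intro exI[of _ "\<lambda>_. 0"]) (auto simp: q_expands_def)

lemma int_modular_forms_add:
  assumes "F \<in> int_modular_forms k" "G \<in> int_modular_forms k"
  shows "F + G \<in> int_modular_forms k"
  using int_modular_forms_diff[OF assms(1) int_modular_forms_diff[OF int_modular_forms_zero assms(2)]] by simp

lemma int_modular_forms_mult: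
  assumes "F \<in> int_modular_forms k" "G \<in> int_modular_forms l"
  shows "F * G \<in> int_modular_forms (k + l)"
proof -
  obtain f g where *: "q_expands (\<lambda>n. of_int (fps_nth F n)) f" "\<And>z. Im z > 0 \<Longrightarrow> f (-1 / z) = z ^ k * f z"
    "q_expands (\<lambda>n. of_int (fps_nth G n)) g" "\<And>z. Im z > 0 \<Longrightarrow> g (-1 / z) = z ^ l * g z"
    using assms unfolding int_modular_forms_iff by blast
  have "(\<lambda>n. of_int (fps_nth (F * G) n) * nome z ^ n) sums (f z * g z)" if z: "Im z > 0" for z
  proof -
    have "(\<lambda>n. \<Sum>i\<le>n. (of_int (fps_nth F i) * nome z ^ i) * (of_int (fps_nth G (n - i)) * nome z ^ (n - i))) sums
       ((\<Sum>i. of_int (fps_nth F i) * nome z ^ i) * (\<Sum>i. of_int (fps_nth G i) * nome z ^ i))"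
      by (intro Cauchy_product_sums q_expands_abs_summable[OF *(1) z] q_expands_abs_summable[OF *(3) z])
    also have "(\<Sum>i. of_int (fps_nth F i) * nome z ^ i) = f z" using * z by (auto simp: q_expands_def sums_iff)
    also have "(\<Sum>i. of_int (fps_nth G i) * nome z ^ i) = g z" using * z by (auto simp: q_expands_def sums_iff)
    also have "(\<lambda>n. \<Sum>i\<le>n. (of_int (fps_nth F i) * nome z ^ i) * (of_int (fps_nth G (n - i)) * nome z ^ (n - i))) =
       (\<lambda>n. of_int (fps_nth (F * G) n) * nome z ^ n)"
    proof
      fix n
      have "(of_int (fps_nth F i) * nome z ^ i) * (of_int (fps_nth G (n - i)) * nome z ^ (n - i)) =
         of_int (fps_nth F i * fps_nth G (n - i)) * nome z ^ n" if "i \<le> n" for i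
      proof -
        have "nome z ^ n = nome z ^ i * nome z ^ (n - i)" using that by (simp flip: power_add)
        thus ?thesis by simp
      qed
      thus "(\<Sum>i\<le>n. (of_int (fps_nth F i) * nome z ^ i) * (of_int (fps_nth G (n - i)) * nome z ^ (n - i))) =
        of_int (fps_nth (F * G) n) * nome z ^ n"
        unfolding fps_mult_nth of_int_sum sum_distrib_right atMost_atLeast0 by (intro sum.cong refl) auto
    qed
    finally show ?thesis .
  qed
  thus ?thesis using * unfolding int_modular_forms_iff
    by (intro exI[of _ "\<lambda>z. f z * g z"]) (auto simp: q_expands_def power_add)
qed

lemma int_modular_forms_one: "1 \<in> int_modular_forms 0"
proof -
  have "(\<lambda>n. of_int (fps_nth 1 n) * nome z ^ n) sums 1" for z
  proof -
    have "(\<lambda>n. of_int (fps_nth 1 n) * nome z ^ n) = (\<lambda>n. if n = 0 then 1 else 0)" by auto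
    thus ?thesis using sums_single[of 0 "\<lambda>_. 1 :: complex"] by simp
  qed
  thus ?thesis unfolding int_modular_forms_iff q_expands_def by (intro exI[of _ "\<lambda>_. 1"]) auto
qed

lemma int_modular_forms_cancel:
  assumes "fps_const n * F \<in> int_modular_forms k" "n \<noteq> 0"
  shows "F \<in> int_modular_forms k"
proof -
  obtain f where *: "q_expands (\<lambda>m. of_int (fps_nth (fps_const n * F) m)) f" "\<And>z. Im z > 0 \<Longrightarrow> f (-1 / z) = z ^ k * f z"
    using assms unfolding int_modular_forms_iff by blast
  have "q_expands (\<lambda>m. of_int (fps_nth F m)) (\<lambda>z. f z / of_int n)"
    unfolding q_expands_def
  proof (intro allI impI)
    fix z :: complex assume "Im z > 0"
    hence "(\<lambda>m. of_int (fps_nth (fps_const n * F) m) * nome z ^ m / of_int n) sums (f z / of_int n)"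
      using *(1) unfolding q_expands_def by (intro sums_divide) auto
    thus "(\<lambda>m. of_int (fps_nth F m) * nome z ^ m) sums (f z / of_int n)" using assms(2) by simp
  qed
  thus ?thesis using *(2) unfolding int_modular_forms_iff by (intro exI[of _ "\<lambda>z. f z / of_int n"]) auto
qed

lemma int_modular_forms_scale:
  assumes "F \<in> int_modular_forms k"
  shows "fps_const n * F \<in> int_modular_forms k"
proof -
  obtain f where *: "q_expands (\<lambda>m. of_int (fps_nth F m)) f" "\<And>z. Im z > 0 \<Longrightarrow> f (-1 / z) = z ^ k * f z"
    using assms unfolding int_modular_forms_iff by blast
  thus ?thesis unfolding int_modular_forms_iff
    by (intro exI[of _ "\<lambda>z. of_int n * f z"]) (auto simp: q_expands_def mult.assoc intro!: sums_mult)
qed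

text \<open>After a translation to |Re z| \<le> 1/2, a point with Im z < 1/2 has |z|^2 \<le> 1/2, so
  S at least doubles its imaginary part.\<close>

lemma weight_0_high:
  fixes f :: "complex \<Rightarrow> complex"
  assumes T: "\<And>z n. Im z > 0 \<Longrightarrow> f (z + of_int n) = f z"
    and S: "\<And>z. Im z > 0 \<Longrightarrow> f (-1 / z) = f z"
  shows "Im z \<ge> (1 / 2) ^ n \<Longrightarrow> \<exists>w. Im w \<ge> 1 / 2 \<and> f w = f z"
proof (induction n arbitrary: z)
  case 0
  thus ?case by (intro exI[of _ z]) auto
next
  case (Suc n)
  show ?case
  proof (cases "Im z \<ge> 1 / 2")
    case False
    have pos: "Im z > 0" using Suc.prems by (rule less_le_trans[rotated]) simp
    define z' where "z' = z + of_int (- round (Re z))"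
    have z': "Im z' = Im z" "f z' = f z" using T[OF pos] by (auto simp: z'_def simp del: of_int_minus)
    have "\<bar>Re z'\<bar> \<le> 1 / 2" using of_int_round_abs_le[of "Re z"] by (simp add: z'_def abs_minus_commute)
    hence "(Re z')\<^sup>2 \<le> (1 / 2)\<^sup>2" using abs_le_square_iff[of "Re z'" "1 / 2"] by simp
    moreover have "(Im z')\<^sup>2 \<le> (1 / 2)\<^sup>2" using False pos z' by (intro power_mono) auto
    ultimately have N: "(Re z')\<^sup>2 + (Im z')\<^sup>2 \<le> 1 / 2" by (simp add: power2_eq_square)
    have N0: "(Re z')\<^sup>2 + (Im z')\<^sup>2 > 0" using pos z' by (intro add_nonneg_pos) auto
    have "Im (-1 / z') = Im z' / ((Re z')\<^sup>2 + (Im z')\<^sup>2)" by (simp add: Im_divide)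
    also have "\<dots> \<ge> Im z' / (1 / 2)" using N N0 pos z' by (intro divide_left_mono) auto
    finally have "Im (-1 / z') \<ge> (1 / 2) ^ n" using Suc.prems z' by simp
    from Suc.IH[OF this] show ?thesis using S[of z'] z' pos by auto
  qed auto
qed

text \<open>All values of f are taken at height at least 1/2, that is, for |q| \<le> exp(-pi). So
  |P| attains its maximum over the open unit disc at an interior point, and the maximum modulus
  principle applies.\<close>

lemma int_modular_forms_weight_0:
  assumes "F \<in> int_modular_forms 0"
  shows "F = fps_const (fps_nth F 0)"
proof -
  obtain f where *: "q_expands (\<lambda>n. of_int (fps_nth F n)) f" "\<And>z. Im z > 0 \<Longrightarrow> f (-1 / z) = f z"
    using assms unfolding int_modular_forms_iff by auto
  obtain P where P: "P holomorphic_on ball 0 1" "\<And>x. norm x < 1 \<Longrightarrow> (\<lambda>n. of_int (fps_nth F n) * x ^ n) sums P x"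
    "\<And>z. Im z > 0 \<Longrightarrow> f z = P (nome z)" using q_expands_powser[OF *(1)] by metis
  define r where "r = exp (- pi)"
  have r: "0 < r" "r < 1" by (auto simp: r_def)
  have cont: "continuous_on (cball 0 r) P"
    by (rule continuous_on_subset[OF holomorphic_on_imp_continuous_on[OF P(1)]]) (use r in auto)
  hence "continuous_on (cball 0 r) (\<lambda>x. norm (P x))" by (intro continuous_intros)
  then obtain \<xi> where xi: "\<xi> \<in> cball 0 r" "\<And>x. x \<in> cball 0 r \<Longrightarrow> norm (P x) \<le> norm (P \<xi>)"
    using continuous_attains_sup[of "cball (0 :: complex) r" "\<lambda>x. norm (P x)"] r by auto
  have le: "norm (P x) \<le> norm (P \<xi>)" if "norm x < 1" for x
  proof (cases "norm x \<le> r")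
    case False
    hence "x \<noteq> 0" using r by auto
    from nome_surj[OF this that] obtain z where z: "Im z > 0" "nome z = x" by blast
    have "\<exists>n. (1 / 2) ^ n < Im z" by (rule real_arch_pow_inv[OF z(1)]) simp
    then obtain n where "(1 / 2) ^ n < Im z" ..
    hence "(1 / 2) ^ n \<le> Im z" by simp
    from weight_0_high[OF q_expands_translate[OF *(1)] *(2) this]
    obtain w where w: "Im w \<ge> 1 / 2" "f w = f z" by blast
    have "norm (nome w) \<le> r" using w by (simp add: norm_nome r_def)
    hence "norm (P (nome w)) \<le> norm (P \<xi>)" using xi by auto
    moreover have "P (nome w) = f w" "f z = P x" using P(3) w z by auto
    ultimately show ?thesis using w by simp
  qed (use xi in auto)
  have "P constant_on ball 0 1"
    by (rule maximum_modulus_principle[OF P(1), where U = "ball 0 1" and \<xi> = \<xi>]) (use xi r le in auto)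
  then obtain c where c: "\<And>x. norm x < 1 \<Longrightarrow> P x = c" by (auto simp: constant_on_def)
  define G where "G = Abs_fps (\<lambda>n. of_int (fps_nth F n) :: complex)"
  have "fps_conv_radius G \<ge> norm (1 / 2 :: complex)" unfolding fps_conv_radius_def
    by (rule conv_radius_geI) (use P(2)[of "1 / 2"] in \<open>auto simp: G_def sums_iff\<close>)
  hence "fps_conv_radius G > 0" by (rule less_le_trans[rotated]) simp
  moreover have "eventually (\<lambda>x. eval_fps G x = eval_fps (fps_const c) x) (nhds 0)"
  proof -
    have "eventually (\<lambda>x :: complex. x \<in> ball 0 1) (nhds 0)" by (intro eventually_nhds_in_open) auto
    thus ?thesis
    proof eventually_elim
      case (elim x)
      hence "eval_fps G x = P x" using P(2)[of x] by (simp add: eval_fps_def G_def sums_iff)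
      thus ?case using c[of x] elim by simp
    qed
  qed
  ultimately have "G = fps_const c" by (intro eval_fps_eqD) auto
  have "fps_nth F n = 0" if "n > 0" for n
  proof -
    have "fps_nth G n = 0" using \<open>G = fps_const c\<close> that by simp
    thus ?thesis by (simp add: G_def)
  qed
  thus ?thesis by (intro fps_ext) (auto simp: fps_const_def)
qed

section \<open>The Hecke operator T_p on q-expansions\<close>

definition hecke :: "nat \<Rightarrow> nat \<Rightarrow> int fps \<Rightarrow> int fps" where
  "hecke p k F = Abs_fps (\<lambda>n. fps_nth F (p * n) + (if p dvd n then int p ^ (k - 1) * fps_nth F (n div p) else 0))"

lemma sum_roots_of_unity:
  fixes p n :: nat
  assumes "p > 0"
  shows "(\<Sum>j<p. nome (of_nat j / of_nat p) ^ n) = (if p dvd n then of_nat p else 0)"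
proof -
  define w where "w = nome (of_nat n / of_nat p)"
  have w: "nome (of_nat j / of_nat p) ^ n = w ^ j" for j
    by (simp add: w_def nome_def mult_ac flip: exp_of_nat_mult)
  have wp: "w ^ p = 1"
  proof -
    have "w ^ p = exp (2 * of_int (int n) * of_real pi * \<i>)" using assms
      by (simp add: w_def nome_def mult_ac flip: exp_of_nat_mult)
    thus ?thesis using exp_integer_2pi[of "of_int (int n)"] by simp
  qed
  show ?thesis
  proof (cases "p dvd n")
    case True
    then obtain m where "n = p * m" by blast
    hence "w = exp (2 * of_int (int m) * of_real pi * \<i>)" using assms by (simp add: w_def nome_def mult_ac)
    hence "w = 1" using exp_integer_2pi[of "of_int (int m)"] by simp
    thus ?thesis using True by (simp add: w)
  next
    case False
    have "w \<noteq> 1"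
    proof
      assume "w = 1"
      then obtain m :: int where "2 * pi * (real n / real p) = of_int (2 * m) * pi"
        unfolding w_def nome_def exp_eq_1 by (auto simp: Im_divide_of_nat)
      hence "real n = of_int m * real p" using assms by (simp add: field_simps)
      hence "real_of_int (int n) = real_of_int (m * int p)" by simp
      hence "int n = m * int p" by (simp only: of_int_eq_iff)
      hence "int p dvd int n" by simp
      thus False using False by simp
    qed
    hence "(\<Sum>j<p. w ^ j) = 0" using wp by (simp add: geometric_sum)
    thus ?thesis using False by (simp add: w)
  qed
qed

text \<open>Under S the summand j of the Hecke sum is matched with the summand j' for which j j'
  \<equiv> -1 modulo p.\<close>

lemma neg_inverse_mod_ex:
  fixes p j :: nat
  assumes "prime p" "j \<in> {1..<p}"
  shows "\<exists>j'\<in>{1..<p}. p dvd j * j' + 1"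
proof -
  have "\<not> p dvd j" using assms by (auto dest: dvd_imp_le)
  hence "coprime p j" using assms prime_imp_coprime by blast
  hence "coprime (int j) (int p)" by (simp add: coprime_commute)
  then obtain x where x: "[int j * x = 1] (mod int p)" using cong_solve_coprime_int by blast
  define y where "y = nat ((-x) mod int p)"
  have p0: "p > 1" using assms prime_gt_1_nat by auto
  have y: "int y = (-x) mod int p" using p0 by (simp add: y_def)
  have "int j * int y + 1 = - (int j * x - 1) - int p * (int j * ((-x) div int p))"
  proof -
    have "int y = -x - int p * ((-x) div int p)" unfolding y by (simp add: minus_mult_div_eq_mod)
    hence "int j * int y = int j * (-x - int p * ((-x) div int p))" by simp
    thus ?thesis by (simp add: algebra_simps)
  qed
  moreover have "int p dvd int j * x - 1" using x by (simp add: cong_iff_dvd_diff)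
  ultimately have "int p dvd int j * int y + 1" by (simp only: dvd_diff dvd_minus_iff dvd_triv_left)
  hence "int p dvd int (j * y + 1)" by (simp add: add.commute)
  hence d: "p dvd j * y + 1" by (subst (asm) int_dvd_int_iff)
  have "y \<noteq> 0" using d p0 by (intro notI) auto
  moreover have "y < p" using y p0 pos_mod_bound[of "int p" "-x"] by linarith
  ultimately show ?thesis using d by auto
qed

text \<open>T_p f is 1/p times the sum of the f((z+j)/p) plus p^{k-1} f(pz). Under S the term j = 0
  and the term f(pz) are exchanged, and the terms with j nonzero are permuted by the involution
  \<open>\<phi>\<close>.\<close>

lemma hecke_int_modular_forms:
  assumes p: "prime p" and k: "k \<ge> 1" and F: "F \<in> int_modular_forms k"
  shows "hecke p k F \<in> int_modular_forms k"
proof -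
  have p0: "p > 0" using p prime_gt_0_nat by blast
  obtain f0 where "modular_form k f0" "q_expands (\<lambda>n. of_int (fps_nth F n)) f0"
    using F by (auto simp: int_modular_forms_def q_expands_def nome_def)
  then obtain f where f: "modular_form k f" and q: "q_expands (\<lambda>n. of_int (fps_nth F n)) f" by blast
  have mod: "f ((of_int a * z + of_int b) / (of_int c * z + of_int d)) = (of_int c * z + of_int d) ^ k * f z"
    if "a * d - b * c = 1" "Im z > 0" for a b c d :: int and z using f that unfolding modular_form_def by blast
  define g where "g = (\<lambda>z. (\<Sum>j<p. f ((z + of_nat j) / of_nat p)) / of_nat p + of_nat p ^ (k - 1) * f (of_nat p * z))"
  have "q_expands (\<lambda>n. of_int (fps_nth (hecke p k F) n)) g"
    unfolding q_expands_def
  proof (intro allI impI)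
    fix z :: complex assume z: "Im z > 0"
    define a where "a = (\<lambda>n. complex_of_int (fps_nth F n))"
    have nz: "nome (z / of_nat p) ^ p = nome z" using p0 by (simp add: nome_def flip: exp_of_nat_mult)
    have "(\<lambda>n. a n * nome ((z + of_nat j) / of_nat p) ^ n) sums f ((z + of_nat j) / of_nat p)" for j
    proof -
      have "Im ((z + of_nat j) / of_nat p) > 0" using z p0 by (simp add: Im_divide_of_nat)
      thus ?thesis using q unfolding q_expands_def a_def by blast
    qed
    hence "(\<lambda>n. (\<Sum>j<p. a n * nome ((z + of_nat j) / of_nat p) ^ n) / of_nat p) sums
       ((\<Sum>j<p. f ((z + of_nat j) / of_nat p)) / of_nat p)"
      by (intro sums_divide sums_sum) auto
    also have "(\<lambda>n. (\<Sum>j<p. a n * nome ((z + of_nat j) / of_nat p) ^ n) / of_nat p) =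
       (\<lambda>n. if p dvd n then a n * nome (z / of_nat p) ^ n else 0)"
    proof
      fix n
      have "nome ((z + of_nat j) / of_nat p) ^ n = nome (z / of_nat p) ^ n * nome (of_nat j / of_nat p) ^ n" for j
        by (simp add: nome_def add_divide_distrib distrib_left exp_add power_mult_distrib)
      hence "(\<Sum>j<p. a n * nome ((z + of_nat j) / of_nat p) ^ n) =
         a n * nome (z / of_nat p) ^ n * (\<Sum>j<p. nome (of_nat j / of_nat p) ^ n)"
        by (simp add: sum_distrib_left mult.assoc)
      thus "(\<Sum>j<p. a n * nome ((z + of_nat j) / of_nat p) ^ n) / of_nat p =
         (if p dvd n then a n * nome (z / of_nat p) ^ n else 0)"
        using p0 by (simp add: sum_roots_of_unity)
    qed
    finally have "(\<lambda>n. if p dvd n then a n * nome (z / of_nat p) ^ n else 0) sums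
       ((\<Sum>j<p. f ((z + of_nat j) / of_nat p)) / of_nat p)" .
    moreover have sm: "strict_mono (\<lambda>n. p * n)" using p0 by (intro strict_monoI) simp
    have ran: "(if p dvd n then h n else 0) = 0" if "n \<notin> range (\<lambda>n. p * n)" for n and h :: "nat \<Rightarrow> complex"
      using that by (auto elim!: dvdE)
    ultimately have "(\<lambda>n. if p dvd p * n then a (p * n) * nome (z / of_nat p) ^ (p * n) else 0) sums
       ((\<Sum>j<p. f ((z + of_nat j) / of_nat p)) / of_nat p)"
      by (subst sums_mono_reindex[OF sm ran])
    hence 1: "(\<lambda>n. a (p * n) * nome z ^ n) sums ((\<Sum>j<p. f ((z + of_nat j) / of_nat p)) / of_nat p)"
      by (simp add: power_mult nz)
    have "nome (of_nat p * z) = nome z ^ p" by (rule nome_of_nat_mult)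
    moreover have "Im (of_nat p * z) > 0" using z p0 by simp
    ultimately have "(\<lambda>n. a n * (nome z ^ p) ^ n) sums f (of_nat p * z)"
      using q unfolding q_expands_def a_def by metis
    hence "(\<lambda>n. if p dvd p * n then a (p * n div p) * nome z ^ (p * n) else 0) sums f (of_nat p * z)"
      using p0 by (simp add: power_mult)
    hence "(\<lambda>n. if p dvd n then a (n div p) * nome z ^ n else 0) sums f (of_nat p * z)"
      by (subst (asm) sums_mono_reindex[OF sm ran])
    hence 2: "(\<lambda>n. of_nat p ^ (k - 1) * (if p dvd n then a (n div p) * nome z ^ n else 0)) sums (of_nat p ^ (k - 1) * f (of_nat p * z))"
      by (rule sums_mult)
    from sums_add[OF 1 2] show "(\<lambda>n. of_int (fps_nth (hecke p k F) n) * nome z ^ n) sums g z"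
      unfolding g_def by (rule sums_cong[THEN iffD1, rotated]) (simp add: hecke_def a_def algebra_simps)
  qed
  moreover have "g (-1 / z) = z ^ k * g z" if z: "Im z > 0" for z
  proof -
    have z0: "z \<noteq> 0" using z by auto
    obtain \<phi> where \<phi>: "\<And>j. j \<in> {1..<p} \<Longrightarrow> \<phi> j \<in> {1..<p}" "\<And>j. j \<in> {1..<p} \<Longrightarrow> p dvd j * \<phi> j + 1"
      using neg_inverse_mod_ex[OF p] by metis
    have \<phi>\<phi>: "\<phi> (\<phi> j) = j" if j: "j \<in> {1..<p}" for j
    proof -
      have "int p dvd int (j * \<phi> j + 1)" "int p dvd int (\<phi> j * \<phi> (\<phi> j) + 1)"
        using \<phi>(2)[OF j] \<phi>(2)[OF \<phi>(1)[OF j]] by (simp_all only: int_dvd_int_iff)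
      hence "int p dvd int (j * \<phi> j + 1) - int (\<phi> j * \<phi> (\<phi> j) + 1)" by (rule dvd_diff)
      also have "int (j * \<phi> j + 1) - int (\<phi> j * \<phi> (\<phi> j) + 1) = int (\<phi> j) * (int j - int (\<phi> (\<phi> j)))"
        by (simp add: algebra_simps)
      finally have "int p dvd int (\<phi> j) \<or> int p dvd int j - int (\<phi> (\<phi> j))"
        using p by (simp add: prime_dvd_mult_iff)
      moreover have "\<not> int p dvd int (\<phi> j)" using \<phi>(1)[OF j] by (auto dest: dvd_imp_le)
      ultimately have "int j mod int p = int (\<phi> (\<phi> j)) mod int p" by (simp add: mod_eq_dvd_iff)
      thus ?thesis using j \<phi>(1)[OF \<phi>(1)[OF j]] by (simp flip: of_nat_mod)
    qed
    have f1: "f ((-1 / z + of_nat j) / of_nat p) = z ^ k * f ((z + of_nat (\<phi> j)) / of_nat p)" if j: "j \<in> {1..<p}" for j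
    proof -
      obtain b where b: "j * \<phi> j + 1 = p * b" using \<phi>(2)[OF j] by blast
      hence bi: "int j * int (\<phi> j) + 1 = int p * int b" by (metis of_nat_1 of_nat_add of_nat_mult)
      define w where "w = (z + of_nat (\<phi> j)) / of_nat p"
      have w: "Im w > 0" using z p0 by (simp add: w_def Im_divide_of_nat)
      have wz: "of_nat p * w = z + of_nat (\<phi> j)" using p0 by (simp add: w_def)
      \<comment> \<open>The matrix with rows (j, -b) and (p, -phi(j)) has determinant p b - j phi(j)
        = 1.\<close>
      have m1: "f ((of_int (int j) * w + of_int (- int b)) / (of_int (int p) * w + of_int (- int (\<phi> j)))) =
        (of_int (int p) * w + of_int (- int (\<phi> j))) ^ k * f w"
        by (rule mod[OF _ w]) (use bi in \<open>simp add: algebra_simps\<close>)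
      have m2: "of_int (int p) * w + of_int (- int (\<phi> j)) = z" using wz by simp
      have m3: "(of_int (int j) * w + of_int (- int b)) / z = (-1 / z + of_nat j) / of_nat p"
      proof -
        define X where "X = of_int (int j) * w + of_int (- int b)"
        have "of_nat p * X = of_nat j * (of_nat p * w) - of_nat (p * b)"
          by (simp add: X_def algebra_simps)
        also have "\<dots> = of_nat j * z - 1" unfolding wz b[symmetric] by (simp add: algebra_simps)
        finally have "X = (of_nat j * z - 1) / of_nat p" using p0 by (simp add: eq_divide_eq mult.commute)
        moreover have "(of_nat j * z - 1) / of_nat p / z = (-1 / z + of_nat j) / of_nat p"
          using z0 by (simp add: diff_divide_distrib add_divide_distrib)
        ultimately show ?thesis unfolding X_def[symmetric] by simp
      qed
      show ?thesis using m1 unfolding m2 m3 by (simp only: w_def)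
    qed
    have S: "f (-1 / w) = w ^ k * f w" if "Im w > 0" for w by (rule modular_form_S[OF f that])
    have "(\<Sum>j\<in>{1..<p}. f ((-1 / z + of_nat j) / of_nat p)) = (\<Sum>j\<in>{1..<p}. z ^ k * f ((z + of_nat j) / of_nat p))"
      by (rule sum.reindex_bij_witness[where i = \<phi> and j = \<phi>]) (use \<phi>\<phi> \<phi>(1) f1 in auto)
    moreover have sp: "(\<Sum>j<p. h j) = h 0 + (\<Sum>j\<in>{1..<p}. h j)" for h :: "nat \<Rightarrow> complex"
    proof -
      have "{..<p} = insert 0 {1..<p}" using p0 by auto
      thus ?thesis by simp
    qed
    moreover have "f ((-1 / z + of_nat 0) / of_nat p) = (of_nat p * z) ^ k * f (of_nat p * z)"
      using S[of "of_nat p * z"] z p0 by (simp add: mult.commute)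
    moreover have "f (of_nat p * (-1 / z)) = (z / of_nat p) ^ k * f (z / of_nat p)"
      using S[of "z / of_nat p"] z p0 by (simp add: Im_divide_of_nat)
    ultimately have "g (-1 / z) = ((of_nat p * z) ^ k * f (of_nat p * z) + (\<Sum>j\<in>{1..<p}. z ^ k * f ((z + of_nat j) / of_nat p))) / of_nat p
        + of_nat p ^ (k - 1) * ((z / of_nat p) ^ k * f (z / of_nat p))"
      unfolding g_def by (simp only: sp)
    also have "\<dots> = z ^ k * g z"
    proof -
      obtain l where l: "k = Suc l" using k by (cases k) auto
      have a: "(of_nat p * z) ^ k / of_nat p = z ^ k * of_nat p ^ (k - 1)" using p0 by (simp add: l power_mult_distrib)
      have b: "of_nat p ^ (k - 1) * (z / of_nat p) ^ k = z ^ k / of_nat p" using p0 by (simp add: l power_divide)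
      define A B C where "A = f (of_nat p * z)" and "B = f (z / of_nat p)" and "C = (\<Sum>j\<in>{1..<p}. f ((z + of_nat j) / of_nat p))"
      have "((of_nat p * z) ^ k * A + z ^ k * C) / of_nat p + of_nat p ^ (k - 1) * ((z / of_nat p) ^ k * B) =
        ((of_nat p * z) ^ k / of_nat p) * A + z ^ k * C / of_nat p + (of_nat p ^ (k - 1) * (z / of_nat p) ^ k) * B"
        by (simp add: add_divide_distrib)
      also have "\<dots> = z ^ k * ((B + C) / of_nat p + of_nat p ^ (k - 1) * A)"
        unfolding a b by (simp add: add_divide_distrib distrib_left mult.assoc)
      finally show ?thesis unfolding g_def sp sum_distrib_left[symmetric] A_def B_def C_def by simp
    qed
    finally show ?thesis .
  qed
  ultimately show ?thesis unfolding int_modular_forms_iff by blast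
qed

section \<open>Eisenstein series\<close>

text \<open>The derivative of the reflection formula 1 / (Gamma(z) Gamma(1-z)) = sin(pi z) / pi. It
  takes the place of the partial fractions of the cotangent as the source of q-expansions.\<close>

lemma Digamma_reflection:
  fixes z :: complex
  assumes "z \<notin> \<int>"
  shows "(Digamma (1 - z) - Digamma z) * sin (of_real pi * z) = of_real pi * cos (of_real pi * z)"
proof -
  have z: "z \<notin> \<int>\<^sub>\<le>\<^sub>0" using assms nonpos_Ints_subset_Ints by blast
  have "1 - z \<notin> \<int>" using assms by (metis Ints_1 Ints_diff diff_diff_eq2 add_diff_cancel_left')
  hence z1: "1 - z \<notin> \<int>\<^sub>\<le>\<^sub>0" using nonpos_Ints_subset_Ints by blast
  have d1: "((\<lambda>z. rGamma (1 - z)) has_field_derivative (-rGamma (1 - z) * Digamma (1 - z)) * (0 - 1)) (at z)"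
    by (rule DERIV_chain2[where f = rGamma and g = "\<lambda>z. 1 - z" and x = z, OF has_field_derivative_rGamma_no_nonpos_int[OF z1]])
       (intro DERIV_diff DERIV_const DERIV_ident)
  have "((\<lambda>z. rGamma z * rGamma (1 - z)) has_field_derivative
      (-rGamma z * Digamma z) * rGamma (1 - z) + ((-rGamma (1 - z) * Digamma (1 - z)) * (0 - 1)) * rGamma z) (at z)"
    by (rule DERIV_mult[OF has_field_derivative_rGamma_no_nonpos_int[OF z] d1])
  moreover have "((\<lambda>z. rGamma z * rGamma (1 - z)) has_field_derivative cos (of_real pi * z)) (at z)"
    unfolding rGamma_reflection_complex by (auto intro!: derivative_eq_intros)
  ultimately have "(-rGamma z * Digamma z) * rGamma (1 - z) + ((-rGamma (1 - z) * Digamma (1 - z)) * (0 - 1)) * rGamma z = cos (of_real pi * z)"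
    by (rule DERIV_unique)
  hence "(rGamma z * rGamma (1 - z)) * (Digamma (1 - z) - Digamma z) = cos (of_real pi * z)"
    by (simp add: algebra_simps)
  thus ?thesis unfolding rGamma_reflection_complex by (simp add: field_simps)
qed

definition polylog_sum :: "nat \<Rightarrow> complex \<Rightarrow> complex" where
  "polylog_sum n x = (\<Sum>d. of_nat d ^ n * x ^ d)"

lemma summable_polylog: "norm x < 1 \<Longrightarrow> summable (\<lambda>d. of_nat d ^ n * x ^ d)" for x :: complex
proof (induction n arbitrary: x)
  case 0
  thus ?case by (simp add: summable_geometric)
next
  case (Suc n)
  have "summable (\<lambda>d. diffs (\<lambda>d. of_nat d ^ n) d * x ^ d)"
    by (rule termdiff_converges[OF Suc.prems Suc.IH])
  hence "summable (\<lambda>d. x * (diffs (\<lambda>d. of_nat d ^ n) d * x ^ d))" by (rule summable_mult)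
  hence "summable (\<lambda>d. of_nat (Suc d) ^ Suc n * x ^ Suc d)"
    by (rule summable_cong[THEN iffD1, rotated]) (auto simp: diffs_def algebra_simps)
  thus ?case by (subst (asm) summable_Suc_iff)
qed

lemma polylog_deriv:
  assumes "norm x < 1"
  shows "\<exists>D. (polylog_sum n has_field_derivative D) (at x) \<and> x * D = polylog_sum (Suc n) x"
proof -
  define D where "D = (\<Sum>d. diffs (\<lambda>d. of_nat d ^ n) d * x ^ d)"
  have "(polylog_sum n has_field_derivative D) (at x)"
    unfolding polylog_sum_def D_def by (rule termdiffs_strong'[OF summable_polylog assms])
  moreover have "x * D = polylog_sum (Suc n) x"
  proof -
    have "summable (\<lambda>d. diffs (\<lambda>d. of_nat d ^ n) d * x ^ d)"
      by (rule termdiff_converges[OF assms summable_polylog])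
    hence "(\<lambda>d. x * (diffs (\<lambda>d. of_nat d ^ n) d * x ^ d)) sums (x * D)"
      unfolding D_def by (intro sums_mult summable_sums)
    hence "(\<lambda>d. of_nat (Suc d) ^ Suc n * x ^ Suc d) sums (x * D)"
      by (rule sums_cong[THEN iffD1, rotated]) (auto simp: diffs_def algebra_simps)
    hence "(\<lambda>d. of_nat d ^ Suc n * x ^ d) sums (x * D)"
      by (subst (asm) sums_Suc_iff) simp
    thus ?thesis unfolding polylog_sum_def by (simp add: sums_iff)
  qed
  ultimately show ?thesis by blast
qed

lemma Im_pos_not_Ints: "Im z > 0 \<Longrightarrow> z \<notin> \<int>" "Im z > 0 \<Longrightarrow> z \<notin> \<int>\<^sub>\<le>\<^sub>0" "Im z > 0 \<Longrightarrow> 1 - z \<notin> \<int>\<^sub>\<le>\<^sub>0"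
  by (auto elim!: Ints_cases nonpos_Ints_cases dest!: arg_cong[of _ _ Im])

lemma nome_has_derivative: "(nome has_field_derivative (2 * of_real pi * \<i> * nome z)) (at z)"
  unfolding nome_def by (auto intro!: derivative_eq_intros)

text \<open>Formulated for all non-integral z, not only on the upper half plane, because
  \<open>zeta_bernoulli\<close> uses it in a punctured neighbourhood of 0.\<close>

lemma Digamma_reflection_nome:
  assumes "z \<notin> \<int>"
  shows "(Digamma (1 - z) - Digamma z) * (nome z - 1) = of_real pi * \<i> * (nome z + 1)"
proof -
  define e where "e = exp (\<i> * (of_real pi * z))"
  have e0: "e \<noteq> 0" by (simp add: e_def)
  have ee: "nome z = e * e" by (simp add: nome_def e_def mult_ac flip: exp_add)
  have s: "sin (of_real pi * z) = (e - inverse e) / (2 * \<i>)" "cos (of_real pi * z) = (e + inverse e) / 2"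
    by (simp_all add: sin_exp_eq cos_exp_eq e_def exp_minus)
  define X where "X = Digamma (1 - z) - Digamma z"
  have X: "X * ((e - inverse e) / (2 * \<i>)) = of_real pi * ((e + inverse e) / 2)" unfolding X_def
    using Digamma_reflection[OF assms] unfolding s .
  have t: "(e - inverse e) * e = e * e - 1" "(e + inverse e) * e = e * e + 1"
    using e0 by (simp_all add: left_diff_distrib distrib_right)
  have gen: "x * (a / c) * (c * e) = x * (a * e)" if "c \<noteq> 0" for x a c e :: complex
    using that by simp
  have "X * (e * e - 1) = X * ((e - inverse e) / (2 * \<i>)) * (2 * \<i> * e)"
    unfolding t[symmetric] by (rule gen[symmetric]) simp
  also have "\<dots> = of_real pi * \<i> * ((e + inverse e) * e)" unfolding X by simp
  finally show ?thesis unfolding t X_def ee .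
qed

lemma Digamma_nome:
  assumes "Im z > 0"
  shows "Digamma (1 - z) - Digamma z = of_real pi * \<i> - 2 * of_real pi * \<i> * polylog_sum 0 (nome z)"
proof -
  have n1: "norm (nome z) < 1" by (rule norm_nome_less[OF assms])
  hence n2: "nome z \<noteq> 1" by auto
  have p0: "polylog_sum 0 (nome z) = 1 / (1 - nome z)"
    unfolding polylog_sum_def using suminf_geometric[OF n1] by simp
  have "(of_real pi * \<i> - 2 * of_real pi * \<i> * polylog_sum 0 (nome z)) * (nome z - 1) = of_real pi * \<i> * (nome z + 1)"
    unfolding p0 using n2 by (simp add: field_simps)
  with Digamma_reflection_nome[OF Im_pos_not_Ints(1)[OF assms]]
  have "(Digamma (1 - z) - Digamma z) * (nome z - 1) =
    (of_real pi * \<i> - 2 * of_real pi * \<i> * polylog_sum 0 (nome z)) * (nome z - 1)" by simp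
  thus ?thesis using n2 by simp
qed

text \<open>Repeated differentiation of \<open>Digamma_nome\<close>: d/dz acts on functions of q as
  2 pi i q d/dq, and q d/dq raises the order of \<open>polylog_sum\<close> by one.\<close>

lemma Polygamma_nome:
  assumes "Im z > 0"
  shows "(-1) ^ n * Polygamma n (1 - z) - Polygamma n z =
    (if n = 0 then of_real pi * \<i> else 0) - 2 * of_real pi * \<i> * (2 * of_real pi * \<i>) ^ n * polylog_sum n (nome z)"
  using assms
proof (induction n arbitrary: z)
  case 0
  thus ?case using Digamma_nome by simp
next
  case (Suc n)
  define L where "L = (\<lambda>z :: complex. (-1) ^ n * Polygamma n (1 - z) - Polygamma n z)"
  define R where "R = (\<lambda>z. (if n = 0 then of_real pi * \<i> else 0) - 2 * of_real pi * \<i> * (2 * of_real pi * \<i>) ^ n * polylog_sum n (nome z))"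
  have L: "(L has_field_derivative (-1) ^ n * (Polygamma (Suc n) (1 - z) * (0 - 1)) - Polygamma (Suc n) z) (at z)"
    unfolding L_def
    by (intro DERIV_diff DERIV_cmult DERIV_chain2[where f = "Polygamma n"] has_field_derivative_Polygamma
          Im_pos_not_Ints Suc.prems DERIV_const DERIV_ident)
  obtain D where D: "(polylog_sum n has_field_derivative D) (at (nome z))" "nome z * D = polylog_sum (Suc n) (nome z)"
    using polylog_deriv[OF norm_nome_less[OF Suc.prems]] by blast
  have R: "(R has_field_derivative 0 - 2 * of_real pi * \<i> * (2 * of_real pi * \<i>) ^ n * (D * (2 * of_real pi * \<i> * nome z))) (at z)"
    unfolding R_def
    by (intro DERIV_diff DERIV_cmult DERIV_const DERIV_chain2[where f = "polylog_sum n"] D nome_has_derivative)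
  have "open {z. Im z > 0}" by (simp add: open_halfspace_Im_gt)
  hence "(R has_field_derivative (-1) ^ n * (Polygamma (Suc n) (1 - z) * (0 - 1)) - Polygamma (Suc n) z) (at z)"
    by (rule has_field_derivative_transform_within_open[OF L]) (use Suc in \<open>auto simp: L_def R_def\<close>)
  from DERIV_unique[OF this R] have
    "(-1) ^ n * (Polygamma (Suc n) (1 - z) * (0 - 1)) - Polygamma (Suc n) z =
     0 - 2 * of_real pi * \<i> * (2 * of_real pi * \<i>) ^ n * (D * (2 * of_real pi * \<i> * nome z))" .
  also have "D * (2 * of_real pi * \<i> * nome z) = 2 * of_real pi * \<i> * polylog_sum (Suc n) (nome z)"
    unfolding D(2)[symmetric] by (simp only: ac_simps)
  finally show ?case by (simp add: mult.assoc)
qed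

lemma has_sum_int:
  fixes f :: "int \<Rightarrow> 'a :: topological_comm_monoid_add"
  assumes "((\<lambda>n. f (int n)) has_sum a) UNIV" "((\<lambda>n. f (- 1 - int n)) has_sum b) UNIV"
  shows "(f has_sum (a + b)) UNIV"
proof -
  have "(f has_sum a) {0..}"
    using has_sum_reindex_bij_betw[of int UNIV "{0..}" f a] assms bij_betwI[of int UNIV "{0..}" nat] by auto
  moreover have "bij_betw (\<lambda>n. - 1 - int n) UNIV {..<0}"
    by (rule bij_betwI[where g = "\<lambda>n. nat (- 1 - n)"]) auto
  hence "(f has_sum b) {..<0}" using has_sum_reindex_bij_betw[of "\<lambda>n. - 1 - int n" UNIV "{..<0}" f b] assms by simp
  ultimately have "(f has_sum (a + b)) ({0..} \<union> {..<0})" by (rule has_sum_Un_disjoint) auto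
  moreover have "{0..} \<union> {..<0} = (UNIV :: int set)" by auto
  ultimately show ?thesis by simp
qed

lemma summable_on_int_D:
  fixes f :: "int \<Rightarrow> 'a :: banach"
  assumes "f summable_on UNIV"
  shows "(\<lambda>n. f (int n)) summable_on UNIV" "(\<lambda>n. f (- 1 - int n)) summable_on UNIV"
proof -
  have "f summable_on range int" "f summable_on range (\<lambda>n. - 1 - int n)"
    using summable_on_subset_banach[OF assms] by auto
  moreover have "inj int" "inj (\<lambda>n. - 1 - int n)" by (auto simp: inj_def)
  ultimately show "(\<lambda>n. f (int n)) summable_on UNIV" "(\<lambda>n. f (- 1 - int n)) summable_on UNIV"
    by (auto simp: summable_on_reindex o_def)
qed

lemma summable_on_product_nonneg:
  fixes f :: "'a \<Rightarrow> real" and g :: "'b \<Rightarrow> real"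
  assumes "f summable_on A" "g summable_on B" "\<And>x. x \<in> A \<Longrightarrow> f x \<ge> 0" "\<And>y. y \<in> B \<Longrightarrow> g y \<ge> 0"
  shows "(\<lambda>(x, y). f x * g y) summable_on A \<times> B"
proof (rule summable_on_SigmaI)
  show "((\<lambda>y. case (x, y) of (x, y) \<Rightarrow> f x * g y) has_sum f x * infsum g B) B" for x
    using has_sum_cmult_right[OF has_sum_infsum[OF assms(2)], of "f x"] by simp
  show "(\<lambda>x. f x * infsum g B) summable_on A" using assms(1) by (rule summable_on_cmult_left)
qed (use assms in auto)

lemma lattice_norm_bound:
  fixes z :: complex
  assumes "Im z > 0"
  shows "\<exists>c>0. \<forall>m n :: int. norm (of_int m * z + of_int n) \<ge> c * max \<bar>real_of_int m\<bar> \<bar>real_of_int n\<bar>"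
proof -
  define y c where "y = Im z" and "c = min y (1 / (1 + norm z / y))"
  have y: "y > 0" using assms by (simp add: y_def)
  have c: "c > 0" using y by (auto simp: c_def intro!: divide_pos_pos add_pos_nonneg)
  have "norm (of_int m * z + of_int n) \<ge> c * max \<bar>real_of_int m\<bar> \<bar>real_of_int n\<bar>" for m n :: int
  proof -
    define N where "N = norm (of_int m * z + of_int n)"
    have "\<bar>Im (of_int m * z + of_int n)\<bar> \<le> N" unfolding N_def by (rule abs_Im_le_cmod)
    hence 1: "\<bar>real_of_int m\<bar> * y \<le> N" using y by (simp add: abs_mult y_def)
    have "\<bar>real_of_int n\<bar> = norm ((of_int m * z + of_int n) - of_int m * z)" by simp
    also have "\<dots> \<le> N + norm (of_int m * z)" unfolding N_def by (rule norm_triangle_ineq4)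
    also have "norm (of_int m * z) = \<bar>real_of_int m\<bar> * y * (norm z / y)" using y by (simp add: norm_mult)
    also have "\<dots> \<le> N * (norm z / y)" using 1 y by (intro mult_right_mono) auto
    finally have "\<bar>real_of_int n\<bar> \<le> N * (1 + norm z / y)" by (simp add: algebra_simps)
    moreover have "1 + norm z / y > 0" using y by (intro add_pos_nonneg) auto
    ultimately have "\<bar>real_of_int n\<bar> * (1 / (1 + norm z / y)) \<le> N" by (simp add: divide_simps)
    moreover have "c * \<bar>real_of_int n\<bar> \<le> \<bar>real_of_int n\<bar> * (1 / (1 + norm z / y))"
      by (subst mult.commute, intro mult_left_mono) (auto simp: c_def)
    moreover have "c * \<bar>real_of_int m\<bar> \<le> \<bar>real_of_int m\<bar> * y"
      by (subst mult.commute, intro mult_left_mono) (auto simp: c_def)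
    ultimately show ?thesis unfolding N_def[symmetric] using 1 by (auto simp: max_def)
  qed
  thus ?thesis using c by blast
qed

lemma summable_on_inverse_squares: "(\<lambda>n :: int. 1 / (max 1 \<bar>real_of_int n\<bar>)\<^sup>2) summable_on UNIV"
proof -
  have "summable (\<lambda>n. inverse (real (Suc n) ^ 2))" using inverse_power_summable[of 2, where 'a = real]
    by (subst summable_Suc_iff) simp
  hence 2: "(\<lambda>n. 1 / (max 1 \<bar>real_of_int (- 1 - int n)\<bar>)\<^sup>2) summable_on UNIV"
  proof (intro summable_nonneg_imp_summable_on)
    have "max 1 \<bar>real_of_int (- 1 - int n)\<bar> = real (Suc n)" for n by (simp add: abs_if max_def)
    hence "(\<lambda>n. 1 / (max 1 \<bar>real_of_int (- 1 - int n)\<bar>)\<^sup>2) = (\<lambda>n. inverse (real (Suc n) ^ 2))"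
      by (intro ext) (simp only: inverse_eq_divide)
    thus "summable (\<lambda>n. 1 / (max 1 \<bar>real_of_int (- 1 - int n)\<bar>)\<^sup>2)"
      using \<open>summable (\<lambda>n. inverse (real (Suc n) ^ 2))\<close> by (simp only:)
  qed auto
  have "summable (\<lambda>n. 1 / (max 1 \<bar>real_of_int (int n)\<bar>)\<^sup>2)"
  proof -
    have "summable (\<lambda>n. 1 / (max 1 \<bar>real_of_int (int (Suc n))\<bar>)\<^sup>2)"
      using \<open>summable (\<lambda>n. inverse (real (Suc n) ^ 2))\<close> by (simp add: inverse_eq_divide max_def)
    thus ?thesis by (subst (asm) summable_Suc_iff)
  qed
  hence 1: "(\<lambda>n. 1 / (max 1 \<bar>real_of_int (int n)\<bar>)\<^sup>2) summable_on UNIV"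
    by (intro summable_nonneg_imp_summable_on) auto
  show ?thesis using has_sum_int[OF has_sum_infsum[OF 1] has_sum_infsum[OF 2]] by (auto simp: summable_on_def)
qed

text \<open>Up to a constant, |mz + n|^k is at least max(|m|,|n|)^4 and hence at least max(1,|m|)^2
  max(1,|n|)^2, so the double sum is dominated by a product of two convergent single sums.\<close>

lemma eisenstein_summable:
  fixes z :: complex
  assumes "Im z > 0" "k \<ge> 4"
  shows "(\<lambda>(m, n). 1 / (of_int m * z + of_int n) ^ k) summable_on (UNIV - {(0 :: int, 0 :: int)})"
proof -
  obtain c where c: "c > 0" "\<And>m n :: int. norm (of_int m * z + of_int n) \<ge> c * max \<bar>real_of_int m\<bar> \<bar>real_of_int n\<bar>"
    using lattice_norm_bound[OF assms(1)] by blast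
  define g where "g = (\<lambda>n :: int. 1 / (max 1 \<bar>real_of_int n\<bar>)\<^sup>2)"
  have "(\<lambda>(m, n). g m * g n) summable_on UNIV \<times> UNIV"
    by (rule summable_on_product_nonneg) (auto simp: g_def summable_on_inverse_squares)
  hence "(\<lambda>x. (1 / c ^ k) * (\<lambda>(m, n). g m * g n) x) summable_on UNIV" by (intro summable_on_cmult_right) simp
  hence "(\<lambda>x. (1 / c ^ k) * (\<lambda>(m, n). g m * g n) x) summable_on (UNIV - {(0, 0)})"
    by (rule summable_on_subset_banach) auto
  hence "(\<lambda>x. norm ((\<lambda>(m, n). 1 / (of_int m * z + of_int n) ^ k) x)) summable_on (UNIV - {(0 :: int, 0 :: int)})"
  proof (rule Infinite_Sum.abs_summable_on_comparison_test')
    fix x :: "int \<times> int" assume x: "x \<in> UNIV - {(0, 0)}"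
    obtain m n where mn: "x = (m, n)" by (cases x)
    define a b M where "a = max 1 \<bar>real_of_int m\<bar>" and "b = max 1 \<bar>real_of_int n\<bar>" and "M = max \<bar>real_of_int m\<bar> \<bar>real_of_int n\<bar>"
    have M1: "M \<ge> 1" using x mn unfolding M_def by (cases "m = 0") (auto simp: le_max_iff_disj)
    have ab: "1 \<le> a" "1 \<le> b" "a \<le> M" "b \<le> M" using M1 by (auto simp: a_def b_def M_def)
    have "a\<^sup>2 * b\<^sup>2 \<le> M\<^sup>2 * M\<^sup>2" using ab by (intro mult_mono power_mono) auto
    also have "\<dots> = M ^ 4" by (simp flip: power_add)
    also have "\<dots> \<le> M ^ k" using M1 assms by (intro power_increasing) auto
    finally have "c ^ k * (a\<^sup>2 * b\<^sup>2) \<le> c ^ k * M ^ k" using c by (intro mult_left_mono) auto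
    also have "\<dots> = (c * M) ^ k" by (simp add: power_mult_distrib)
    also have "\<dots> \<le> norm (of_int m * z + of_int n) ^ k" using c M1 by (intro power_mono) (auto simp: M_def)
    finally have le: "c ^ k * (a\<^sup>2 * b\<^sup>2) \<le> norm (of_int m * z + of_int n) ^ k" .
    have "0 < c ^ k * (a\<^sup>2 * b\<^sup>2)" using c ab by (intro mult_pos_pos) auto
    hence "1 / norm (of_int m * z + of_int n) ^ k \<le> 1 / (c ^ k * (a\<^sup>2 * b\<^sup>2))"
      using le by (intro frac_le) auto
    thus "norm ((\<lambda>(m, n). 1 / (of_int m * z + of_int n) ^ k) x) \<le> (1 / c ^ k) * (\<lambda>(m, n). g m * g n) x"
      unfolding mn g_def a_def b_def by (simp add: norm_divide norm_power)
  qed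
  thus ?thesis by (rule abs_summable_summable)
qed

text \<open>The sum over n \<ge> 0 is the polygamma series at z; the sum over n < 0, as k is even,
  is the one at 1 - z. The reflection formula evaluates the combination. Summability comes from the
  row m = 1 of the Eisenstein lattice sum.\<close>

lemma lipschitz_formula:
  fixes z :: complex
  assumes z: "Im z > 0" and k: "even k" "k \<ge> 4"
  shows "((\<lambda>n :: int. 1 / (z + of_int n) ^ k) has_sum
     ((2 * of_real pi * \<i>) ^ k / fact (k - 1) * polylog_sum (k - 1) (nome z))) UNIV"
proof -
  obtain n where n: "k = Suc n" "n > 0" "odd n" using k by (cases k) auto
  have "(\<lambda>x. (\<lambda>(m, n). 1 / (of_int m * z + of_int n) ^ k) x) summable_on range (\<lambda>n :: int. (1 :: int, n))"
    by (rule summable_on_subset_banach[OF eisenstein_summable[OF z k(2)]]) auto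
  hence s: "(\<lambda>n :: int. 1 / (z + of_int n) ^ k) summable_on UNIV"
    by (subst (asm) summable_on_reindex) (auto simp: inj_def o_def)
  have z0: "z \<noteq> 0" "1 - z \<noteq> 0" using z by auto
  define a b where "a = infsum (\<lambda>m. 1 / (z + of_int (int m)) ^ k) UNIV" and "b = infsum (\<lambda>m. 1 / (z + of_int (- 1 - int m)) ^ k) UNIV"
  have a: "((\<lambda>m. 1 / (z + of_int (int m)) ^ k) has_sum a) UNIV" unfolding a_def
    by (rule has_sum_infsum[OF summable_on_int_D(1)[OF s]])
  have b: "((\<lambda>m. 1 / (z + of_int (- 1 - int m)) ^ k) has_sum b) UNIV" unfolding b_def
    by (rule has_sum_infsum[OF summable_on_int_D(2)[OF s]])
  have "(\<lambda>m. 1 / (z + of_nat m) ^ k) sums a" using has_sum_imp_sums[OF a] by simp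
  moreover have "(\<lambda>m. 1 / (z + of_nat m) ^ k) sums (Polygamma n z / fact n)"
    using Polygamma_LIMSEQ[OF z0(1) n(2)] n by (simp add: inverse_eq_divide)
  ultimately have a': "a = Polygamma n z / fact n" by (rule sums_unique2)
  have "(z + of_int (- 1 - int m)) ^ k = ((1 - z) + of_nat m) ^ k" for m
  proof -
    have "z + of_int (- 1 - int m) = - ((1 - z) + of_nat m)" by simp
    thus ?thesis using k by (simp only: power_minus_even)
  qed
  hence "(\<lambda>m. 1 / ((1 - z) + of_nat m) ^ k) sums b" using has_sum_imp_sums[OF b] by (simp only:)
  moreover have "(\<lambda>m. 1 / ((1 - z) + of_nat m) ^ k) sums (Polygamma n (1 - z) / fact n)"
    using Polygamma_LIMSEQ[OF z0(2) n(2)] n by (simp add: inverse_eq_divide)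
  ultimately have b': "b = Polygamma n (1 - z) / fact n" by (rule sums_unique2)
  have "a + b = - ((-1) ^ n * Polygamma n (1 - z) - Polygamma n z) / fact n"
    unfolding a' b' using n by (simp add: add_divide_distrib)
  also have "\<dots> = (2 * of_real pi * \<i>) ^ k / fact (k - 1) * polylog_sum (k - 1) (nome z)"
    unfolding Polygamma_nome[OF z] using n by simp
  finally show ?thesis using has_sum_int[OF a b] by simp
qed


definition zeta_sum :: "nat \<Rightarrow> complex" where "zeta_sum k = (\<Sum>n. 1 / of_nat (Suc n) ^ k)"

lemma zeta_sums:
  assumes "k \<ge> 4"
  shows "((\<lambda>n :: nat. 1 / of_nat (Suc n) ^ k :: complex) has_sum zeta_sum k) UNIV"
proof (rule norm_summable_imp_has_sum)
  have "summable (\<lambda>n. inverse (real (Suc n) ^ k))" using inverse_power_summable[of k, where 'a = real] assms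
    by (subst summable_Suc_iff) simp
  thus s: "summable (\<lambda>n. norm (1 / of_nat (Suc n) ^ k :: complex))"
    by (simp add: norm_divide norm_power inverse_eq_divide del: of_nat_Suc)
  show "(\<lambda>n :: nat. 1 / of_nat (Suc n) ^ k :: complex) sums zeta_sum k"
    unfolding zeta_sum_def by (rule summable_sums[OF summable_norm_cancel[OF s]])
qed

lemma zeta_sum_nonzero:
  assumes "k \<ge> 4"
  shows "zeta_sum k \<noteq> 0"
proof -
  have s: "summable (\<lambda>n. inverse (real (Suc n) ^ k))" using inverse_power_summable[of k, where 'a = real] assms
    by (subst summable_Suc_iff) simp
  have "(\<lambda>n. of_real (inverse (real (Suc n) ^ k)) :: complex) sums of_real (\<Sum>n. inverse (real (Suc n) ^ k))"
    by (intro sums_of_real summable_sums s)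
  moreover have "(\<lambda>n. of_real (inverse (real (Suc n) ^ k)) :: complex) sums zeta_sum k"
    using has_sum_imp_sums[OF zeta_sums[OF assms]] by (simp add: inverse_eq_divide)
  ultimately have "zeta_sum k = of_real (\<Sum>n. inverse (real (Suc n) ^ k))" by (rule sums_unique2[symmetric])
  moreover have "(\<Sum>n. inverse (real (Suc n) ^ k)) > 0" by (rule suminf_pos[OF s]) simp
  ultimately show ?thesis by simp
qed

definition G_eis :: "nat \<Rightarrow> complex \<Rightarrow> complex" where
  "G_eis k z = infsum (\<lambda>(m, n). 1 / (of_int m * z + of_int n) ^ k) (UNIV - {(0 :: int, 0 :: int)})"

lemma G_eis_S:
  assumes z: "Im z > 0"
  shows "G_eis k (-1 / z) = z ^ k * G_eis k z"
proof -
  have z0: "z \<noteq> 0" using z by auto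
  have "G_eis k (-1 / z) = infsum (\<lambda>x. z ^ k * (\<lambda>(m, n). 1 / (of_int m * z + of_int n) ^ k) x) (UNIV - {(0 :: int, 0 :: int)})"
    unfolding G_eis_def
  proof (rule infsum_reindex_bij_witness[where j = "\<lambda>(m, n). (n, -m)" and i = "\<lambda>(m, n). (-n, m)"])
    fix x :: "int \<times> int" assume "x \<in> UNIV - {(0, 0)}"
    obtain m n where x: "x = (m, n)" by (cases x)
    have "of_int m * (-1 / z) + of_int n = (of_int n * z + of_int (-m)) / z" using z0 by (simp add: field_simps)
    thus "z ^ k * (\<lambda>(m, n). 1 / (of_int m * z + of_int n) ^ k) ((\<lambda>(m, n). (n, -m)) x) =
       (\<lambda>(m, n). 1 / (of_int m * (-1 / z) + of_int n) ^ k) x"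
      unfolding x by (simp add: power_divide)
  qed auto
  thus ?thesis unfolding infsum_cmult_right' G_eis_def .
qed

definition divisor_sigma :: "nat \<Rightarrow> nat \<Rightarrow> nat" where "divisor_sigma k n = (\<Sum>d | d dvd n. d ^ k)"

text \<open>Absolute convergence allows summing d^(j+1) q^(md) over pairs (m,d) by rows m or along n
  = m d. The exponent \<open>Suc j\<close> is positive, which kills the term d = 0 of
  \<open>polylog_sum\<close>.\<close>

lemma double_sum_divisors:
  fixes q :: complex
  assumes "norm q < 1"
  obtains T where "((\<lambda>m. polylog_sum (Suc j) (q ^ Suc m)) has_sum T) UNIV"
    "(\<lambda>n. of_nat (if n = 0 then 0 else divisor_sigma (Suc j) n) * q ^ n) sums T"
proof -
  define h where "h = (\<lambda>(m :: nat, d :: nat). of_nat d ^ Suc j * q ^ (m * d))"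
  define A where "A = {1 :: nat..}"
  define r where "r = norm q"
  have r: "0 \<le> r" "r < 1" using assms by (auto simp: r_def)
  have s1: "(\<lambda>d. real d ^ Suc j * r ^ d) summable_on A"
  proof -
    have "norm (complex_of_real r) < 1" using r by simp
    hence "summable (\<lambda>d. of_nat d ^ Suc j * complex_of_real r ^ d)" by (rule summable_polylog)
    moreover have "(\<lambda>d. of_nat d ^ Suc j * complex_of_real r ^ d) = (\<lambda>d. complex_of_real (real d ^ Suc j * r ^ d))"
      by (intro ext) (simp only: of_real_mult of_real_power of_real_of_nat_eq)
    ultimately have "summable (\<lambda>d. complex_of_real (real d ^ Suc j * r ^ d))" by (simp only:)
    hence "summable (\<lambda>d. real d ^ Suc j * r ^ d)" by (rule summable_complex_of_real[THEN iffD1])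
    hence "(\<lambda>d. real d ^ Suc j * r ^ d) summable_on UNIV" using r by (intro summable_nonneg_imp_summable_on) auto
    thus ?thesis by (rule summable_on_subset_banach) auto
  qed
  have s2: "(\<lambda>m. r ^ (m - 1)) summable_on A"
  proof -
    have "summable (\<lambda>m. r ^ m)" using r by (intro summable_geometric) auto
    hence "summable (\<lambda>m. r ^ (m - 1))" by (subst summable_Suc_iff[symmetric]) simp
    hence "(\<lambda>m. r ^ (m - 1)) summable_on UNIV" using r by (intro summable_nonneg_imp_summable_on) auto
    thus ?thesis by (rule summable_on_subset_banach) auto
  qed
  have "(\<lambda>(m, d). r ^ (m - 1) * (real d ^ Suc j * r ^ d)) summable_on A \<times> A"
    by (rule summable_on_product_nonneg[OF s2 s1]) (use r in auto)
  hence "(\<lambda>x. norm (h x)) summable_on A \<times> A"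
  proof (rule Infinite_Sum.abs_summable_on_comparison_test')
    fix x assume "x \<in> A \<times> A"
    then obtain m d where x: "x = (m, d)" "m \<ge> 1" "d \<ge> 1" by (auto simp: A_def)
    obtain m' d' where md: "m = Suc m'" "d = Suc d'" using x by (cases m; cases d) auto
    have "r ^ (m * d) \<le> r ^ (m' + d)" using r md by (intro power_decreasing) auto
    also have "\<dots> = r ^ (m - 1) * r ^ d" by (simp add: power_add md)
    finally have "real d ^ Suc j * r ^ (m * d) \<le> real d ^ Suc j * (r ^ (m - 1) * r ^ d)" by (intro mult_left_mono) auto
    thus "norm (h x) \<le> (\<lambda>(m, d). r ^ (m - 1) * (real d ^ Suc j * r ^ d)) x"
      unfolding x h_def by (simp add: norm_mult norm_power r_def mult_ac)
  qed
  hence hs: "h summable_on A \<times> A" by (rule abs_summable_summable)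
  define T where "T = infsum h (A \<times> A)"
  have hT: "(h has_sum T) (A \<times> A)" unfolding T_def by (rule has_sum_infsum[OF hs])
  have inner: "((\<lambda>d. h (m, d)) has_sum polylog_sum (Suc j) (q ^ m)) A" if "m \<in> A" for m
  proof -
    have "norm (q ^ m) < 1" using that assms by (auto simp: A_def norm_power power_less_one_iff)
    hence sq: "summable (\<lambda>d. of_nat d ^ Suc j * (q ^ m) ^ d)" by (rule summable_polylog)
    have "(\<lambda>x. h x) summable_on Pair m ` A" by (rule summable_on_subset_banach[OF hs]) (use that in auto)
    hence "(\<lambda>d. h (m, d)) summable_on A" by (subst (asm) summable_on_reindex) (auto simp: inj_on_def o_def)
    then obtain v where v: "((\<lambda>d. h (m, d)) has_sum v) A" by (auto simp: summable_on_def)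
    hence "((\<lambda>d. h (m, d)) has_sum v) UNIV"
      by (rule has_sum_cong_neutral[THEN iffD1, rotated 3]) (auto simp: A_def h_def not_less_eq_eq)
    hence "(\<lambda>d. h (m, d)) sums v" by (rule has_sum_imp_sums)
    hence "v = polylog_sum (Suc j) (q ^ m)" unfolding polylog_sum_def h_def by (simp add: sums_iff power_mult)
    thus ?thesis using v by simp
  qed
  have "((\<lambda>m. polylog_sum (Suc j) (q ^ m)) has_sum T) A" by (rule has_sum_SigmaD[OF hT inner])
  moreover have "bij_betw Suc UNIV A" by (rule bij_betwI[where g = "\<lambda>n. n - 1"]) (auto simp: A_def)
  ultimately have 1: "((\<lambda>m. polylog_sum (Suc j) (q ^ Suc m)) has_sum T) UNIV"
    using has_sum_reindex_bij_betw[of Suc UNIV A "\<lambda>m. polylog_sum (Suc j) (q ^ m)" T] by blast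
  have "(h has_sum T) (A \<times> A) \<longleftrightarrow> ((\<lambda>(n, d). of_nat d ^ Suc j * q ^ n) has_sum T) (Sigma A (\<lambda>n. {d. d dvd n}))"
    by (rule has_sum_reindex_bij_witness[where j = "\<lambda>(m, d). (m * d, d)" and i = "\<lambda>(n, d). (n div d, d)"])
       (auto simp: A_def h_def dvd_def Suc_le_eq)
  with hT have "((\<lambda>(n, d). of_nat d ^ Suc j * q ^ n) has_sum T) (Sigma A (\<lambda>n. {d. d dvd n}))" by blast
  hence "((\<lambda>n. \<Sum>d | d dvd n. of_nat d ^ Suc j * q ^ n) has_sum T) A"
    by (rule has_sum_SigmaD) (auto simp: A_def intro!: has_sum_finiteI)
  hence "((\<lambda>n. of_nat (if n = 0 then 0 else divisor_sigma (Suc j) n) * q ^ n) has_sum T) UNIV"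
    by (rule has_sum_cong_neutral[THEN iffD1, rotated 3])
       (auto simp: A_def divisor_sigma_def sum_distrib_right not_less_eq_eq)
  hence 2: "(\<lambda>n. of_nat (if n = 0 then 0 else divisor_sigma (Suc j) n) * q ^ n) sums T" by (rule has_sum_imp_sums)
  show ?thesis using that 1 2 by blast
qed

text \<open>Summation by rows: m = 0 gives 2 zeta(k), and the rows m and -m both give the Lipschitz
  formula at |m| z because k is even.\<close>

lemma G_eis_expansion:
  assumes z: "Im z > 0" and k: "even k" "k \<ge> 4"
  shows "(\<lambda>n. (if n = 0 then 2 * zeta_sum k else
     2 * ((2 * of_real pi * \<i>) ^ k / fact (k - 1)) * of_nat (divisor_sigma (k - 1) n)) * nome z ^ n) sums G_eis k z"
proof -
  define C where "C = (2 * of_real pi * \<i>) ^ k / (fact (k - 1) :: complex)"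
  define q where "q = nome z"
  define f where "f = (\<lambda>(m :: int, n :: int). 1 / (of_int m * z + of_int n) ^ k)"
  define B where "B = (\<lambda>m :: int. if m = 0 then - {0 :: int} else UNIV)"
  define b where "b = (\<lambda>m :: int. if m = 0 then 2 * zeta_sum k else C * polylog_sum (k - 1) (q ^ nat \<bar>m\<bar>))"
  have "UNIV - {(0, 0)} = Sigma UNIV B" by (auto simp: B_def split: if_splits)
  hence fG: "(f has_sum G_eis k z) (Sigma UNIV B)"
    using has_sum_infsum[OF eisenstein_summable[OF z k(2)]] unfolding G_eis_def f_def by simp
  have inner: "((\<lambda>n. f (m, n)) has_sum b m) (B m)" for m
  proof (cases "m = 0")
    case True
    define e where "e = (\<lambda>n :: int. if n = 0 then 0 else 1 / of_int n ^ k :: complex)"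
    have "((\<lambda>n. e (int n)) has_sum zeta_sum k) UNIV"
    proof -
      have "((\<lambda>n. e (int n)) has_sum zeta_sum k) (range Suc)"
        using zeta_sums[OF k(2)] by (subst has_sum_reindex) (auto simp: o_def e_def)
      thus ?thesis by (rule has_sum_cong_neutral[THEN iffD1, rotated 3]) (auto simp: e_def image_iff gr0_conv_Suc)
    qed
    moreover have "((\<lambda>n. e (- 1 - int n)) has_sum zeta_sum k) UNIV"
    proof -
      have "of_int (- 1 - int n) ^ k = (of_nat (Suc n) ^ k :: complex)" for n
      proof -
        have "of_int (- 1 - int n) = - (of_nat (Suc n) :: complex)" by simp
        thus ?thesis using k by (simp only: power_minus_even)
      qed
      hence "e (- 1 - int n) = 1 / of_nat (Suc n) ^ k" for n unfolding e_def by simp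
      thus ?thesis using zeta_sums[OF k(2)] by simp
    qed
    ultimately have "(e has_sum (zeta_sum k + zeta_sum k)) UNIV" by (rule has_sum_int)
    hence "((\<lambda>n. f (0, n)) has_sum (zeta_sum k + zeta_sum k)) (- {0})"
      by (rule has_sum_cong_neutral[THEN iffD1, rotated 3]) (auto simp: e_def f_def)
    thus ?thesis using True by (simp add: b_def B_def)
  next
    case False
    define w where "w = of_nat (nat \<bar>m\<bar>) * z"
    have w: "Im w > 0" using False z by (simp add: w_def)
    have nw: "nome w = q ^ nat \<bar>m\<bar>" unfolding w_def q_def by (rule nome_of_nat_mult)
    have L: "((\<lambda>n :: int. 1 / (w + of_int n) ^ k) has_sum b m) UNIV"
      using lipschitz_formula[OF w k] False unfolding nw b_def C_def by simp
    show ?thesis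
    proof (cases "m > 0")
      case True
      thus ?thesis using L by (simp add: f_def B_def w_def)
    next
      case neg: False
      have "f (m, n) = 1 / (w + of_int (-n)) ^ k" for n
      proof -
        have "of_int m * z + of_int n = - (w + of_int (-n))" using neg by (simp add: w_def)
        thus ?thesis unfolding f_def using k by (simp only: power_minus_even prod.case)
      qed
      moreover have "bij_betw uminus UNIV (UNIV :: int set)" by (rule bij_betwI[where g = uminus]) auto
      ultimately show ?thesis using L False
        has_sum_reindex_bij_betw[of uminus UNIV UNIV "\<lambda>n. 1 / (w + of_int n) ^ k" "b m"] by (simp add: B_def)
    qed
  qed
  have bG: "(b has_sum G_eis k z) UNIV" by (rule has_sum_SigmaD[OF fG inner])
  obtain j where j: "k - 1 = Suc j" using k by (cases "k - 1") auto
  have "norm q < 1" unfolding q_def by (rule norm_nome_less[OF z])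
  then obtain T where T: "((\<lambda>m. polylog_sum (k - 1) (q ^ Suc m)) has_sum T) UNIV"
    "(\<lambda>n. of_nat (if n = 0 then 0 else divisor_sigma (k - 1) n) * q ^ n) sums T"
    using double_sum_divisors[of q j] unfolding j by blast
  have T1: "((\<lambda>m. C * polylog_sum (k - 1) (q ^ Suc m)) has_sum (C * T)) UNIV" by (rule has_sum_cmult_right[OF T(1)])
  have "((\<lambda>m. b (int m)) has_sum (2 * zeta_sum k + C * T)) UNIV"
  proof -
    have "((\<lambda>m. b (int m)) has_sum (C * T)) (range Suc)"
      using T1 by (subst has_sum_reindex) (auto simp: o_def b_def nat_add_distrib)
    moreover have "((\<lambda>m. b (int m)) has_sum (2 * zeta_sum k)) {0}" by (auto simp: b_def intro!: has_sum_finiteI)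
    ultimately have "((\<lambda>m. b (int m)) has_sum (2 * zeta_sum k + C * T)) ({0} \<union> range Suc)"
      by (intro has_sum_Un_disjoint) auto
    moreover have "{0} \<union> range Suc = UNIV" by (auto simp: image_iff gr0_conv_Suc) (metis not0_implies_Suc)
    ultimately show ?thesis by simp
  qed
  moreover have "((\<lambda>m. b (- 1 - int m)) has_sum (C * T)) UNIV"
  proof -
    have "nat \<bar>- 1 - int m\<bar> = Suc m" for m by simp
    thus ?thesis using T1 by (simp add: b_def)
  qed
  ultimately have "(b has_sum (2 * zeta_sum k + C * T + C * T)) UNIV" by (rule has_sum_int)
  hence G: "G_eis k z = 2 * zeta_sum k + 2 * C * T" using has_sum_unique[OF bG] by simp
  have "(\<lambda>n. if n = 0 then 2 * zeta_sum k else 0) sums (2 * zeta_sum k)"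
    using sums_single[of 0 "\<lambda>_. 2 * zeta_sum k"] by simp
  from sums_add[OF this sums_mult[OF T(2), of "2 * C"]]
  show ?thesis unfolding G q_def[symmetric] C_def[symmetric]
    by (rule sums_cong[THEN iffD1, rotated]) auto
qed


section \<open>Bernoulli numbers, even zeta values and integrality of Eisenstein series\<close>

definition bernoulli_fps :: "'a :: field_char_0 fps" where "bernoulli_fps = fps_X / (fps_exp 1 - 1)"

lemma fps_exp_minus_one_nonzero: "c \<noteq> 0 \<Longrightarrow> fps_exp c - 1 \<noteq> (0 :: 'a :: field_char_0 fps)"
proof
  assume "c \<noteq> 0" "fps_exp c - 1 = (0 :: 'a fps)"
  hence "fps_nth (fps_exp c - 1) 1 = 0" by simp
  thus False using \<open>c \<noteq> 0\<close> by simp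
qed

lemma bernoulli_fps_mult: "bernoulli_fps * (fps_exp 1 - 1) = (fps_X :: 'a :: field_char_0 fps)"
proof -
  have "subdegree (fps_exp 1 - 1 :: 'a fps) = 1" by (rule subdegreeI) auto
  thus ?thesis unfolding bernoulli_fps_def
    using fps_exp_minus_one_nonzero[of "1 :: 'a"] by (intro fps_times_divide_eq) auto
qed

lemma bernoulli_num_fps: "bernoulli_num n = fact n * fps_nth bernoulli_fps n"
  by (simp add: bernoulli_num_def bernoulli_fps_def)

text \<open>The zeta values are computed over the complex numbers and used over the p-adic field;
  the rational Bernoulli numbers carry them across.\<close>

lemma bernoulli_num_of_rat: "(bernoulli_num n :: 'a :: field_char_0) = of_rat (bernoulli_num n)"
proof -
  define B :: "'a fps" where "B = Abs_fps (\<lambda>n. of_rat (fps_nth bernoulli_fps n))"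
  have e: "fps_nth (fps_exp 1 - 1 :: 'a fps) m = of_rat (fps_nth (fps_exp 1 - 1) m)" for m
  proof -
    have "(of_rat (fact m) :: 'a) = fact m" by (metis of_nat_fact of_rat_of_nat_eq)
    thus ?thesis by (cases "m = 0") (auto simp: of_rat_divide)
  qed
  have "B * (fps_exp 1 - 1) = fps_X"
  proof (rule fps_ext)
    fix n
    have "fps_nth (B * (fps_exp 1 - 1)) n = of_rat (fps_nth (bernoulli_fps * (fps_exp 1 - 1)) n)"
      unfolding fps_mult_nth e of_rat_sum of_rat_mult B_def by simp
    thus "fps_nth (B * (fps_exp 1 - 1)) n = fps_nth fps_X n"
      unfolding bernoulli_fps_mult by (cases "n = 1") auto
  qed
  hence "B * (fps_exp 1 - 1) = bernoulli_fps * (fps_exp 1 - 1)" unfolding bernoulli_fps_mult .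
  hence "B = bernoulli_fps" using fps_exp_minus_one_nonzero[of "1 :: 'a"] by simp
  hence "fps_nth bernoulli_fps n = (of_rat (fps_nth bernoulli_fps n) :: 'a)" unfolding B_def
    by (metis fps_nth_Abs_fps)
  thus ?thesis unfolding bernoulli_num_fps by (simp add: of_rat_mult) (metis of_rat_of_nat_eq of_nat_fact)
qed

lemma has_fps_expansion_eq:
  fixes f g :: "complex \<Rightarrow> complex"
  assumes "f has_fps_expansion F" "g has_fps_expansion G" "eventually (\<lambda>z. f z = g z) (nhds 0)"
  shows "F = G"
proof (rule eval_fps_eqD)
  have "eventually (\<lambda>z. eval_fps F z = f z) (nhds 0)" "eventually (\<lambda>z. eval_fps G z = g z) (nhds 0)"
    using assms by (auto simp: has_fps_expansion_def)
  with assms(3) show "eventually (\<lambda>z. eval_fps F z = eval_fps G z) (nhds 0)"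
    by eventually_elim simp
qed (use assms in \<open>auto simp: has_fps_expansion_def\<close>)

text \<open>psi(1-z) - psi(1+z) is holomorphic near 0, and its Taylor coefficient of order k - 1 is
  -2 zeta(k). The reflection formula, multiplied by z (e^{cz} - 1), identifies z times this function
  with pi i z - 1 plus the Bernoulli series at c z, where c = 2 pi i.\<close>

lemma zeta_bernoulli:
  assumes "even k" "k \<ge> 4"
  shows "2 * zeta_sum k = - ((2 * of_real pi * \<i>) ^ k * bernoulli_num k / fact k)"
proof -
  obtain n where n: "k = Suc n" "n > 0" "odd n" using assms by (cases k) auto
  define c where "c = 2 * of_real pi * \<i>"
  have c0: "c \<noteq> 0" by (simp add: c_def)
  define f where "f = (\<lambda>z :: complex. Digamma (1 - z) - Digamma (1 + z))"
  have np: "1 - z \<notin> \<int>\<^sub>\<le>\<^sub>0" "1 + z \<notin> \<int>\<^sub>\<le>\<^sub>0" if "z \<in> ball 0 1" for z :: complex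
  proof -
    have "\<bar>Re z\<bar> < 1" using that abs_Re_le_cmod[of z] by simp
    thus "1 - z \<notin> \<int>\<^sub>\<le>\<^sub>0" "1 + z \<notin> \<int>\<^sub>\<le>\<^sub>0" by (auto elim!: nonpos_Ints_cases dest!: arg_cong[of _ _ Re])
  qed
  have D: "((\<lambda>z. (-1) ^ m * Polygamma m (1 - z) - Polygamma m (1 + z)) has_field_derivative
      (-1) ^ Suc m * Polygamma (Suc m) (1 - z) - Polygamma (Suc m) (1 + z)) (at z)" if "z \<in> ball 0 1" for z :: complex and m
  proof -
    have "((\<lambda>z. (-1) ^ m * Polygamma m (1 - z) - Polygamma m (1 + z)) has_field_derivative
      (-1) ^ m * (Polygamma (Suc m) (1 - z) * (0 - 1)) - Polygamma (Suc m) (1 + z) * (0 + 1)) (at z)"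
      by (intro DERIV_diff DERIV_cmult DERIV_chain2[where f = "Polygamma m"] has_field_derivative_Polygamma
          np that DERIV_const DERIV_ident DERIV_add)
    thus ?thesis by simp
  qed
  have hd: "(deriv ^^ m) f z = (-1) ^ m * Polygamma m (1 - z) - Polygamma m (1 + z)" if "z \<in> ball 0 1" for m z
    using that
  proof (induction m arbitrary: z)
    case (Suc m)
    have "((deriv ^^ m) f has_field_derivative (-1) ^ Suc m * Polygamma (Suc m) (1 - z) - Polygamma (Suc m) (1 + z)) (at z)"
      by (rule has_field_derivative_transform_within_open[OF D[OF Suc.prems] open_ball Suc.prems]) (simp add: Suc.IH)
    from DERIV_imp_deriv[OF this] show ?case by simp
  qed (simp add: f_def)
  have "f holomorphic_on ball 0 1"
    unfolding holomorphic_on_open[OF open_ball]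
  proof
    fix z :: complex assume "z \<in> ball 0 1"
    from D[OF this, of 0] have "(f has_field_derivative (-1) ^ Suc 0 * Polygamma (Suc 0) (1 - z) - Polygamma (Suc 0) (1 + z)) (at z)"
      by (simp add: f_def)
    thus "\<exists>f'. (f has_field_derivative f') (at z)" ..
  qed
  hence fF: "f has_fps_expansion fps_expansion f 0" by (intro has_fps_expansion_fps_expansion) auto
  define F where "F = fps_expansion f 0"
  have Fn: "fps_nth F n = - 2 * Polygamma n 1 / fact n"
    unfolding F_def fps_expansion_def using hd[of 0 n] n by (simp add: algebra_simps)
  have "fps_X * F * (fps_exp c - 1) = (fps_const (of_real pi * \<i>) * fps_X - 1) * (fps_exp c - 1) + fps_const c * fps_X"
  proof (rule has_fps_expansion_eq)
    show "(\<lambda>z. z * f z * (exp (c * z) - 1)) has_fps_expansion fps_X * F * (fps_exp c - 1)"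
      unfolding F_def by (intro fps_expansion_intros fF)
    show "(\<lambda>z. (of_real pi * \<i> * z - 1) * (exp (c * z) - 1) + c * z) has_fps_expansion
       (fps_const (of_real pi * \<i>) * fps_X - 1) * (fps_exp c - 1) + fps_const c * fps_X"
      by (intro fps_expansion_intros)
    have "eventually (\<lambda>z :: complex. z \<in> ball 0 1) (nhds 0)" by (intro eventually_nhds_in_open) auto
    thus "eventually (\<lambda>z. z * f z * (exp (c * z) - 1) = (of_real pi * \<i> * z - 1) * (exp (c * z) - 1) + c * z) (nhds 0)"
    proof eventually_elim
      case (elim z)
      show ?case
      proof (cases "z = 0")
        case False
        have "z \<notin> \<int>"
        proof
          assume "z \<in> \<int>"
          then obtain m where m: "z = of_int m" by (elim Ints_cases)
          hence "norm z = \<bar>real_of_int m\<bar>" by simp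
          thus False using elim False m by auto
        qed
        from Digamma_reflection_nome[OF this]
        have r: "(Digamma (1 - z) - Digamma z) * (exp (c * z) - 1) = of_real pi * \<i> * (exp (c * z) + 1)"
          by (simp add: nome_def c_def)
        have "Digamma (1 + z) = Digamma z + 1 / z" using Digamma_plus1[OF False] by (simp add: add.commute)
        hence "z * f z * (exp (c * z) - 1) = z * ((Digamma (1 - z) - Digamma z) * (exp (c * z) - 1)) - (exp (c * z) - 1)"
          using False unfolding f_def by (simp add: field_simps)
        also have "\<dots> = (of_real pi * \<i> * z - 1) * (exp (c * z) - 1) + c * z"
          unfolding r by (simp add: c_def algebra_simps)
        finally show ?thesis .
      qed auto
    qed
  qed
  also have "fps_const c * fps_X = (bernoulli_fps oo (fps_const c * fps_X)) * (fps_exp c - 1)"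
  proof -
    have "(bernoulli_fps * (fps_exp 1 - 1)) oo (fps_const c * fps_X) = (bernoulli_fps oo (fps_const c * fps_X)) * (fps_exp c - 1)"
      by (subst fps_compose_mult_distrib) (simp_all add: fps_compose_sub_distrib)
    thus ?thesis unfolding bernoulli_fps_mult by simp
  qed
  finally have "fps_X * F * (fps_exp c - 1) =
     (fps_const (of_real pi * \<i>) * fps_X - 1 + (bernoulli_fps oo (fps_const c * fps_X))) * (fps_exp c - 1)"
    by (simp only: distrib_right)
  hence "fps_X * F = fps_const (of_real pi * \<i>) * fps_X - 1 + (bernoulli_fps oo (fps_const c * fps_X))"
    using fps_exp_minus_one_nonzero[OF c0] by simp
  hence "fps_nth (fps_X * F) k = fps_nth (fps_const (of_real pi * \<i>) * fps_X - 1 + (bernoulli_fps oo (fps_const c * fps_X))) k"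
    by simp
  hence "- 2 * Polygamma n 1 / fact n = c ^ k * fps_nth bernoulli_fps k"
    using n Fn by simp
  moreover have "zeta_sum k = Polygamma n 1 / fact n"
  proof -
    have "(\<lambda>m. inverse ((1 + of_nat m) ^ Suc n)) sums ((-1) ^ Suc n * Polygamma n (1 :: complex) / fact n)"
      by (rule Polygamma_LIMSEQ) (use n in auto)
    hence "(\<lambda>m. 1 / of_nat (Suc m) ^ k :: complex) sums (Polygamma n 1 / fact n)" using n by (simp add: inverse_eq_divide)
    thus ?thesis unfolding zeta_sum_def by (simp add: sums_iff)
  qed
  ultimately have "- (2 * zeta_sum k) = c ^ k * fps_nth bernoulli_fps k" by simp
  hence "2 * zeta_sum k = - (c ^ k * fps_nth bernoulli_fps k)" by (metis minus_minus)
  thus ?thesis unfolding c_def bernoulli_num_fps by simp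
qed

text \<open>The multiplier is the numerator of B_k, which turns -2k / B_k into an integer. B_k is
  nonzero because zeta(k) is.\<close>

theorem Eis_int_modular_form:
  assumes k: "even k" "k \<ge> 4"
  shows "\<exists>D F. D \<noteq> 0 \<and> F \<in> int_modular_forms k \<and> (\<forall>n. (of_int (fps_nth F n) :: rat) = of_int D * fps_nth (Eis k) n)"
    and "(bernoulli_num k :: rat) \<noteq> 0"
proof -
  define B :: rat where "B = bernoulli_num k"
  define c where "c = 2 * of_real pi * \<i>"
  have c0: "c \<noteq> 0" by (simp add: c_def)
  have BC: "(bernoulli_num k :: complex) = of_rat B" unfolding B_def by (rule bernoulli_num_of_rat)
  have zb: "2 * zeta_sum k = - (c ^ k * of_rat B / fact k)" using zeta_bernoulli[OF k] unfolding BC c_def .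
  have zeta0: "zeta_sum k \<noteq> 0" by (rule zeta_sum_nonzero[OF k(2)])
  hence B0: "B \<noteq> 0" using zb by auto
  thus "(bernoulli_num k :: rat) \<noteq> 0" by (simp add: B_def)
  obtain a b where ab: "quotient_of B = (a, b)" by (cases "quotient_of B")
  have Bab: "B = of_int a / of_int b" "b > 0" using quotient_of_div[OF ab] quotient_of_denom_pos[OF ab] by auto
  have a0: "a \<noteq> 0" using B0 Bab by auto
  define F where "F = Abs_fps (\<lambda>n. if n = 0 then a else - 2 * int k * b * int (divisor_sigma (k - 1) n))"
  define f where "f = (\<lambda>z. of_int a / (2 * zeta_sum k) * G_eis k z)"
  have K: "of_int a / (2 * zeta_sum k) * (2 * (c ^ k / fact (k - 1))) = of_int (- 2 * int k * b)"
  proof -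
    have fk: "(fact k :: complex) = of_nat k * fact (k - 1)" using k by (simp add: fact_reduce)
    have Bc: "(of_rat B :: complex) = of_int a / of_int b" unfolding Bab(1) by (simp add: of_rat_divide)
    show ?thesis unfolding zb Bc fk using c0 a0 Bab k by (simp add: field_simps)
  qed
  have "q_expands (\<lambda>n. of_int (fps_nth F n)) f"
    unfolding q_expands_def
  proof (intro allI impI)
    fix z :: complex assume "Im z > 0"
    from sums_mult[OF G_eis_expansion[OF this k, folded c_def], of "of_int a / (2 * zeta_sum k)"]
    show "(\<lambda>n. of_int (fps_nth F n) * nome z ^ n) sums f z" unfolding f_def
    proof (rule sums_cong[THEN iffD1, rotated])
      fix n
      show "of_int a / (2 * zeta_sum k) * ((if n = 0 then 2 * zeta_sum k else
           2 * (c ^ k / fact (k - 1)) * of_nat (divisor_sigma (k - 1) n)) * nome z ^ n) = of_int (fps_nth F n) * nome z ^ n"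
      proof (cases "n = 0")
        case False
        have "of_int a / (2 * zeta_sum k) * (2 * (c ^ k / fact (k - 1)) * of_nat (divisor_sigma (k - 1) n) * nome z ^ n) =
          (of_int a / (2 * zeta_sum k) * (2 * (c ^ k / fact (k - 1)))) * of_nat (divisor_sigma (k - 1) n) * nome z ^ n"
          by (simp only: mult.assoc)
        thus ?thesis unfolding K using False by (simp add: F_def)
      qed (use zeta0 in \<open>simp add: F_def\<close>)
    qed
  qed
  moreover have "f (-1 / z) = z ^ k * f z" if "Im z > 0" for z
    unfolding f_def G_eis_S[OF that] by (simp only: ac_simps)
  ultimately have "F \<in> int_modular_forms k" unfolding int_modular_forms_iff by blast
  moreover have "(of_int (fps_nth F n) :: rat) = of_int a * fps_nth (Eis k) n" for n
  proof (cases "n = 0")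
    case False
    have "2 * of_nat k / (bernoulli_num k :: rat) = 2 * of_nat k * of_int b / of_int a"
      unfolding B_def[symmetric] Bab(1) by simp
    thus ?thesis using False a0 unfolding F_def Eis_def divisor_sigma_def by simp
  qed (simp add: F_def Eis_def)
  ultimately show "\<exists>D F. D \<noteq> 0 \<and> F \<in> int_modular_forms k \<and> (\<forall>n. (of_int (fps_nth F n) :: rat) = of_int D * fps_nth (Eis k) n)"
    using a0 by blast
qed

section \<open>The \<open>p\<close>-adic integers and evaluation of power series\<close>

locale padic_field =
  fixes p :: nat and ty :: "'c :: {field_char_0, complete_space} itself"
  assumes prime_p: "prime p" and p_ge_5: "p \<ge> 5" and padic: "padic_complex p TYPE('c)"
begin

definition nm :: "'c \<Rightarrow> real" where "nm x = dist x 0"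

lemma dist_nm: "dist x y = nm (x - y)"
proof -
  have "dist (x + (-y)) (y + (-y)) = dist x y" using padic unfolding padic_complex_def by blast
  thus ?thesis by (simp add: nm_def)
qed

lemma nm_ge_0 [simp]: "nm x \<ge> 0" by (simp add: nm_def)
lemma nm_0 [simp]: "nm 0 = 0" by (simp add: nm_def)
lemma nm_eq_0 [simp]: "nm x = 0 \<longleftrightarrow> x = 0" by (simp add: nm_def)
lemma nm_pos [simp]: "nm x > 0 \<longleftrightarrow> x \<noteq> 0" by (simp add: nm_def)
lemma nm_mult: "nm (x * y) = nm x * nm y" using padic unfolding padic_complex_def nm_def by blast
lemma nm_p: "nm (of_nat p) = 1 / real p" using padic unfolding padic_complex_def nm_def by blast
lemma nm_minus_commute: "nm (x - y) = nm (y - x)" using dist_nm dist_commute by metis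
lemma nm_minus [simp]: "nm (- x) = nm x" using nm_minus_commute[of 0 x] by simp
lemma nm_add: "nm (x + y) \<le> max (nm x) (nm y)"
proof -
  have "dist x (-y) \<le> max (dist x 0) (dist 0 (-y))" using padic unfolding padic_complex_def by blast
  thus ?thesis by (simp add: dist_nm)
qed
lemma nm_diff: "nm (x - y) \<le> max (nm x) (nm y)" using nm_add[of x "-y"] by simp
lemma nm_add_le: "nm x \<le> e \<Longrightarrow> nm y \<le> e \<Longrightarrow> nm (x + y) \<le> e" using nm_add[of x y] by linarith
lemma nm_diff_le: "nm x \<le> e \<Longrightarrow> nm y \<le> e \<Longrightarrow> nm (x - y) \<le> e" using nm_diff[of x y] by linarith
lemma nm_trans: "nm (x - y) \<le> e \<Longrightarrow> nm (y - z) \<le> e \<Longrightarrow> nm (x - z) \<le> e"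
  using nm_add_le[of "x - y" e "y - z"] by simp
lemma nm_1 [simp]: "nm 1 = 1" using nm_mult[of 1 1] by simp
lemma nm_power: "nm (x ^ n) = nm x ^ n" by (induction n) (auto simp: nm_mult)
lemma nm_inverse: "nm (inverse x) = inverse (nm x)"
proof (cases "x = 0")
  case False
  hence "nm x * nm (inverse x) = 1" using nm_mult[of x "inverse x"] by simp
  thus ?thesis using False by (simp add: field_simps)
qed auto
lemma nm_divide: "nm (x / y) = nm x / nm y" by (simp add: divide_inverse nm_mult nm_inverse)
lemma nm_sum_le: "0 \<le> e \<Longrightarrow> (\<And>i. i \<in> A \<Longrightarrow> nm (f i) \<le> e) \<Longrightarrow> nm (sum f A) \<le> e"
  by (induction A rule: infinite_finite_induct) (auto intro: nm_add_le)
lemma nm_of_nat: "nm (of_nat n) \<le> 1" by (induction n) (auto intro: nm_add_le)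
lemma nm_of_int: "nm (of_int n) \<le> 1"
  using nm_of_nat[of "nat n"] nm_of_nat[of "nat (-n)"] by (cases "n \<ge> 0") auto
lemma nm_mult_le: "nm x \<le> a \<Longrightarrow> nm y \<le> b \<Longrightarrow> nm (x * y) \<le> a * b"
  unfolding nm_mult by (intro mult_mono) (auto intro: order.trans[OF nm_ge_0])
lemma nm_mult_le1: "nm x \<le> a \<Longrightarrow> nm y \<le> 1 \<Longrightarrow> nm (x * y) \<le> a" using nm_mult_le[of x a y 1] by simp
lemma nm_mult_le1': "nm x \<le> a \<Longrightarrow> nm y \<le> 1 \<Longrightarrow> nm (y * x) \<le> a"
  using nm_mult_le1[of x a y] by (simp add: mult.commute)

lemma p_gt_1: "p > 1" using prime_p prime_gt_1_nat by blast
lemma p_pos: "real p > 0" using p_gt_1 by simp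

definition pe :: "nat \<Rightarrow> real" where "pe n = (1 / real p) ^ n"

lemma pe_pos [simp]: "pe n > 0" using p_pos by (simp add: pe_def)
lemma pe_nonneg [simp]: "pe n \<ge> 0" using pe_pos[of n] by linarith
lemma pe_0 [simp]: "pe 0 = 1" by (simp add: pe_def)
lemma pe_add: "pe (m + n) = pe m * pe n" by (simp add: pe_def power_add)
lemma pe_mono: "m \<le> n \<Longrightarrow> pe n \<le> pe m" unfolding pe_def using p_gt_1 by (intro power_decreasing) auto
lemma pe_le_1: "pe n \<le> 1" using pe_mono[of 0 n] by simp
lemma nm_p_power: "nm (of_nat p ^ n) = pe n" by (simp add: nm_power nm_p pe_def)
lemma pe_small: "e > 0 \<Longrightarrow> \<exists>n. pe n < e"
  unfolding pe_def by (rule real_arch_pow_inv) (use p_gt_1 in auto)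
lemma pp0 [simp]: "(of_nat p :: 'c) \<noteq> 0" using p_gt_1 by simp

lemma nm_zeroI: "(\<And>n. nm x \<le> pe n) \<Longrightarrow> x = 0"
  using pe_small[of "nm x"] by (metis leD nm_pos)

lemma power_small: "0 \<le> x \<Longrightarrow> x < 1 \<Longrightarrow> e > 0 \<Longrightarrow> \<exists>n. x ^ n < e" for x e :: real
  using real_arch_pow_inv by blast

lemma nm_coprime:
  assumes "\<not> int p dvd a"
  shows "nm (of_int a) = 1"
proof -
  have "coprime (int p) a" using assms prime_p by (simp add: prime_imp_coprime)
  then obtain u v where uv: "u * int p + v * a = 1" using bezout_int[of "int p" a] by (auto simp: coprime_iff_gcd_eq_1)
  have "of_int u * of_nat p + of_int v * of_int a = (of_int (u * int p + v * a) :: 'c)" by simp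
  hence e: "of_int u * of_nat p + of_int v * of_int a = (1 :: 'c)" unfolding uv by simp
  have "nm (of_int u * of_nat p) \<le> 1 / real p" using nm_mult_le1'[of "of_nat p" "1 / real p" "of_int u"] nm_p nm_of_int by simp
  moreover have "1 / real p < 1" using p_gt_1 by simp
  moreover have "1 \<le> max (nm (of_int u * of_nat p)) (nm (of_int v * of_int a))"
    using nm_add[of "of_int u * of_nat p" "of_int v * of_int a"] unfolding e by simp
  ultimately have "1 \<le> nm (of_int v * of_int a)" by linarith
  moreover have "nm (of_int v * of_int a) \<le> nm (of_int a)" using nm_mult_le1'[of "of_int a" _ "of_int v"] nm_of_int by simp
  ultimately show ?thesis using nm_of_int[of a] by linarith
qed

lemma nm_coprime_nat: "\<not> p dvd n \<Longrightarrow> nm (of_nat n) = 1"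
  using nm_coprime[of "int n"] by simp

lemma nm_int_le_iff: "nm (of_int a) \<le> pe n \<longleftrightarrow> int p ^ n dvd a"
proof
  assume "int p ^ n dvd a"
  then obtain b where b: "a = int p ^ n * b" by blast
  have "nm (of_nat p ^ n * of_int b) \<le> pe n" using nm_mult_le1[of "of_nat p ^ n" "pe n" "of_int b"] nm_p_power nm_of_int by simp
  thus "nm (of_int a) \<le> pe n" unfolding b by simp
next
  show "nm (of_int a) \<le> pe n \<Longrightarrow> int p ^ n dvd a"
  proof (induction n arbitrary: a)
    case (Suc n)
    have "nm (of_int a) < 1" 
    proof -
      have "pe (Suc n) \<le> pe 1" by (rule pe_mono) simp
      moreover have "pe 1 < 1" using p_gt_1 by (simp add: pe_def)
      ultimately show ?thesis using Suc.prems by linarith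
    qed
    hence "int p dvd a" using nm_coprime[of a] by force
    then obtain b where b: "a = int p * b" by blast
    have "nm (of_nat p * of_int b) \<le> pe (Suc n)" using Suc.prems unfolding b by simp
    hence "(1 / real p) * nm (of_int b) \<le> (1 / real p) * pe n" unfolding nm_mult nm_p by (simp add: pe_def)
    hence "nm (of_int b) \<le> pe n" using p_pos by (simp add: divide_le_cancel)
    thus ?case using Suc.IH b by simp
  qed auto
qed

lemma LIMSEQ_nm_iff: "X \<longlonglongrightarrow> L \<longleftrightarrow> (\<forall>e>0. \<exists>N. \<forall>n\<ge>N. nm (X n - L) < e)"
  unfolding lim_sequentially dist_nm ..

lemma LIMSEQ_bound:
  assumes "\<And>n. nm (X n - L) \<le> b n" "b \<longlonglongrightarrow> 0"
  shows "X \<longlonglongrightarrow> L"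
  unfolding LIMSEQ_nm_iff
proof (intro allI impI)
  fix e :: real assume "e > 0"
  then obtain N where "\<And>n. n \<ge> N \<Longrightarrow> \<bar>b n\<bar> < e" using assms(2) unfolding lim_sequentially dist_real_def by auto
  thus "\<exists>N. \<forall>n\<ge>N. nm (X n - L) < e" using assms(1) by (metis abs_ge_self le_less_trans)
qed

lemma pe_tendsto_0: "pe \<longlonglongrightarrow> 0"
  unfolding pe_def using p_gt_1 by (intro LIMSEQ_realpow_zero) auto

lemma LIMSEQ_nm_le:
  assumes "X \<longlonglongrightarrow> L" "\<And>n. n \<ge> N \<Longrightarrow> nm (X n - y) \<le> e"
  shows "nm (L - y) \<le> e"
proof -
  have "e \<ge> 0" using assms(2)[of N] nm_ge_0 order.trans by blast
  show ?thesis
  proof (rule ccontr)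
    assume "\<not> nm (L - y) \<le> e"
    hence l: "nm (L - y) > e" by simp
    then obtain n0 where "\<And>n. n \<ge> n0 \<Longrightarrow> nm (X n - L) < nm (L - y)"
      using assms(1) \<open>e \<ge> 0\<close> unfolding LIMSEQ_nm_iff by (meson le_less_trans)
    hence 1: "nm (X (max N n0) - L) < nm (L - y)" by simp
    have "nm (L - y) \<le> max (nm (L - X (max N n0))) (nm (X (max N n0) - y))"
      using nm_add[of "L - X (max N n0)" "X (max N n0) - y"] by simp
    thus False using 1 l assms(2)[of "max N n0"] by (simp add: nm_minus_commute[of L] max_def split: if_splits)
  qed
qed

lemma nm_seq_tail:
  assumes "\<And>n. nm (X (Suc n) - X n) \<le> e n" "\<And>m n. m \<le> n \<Longrightarrow> e n \<le> e m"
  shows "n \<le> m \<Longrightarrow> nm (X m - X n) \<le> e n"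
proof (induction m)
  case 0
  have "e 0 \<ge> 0" using assms(1)[of 0] nm_ge_0 order.trans by blast
  thus ?case using 0 by simp
next
  case (Suc m)
  show ?case
  proof (cases "n = Suc m")
    case True
    have "e (Suc m) \<ge> 0" using assms(1)[of "Suc m"] nm_ge_0 order.trans by blast
    thus ?thesis using True by simp
  next
    case False
    hence "nm (X m - X n) \<le> e n" using Suc by simp
    moreover have "nm (X (Suc m) - X m) \<le> e n" using assms(1)[of m] assms(2)[of n m] False Suc.prems by simp
    ultimately show ?thesis using nm_trans by blast
  qed
qed

text \<open>By the strong triangle inequality, bounds on consecutive differences that decrease to 0
  suffice for convergence, and they bound the distance to the limit as well.\<close>

lemma seq_conv:
  fixes X :: "nat \<Rightarrow> 'c"
  assumes "\<And>n. nm (X (Suc n) - X n) \<le> e n" "\<And>m n. m \<le> n \<Longrightarrow> e n \<le> e m" "e \<longlonglongrightarrow> 0"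
  shows "\<exists>L. \<forall>n. nm (L - X n) \<le> e n"
proof -
  have "Cauchy X" unfolding Cauchy_def
  proof (intro allI impI)
    fix r :: real assume "r > 0"
    then obtain N where "\<bar>e N\<bar> < r" using assms(3) unfolding lim_sequentially dist_real_def by auto
    hence eN: "e N < r" by simp
    have "dist (X m) (X n) < r" if "m \<ge> N" "n \<ge> N" for m n
    proof -
      have "nm (X m - X N) \<le> e N" "nm (X n - X N) \<le> e N" using nm_seq_tail[of X e, OF assms(1,2)] that by auto
      hence "nm (X m - X n) \<le> e N" using nm_trans[of "X m" "X N" "e N" "X n"] by (simp add: nm_minus_commute[of "X N"])
      thus ?thesis using eN by (simp add: dist_nm)
    qed
    thus "\<exists>M. \<forall>m\<ge>M. \<forall>n\<ge>M. dist (X m) (X n) < r" by blast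
  qed
  then obtain L where L: "X \<longlonglongrightarrow> L" using Cauchy_convergent convergent_def by blast
  have "nm (L - X n) \<le> e n" for n
    by (rule LIMSEQ_nm_le[OF L, of n]) (rule nm_seq_tail[of X e, OF assms(1,2)])
  thus ?thesis by blast
qed

abbreviation Zc :: "'c set" where "Zc \<equiv> Zp"

lemma Zp_iff: "x \<in> Zc \<longleftrightarrow> (\<forall>n. \<exists>a :: int. nm (x - of_int a) \<le> pe n)"
proof
  assume x: "x \<in> Zc"
  show "\<forall>n. \<exists>a :: int. nm (x - of_int a) \<le> pe n"
  proof
    fix n
    from x have "\<exists>y\<in>\<int>. dist y x < pe n" unfolding Zp_def closure_approachable by simp
    then obtain a :: int where "dist (of_int a) x < pe n" by (auto elim!: Ints_cases)
    thus "\<exists>a :: int. nm (x - of_int a) \<le> pe n" by (intro exI[of _ a]) (simp add: dist_nm nm_minus_commute)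
  qed
next
  assume *: "\<forall>n. \<exists>a :: int. nm (x - of_int a) \<le> pe n"
  show "x \<in> Zc" unfolding Zp_def closure_approachable
  proof (intro allI impI)
    fix e :: real assume "e > 0"
    then obtain n where "pe n < e" using pe_small by blast
    moreover obtain a :: int where "nm (x - of_int a) \<le> pe n" using * by blast
    ultimately show "\<exists>y\<in>\<int>. dist y x < e" by (intro bexI[of _ "of_int a"]) (auto simp: dist_nm nm_minus_commute)
  qed
qed

lemma Zp_approx: "x \<in> Zc \<Longrightarrow> \<exists>a :: int. nm (x - of_int a) \<le> pe n" using Zp_iff by blast
lemma Zp_of_int [simp]: "of_int a \<in> Zc" unfolding Zp_iff by (auto intro!: exI[of _ a])
lemma Zp_of_nat [simp]: "of_nat a \<in> Zc" using Zp_of_int[of "int a"] by simp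
lemma Zp_0 [simp]: "0 \<in> Zc" and Zp_1 [simp]: "1 \<in> Zc" using Zp_of_int[of 0] Zp_of_int[of 1] by auto
lemma Zp_nm: "x \<in> Zc \<Longrightarrow> nm x \<le> 1"
proof -
  assume "x \<in> Zc"
  then obtain a :: int where "nm (x - of_int a) \<le> pe 0" using Zp_approx by blast
  thus ?thesis using nm_add_le[of "x - of_int a" 1 "of_int a"] nm_of_int by simp
qed
lemma Zp_diff: "x \<in> Zc \<Longrightarrow> y \<in> Zc \<Longrightarrow> x - y \<in> Zc"
  unfolding Zp_iff
proof
  fix n assume *: "\<forall>n. \<exists>a :: int. nm (x - of_int a) \<le> pe n" "\<forall>n. \<exists>a :: int. nm (y - of_int a) \<le> pe n"
  obtain a b :: int where "nm (x - of_int a) \<le> pe n" "nm (y - of_int b) \<le> pe n" using * by meson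
  thus "\<exists>a :: int. nm (x - y - of_int a) \<le> pe n"
    using nm_diff_le[of "x - of_int a" "pe n" "y - of_int b"] by (intro exI[of _ "a - b"]) (simp add: algebra_simps)
qed
lemma Zp_uminus: "x \<in> Zc \<Longrightarrow> - x \<in> Zc" using Zp_diff[of 0 x] by simp
lemma Zp_add: "x \<in> Zc \<Longrightarrow> y \<in> Zc \<Longrightarrow> x + y \<in> Zc" using Zp_diff[of x "-y"] Zp_uminus[of y] by simp
lemma Zp_mult: "x \<in> Zc \<Longrightarrow> y \<in> Zc \<Longrightarrow> x * y \<in> Zc"
  unfolding Zp_iff[of "x * y"]
proof
  fix n assume *: "x \<in> Zc" "y \<in> Zc"
  obtain a b :: int where ab: "nm (x - of_int a) \<le> pe n" "nm (y - of_int b) \<le> pe n" using * Zp_approx by meson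
  have "nm ((x - of_int a) * y + of_int a * (y - of_int b)) \<le> pe n"
    by (intro nm_add_le nm_mult_le1 nm_mult_le1' ab Zp_nm * nm_of_int)
  thus "\<exists>a :: int. nm (x * y - of_int a) \<le> pe n"
    by (intro exI[of _ "a * b"]) (simp add: algebra_simps)
qed
lemma Zp_power: "x \<in> Zc \<Longrightarrow> x ^ n \<in> Zc" by (induction n) (auto intro: Zp_mult)
lemma Zp_sum: "(\<And>i. i \<in> A \<Longrightarrow> f i \<in> Zc) \<Longrightarrow> sum f A \<in> Zc"
  by (rule sum_closed) (auto intro: Zp_add)
lemma Zp_closed: "(\<And>n. \<exists>y\<in>Zc. nm (x - y) \<le> pe n) \<Longrightarrow> x \<in> Zc"
  unfolding Zp_iff[of x]
proof
  fix n assume "\<And>n. \<exists>y\<in>Zc. nm (x - y) \<le> pe n"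
  then obtain y where "y \<in> Zc" "nm (x - y) \<le> pe n" by blast
  moreover obtain a :: int where "nm (y - of_int a) \<le> pe n" using Zp_approx calculation by blast
  ultimately show "\<exists>a :: int. nm (x - of_int a) \<le> pe n" using nm_trans by blast
qed
lemma Zp_divide_p:
  assumes "x \<in> Zc" "nm x \<le> pe n"
  shows "\<exists>z\<in>Zc. x = of_nat p ^ n * z"
proof -
  have "x / of_nat p ^ n \<in> Zc" unfolding Zp_iff
  proof
    fix m
    obtain a :: int where a: "nm (x - of_int a) \<le> pe (m + n)" using Zp_approx assms(1) by blast
    have "nm (of_int a) \<le> pe n"
      using nm_diff_le[OF assms(2) order.trans[OF a pe_mono]] by simp
    then obtain b where b: "a = int p ^ n * b" unfolding nm_int_le_iff by blast
    have "x / of_nat p ^ n - of_int b = (x - of_int a) / of_nat p ^ n" unfolding b using p_gt_1 by (simp add: diff_divide_distrib)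
    hence "nm (x / of_nat p ^ n - of_int b) = nm (x - of_int a) / pe n" by (simp add: nm_divide nm_p_power)
    also have "\<dots> \<le> pe m" using a by (simp add: divide_le_eq pe_add)
    finally show "\<exists>b :: int. nm (x / of_nat p ^ n - of_int b) \<le> pe m" by blast
  qed
  thus ?thesis using p_gt_1 by (intro bexI[of _ "x / of_nat p ^ n"]) auto
qed
lemma Zp_inverse:
  assumes "x \<in> Zc" "nm x = 1"
  shows "inverse x \<in> Zc"
  unfolding Zp_iff
proof
  fix n
  obtain a :: int where a: "nm (x - of_int a) \<le> pe (n + 1)" using Zp_approx assms(1) by blast
  have "\<not> int p dvd a"
  proof
    assume "int p dvd a"
    hence "nm (of_int a) \<le> pe 1" by (subst nm_int_le_iff) simp
    hence "nm x \<le> pe 1" using nm_add_le[OF order.trans[OF a pe_mono[of 1 "n + 1"]], of "of_int a"] by simp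
    moreover have "pe 1 < 1" using p_gt_1 by (simp add: pe_def)
    ultimately show False using assms(2) by simp
  qed
  hence "coprime a (int p ^ n)" using prime_p prime_imp_coprime[of "int p" a] by (simp add: coprime_commute)
  then obtain b where "[a * b = 1] (mod int p ^ n)" using cong_solve_coprime_int by blast
  hence "int p ^ n dvd 1 - a * b" by (simp add: cong_iff_dvd_diff dvd_diff_commute)
  hence ab: "nm (of_int (1 - a * b)) \<le> pe n" by (simp only: nm_int_le_iff)
  have x0: "x \<noteq> 0" using assms by auto
  have "nm (of_int b * (x - of_int a)) \<le> pe n"
    by (intro nm_mult_le1' nm_of_int order.trans[OF a] pe_mono) simp
  hence "nm (of_int (1 - a * b) - of_int b * (x - of_int a)) \<le> pe n" using ab by (intro nm_diff_le)
  moreover have "inverse x - of_int b = inverse x * (of_int (1 - a * b) - of_int b * (x - of_int a))"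
    using x0 by (simp add: field_simps)
  ultimately have "nm (inverse x - of_int b) \<le> pe n" by (simp add: nm_mult nm_inverse assms)
  thus "\<exists>b :: int. nm (inverse x - of_int b) \<le> pe n" by blast
qed

lemma Zp_units_iff: "x \<in> Zp_units \<longleftrightarrow> x \<in> Zc \<and> nm x = 1"
proof
  assume "x \<in> Zp_units"
  then obtain y where "x \<in> Zc" "y \<in> Zc" "x * y = 1" by (auto simp: Zp_units_def)
  moreover from this have "nm x * nm y = 1" by (metis nm_1 nm_mult)
  moreover have "nm x \<le> 1" "nm y \<le> 1" using calculation Zp_nm by auto
  moreover have "nm x * nm y \<le> nm x * 1" using calculation by (intro mult_left_mono) auto
  ultimately show "x \<in> Zc \<and> nm x = 1" by simp
next
  assume x: "x \<in> Zc \<and> nm x = 1"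
  hence "x \<noteq> 0" by auto
  hence "x * inverse x = 1" by (rule right_inverse)
  thus "x \<in> Zp_units" using x Zp_inverse unfolding Zp_units_def by blast
qed

lemma Zp_divide: "x \<in> Zc \<Longrightarrow> y \<in> Zc \<Longrightarrow> nm y = 1 \<Longrightarrow> x / y \<in> Zc"
  unfolding divide_inverse by (intro Zp_mult Zp_inverse)

lemma Zp_half: "1 / 2 \<in> Zc"
proof -
  have "\<not> p dvd 2" using p_ge_5 by (auto dest: dvd_imp_le)
  hence "nm (of_nat 2) = 1" by (rule nm_coprime_nat)
  thus ?thesis using Zp_divide[of 1 "of_nat 2"] Zp_of_nat[of 2] by simp
qed

text \<open>The value of f at w, together with the error bound |w|^J for partial sums that integral
  coefficients provide. The case J = 0 says |x| \<le> 1; for |w| < 1 the value is unique, and values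
  of products reduce to estimates of finite sums.\<close>

definition evals :: "'c \<Rightarrow> 'c fps \<Rightarrow> 'c \<Rightarrow> bool" where
  "evals w f x \<longleftrightarrow> (\<forall>J. nm (x - (\<Sum>j<J. fps_nth f j * w ^ j)) \<le> nm w ^ J)"

definition Zq :: "'c fps set" where "Zq = {f. \<forall>n. fps_nth f n \<in> Zp}"

lemma Zq_D: "f \<in> Zq \<Longrightarrow> fps_nth f n \<in> Zc" by (simp add: Zq_def)
lemma Zq_nm: "f \<in> Zq \<Longrightarrow> nm (fps_nth f n) \<le> 1" using Zp_nm by (simp add: Zq_def)
lemma Zq_diff: "f \<in> Zq \<Longrightarrow> g \<in> Zq \<Longrightarrow> f - g \<in> Zq" by (simp add: Zq_def Zp_diff)
lemma Zq_one: "1 \<in> Zq" by (simp add: Zq_def)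
lemma Zq_zero: "0 \<in> Zq" by (simp add: Zq_def)
lemma Zq_add: "f \<in> Zq \<Longrightarrow> g \<in> Zq \<Longrightarrow> f + g \<in> Zq" by (simp add: Zq_def Zp_add)
lemma Zq_mult: "f \<in> Zq \<Longrightarrow> g \<in> Zq \<Longrightarrow> f * g \<in> Zq"
  by (auto simp: Zq_def fps_mult_nth intro!: Zp_sum Zp_mult)
lemma Zq_const: "x \<in> Zc \<Longrightarrow> fps_const x \<in> Zq" by (simp add: Zq_def fps_const_def)
lemma Zq_X: "fps_X \<in> Zq" by (simp add: Zq_def fps_X_def)
lemma Zq_sum: "(\<And>i. i \<in> A \<Longrightarrow> f i \<in> Zq) \<Longrightarrow> sum f A \<in> Zq"
  by (rule sum_closed) (auto intro: Zq_zero Zq_add)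
lemma Zq_power: "f \<in> Zq \<Longrightarrow> f ^ n \<in> Zq" by (induction n) (auto intro: Zq_one Zq_mult)

lemma Zq_inverse:
  assumes "f \<in> Zq" "nm (fps_nth f 0) = 1"
  shows "inverse f \<in> Zq"
proof -
  have f0: "inverse (fps_nth f 0) \<in> Zc" using assms Zp_inverse Zq_D by blast
  have "fps_nth (inverse f) n \<in> Zc" for n
  proof (induction n rule: less_induct)
    case (less n)
    show ?case
    proof (cases n)
      case 0
      thus ?thesis using f0 by simp
    next
      case (Suc m)
      have "(\<Sum>i=1..Suc m. fps_nth f i * fps_nth (inverse f) (Suc m - i)) \<in> Zc"
        by (intro Zp_sum Zp_mult Zq_D assms less) (use Suc in auto)
      moreover have "fps_nth (inverse f) (Suc m) =
         - (inverse (fps_nth f 0) * (\<Sum>i=1..Suc m. fps_nth f i * fps_nth (inverse f) (Suc m - i)))"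
      proof -
        have f0': "fps_nth f 0 \<noteq> 0" using assms(2) by auto
        hence "f * inverse f = 1" by (simp add: inverse_mult_eq_1')
        hence "(\<Sum>i=0..Suc m. fps_nth f i * fps_nth (inverse f) (Suc m - i)) = 0"
          unfolding fps_mult_nth[symmetric] by simp
        moreover have "(\<Sum>i=0..Suc m. fps_nth f i * fps_nth (inverse f) (Suc m - i)) =
           fps_nth f 0 * fps_nth (inverse f) (Suc m - 0) + (\<Sum>i=Suc 0..Suc m. fps_nth f i * fps_nth (inverse f) (Suc m - i))"
          by (rule sum.atLeast_Suc_atMost) simp
        ultimately have "fps_nth f 0 * fps_nth (inverse f) (Suc m) = - (\<Sum>i=1..Suc m. fps_nth f i * fps_nth (inverse f) (Suc m - i))"
          by (simp only: eq_neg_iff_add_eq_0 One_nat_def diff_zero)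
        thus ?thesis using f0' by (simp add: field_simps)
      qed
      ultimately show ?thesis unfolding Suc by (auto intro!: Zp_mult Zp_uminus f0)
    qed
  qed
  thus ?thesis by (simp add: Zq_def)
qed

lemma evals_unique:
  assumes "nm w < 1" "evals w f x" "evals w f y"
  shows "x = y"
proof (rule ccontr)
  assume "x \<noteq> y"
  hence "nm (x - y) > 0" by simp
  then obtain J where "nm w ^ J < nm (x - y)" using power_small[OF nm_ge_0 assms(1)] by blast
  moreover have "nm (x - y) \<le> nm w ^ J"
  proof -
    have "nm (x - (\<Sum>j<J. fps_nth f j * w ^ j)) \<le> nm w ^ J" "nm (y - (\<Sum>j<J. fps_nth f j * w ^ j)) \<le> nm w ^ J"
      using assms(2,3) unfolding evals_def by blast+
    from nm_diff_le[OF this] show ?thesis by simp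
  qed
  ultimately show False by simp
qed

lemma nm_pow_le: "nm w < 1 \<Longrightarrow> m \<le> n \<Longrightarrow> nm w ^ n \<le> nm w ^ m"
  by (intro power_decreasing) auto

lemma evals_ex:
  assumes "nm w < 1" "f \<in> Zq"
  shows "\<exists>x. evals w f x"
proof -
  have "\<exists>L. \<forall>J. nm (L - (\<Sum>j<J. fps_nth f j * w ^ j)) \<le> nm w ^ J"
  proof (rule seq_conv)
    show "nm ((\<Sum>j<Suc n. fps_nth f j * w ^ j) - (\<Sum>j<n. fps_nth f j * w ^ j)) \<le> nm w ^ n" for n
      using nm_mult_le1'[of "w ^ n" "nm w ^ n" "fps_nth f n"] Zq_nm[OF assms(2)] by (simp add: nm_power)
    show "nm w ^ n \<le> nm w ^ m" if "m \<le> n" for m n using nm_pow_le assms that by blast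
    show "(\<lambda>n. nm w ^ n) \<longlonglongrightarrow> 0" using assms by (intro LIMSEQ_realpow_zero) auto
  qed
  thus ?thesis by (simp add: evals_def)
qed

lemma evals_sums:
  assumes "nm w < 1" "evals w f x"
  shows "(\<lambda>j. fps_nth f j * w ^ j) sums x"
  unfolding sums_def
proof (rule LIMSEQ_bound)
  show "nm ((\<Sum>j<J. fps_nth f j * w ^ j) - x) \<le> nm w ^ J" for J
    using assms(2) by (simp add: evals_def nm_minus_commute[of _ x])
  show "(\<lambda>n. nm w ^ n) \<longlonglongrightarrow> 0" using assms by (intro LIMSEQ_realpow_zero) auto
qed

lemma evals_nm: "evals w f x \<Longrightarrow> nm x \<le> 1"
  unfolding evals_def by (drule spec[of _ 0]) simp

lemma evals_diff: "evals w f x \<Longrightarrow> evals w g y \<Longrightarrow> evals w (f - g) (x - y)"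
  unfolding evals_def
proof
  fix J assume *: "\<forall>J. nm (x - (\<Sum>j<J. fps_nth f j * w ^ j)) \<le> nm w ^ J" "\<forall>J. nm (y - (\<Sum>j<J. fps_nth g j * w ^ j)) \<le> nm w ^ J"
  from nm_diff_le[OF *(1)[rule_format] *(2)[rule_format], of J]
  show "nm (x - y - (\<Sum>j<J. fps_nth (f - g) j * w ^ j)) \<le> nm w ^ J"
    by (simp add: algebra_simps sum_subtractf)
qed

lemma evals_const: "nm c \<le> 1 \<Longrightarrow> evals w (fps_const c) c"
  unfolding evals_def
proof
  fix J assume c: "nm c \<le> 1"
  show "nm (c - (\<Sum>j<J. fps_nth (fps_const c) j * w ^ j)) \<le> nm w ^ J"
  proof (cases J)
    case (Suc K)
    have "(\<Sum>j<J. fps_nth (fps_const c) j * w ^ j) = (\<Sum>j\<in>{0}. fps_nth (fps_const c) j * w ^ j)"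
      using Suc by (intro sum.mono_neutral_right) auto
    thus ?thesis by simp
  qed (use c in simp)
qed

lemma evals_zero: "evals w 0 0" using evals_const[of 0] by simp
lemma evals_one: "evals w 1 1" using evals_const[of 1] by simp
lemma evals_add: "evals w f x \<Longrightarrow> evals w g y \<Longrightarrow> evals w (f + g) (x + y)"
  using evals_diff[of w f x "- g" "- y"] evals_diff[OF evals_zero, of w g y] by simp
lemma evals_sum: "(\<And>i. i \<in> A \<Longrightarrow> evals w (f i) (x i)) \<Longrightarrow> evals w (sum f A) (sum x A)"
  by (induction A rule: infinite_finite_induct) (auto intro: evals_zero evals_add)

lemma evals_X: "nm w < 1 \<Longrightarrow> evals w fps_X w"
  unfolding evals_def
proof
  fix J assume w: "nm w < 1"
  show "nm (w - (\<Sum>j<J. fps_nth fps_X j * w ^ j)) \<le> nm w ^ J"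
  proof (cases "J \<ge> 2")
    case True
    have "(\<Sum>j<J. fps_nth fps_X j * w ^ j) = (\<Sum>j\<in>{1}. fps_nth fps_X j * w ^ j)"
      using True by (intro sum.mono_neutral_right) (auto simp: fps_X_def)
    thus ?thesis by simp
  next
    case False
    hence "J = 0 \<or> J = 1" by auto
    thus ?thesis using w by auto
  qed
qed

text \<open>The product of two partial sums and the partial sum of the product differ by terms of
  total degree at least J, each of norm at most |w|^J.\<close>

lemma evals_mult:
  assumes w: "nm w < 1" and f: "f \<in> Zq" and g: "g \<in> Zq" and ev: "evals w f x" "evals w g y"
  shows "evals w (f * g) (x * y)"
  unfolding evals_def
proof
  fix J
  define F G where "F = (\<Sum>j<J. fps_nth f j * w ^ j)" and "G = (\<Sum>j<J. fps_nth g j * w ^ j)"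
  have le1: "nm w ^ j \<le> 1" for j using w by (intro power_le_one) auto
  have t: "nm (fps_nth f j * w ^ j) \<le> nm w ^ j" "nm (fps_nth g j * w ^ j) \<le> nm w ^ j" for j
    by (intro nm_mult_le1' Zq_nm f g, simp add: nm_power)+
  have F1: "nm F \<le> 1" unfolding F_def by (rule nm_sum_le) (auto intro: order.trans[OF t(1) le1])
  have 1: "nm (x * y - F * G) \<le> nm w ^ J"
  proof -
    have "nm (x - F) \<le> nm w ^ J" "nm (y - G) \<le> nm w ^ J" using ev unfolding evals_def F_def G_def by blast+
    hence "nm ((x - F) * y + F * (y - G)) \<le> nm w ^ J"
      by (intro nm_add_le nm_mult_le1 nm_mult_le1' F1 evals_nm[OF ev(2)])
    thus ?thesis by (simp add: algebra_simps)
  qed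
  have 2: "nm (F * G - (\<Sum>j<J. fps_nth (f * g) j * w ^ j)) \<le> nm w ^ J"
  proof -
    define t where "t = (\<lambda>(i, l). fps_nth f i * w ^ i * (fps_nth g l * w ^ l))"
    define A B where "A = {..<J} \<times> {..<J}" and "B = {(i, l). i + l < J}"
    have fin: "finite A" by (simp add: A_def)
    have BA: "B \<subseteq> A" by (auto simp: A_def B_def)
    have FG: "F * G = sum t A" unfolding F_def G_def A_def t_def by (simp add: sum_product sum.cartesian_product)
    have "(\<Sum>j<J. fps_nth (f * g) j * w ^ j) = (\<Sum>j<J. \<Sum>i\<le>j. t (i, j - i))"
    proof (rule sum.cong)
      fix j
      have "fps_nth f i * fps_nth g (j - i) * w ^ j = t (i, j - i)" if "i \<le> j" for i
      proof -
        have "w ^ j = w ^ i * w ^ (j - i)" using that by (simp flip: power_add)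
        thus ?thesis unfolding t_def by simp
      qed
      thus "fps_nth (f * g) j * w ^ j = (\<Sum>i\<le>j. t (i, j - i))"
        unfolding fps_mult_nth sum_distrib_right atMost_atLeast0 by (intro sum.cong) auto
    qed auto
    also have "\<dots> = sum t B" unfolding B_def using sum.triangle_reindex[of "\<lambda>i l. t (i, l)" J] by (simp add: case_prod_unfold t_def)
    finally have "F * G - (\<Sum>j<J. fps_nth (f * g) j * w ^ j) = sum t (A - B)"
      unfolding FG by (simp add: sum_diff[OF fin BA])
    also have "nm \<dots> \<le> nm w ^ J"
    proof (rule nm_sum_le)
      fix il assume "il \<in> A - B"
      then obtain i l where il: "il = (i, l)" "i + l \<ge> J" by (auto simp: A_def B_def)
      have "nm (t il) \<le> nm w ^ i * nm w ^ l" unfolding il t_def prod.case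
        by (intro nm_mult_le) (use Zq_nm[OF f] Zq_nm[OF g] in \<open>auto intro!: nm_mult_le1' simp: nm_power\<close>)
      also have "\<dots> \<le> nm w ^ J" using nm_pow_le[OF w il(2)] by (simp add: power_add)
      finally show "nm (t il) \<le> nm w ^ J" .
    qed auto
    finally show ?thesis .
  qed
  show "nm (x * y - (\<Sum>j<J. fps_nth (f * g) j * w ^ j)) \<le> nm w ^ J" using nm_trans[OF 1 2] .
qed

lemma evals_power: "nm w < 1 \<Longrightarrow> f \<in> Zq \<Longrightarrow> evals w f x \<Longrightarrow> evals w (f ^ n) (x ^ n)"
  by (induction n) (auto intro!: evals_one evals_mult Zq_power)

end

section \<open>Characters as power series in \<open>w\<close>\<close>

lemma nat_power_one_plus_sq: "\<exists>s. (1 + y) ^ c = 1 + c * y + y\<^sup>2 * s" for y c :: nat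
  using nat_pow_one_plus[of y 1 c] by simp

text \<open>For v = v_p(b) the number (1+p)^b - 1 has valuation exactly v + 1. So the exponent of 1
  + p is determined modulo p^n by the power modulo p^(n+1).\<close>

lemma one_plus_p_order:
  fixes p n b :: nat
  assumes "prime p" "odd p" "p ^ (n + 1) dvd (1 + p) ^ b - 1"
  shows "p ^ n dvd b"
proof (cases "b = 0")
  case False
  have p1: "p > 1" using assms prime_gt_1_nat by blast
  define v where "v = multiplicity p b"
  obtain b' where b': "b = p ^ v * b'" and nd: "\<not> p dvd b'"
    using multiplicity_decompose'[of b p] assms(1) False p1 unfolding v_def
    by (metis not_prime_unit)
  show ?thesis
  proof (rule ccontr)
    assume "\<not> p ^ n dvd b"
    hence "v < n" using b' by (metis dvd_trans dvd_triv_left le_imp_power_dvd not_le)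
    obtain s where s: "(1 + p) ^ (p ^ v) = 1 + p ^ (v + 1) * (1 + p * s)"
      using one_plus_p_power[OF assms(2)] by blast
    define y where "y = p ^ (v + 1) * (1 + p * s)"
    obtain t where t: "(1 + y) ^ b' = 1 + b' * y + y\<^sup>2 * t" using nat_power_one_plus_sq by blast
    have "(1 + p) ^ b = (1 + y) ^ b'" unfolding b' power_mult s y_def ..
    hence "(1 + p) ^ b - 1 = y * (b' + y * t)" unfolding t by (simp add: power2_eq_square algebra_simps)
    also have "\<dots> = p ^ (v + 1) * ((1 + p * s) * (b' + y * t))" unfolding y_def by (simp only: mult.assoc)
    finally have "p ^ (n + 1) dvd p ^ (v + 1) * ((1 + p * s) * (b' + y * t))" using assms(3) by simp
    moreover have "p ^ (v + 1) * p dvd p ^ (n + 1)"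
      using \<open>v < n\<close> le_imp_power_dvd[of "v + 2" "n + 1" p] by (simp add: mult.commute)
    ultimately have "p ^ (v + 1) * p dvd p ^ (v + 1) * ((1 + p * s) * (b' + y * t))" using dvd_trans by blast
    hence "p dvd (1 + p * s) * (b' + y * t)" using p1 by simp
    hence "p dvd 1 + p * s \<or> p dvd b' + y * t" using assms(1) by (simp only: prime_dvd_mult_iff)
    moreover have "\<not> p dvd 1 + p * s" using p1 dvd_add_left_iff[of p "p * s" 1] by auto
    moreover have "p dvd y * t" by (simp add: y_def)
    hence "\<not> p dvd b' + y * t" using nd by (simp add: dvd_add_left_iff)
    ultimately show False by blast
  qed
qed auto

context padic_field
begin

lemma odd_p: "odd p" using prime_p p_ge_5 prime_odd_nat by auto

text \<open>The n-th power of the maximal ideal (p, X) of Z_p[[X]]; the truncated subtraction leaves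
  the coefficients with j \<ge> n unrestricted. In this topology (1 + X)^(p^n) tends to 1, which
  fails p-adically, and evaluation at any |w| < 1 is continuous (\<open>evals_mI\<close>).\<close>

definition mI :: "nat \<Rightarrow> 'c fps set" where
  "mI n = {f. \<forall>j. fps_nth f j \<in> Zp \<and> nm (fps_nth f j) \<le> pe (n - j)}"

lemma mI_Zq: "f \<in> mI n \<Longrightarrow> f \<in> Zq" by (simp add: mI_def Zq_def)
lemma mI_0: "mI 0 = Zq" by (auto simp: mI_def Zq_def Zp_nm)
lemma mI_zero: "0 \<in> mI n" by (simp add: mI_def)
lemma mI_diff: "f \<in> mI n \<Longrightarrow> g \<in> mI n \<Longrightarrow> f - g \<in> mI n"
  by (auto simp: mI_def intro: Zp_diff nm_diff_le)
lemma mI_add: "f \<in> mI n \<Longrightarrow> g \<in> mI n \<Longrightarrow> f + g \<in> mI n"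
  by (auto simp: mI_def intro: Zp_add nm_add_le)
lemma mI_sum: "(\<And>i. i \<in> A \<Longrightarrow> f i \<in> mI n) \<Longrightarrow> sum f A \<in> mI n"
  by (rule sum_closed) (auto intro: mI_zero mI_add)
lemma mI_mult: "f \<in> mI m \<Longrightarrow> g \<in> mI n \<Longrightarrow> f * g \<in> mI (m + n)"
proof -
  assume f: "f \<in> mI m" and g: "g \<in> mI n"
  have "nm (fps_nth (f * g) j) \<le> pe (m + n - j)" for j
    unfolding fps_mult_nth
  proof (rule nm_sum_le)
    fix i assume i: "i \<in> {0..j}"
    have "nm (fps_nth f i * fps_nth g (j - i)) \<le> pe (m - i) * pe (n - (j - i))"
      using f g by (intro nm_mult_le) (auto simp: mI_def)
    also have "\<dots> = pe ((m - i) + (n - (j - i)))" by (simp add: pe_add)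
    also have "\<dots> \<le> pe (m + n - j)" using i by (intro pe_mono) auto
    finally show "nm (fps_nth f i * fps_nth g (j - i)) \<le> pe (m + n - j)" .
  qed auto
  moreover have "f * g \<in> Zq" using f g mI_Zq Zq_mult by blast
  ultimately show ?thesis by (simp add: mI_def Zq_def)
qed
lemma mI_mult_left: "f \<in> mI n \<Longrightarrow> g \<in> Zq \<Longrightarrow> g * f \<in> mI n" using mI_mult[of g 0 f n] mI_0 by simp
lemma mI_mult_right: "f \<in> mI n \<Longrightarrow> g \<in> Zq \<Longrightarrow> f * g \<in> mI n" using mI_mult[of f n g 0] mI_0 by simp
lemma mI_mono: "f \<in> mI m \<Longrightarrow> n \<le> m \<Longrightarrow> f \<in> mI n"
  unfolding mI_def using pe_mono by (auto intro: order.trans diff_le_mono)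
lemma mI_X: "fps_X \<in> mI 1" by (auto simp: mI_def fps_X_def)
lemma mI_const: "c \<in> Zp \<Longrightarrow> nm c \<le> pe n \<Longrightarrow> fps_const c \<in> mI n" by (auto simp: mI_def fps_const_def)
lemma mI_sym: "f - g \<in> mI n \<Longrightarrow> g - f \<in> mI n" using mI_diff[OF mI_zero, of "f - g" n] by simp
lemma mI_trans: "f - g \<in> mI n \<Longrightarrow> g - h \<in> mI n \<Longrightarrow> f - h \<in> mI n" using mI_add[of "f - g" n "g - h"] by simp

lemma evals_mI:
  assumes w: "nm w < 1" and f: "f \<in> mI n" and ev: "evals w f x"
  shows "nm x \<le> max (1 / real p) (nm w) ^ n"
proof -
  define m where "m = max (1 / real p) (nm w)"
  have m: "0 \<le> m" "1 / real p \<le> m" "nm w \<le> m" using nm_ge_0[of w] by (auto simp: m_def le_max_iff_disj)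
  have "nm (x - (\<Sum>j<n. fps_nth f j * w ^ j)) \<le> nm w ^ n" using ev by (simp add: evals_def)
  also have "\<dots> \<le> m ^ n" using m by (intro power_mono) auto
  finally have 1: "nm (x - (\<Sum>j<n. fps_nth f j * w ^ j)) \<le> m ^ n" .
  have 2: "nm (\<Sum>j<n. fps_nth f j * w ^ j) \<le> m ^ n"
  proof (rule nm_sum_le)
    fix j assume j: "j \<in> {..<n}"
    have "nm (fps_nth f j * w ^ j) \<le> pe (n - j) * nm w ^ j"
      using f by (intro nm_mult_le) (auto simp: mI_def nm_power)
    also have "\<dots> \<le> m ^ (n - j) * m ^ j" unfolding pe_def using m p_pos by (intro mult_mono power_mono) auto
    also have "\<dots> = m ^ n" using j by (simp flip: power_add)
    finally show "nm (fps_nth f j * w ^ j) \<le> m ^ n" .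
  qed (use m in auto)
  show ?thesis using nm_add_le[OF 1 2] by (simp add: m_def)
qed

lemma max_less_1: "nm w < 1 \<Longrightarrow> max (1 / real p) (nm w) < 1" using p_gt_1 by simp

lemma mI_complete:
  assumes F: "\<And>n. F n \<in> Zq" and d: "\<And>n. F (Suc n) - F n \<in> mI n"
  shows "\<exists>P\<in>Zq. \<forall>n. P - F n \<in> mI n"
proof -
  have "\<exists>L. \<forall>n. nm (L - fps_nth (F n) j) \<le> pe (n - j)" for j
  proof (rule seq_conv)
    show "nm (fps_nth (F (Suc n)) j - fps_nth (F n) j) \<le> pe (n - j)" for n
      using d[of n] by (simp add: mI_def)
    show "pe (n - j) \<le> pe (m - j)" if "m \<le> n" for m n using that by (intro pe_mono) auto
    have "(\<lambda>n. pe (n + j - j)) \<longlonglongrightarrow> 0" using pe_tendsto_0 by simp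
    thus "(\<lambda>n. pe (n - j)) \<longlonglongrightarrow> 0" by (rule LIMSEQ_offset)
  qed
  then obtain L where L: "\<And>j n. nm (L j - fps_nth (F n) j) \<le> pe (n - j)" by metis
  have LZ: "L j \<in> Zp" for j
  proof (rule Zp_closed)
    fix n
    show "\<exists>y\<in>Zp. nm (L j - y) \<le> pe n" using L[of j "n + j"] F by (intro bexI[of _ "fps_nth (F (n + j)) j"]) (auto simp: Zq_def)
  qed
  have "Abs_fps L - F n \<in> mI n" for n
    unfolding mI_def using L LZ F[of n] by (auto intro: Zp_diff Zq_D)
  thus ?thesis using LZ by (intro bexI[of _ "Abs_fps L"]) (auto simp: Zq_def)
qed

definition oX :: "'c fps" where "oX = 1 + fps_X"

lemma oX_Zq: "oX \<in> Zq" unfolding oX_def by (intro Zq_add Zq_one Zq_X)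

lemma not_dvd_one_plus: "\<not> p dvd (1 + p) ^ n"
proof
  assume "p dvd (1 + p) ^ n"
  hence "p dvd 1 + p" using prime_p prime_dvd_power by blast
  hence "p dvd 1" by (simp only: dvd_add_left_iff[OF dvd_refl])
  thus False using p_gt_1 by simp
qed

lemma one_plus_unit: "of_nat ((1 + p) ^ n) \<in> (Zp_units :: 'c set)"
  unfolding Zp_units_iff using nm_coprime_nat[OF not_dvd_one_plus] Zp_of_nat by blast

lemma mI_geometric:
  assumes "y \<in> mI e"
  shows "(1 + y) ^ c - 1 \<in> mI e"
proof -
  have "(1 + y) ^ c - 1 = y * (\<Sum>i<c. (1 + y) ^ i)" using power_diff_1_eq[of "1 + y" c] by simp
  moreover have "y * (\<Sum>i<c. (1 + y) ^ i) \<in> mI e"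
    by (rule mI_mult_right[OF assms]) (intro Zq_sum Zq_power Zq_add Zq_one mI_Zq[OF assms])
  ultimately show ?thesis by simp
qed

lemma oX_p_power: "oX ^ (p ^ n) - 1 \<in> mI (n + 1)"
proof (induction n)
  case 0
  show ?case using mI_X by (simp add: oX_def)
next
  case (Suc n)
  define y where "y = oX ^ (p ^ n) - 1"
  have y: "y \<in> mI (n + 1)" unfolding y_def by (rule Suc)
  have "(1 + y) ^ p - 1 = y * (\<Sum>i<p. (1 + y) ^ i)" using power_diff_1_eq[of "1 + y" p] by simp
  also have "(\<Sum>i<p. (1 + y) ^ i) = fps_const (of_nat p) + (\<Sum>i<p. (1 + y) ^ i - 1)"
    by (simp add: sum_subtractf fps_of_nat)
  finally have "(1 + y) ^ p - 1 = y * (fps_const (of_nat p) + (\<Sum>i<p. (1 + y) ^ i - 1))" .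
  moreover have "fps_const (of_nat p) \<in> mI 1" by (rule mI_const) (auto simp: nm_p pe_def)
  moreover have "(\<Sum>i<p. (1 + y) ^ i - 1) \<in> mI 1" by (intro mI_sum mI_geometric mI_mono[OF y]) simp
  ultimately have "(1 + y) ^ p - 1 \<in> mI (n + 1 + 1)" using mI_mult[OF y mI_add] by metis
  moreover have "(1 + y) ^ p = oX ^ (p ^ Suc n)" unfolding y_def by (simp add: mult.commute flip: power_mult)
  ultimately show ?case by simp
qed

lemma oX_p_power_mult: "oX ^ (c * p ^ n) - 1 \<in> mI (n + 1)"
proof -
  have "oX ^ (c * p ^ n) - 1 = (1 + (oX ^ (p ^ n) - 1)) ^ c - 1" by (simp add: mult.commute flip: power_mult)
  thus ?thesis using mI_geometric[OF oX_p_power] by simp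
qed

lemma pe_1_less: "pe 1 < 1" using p_gt_1 by (simp add: pe_def)

text \<open>1 + p generates 1 + p Z_p topologically: a factor (1+p)^(c p^n), which is 1 + c p^(n+1)
  modulo p^(n+2), corrects the next p-adic digit.\<close>

lemma exponent_step:
  assumes x: "x \<in> Zp" and a: "nm (x - of_nat ((1 + p) ^ a)) \<le> pe (n + 1)"
  shows "\<exists>c. nm (x - of_nat ((1 + p) ^ (a + c * p ^ n))) \<le> pe (n + 2)"
proof -
  obtain z where z: "z \<in> Zp" "x - of_nat ((1 + p) ^ a) = of_nat p ^ (n + 1) * z"
    using Zp_divide_p[OF Zp_diff[OF x Zp_of_nat] a] by blast
  obtain c0 :: int where c0: "nm (z - of_int c0) \<le> pe 1" using Zp_approx[OF z(1)] by blast
  define c where "c = nat (c0 mod int p)"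
  have c: "int c = c0 mod int p" using p_gt_1 by (simp add: c_def)
  have "int p ^ 1 dvd c0 - int c" unfolding c by (simp add: minus_mod_eq_mult_div)
  hence "nm (of_int (c0 - int c)) \<le> pe 1" by (simp only: nm_int_le_iff)
  hence zc: "nm (z - of_nat c) \<le> pe 1" using nm_add_le[OF c0, of "of_int (c0 - int c)"] by simp
  obtain s where s: "(1 + p) ^ (p ^ n) = 1 + p ^ (n + 1) * (1 + p * s)" using one_plus_p_power[OF odd_p] by blast
  define y where "y = p ^ (n + 1) * (1 + p * s)"
  obtain t where t: "(1 + y) ^ c = 1 + c * y + y\<^sup>2 * t" using nat_power_one_plus_sq by blast
  obtain r where r: "(1 + p) ^ a = 1 + a * p + p\<^sup>2 * r" using nat_power_one_plus_sq by blast
  have pw: "(1 + p) ^ (a + c * p ^ n) = (1 + p) ^ a * (1 + c * y + y\<^sup>2 * t)"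
  proof -
    have "(1 + p) ^ (c * p ^ n) = ((1 + p) ^ (p ^ n)) ^ c" by (simp only: power_mult[symmetric] mult.commute)
    also have "\<dots> = (1 + y) ^ c" unfolding s y_def ..
    finally show ?thesis unfolding power_add[of "1 + p" a] t by (simp only:)
  qed
  define A :: 'c where "A = of_nat ((1 + p) ^ a)"
  define P :: 'c where "P = of_nat p ^ (n + 1)"
  define e :: 'c where "e = of_nat p"
  have yc: "of_nat y = P * (1 + e * of_nat s)" by (simp add: y_def P_def e_def distrib_left)
  have A1: "A - 1 = e * (of_nat a + e * of_nat r)" unfolding A_def r e_def by (simp add: power2_eq_square algebra_simps)
  \<comment> \<open>The corrections of higher order add up to p times \<open>q\<close>: they come
    from (1+p)^a \<equiv> 1 modulo p, from the cofactor 1 + p s, and from y^2.\<close>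
  define q where "q = A * (of_nat c * of_nat s + (of_nat p ^ n * (1 + e * of_nat s) * (1 + e * of_nat s)) * of_nat t)
      + of_nat c * (of_nat a + e * of_nat r)"
  have "x - of_nat ((1 + p) ^ (a + c * p ^ n)) = (x - A) - A * (of_nat c * of_nat y + of_nat y * of_nat y * of_nat t)"
    unfolding pw A_def by (simp add: algebra_simps power2_eq_square)
  also have "x - A = P * z" using z(2) by (simp add: A_def P_def)
  also have "P * z - A * (of_nat c * of_nat y + of_nat y * of_nat y * of_nat t) = P * ((z - of_nat c) - e * q)"
  proof -
    have PP: "P = e * of_nat p ^ n" by (simp add: P_def e_def)
    have "A * (of_nat c * of_nat y + of_nat y * of_nat y * of_nat t) =
      P * (A * (of_nat c * (1 + e * of_nat s) + (1 + e * of_nat s) * (e * of_nat p ^ n * (1 + e * of_nat s)) * of_nat t))"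
      unfolding yc by (simp add: PP algebra_simps)
    also have "A * (of_nat c * (1 + e * of_nat s) + (1 + e * of_nat s) * (e * of_nat p ^ n * (1 + e * of_nat s)) * of_nat t) =
       of_nat c + (A - 1) * of_nat c + e * (A * (of_nat c * of_nat s + (of_nat p ^ n * (1 + e * of_nat s) * (1 + e * of_nat s)) * of_nat t))"
      by (simp add: algebra_simps)
    also have "\<dots> = of_nat c + e * q" unfolding A1 q_def by (simp add: algebra_simps)
    finally show ?thesis by (simp add: algebra_simps)
  qed
  finally have eq: "x - of_nat ((1 + p) ^ (a + c * p ^ n)) = P * ((z - of_nat c) - e * q)" .
  have "q \<in> Zp" unfolding q_def A_def e_def by (intro Zp_add Zp_mult Zp_power Zp_of_nat Zp_1)
  hence "nm (e * q) \<le> pe 1" unfolding e_def by (intro nm_mult_le1 Zp_nm) (simp_all add: nm_p pe_def)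
  hence "nm ((z - of_nat c) - e * q) \<le> pe 1" by (intro nm_diff_le zc)
  hence "nm (P * ((z - of_nat c) - e * q)) \<le> pe (n + 1) * pe 1"
    by (intro nm_mult_le) (simp_all add: P_def nm_p_power del: power_Suc power_add)
  thus ?thesis unfolding eq[symmetric] by (auto simp: pe_add[symmetric])
qed

text \<open>\<open>P\<close> is (1 + X)^a for the p-adic exponent a = log x / log(1+p), described
  through integer exponents that approximate x by powers of 1 + p and P by powers of 1 + X
  simultaneously. Its value at w is kappa(x).\<close>

definition is_cpow :: "'c \<Rightarrow> 'c fps \<Rightarrow> bool" where
  "is_cpow x P \<longleftrightarrow> P \<in> Zq \<and> (\<forall>n. \<exists>a. nm (x - of_nat ((1 + p) ^ a)) \<le> pe (n + 1) \<and> P - oX ^ a \<in> mI (n + 1))"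

lemma cpow_ex:
  assumes x: "x \<in> Zp" "nm (x - 1) \<le> pe 1"
  shows "\<exists>P. is_cpow x P"
proof -
  have "\<exists>a. \<forall>n. nm (x - of_nat ((1 + p) ^ a n)) \<le> pe (n + 1) \<and> (\<exists>c. a (Suc n) = a n + c * p ^ n)"
  proof (rule dependent_nat_choice)
    show "\<exists>a. nm (x - of_nat ((1 + p) ^ a)) \<le> pe (0 + 1)" using x by (intro exI[of _ 0]) simp
    show "\<exists>y. nm (x - of_nat ((1 + p) ^ y)) \<le> pe (Suc n + 1) \<and> (\<exists>c. y = a + c * p ^ n)"
      if "nm (x - of_nat ((1 + p) ^ a)) \<le> pe (n + 1)" for a n
      using exponent_step[OF x(1) that] by auto
  qed
  then obtain a where a: "\<And>n. nm (x - of_nat ((1 + p) ^ a n)) \<le> pe (n + 1)" "\<And>n. \<exists>c. a (Suc n) = a n + c * p ^ n" by blast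
  have "oX ^ a (Suc n) - oX ^ a n \<in> mI (n + 1)" for n
  proof -
    obtain c where c: "a (Suc n) = a n + c * p ^ n" using a(2) by blast
    have "oX ^ a (Suc n) - oX ^ a n = oX ^ a n * (oX ^ (c * p ^ n) - 1)" unfolding c by (simp add: power_add algebra_simps)
    thus ?thesis using oX_p_power_mult by (auto intro!: mI_mult_left Zq_power oX_Zq)
  qed
  note step = this
  have "\<exists>P\<in>Zq. \<forall>n. P - oX ^ a n \<in> mI n"
    by (rule mI_complete) (auto intro!: Zq_power oX_Zq intro: mI_mono[OF step])
  then obtain P where P: "P \<in> Zq" "\<And>n. P - oX ^ a n \<in> mI n" by blast
  have "P - oX ^ a n \<in> mI (n + 1)" for n
    using mI_trans[of P "oX ^ a (Suc n)" "n + 1" "oX ^ a n"] P(2)[of "Suc n"] step[of n] by simp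
  thus ?thesis unfolding is_cpow_def using P(1) a(1) by blast
qed

lemma cpow_cong:
  assumes "is_cpow x P" "is_cpow y Q" "nm (x - y) \<le> pe (n + 1)"
  shows "P - Q \<in> mI (n + 1)"
proof -
  obtain a where a: "nm (x - of_nat ((1 + p) ^ a)) \<le> pe (n + 1)" "P - oX ^ a \<in> mI (n + 1)"
    using assms(1) unfolding is_cpow_def by blast
  obtain b where b: "nm (y - of_nat ((1 + p) ^ b)) \<le> pe (n + 1)" "Q - oX ^ b \<in> mI (n + 1)"
    using assms(2) unfolding is_cpow_def by blast
  have "nm (of_nat ((1 + p) ^ a) - y) \<le> pe (n + 1)"
    by (rule nm_trans[OF _ assms(3)]) (use a(1) in \<open>simp only: nm_minus_commute\<close>)
  hence ab: "nm (of_nat ((1 + p) ^ a) - of_nat ((1 + p) ^ b)) \<le> pe (n + 1)" using nm_trans[OF _ b(1)] by blast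
  have key: "oX ^ (k + d) - oX ^ k \<in> mI (n + 1)" if "nm (of_nat ((1 + p) ^ (k + d)) - of_nat ((1 + p) ^ k)) \<le> pe (n + 1)" for k d
  proof -
    have "(of_nat ((1 + p) ^ (k + d)) - of_nat ((1 + p) ^ k) :: 'c) = of_nat ((1 + p) ^ k) * of_nat ((1 + p) ^ d - 1)"
      by (simp add: power_add of_nat_diff algebra_simps)
    moreover have "nm (of_nat ((1 + p) ^ k)) = 1" by (rule nm_coprime_nat[OF not_dvd_one_plus])
    ultimately have "nm (of_nat ((1 + p) ^ d - 1)) \<le> pe (n + 1)" using that by (simp only: nm_mult mult_1)
    hence "nm (of_int (int ((1 + p) ^ d - 1))) \<le> pe (n + 1)" by (simp only: of_int_of_nat_eq)
    hence "int p ^ (n + 1) dvd int ((1 + p) ^ d - 1)" by (simp only: nm_int_le_iff)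
    hence "int (p ^ (n + 1)) dvd int ((1 + p) ^ d - 1)" by (simp only: of_nat_power)
    hence "p ^ (n + 1) dvd (1 + p) ^ d - 1" by (simp only: int_dvd_int_iff)
    hence "p ^ n dvd d" by (rule one_plus_p_order[OF prime_p odd_p])
    then obtain c where "d = c * p ^ n" by (metis dvd_def mult.commute)
    hence "oX ^ (k + d) - oX ^ k = oX ^ k * (oX ^ (c * p ^ n) - 1)" by (simp add: power_add algebra_simps)
    thus ?thesis using oX_p_power_mult by (auto intro!: mI_mult_left Zq_power oX_Zq)
  qed
  have "oX ^ a - oX ^ b \<in> mI (n + 1)"
  proof (cases "b \<le> a")
    case True
    thus ?thesis using key[of b "a - b"] ab by simp
  next
    case False
    thus ?thesis using key[of a "b - a"] ab by (intro mI_sym[of "oX ^ b"]) (simp add: nm_minus_commute)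
  qed
  from mI_trans[OF mI_trans[OF a(2) this] mI_sym[OF b(2)]] show ?thesis .
qed

text \<open>For y = kappa(1+p), continuity gives y^(p^n) -> 1, so some y^(p^N) lies in the open unit
  disc around 1. An element t of norm 1 with t^p in this disc lies in it too, since (t-1)^p \<equiv>
  t^p - 1 modulo p; descending from y^(p^N) gives |w| < 1.\<close>

lemma char_w_small:
  assumes \<kappa>: "\<kappa> \<in> (weight_chars :: ('c \<Rightarrow> 'c) set)"
  shows "nm (wt p \<kappa>) < 1" "\<kappa> (of_nat ((1 + p) ^ n)) = (1 + wt p \<kappa>) ^ n"
proof -
  have hom: "\<kappa> (x * y) = \<kappa> x * \<kappa> y" if "x \<in> Zp_units" "y \<in> Zp_units" for x y
    using \<kappa> that unfolding weight_chars_def by blast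
  have nz: "\<kappa> x \<noteq> 0" if "x \<in> Zp_units" for x using \<kappa> that unfolding weight_chars_def by (auto simp: PiE_def Pi_def)
  have cont: "continuous_on Zp_units \<kappa>" using \<kappa> unfolding weight_chars_def by blast
  note u = one_plus_unit
  have "\<kappa> 1 * \<kappa> 1 = \<kappa> 1 * 1" using hom[of 1 1] u[of 0] by simp
  hence k1: "\<kappa> 1 = 1" using nz[of 1] u[of 0] by simp
  have pw: "\<kappa> (of_nat ((1 + p) ^ n)) = (1 + wt p \<kappa>) ^ n" for n
  proof (induction n)
    case (Suc n)
    have "\<kappa> (of_nat ((1 + p) ^ Suc n)) = \<kappa> (of_nat ((1 + p) ^ 1) * of_nat ((1 + p) ^ n))"
      by (simp only: power_Suc power_one_right of_nat_mult)
    also have "\<dots> = \<kappa> (of_nat ((1 + p) ^ 1)) * \<kappa> (of_nat ((1 + p) ^ n))" by (rule hom[OF u u])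
    also have "\<kappa> (of_nat ((1 + p) ^ 1)) = 1 + wt p \<kappa>" by (simp add: wt_def)
    finally show ?case using Suc by simp
  qed (simp add: k1)
  thus "\<kappa> (of_nat ((1 + p) ^ n)) = (1 + wt p \<kappa>) ^ n" .
  define y where "y = 1 + wt p \<kappa>"
  have lim: "(\<lambda>n. y ^ (p ^ n)) \<longlonglongrightarrow> 1"
  proof -
    have "(\<lambda>n. of_nat ((1 + p) ^ (p ^ n)) :: 'c) \<longlonglongrightarrow> 1"
    proof (rule LIMSEQ_bound)
      show "nm (of_nat ((1 + p) ^ (p ^ n)) - 1) \<le> pe n" for n
      proof -
        obtain s where s: "(1 + p) ^ (p ^ n) = 1 + p ^ (n + 1) * (1 + p * s)" using one_plus_p_power[OF odd_p] by blast
        have "(of_nat ((1 + p) ^ (p ^ n)) - 1 :: 'c) = of_nat p ^ n * (of_nat p * of_nat (1 + p * s))"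
          unfolding s by (simp add: algebra_simps)
        also have "nm \<dots> \<le> pe n"
          by (rule nm_mult_le1[OF _ Zp_nm[OF Zp_mult[OF Zp_of_nat Zp_of_nat]]]) (simp add: nm_p_power)
        finally show ?thesis .
      qed
    qed (rule pe_tendsto_0)
    hence "(\<lambda>n. \<kappa> (of_nat ((1 + p) ^ (p ^ n)))) \<longlonglongrightarrow> \<kappa> 1"
      using cont u[of 0] u by (intro continuous_on_tendsto_compose[OF cont]) auto
    thus ?thesis unfolding pw k1 y_def .
  qed
  then obtain N where N: "\<And>n. n \<ge> N \<Longrightarrow> nm (y ^ (p ^ n) - 1) < 1" unfolding LIMSEQ_nm_iff by (metis zero_less_one)
  have step: "nm (t - 1) < 1" if "nm (t ^ p - 1) < 1" "nm t = 1" for t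
  proof (rule ccontr)
    assume "\<not> nm (t - 1) < 1"
    hence t1: "nm (t - 1) \<ge> 1" by simp
    have t1': "nm (t - 1) \<le> 1" using that by (intro nm_diff_le) auto
    have "t ^ p = (1 + (t - 1)) ^ p" by simp
    also have "\<dots> = (\<Sum>j\<le>p. of_nat (p choose j) * (t - 1) ^ j)" using binomial_ring[of "t - 1" 1 p] by (simp add: add.commute)
    also have "{..p} = insert 0 (insert p {1..<p})" using p_gt_1 by auto
    finally have "t ^ p - 1 = (t - 1) ^ p + (\<Sum>j\<in>{1..<p}. of_nat (p choose j) * (t - 1) ^ j)" using p_gt_1 by simp
    moreover have "nm (\<Sum>j\<in>{1..<p}. of_nat (p choose j) * (t - 1) ^ j) \<le> pe 1"
    proof (rule nm_sum_le)
      fix j assume j: "j \<in> {1..<p}"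
      have "p dvd p choose j" using j by (intro dvd_choose_prime prime_p) auto
      hence "nm (of_int (int (p choose j))) \<le> pe 1" by (subst nm_int_le_iff) simp
      thus "nm (of_nat (p choose j) * (t - 1) ^ j) \<le> pe 1" using t1'
        by (intro nm_mult_le1) (auto simp: nm_power intro: power_le_one)
    qed auto
    ultimately have "nm ((t - 1) ^ p) < 1" using that(1) pe_1_less nm_diff[of "t ^ p - 1" "\<Sum>j\<in>{1..<p}. of_nat (p choose j) * (t - 1) ^ j"]
      by simp
    moreover have "nm ((t - 1) ^ p) \<ge> 1" unfolding nm_power using t1 by (rule one_le_power)
    ultimately show False by simp
  qed
  have "nm (y ^ (p ^ N)) = 1"
  proof -
    have "nm (y ^ (p ^ N)) \<le> 1" using nm_add_le[of "y ^ (p ^ N) - 1" 1 1] N[of N] by simp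
    moreover have "nm (y ^ (p ^ N)) \<ge> 1"
    proof (rule ccontr)
      assume "\<not> nm (y ^ (p ^ N)) \<ge> 1"
      moreover have "1 \<le> max (nm (y ^ (p ^ N))) (nm (y ^ (p ^ N) - 1))" using nm_diff[of "y ^ (p ^ N)" "y ^ (p ^ N) - 1"] by simp
      ultimately show False using N[of N] by simp
    qed
    ultimately show ?thesis by simp
  qed
  hence "nm y ^ (p ^ N) = 1" by (simp add: nm_power)
  moreover have "p ^ N > 0" using p_gt_1 by simp
  ultimately have y1: "nm y = 1" using nm_ge_0[of y] by (metis power_eq_1_iff abs_of_nonneg real_norm_def less_irrefl)
  have "nm (y ^ (p ^ n) - 1) < 1 \<Longrightarrow> nm (y - 1) < 1" for n
  proof (induction n)
    case (Suc n)
    have "nm ((y ^ (p ^ n)) ^ p - 1) < 1" using Suc.prems by (simp add: mult.commute flip: power_mult)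
    thus ?case using step[of "y ^ (p ^ n)"] Suc.IH y1 by (simp add: nm_power)
  qed auto
  from this[OF N[of N]] show "nm (wt p \<kappa>) < 1" by (simp add: y_def)
qed

text \<open>Along integer exponents a approximating x, the powers (1 + w)^a tend to kappa(x) by
  continuity of kappa and to the value of P by \<open>evals_mI\<close>.\<close>

lemma cpow_char:
  assumes \<kappa>: "\<kappa> \<in> (weight_chars :: ('c \<Rightarrow> 'c) set)" and x: "x \<in> Zp_units" and P: "is_cpow x P"
  shows "evals (wt p \<kappa>) P (\<kappa> x)"
proof -
  define w where "w = wt p \<kappa>"
  have w: "nm w < 1" unfolding w_def by (rule char_w_small(1)[OF \<kappa>])
  obtain y where y: "evals w P y" using evals_ex[OF w] P unfolding is_cpow_def by blast
  obtain a where a: "\<And>n. nm (x - of_nat ((1 + p) ^ a n)) \<le> pe (n + 1)" "\<And>n. P - oX ^ a n \<in> mI (n + 1)"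
    using P unfolding is_cpow_def by metis
  have evoX: "evals w (oX ^ m) ((1 + w) ^ m)" for m
    by (rule evals_power[OF w oX_Zq]) (unfold oX_def, intro evals_add evals_one evals_X[OF w])
  have "(\<lambda>n. of_nat ((1 + p) ^ a n)) \<longlonglongrightarrow> x"
  proof (rule LIMSEQ_bound)
    show "nm (of_nat ((1 + p) ^ a n) - x) \<le> pe n" for n
      using a(1)[of n] pe_mono[of n "n + 1"] by (simp only: nm_minus_commute[of _ x]) linarith
  qed (rule pe_tendsto_0)
  moreover note one_plus_unit
  moreover have "continuous_on Zp_units \<kappa>" using \<kappa> unfolding weight_chars_def by blast
  ultimately have "(\<lambda>n. \<kappa> (of_nat ((1 + p) ^ a n))) \<longlonglongrightarrow> \<kappa> x"
    using x by (intro continuous_on_tendsto_compose[of Zp_units \<kappa>]) auto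
  hence 1: "(\<lambda>n. (1 + w) ^ a n) \<longlonglongrightarrow> \<kappa> x" unfolding char_w_small(2)[OF \<kappa>] w_def .
  have 2: "(\<lambda>n. (1 + w) ^ a n) \<longlonglongrightarrow> y"
  proof (rule LIMSEQ_bound)
    define m where "m = max (1 / real p) (nm w)"
    show "nm ((1 + w) ^ a n - y) \<le> m ^ (n + 1)" for n
      using evals_mI[OF w a(2) evals_diff[OF y evoX], of n] by (simp add: m_def nm_minus_commute[of y])
    have "(\<lambda>n. m ^ n) \<longlonglongrightarrow> 0" using max_less_1[OF w] by (intro LIMSEQ_realpow_zero) (auto simp: m_def le_max_iff_disj)
    thus "(\<lambda>n. m ^ (n + 1)) \<longlonglongrightarrow> 0" by (rule LIMSEQ_ignore_initial_segment)
  qed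
  have "y = \<kappa> x" using LIMSEQ_unique[OF 2 1] .
  thus ?thesis using y by (simp add: w_def)
qed

definition is_teich :: "nat \<Rightarrow> 'c \<Rightarrow> bool" where
  "is_teich d \<omega> \<longleftrightarrow> \<omega> \<in> Zp \<and> \<omega> ^ (p - 1) = 1 \<and> (\<forall>n. nm (\<omega> - of_nat (d ^ (p ^ n))) \<le> pe (n + 1))"

lemma euler_p_power:
  assumes "\<not> p dvd d"
  shows "p ^ (n + 1) dvd d ^ (p ^ n * (p - 1)) - 1"
proof -
  have "coprime d (p ^ (n + 1))" using assms prime_p prime_imp_coprime[of p d] by (simp add: coprime_commute)
  hence "[d ^ totient (p ^ (n + 1)) = 1] (mod p ^ (n + 1))" by (rule euler_theorem)
  moreover have "totient (p ^ (n + 1)) = p ^ n * (p - 1)" using totient_prime_power_Suc[OF prime_p, of n] by simp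
  ultimately have "[1 = d ^ (p ^ n * (p - 1))] (mod p ^ (n + 1))" by (simp add: cong_sym)
  moreover have "d ^ (p ^ n * (p - 1)) \<ge> 1" using assms by (cases "d = 0") auto
  ultimately show ?thesis by (subst cong_altdef_nat[symmetric]) (auto simp: cong_sym_eq)
qed

lemma nm_nat_dvd: "p ^ n dvd m \<Longrightarrow> nm (of_nat m) \<le> pe n"
  using nm_int_le_iff[of "int m" n] by (simp flip: of_nat_power)

text \<open>The limit of d^(p^n), which exists because Euler's theorem gives d^(p^n (p-1)) \<equiv>
  1 modulo p^(n+1).\<close>

lemma teich_ex:
  assumes "\<not> p dvd d"
  shows "\<exists>\<omega>. is_teich d \<omega>"
proof -
  have d1: "d ^ k \<ge> 1" for k using assms by (cases "d = 0") auto
  have "\<exists>L. \<forall>n. nm (L - of_nat (d ^ (p ^ n))) \<le> pe (n + 1)"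
  proof (rule seq_conv)
    show "nm (of_nat (d ^ (p ^ Suc n)) - of_nat (d ^ (p ^ n))) \<le> pe (n + 1)" for n
    proof -
      have "p ^ Suc n = p ^ n + p ^ n * (p - 1)" using p_gt_1 by (cases p) auto
      hence "(of_nat (d ^ (p ^ Suc n)) - of_nat (d ^ (p ^ n)) :: 'c) = of_nat (d ^ (p ^ n)) * (of_nat (d ^ (p ^ n * (p - 1))) - 1)"
        by (simp only: power_add of_nat_mult right_diff_distrib mult_1_right)
      also have "of_nat (d ^ (p ^ n * (p - 1))) - 1 = (of_nat (d ^ (p ^ n * (p - 1)) - 1) :: 'c)"
        using of_nat_diff[OF d1, where ?'a = 'c] by (simp only: of_nat_1)
      finally have "(of_nat (d ^ (p ^ Suc n)) - of_nat (d ^ (p ^ n)) :: 'c) = of_nat (d ^ (p ^ n)) * of_nat (d ^ (p ^ n * (p - 1)) - 1)" .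
      thus ?thesis using nm_nat_dvd[OF euler_p_power[OF assms]] nm_mult_le1' nm_of_nat by metis
    qed
    show "pe (n + 1) \<le> pe (m + 1)" if "m \<le> n" for m n using that by (intro pe_mono) simp
    show "(\<lambda>n. pe (n + 1)) \<longlonglongrightarrow> 0" by (rule LIMSEQ_ignore_initial_segment[OF pe_tendsto_0])
  qed
  then obtain \<omega> where w: "\<And>n. nm (\<omega> - of_nat (d ^ (p ^ n))) \<le> pe (n + 1)" by blast
  have wZ: "\<omega> \<in> Zp"
  proof (rule Zp_closed)
    fix n
    have "nm (\<omega> - of_nat (d ^ (p ^ n))) \<le> pe n" by (rule order.trans[OF w pe_mono]) simp
    thus "\<exists>y\<in>Zp. nm (\<omega> - y) \<le> pe n" using Zp_of_nat by blast
  qed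
  have "\<omega> ^ (p - 1) - 1 = 0"
  proof (rule nm_zeroI)
    fix n
    define y :: 'c where "y = of_nat (d ^ (p ^ n))"
    have "\<omega> ^ k - y ^ k = (\<omega> - y) * (\<Sum>i<k. y ^ (k - Suc i) * \<omega> ^ i)" for k
      using power_diff_sumr2[of \<omega> k y] by simp
    hence "nm (\<omega> ^ (p - 1) - y ^ (p - 1)) \<le> pe (n + 1)"
      using w[of n] unfolding y_def[symmetric]
      by (simp only:) (intro nm_mult_le1 Zp_nm Zp_sum Zp_mult Zp_power wZ, simp_all add: y_def Zp_power)
    moreover have "nm (y ^ (p - 1) - 1) \<le> pe (n + 1)"
    proof -
      have "y ^ (p - 1) - 1 = of_nat (d ^ (p ^ n * (p - 1)) - 1)" unfolding y_def
        using d1 by (simp add: of_nat_diff power_mult)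
      thus ?thesis using nm_nat_dvd[OF euler_p_power[OF assms]] by simp
    qed
    ultimately have "nm (\<omega> ^ (p - 1) - 1) \<le> pe (n + 1)" by (rule nm_trans)
    thus "nm (\<omega> ^ (p - 1) - 1) \<le> pe n" using pe_mono[of n "n + 1"] by simp
  qed
  thus ?thesis unfolding is_teich_def using wZ w by auto
qed

end

section \<open>The Bernoulli measure\<close>

lemma fps_const_sum: "fps_const (sum f A) = (\<Sum>i\<in>A. fps_const (f i))"
  by (induction A rule: infinite_finite_induct) (auto simp: fps_const_add[symmetric] simp del: fps_const_add)

context padic_field
begin

definition teich :: "nat \<Rightarrow> 'c" where "teich d = (SOME \<omega>. is_teich d \<omega>)"
text \<open>The power series in w with value kappa(d) for every kappa in the subgroup B: dividing d
  by its Teichmueller representative leaves an element of 1 + p Z_p and does not change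
  kappa.\<close>

definition ser :: "nat \<Rightarrow> 'c fps" where "ser d = (SOME P. is_cpow (of_nat d / teich d) P)"

lemma teich: "\<not> p dvd d \<Longrightarrow> is_teich d (teich d)"
  unfolding teich_def using someI_ex[OF teich_ex] .

lemma nm_eq_1_of_power:
  assumes "nm x ^ n = 1" "n > 0"
  shows "nm x = 1"
  using assms nm_ge_0[of x] by (metis power_eq_1_iff abs_of_nonneg real_norm_def less_irrefl)

lemma teich_facts:
  assumes "\<not> p dvd d"
  shows "teich d \<in> Zp" "teich d ^ (p - 1) = 1" "nm (teich d) = 1" "nm (of_nat d - teich d) \<le> pe 1" "teich d \<in> Zp_units"
proof -
  note t = teich[OF assms]
  show 1: "teich d \<in> Zp" and 2: "teich d ^ (p - 1) = 1" using t by (auto simp: is_teich_def)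
  have "nm (teich d) ^ (p - 1) = 1" using 2 by (metis nm_1 nm_power)
  thus 3: "nm (teich d) = 1" by (rule nm_eq_1_of_power) (use p_gt_1 in simp)
  have "nm (teich d - of_nat (d ^ (p ^ 0))) \<le> pe (0 + 1)" using t unfolding is_teich_def by blast
  thus "nm (of_nat d - teich d) \<le> pe 1" by (simp add: nm_minus_commute)
  show "teich d \<in> Zp_units" unfolding Zp_units_iff using 1 3 by simp
qed

lemma nm_units_near:
  assumes "x \<in> Zp" "nm (x - 1) \<le> pe 1" "x ^ (p - 1) = 1"
  shows "x = 1"
proof -
  have "x ^ (p - 1) - 1 = (x - 1) * (\<Sum>i<p - 1. x ^ i)" by (rule power_diff_1_eq)
  hence "(x - 1) * (\<Sum>i<p - 1. x ^ i) = 0" using assms(3) by simp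
  moreover have "(\<Sum>i<p - 1. x ^ i) \<noteq> 0"
  proof
    assume *: "(\<Sum>i<p - 1. x ^ i) = 0"
    have "nm (x ^ i - 1) \<le> pe 1" for i
    proof -
      have "x ^ i - 1 = (x - 1) * (\<Sum>j<i. x ^ j)" by (rule power_diff_1_eq)
      thus ?thesis using assms by (auto intro!: nm_mult_le1 Zp_nm Zp_sum Zp_power)
    qed
    hence "nm (\<Sum>i<p - 1. x ^ i - 1) \<le> pe 1" by (intro nm_sum_le) auto
    moreover have "(\<Sum>i<p - 1. x ^ i - 1) = - of_nat (p - 1)" using * by (simp add: sum_subtractf)
    ultimately have "nm (of_nat (p - 1)) \<le> pe 1" by simp
    moreover have "\<not> p dvd p - 1" using p_gt_1 by (auto dest: dvd_imp_le)
    ultimately show False using nm_coprime_nat[of "p - 1"] pe_1_less by simp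
  qed
  ultimately show ?thesis by simp
qed

lemma teich_cong:
  assumes "\<not> p dvd d" "\<not> p dvd d'" "nm (of_nat d - of_nat d') \<le> pe 1"
  shows "teich d = teich d'"
proof -
  note t = teich_facts[OF assms(1)] teich_facts[OF assms(2)]
  have nz: "teich d' \<noteq> 0" using t by auto
  have "nm (teich d - of_nat d) \<le> pe 1" using t by (simp add: nm_minus_commute)
  hence "nm (teich d - of_nat d') \<le> pe 1" using nm_trans assms(3) by blast
  hence dd: "nm (teich d - teich d') \<le> pe 1" using nm_trans t by blast
  have "teich d / teich d' = 1"
  proof (rule nm_units_near)
    show "teich d / teich d' \<in> Zp" using t by (intro Zp_divide)
    have "teich d / teich d' - 1 = (teich d - teich d') / teich d'" using nz by (simp add: field_simps)
    thus "nm (teich d / teich d' - 1) \<le> pe 1" using dd t by (simp add: nm_divide)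
    show "(teich d / teich d') ^ (p - 1) = 1" using t by (simp add: power_divide)
  qed
  thus ?thesis using nz by simp
qed

lemma ser_arg:
  assumes "\<not> p dvd d"
  shows "of_nat d / teich d \<in> Zp_units" "nm (of_nat d / teich d - 1) \<le> pe 1"
proof -
  note t = teich_facts[OF assms]
  have nz: "teich d \<noteq> 0" using t by auto
  show "of_nat d / teich d \<in> Zp_units" unfolding Zp_units_iff
    using t nm_coprime_nat[OF assms] by (simp add: Zp_divide nm_divide)
  have "of_nat d / teich d - 1 = (of_nat d - teich d) / teich d" using nz by (simp add: field_simps)
  thus "nm (of_nat d / teich d - 1) \<le> pe 1" using t by (simp add: nm_divide)
qed

lemma ser_cpow: "\<not> p dvd d \<Longrightarrow> is_cpow (of_nat d / teich d) (ser d)"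
  unfolding ser_def using ser_arg[of d] by (intro someI_ex[OF cpow_ex]) (auto simp: Zp_units_iff)

lemma ser_Zq: "\<not> p dvd d \<Longrightarrow> ser d \<in> Zq" using ser_cpow by (simp add: is_cpow_def)

lemma ser_0:
  assumes "\<not> p dvd d"
  shows "fps_nth (ser d) 0 = 1"
proof -
  have "fps_nth (ser d) 0 - 1 = 0"
  proof (rule nm_zeroI)
    fix n
    obtain a where "ser d - oX ^ a \<in> mI (n + 1)" using ser_cpow[OF assms] unfolding is_cpow_def by blast
    hence "nm (fps_nth (ser d - oX ^ a) 0) \<le> pe (n + 1)" unfolding mI_def by (metis (mono_tags, lifting) diff_zero mem_Collect_eq)
    moreover have "fps_nth (oX ^ a) 0 = 1" by (simp add: oX_def fps_nth_power_0)
    ultimately show "nm (fps_nth (ser d) 0 - 1) \<le> pe n" using pe_mono[of n "n + 1"] by simp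
  qed
  thus ?thesis by simp
qed

lemma ser_cong:
  assumes "\<not> p dvd d" "\<not> p dvd d'" "nm (of_nat d - of_nat d') \<le> pe (n + 1)"
  shows "ser d - ser d' \<in> mI (n + 1)"
proof (rule cpow_cong[OF ser_cpow ser_cpow])
  have "nm (of_nat d - of_nat d') \<le> pe 1" using assms(3) pe_mono[of 1 "n + 1"] by simp
  hence "teich d = teich d'" using teich_cong assms by blast
  hence "of_nat d / teich d - of_nat d' / teich d' = (of_nat d - of_nat d') / teich d" by (simp add: diff_divide_distrib)
  thus "nm (of_nat d / teich d - of_nat d' / teich d') \<le> pe (n + 1)"
    using assms teich_facts[OF assms(1)] by (simp add: nm_divide)
qed (use assms in auto)

lemma ser_eval:
  assumes \<kappa>: "\<kappa> \<in> (weight_chars_B p :: ('c \<Rightarrow> 'c) set)" and d: "\<not> p dvd d"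
  shows "evals (wt p \<kappa>) (ser d) (\<kappa> (of_nat d))"
proof -
  have k: "\<kappa> \<in> weight_chars" using \<kappa> by (simp add: weight_chars_B_def)
  note t = teich_facts[OF d]
  have "evals (wt p \<kappa>) (ser d) (\<kappa> (of_nat d / teich d))" by (rule cpow_char[OF k ser_arg(1)[OF d] ser_cpow[OF d]])
  moreover have "\<kappa> (teich d * (of_nat d / teich d)) = \<kappa> (teich d) * \<kappa> (of_nat d / teich d)"
    using k t(5) ser_arg(1)[OF d] unfolding weight_chars_def by blast
  moreover have "\<kappa> (teich d) = 1" using \<kappa> t by (simp add: weight_chars_B_def)
  moreover have "teich d * (of_nat d / teich d) = of_nat d" using t by auto
  ultimately show ?thesis by simp
qed

definition mu :: "nat \<Rightarrow> nat \<Rightarrow> 'c" where "mu n a = bernoulli_measure p (1 + int p) n (int a)"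
definition minv :: "nat \<Rightarrow> nat \<Rightarrow> int" where
  "minv n a = (modular_inverse (int p ^ n) (1 + int p) * int a) mod int p ^ n"

lemma coprime_1p: "coprime (1 + int p) (int p ^ n)"
  by (metis coprime_1_left coprime_commute coprime_power_right_iff coprime_add_one_left add.commute)

lemma minv_range: "0 \<le> minv n a" "minv n a < int p ^ n"
  using p_gt_1 by (simp_all add: minv_def)

lemma minv_dvd: "int p ^ n dvd (1 + int p) * minv n a - int a"
proof -
  have "[(1 + int p) * minv n a = (1 + int p) * (modular_inverse (int p ^ n) (1 + int p) * int a)] (mod int p ^ n)"
    unfolding minv_def by (intro cong_mult cong_refl) (simp add: cong_def)
  also have "(1 + int p) * (modular_inverse (int p ^ n) (1 + int p) * int a) = ((1 + int p) * modular_inverse (int p ^ n) (1 + int p)) * int a"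
    by (simp only: mult.assoc)
  also have "[\<dots> = 1 * int a] (mod int p ^ n)" by (intro cong_mult cong_refl cong_modular_inverse1 coprime_1p)
  finally show ?thesis by (simp add: cong_iff_dvd_diff)
qed

text \<open>The carry in (1+p) b = a + p^n quo, where b is the residue of (1+p)^(-1) a. The
  Bernoulli measure of a + p^n Z_p equals p/2 - quo, which shows its integrality.\<close>

definition quo :: "nat \<Rightarrow> nat \<Rightarrow> int" where "quo n a = ((1 + int p) * minv n a - int a) div int p ^ n"

lemma minv_quo: "(1 + int p) * minv n a = int a + int p ^ n * quo n a"
  unfolding quo_def using minv_dvd[of n a] by simp

lemma minv_unique:
  assumes "int p ^ n dvd (1 + int p) * b - int a" "0 \<le> b" "b < int p ^ n"
  shows "b = minv n a"
proof -
  have "int p ^ n dvd ((1 + int p) * b - int a) - ((1 + int p) * minv n a - int a)" by (rule dvd_diff[OF assms(1) minv_dvd])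
  hence "int p ^ n dvd (1 + int p) * (b - minv n a)" by (simp add: algebra_simps)
  hence "int p ^ n dvd b - minv n a" using coprime_dvd_mult_right_iff[of "int p ^ n" "1 + int p"] coprime_1p
    by (simp add: coprime_commute)
  hence "b mod int p ^ n = minv n a mod int p ^ n" by (simp add: mod_eq_dvd_iff)
  thus ?thesis using assms minv_range by simp
qed

lemma mu_eq: "a < p ^ n \<Longrightarrow> mu n a = of_nat p / 2 - of_int (quo n a)"
proof -
  assume a: "a < p ^ n"
  have "int a mod int p ^ n = int a" using a by (simp flip: of_nat_power of_nat_mod)
  hence "mu n a = (of_nat a / of_nat p ^ n - 1 / 2) - (1 + of_nat p) * (of_int (minv n a) / of_nat p ^ n - 1 / 2)"
    unfolding mu_def bernoulli_measure_def minv_def by simp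
  also have "\<dots> = (of_nat a - (1 + of_nat p) * of_int (minv n a)) / of_nat p ^ n + of_nat p / 2"
    by (simp add: diff_divide_distrib algebra_simps add_divide_distrib)
  also have "(1 + of_nat p) * of_int (minv n a) = (of_int ((1 + int p) * minv n a) :: 'c)" by simp
  also have "\<dots> = of_nat a + of_nat p ^ n * of_int (quo n a)" unfolding minv_quo by simp
  finally show ?thesis using p_gt_1 by simp
qed

lemma mu_Zp: "a < p ^ n \<Longrightarrow> mu n a \<in> Zp"
  using Zp_diff[OF Zp_mult[OF Zp_of_nat[of p] Zp_half] Zp_of_int] by (simp add: mu_eq)

text \<open>For the lifts a + p^n i the residues \<open>minv\<close> are those of a plus p^n j(i),
  where j permutes 0, ..., p - 1. In the sum the i and the j(i) therefore both contribute multiples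
  of p (p-1) / 2.\<close>

lemma mu_distribution:
  assumes a: "a < p ^ n"
  shows "(\<Sum>i<p. mu (Suc n) (a + p ^ n * i)) = mu n a"
proof -
  define q :: 'c where "q = of_nat p ^ n"
  have q0: "q \<noteq> 0" using p_gt_1 by (simp add: q_def)
  have lt: "a + p ^ n * i < p ^ Suc n" if "i < p" for i
  proof -
    have "a + p ^ n * i < p ^ n * (i + 1)" using a by simp
    also have "\<dots> \<le> p ^ n * p" using that by (intro mult_le_mono2) simp
    finally show ?thesis by (simp add: mult.commute)
  qed
  define b where "b = (\<lambda>i. minv (Suc n) (a + p ^ n * i))"
  define j where "j = (\<lambda>i. nat (b i div int p ^ n))"
  have b_mod: "b i mod int p ^ n = minv n a" for i
  proof (rule minv_unique)
    have "int p ^ n dvd int p ^ Suc n" by simp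
    hence "int p ^ n dvd (1 + int p) * b i - int (a + p ^ n * i)" unfolding b_def using minv_dvd dvd_trans by blast
    hence "int p ^ n dvd ((1 + int p) * b i - int (a + p ^ n * i)) + int p ^ n * int i" by (rule dvd_add) simp
    hence 1: "int p ^ n dvd (1 + int p) * b i - int a" by (simp add: algebra_simps)
    have "int p ^ n dvd (1 + int p) * (b i - b i mod int p ^ n)" by (simp add: minus_mod_eq_mult_div)
    from dvd_diff[OF 1 this] show "int p ^ n dvd (1 + int p) * (b i mod int p ^ n) - int a" by (simp add: algebra_simps)
  qed (use p_gt_1 in auto)
  have jn: "int (j i) = b i div int p ^ n" for i
    unfolding j_def using minv_range[of "Suc n" "a + p ^ n * i"] p_gt_1 by (simp add: b_def pos_imp_zdiv_nonneg_iff)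
  have bj: "b i = minv n a + int p ^ n * int (j i)" for i unfolding jn using b_mod[of i] mult_div_mod_eq[of "int p ^ n" "b i"] by linarith
  have jp: "j i < p" for i
  proof -
    have "b i < int p * int p ^ n" using minv_range(2)[of "Suc n" "a + p ^ n * i"] by (simp add: b_def)
    hence "int p ^ n * int (j i) < int p ^ n * int p" using bj[of i] minv_range(1)[of n a] by (simp add: mult.commute)
    thus ?thesis using p_gt_1 by (simp add: mult_less_cancel_left)
  qed
  have "inj_on j {..<p}"
  proof (rule inj_onI)
    fix i i' assume ii: "i \<in> {..<p}" "i' \<in> {..<p}" "j i = j i'"
    hence bb: "b i = b i'" using bj by metis
    have "int p ^ Suc n dvd ((1 + int p) * b i' - int (a + p ^ n * i')) - ((1 + int p) * b i - int (a + p ^ n * i))"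
      unfolding b_def by (intro dvd_diff minv_dvd)
    hence "int p ^ n * int p dvd int p ^ n * (int i - int i')" unfolding bb by (simp add: algebra_simps)
    hence "int p dvd int i - int i'" using p_gt_1 by simp
    hence "int i mod int p = int i' mod int p" by (simp add: mod_eq_dvd_iff)
    thus "i = i'" using ii by (simp flip: of_nat_mod)
  qed
  moreover from this have "j ` {..<p} = {..<p}" by (intro endo_inj_surj) (auto simp: jp)
  ultimately have sj: "(\<Sum>i<p. of_nat (j i) :: 'c) = (\<Sum>i<p. of_nat i)"
    using sum.reindex[of j "{..<p}" "of_nat :: nat \<Rightarrow> 'c"] by simp
  have "mu (Suc n) (a + p ^ n * i) =
      of_nat p / 2 + (of_nat a - (1 + of_nat p) * of_int (minv n a)) / (q * of_nat p) + (of_nat i - (1 + of_nat p) * of_nat (j i)) / of_nat p" if "i < p" for i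
  proof -
    have "(1 + int p) * b i = int (a + p ^ n * i) + int p ^ Suc n * quo (Suc n) (a + p ^ n * i)"
      unfolding b_def by (rule minv_quo)
    hence "(of_int ((1 + int p) * b i) :: 'c) = of_int (int (a + p ^ n * i) + int p ^ Suc n * quo (Suc n) (a + p ^ n * i))" by simp
    hence "(1 + of_nat p) * (of_int (minv n a) + q * of_nat (j i)) = of_nat a + q * of_nat i + q * of_nat p * of_int (quo (Suc n) (a + p ^ n * i))"
      unfolding bj q_def by (simp add: algebra_simps)
    hence "of_int (quo (Suc n) (a + p ^ n * i)) =
      ((1 + of_nat p) * (of_int (minv n a) + q * of_nat (j i)) - of_nat a - q * of_nat i) / (q * of_nat p)"
      using q0 p_gt_1 by (simp add: field_simps)
    also have "\<dots> = - ((of_nat a - (1 + of_nat p) * of_int (minv n a)) / (q * of_nat p)) - (of_nat i - (1 + of_nat p) * of_nat (j i)) / of_nat p"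
      using q0 p_gt_1 by (simp add: field_simps)
    finally show ?thesis unfolding mu_eq[OF lt[OF that]] by simp
  qed
  hence "(\<Sum>i<p. mu (Suc n) (a + p ^ n * i)) = (\<Sum>i<p. of_nat p / 2 + (of_nat a - (1 + of_nat p) * of_int (minv n a)) / (q * of_nat p) + (of_nat i - (1 + of_nat p) * of_nat (j i)) / of_nat p)"
    by (intro sum.cong) auto
  also have "\<dots> = of_nat p * (of_nat p / 2) + of_nat p * ((of_nat a - (1 + of_nat p) * of_int (minv n a)) / (q * of_nat p)) + ((\<Sum>i<p. of_nat i) - (1 + of_nat p) * (\<Sum>i<p. of_nat (j i))) / of_nat p"
    by (simp add: sum.distrib distrib_left sum_divide_distrib[symmetric] sum_subtractf sum_distrib_left[symmetric])
  also have "((\<Sum>i<p. of_nat i) - (1 + of_nat p) * (\<Sum>i<p. of_nat (j i))) / of_nat p = (- (\<Sum>i<p. of_nat i) :: 'c)"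
    unfolding sj using p_gt_1 by (simp add: field_simps)
  also have "(\<Sum>i<p. of_nat i) = (of_nat p * (of_nat p - 1) / 2 :: 'c)"
  proof -
    have "(\<Sum>i<m. of_nat i) = (of_nat m * (of_nat m - 1) / 2 :: 'c)" for m
      by (induction m) (auto simp: field_simps)
    thus ?thesis .
  qed
  also have "of_nat p * (of_nat p / 2) + of_nat p * ((of_nat a - (1 + of_nat p) * of_int (minv n a)) / (q * of_nat p)) + - (of_nat p * (of_nat p - 1) / 2) =
     of_nat p / 2 + (of_nat a - (1 + of_nat p) * of_int (minv n a)) / q"
    using q0 p_gt_1 by (simp add: field_simps)
  also have "(of_nat a - (1 + of_nat p) * of_int (minv n a)) / q = - of_int (quo n a)"
  proof -
    have "(of_int ((1 + int p) * minv n a) :: 'c) = of_int (int a + int p ^ n * quo n a)" unfolding minv_quo ..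
    hence "(1 + of_nat p) * of_int (minv n a) = of_nat a + q * of_int (quo n a)" by (simp add: q_def)
    thus ?thesis using q0 by simp
  qed
  finally show ?thesis unfolding mu_eq[OF a] by simp
qed

definition Rn :: "nat \<Rightarrow> nat set" where "Rn n = {a. a < p ^ n \<and> \<not> p dvd a}"

lemma finite_Rn [simp]: "finite (Rn n)" by (simp add: Rn_def)

lemma sum_Rn_Suc:
  assumes "n \<ge> 1"
  shows "(\<Sum>b\<in>Rn (Suc n). h b) = (\<Sum>a\<in>Rn n. \<Sum>i<p. h (a + p ^ n * i))"
proof -
  have pn: "p ^ n > 0" "p dvd p ^ n" using assms p_gt_1 by (auto simp: dvd_power)
  have lt: "a + p ^ n * i < p * p ^ n" if "a < p ^ n" "i < p" for a i
  proof -
    have "a + p ^ n * i < p ^ n * (i + 1)" using that by simp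
    also have "\<dots> \<le> p ^ n * p" using that by (intro mult_le_mono2) simp
    finally show ?thesis by (simp add: mult.commute)
  qed
  have dv: "p dvd a + p ^ n * i \<longleftrightarrow> p dvd a" for a i using pn by (simp add: dvd_add_left_iff)
  have "(\<Sum>(a, i)\<in>Rn n \<times> {..<p}. h (a + p ^ n * i)) = (\<Sum>b\<in>Rn (Suc n). h b)"
  proof (rule sum.reindex_bij_witness[where i = "\<lambda>b. (b mod p ^ n, b div p ^ n)" and j = "\<lambda>(a, i). a + p ^ n * i"])
    fix b assume b: "b \<in> Rn (Suc n)"
    have "b div p ^ n < p" using b pn by (simp add: Rn_def less_mult_imp_div_less)
    moreover have "\<not> p dvd b mod p ^ n" using b pn(2) dv[of "b mod p ^ n" "b div p ^ n"] by (simp add: Rn_def)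
    ultimately show "(b mod p ^ n, b div p ^ n) \<in> Rn n \<times> {..<p}" using pn by (simp add: Rn_def)
  qed (use lt dv pn in \<open>auto simp: Rn_def\<close>)
  thus ?thesis by (simp add: sum.cartesian_product)
qed

text \<open>Riemann sum for the integral of kappa(a) / a with kappa(a) replaced by its power series
  in w. The limit \<open>Gs\<close> is an Iwasawa series, with value w times
  \<open>padic_zeta p \<kappa>\<close> for nonzero w.\<close>

definition Gn :: "nat \<Rightarrow> 'c fps" where "Gn n = (\<Sum>a\<in>Rn n. fps_const (mu n a / of_nat a) * ser a)"

lemma Rn_D: "a \<in> Rn n \<Longrightarrow> a < p ^ n" "a \<in> Rn n \<Longrightarrow> \<not> p dvd a" by (auto simp: Rn_def)

lemma Gn_Zq: "Gn n \<in> Zq"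
  unfolding Gn_def
  by (intro Zq_sum Zq_mult Zq_const ser_Zq Zp_divide mu_Zp nm_coprime_nat Zp_of_nat) (auto dest: Rn_D)

text \<open>Refining the partition replaces a by some b \<equiv> a modulo p^n, which changes 1/a and
  \<open>ser a\<close> only within (p, X)^n; the masses are matched by the distribution
  relation.\<close>

lemma Gn_step:
  assumes "n \<ge> 1"
  shows "Gn (Suc n) - Gn n \<in> mI n"
proof -
  obtain n' where n': "n = n' + 1" using assms by (metis add.commute le_Suc_ex plus_1_eq_Suc)
  have pn: "p dvd p ^ n" using assms by (simp add: dvd_power)
  have "Gn n = (\<Sum>a\<in>Rn n. \<Sum>i<p. fps_const (mu (Suc n) (a + p ^ n * i)) * (fps_const (1 / of_nat a) * ser a))"
    unfolding Gn_def
  proof (rule sum.cong)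
    fix a assume a: "a \<in> Rn n"
    have "fps_const (mu n a / of_nat a) = fps_const (mu n a) * fps_const (1 / of_nat a)" by simp
    also have "fps_const (mu n a) = (\<Sum>i<p. fps_const (mu (Suc n) (a + p ^ n * i)))"
      unfolding mu_distribution[OF Rn_D(1)[OF a], symmetric] by (simp add: fps_const_sum)
    finally show "fps_const (mu n a / of_nat a) * ser a = (\<Sum>i<p. fps_const (mu (Suc n) (a + p ^ n * i)) * (fps_const (1 / of_nat a) * ser a))"
      by (simp only: sum_distrib_right mult.assoc)
  qed auto
  moreover have "Gn (Suc n) = (\<Sum>a\<in>Rn n. \<Sum>i<p. fps_const (mu (Suc n) (a + p ^ n * i)) * (fps_const (1 / of_nat (a + p ^ n * i)) * ser (a + p ^ n * i)))"
    unfolding Gn_def sum_Rn_Suc[OF assms] by (simp add: mult.assoc[symmetric])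
  ultimately have "Gn (Suc n) - Gn n = (\<Sum>a\<in>Rn n. \<Sum>i<p. fps_const (mu (Suc n) (a + p ^ n * i)) *
     (fps_const (1 / of_nat (a + p ^ n * i)) * ser (a + p ^ n * i) - fps_const (1 / of_nat a) * ser a))"
    by (simp only: sum_subtractf right_diff_distrib)
  also have "\<dots> \<in> mI n"
  proof (intro mI_sum mI_mult_left)
    fix a i assume a: "a \<in> Rn n" and i: "i \<in> {..<p}"
    define b where "b = a + p ^ n * i"
    have nd: "\<not> p dvd a" "\<not> p dvd b" using Rn_D[OF a] pn by (auto simp: b_def dvd_add_left_iff)
    have n1: "nm (of_nat a) = 1" "nm (of_nat b) = 1" using nd nm_coprime_nat by auto
    hence nz: "(of_nat a :: 'c) \<noteq> 0" "(of_nat b :: 'c) \<noteq> 0" by (metis nm_0 zero_neq_one)+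
    have ba: "nm (of_nat b - of_nat a) \<le> pe n"
    proof -
      have "(of_nat b - of_nat a :: 'c) = of_nat p ^ n * of_nat i" by (simp add: b_def)
      thus ?thesis by (simp add: nm_mult_le1 nm_p_power nm_of_nat)
    qed
    have "mu (Suc n) b \<in> Zp"
    proof (rule mu_Zp)
      have "b < p ^ n * (i + 1)" using Rn_D[OF a] by (simp add: b_def)
      also have "\<dots> \<le> p ^ n * p" using i by (intro mult_le_mono2) simp
      finally show "b < p ^ Suc n" by (simp add: mult.commute)
    qed
    thus "fps_const (mu (Suc n) (a + p ^ n * i)) \<in> Zq" unfolding b_def by (rule Zq_const)
    have inv: "1 / of_nat b - 1 / of_nat a = (of_nat a - of_nat b) / (of_nat a * of_nat b :: 'c)" using nz by (simp add: field_simps)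
    have ci: "fps_const (1 / of_nat b - 1 / of_nat a) \<in> mI n"
    proof (rule mI_const)
      show "1 / of_nat b - 1 / of_nat a \<in> Zc" using n1 by (intro Zp_diff Zp_divide Zp_1 Zp_of_nat)
      show "nm (1 / of_nat b - 1 / of_nat a) \<le> pe n" unfolding inv using ba n1 by (simp add: nm_divide nm_mult nm_minus_commute)
    qed
    have "ser b - ser a \<in> mI n" unfolding n' by (rule ser_cong) (use nd ba n' in auto)
    hence "fps_const (1 / of_nat b) * (ser b - ser a) + fps_const (1 / of_nat b - 1 / of_nat a) * ser a \<in> mI n"
      using n1 nd by (intro mI_add mI_mult_left mI_mult_right ci ser_Zq Zq_const Zp_divide Zp_1 Zp_of_nat)
    moreover have "fps_const (1 / of_nat b) * (ser b - ser a) + fps_const (1 / of_nat b - 1 / of_nat a) * ser a =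
       fps_const (1 / of_nat b) * ser b - fps_const (1 / of_nat a) * ser a"
      unfolding fps_const_sub[symmetric] by (simp add: algebra_simps del: fps_const_sub)
    ultimately show "fps_const (1 / of_nat (a + p ^ n * i)) * ser (a + p ^ n * i) - fps_const (1 / of_nat a) * ser a \<in> mI n"
      by (simp add: b_def)
  qed
  finally show ?thesis .
qed

lemma Gs_ex: "\<exists>G\<in>Zq. \<forall>n\<ge>1. G - Gn n \<in> mI n"
proof -
  have "\<exists>P\<in>Zq. \<forall>n. P - Gn (Suc n) \<in> mI n"
    by (rule mI_complete[OF Gn_Zq]) (rule mI_mono[OF Gn_step], auto)
  then obtain G where G: "G \<in> Zq" "\<And>n. G - Gn (Suc n) \<in> mI n" by blast
  have "G - Gn n \<in> mI n" if "n \<ge> 1" for n using mI_trans[OF G(2)[of n] Gn_step[OF that]] .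
  thus ?thesis using G(1) by blast
qed

definition Gs :: "'c fps" where "Gs = (SOME G. G \<in> Zq \<and> (\<forall>n\<ge>1. G - Gn n \<in> mI n))"

lemma Gs: "Gs \<in> Zq" "n \<ge> 1 \<Longrightarrow> Gs - Gn n \<in> mI n"
proof -
  have "\<exists>G. G \<in> Zq \<and> (\<forall>n\<ge>1. G - Gn n \<in> mI n)" using Gs_ex by blast
  from someI_ex[OF this] show "Gs \<in> Zq" "n \<ge> 1 \<Longrightarrow> Gs - Gn n \<in> mI n" unfolding Gs_def by auto
qed

text \<open>The pole of the zeta function at w = 0 has a unit as leading coefficient. At level n = 1
  the measure of a is p/2 - a, so division by a and summation give -(p-1) \<equiv> 1 modulo
  p.\<close>

lemma Gs_0: "nm (fps_nth Gs 0) = 1"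
proof -
  have R1: "Rn 1 = {1..<p}" by (auto simp: Rn_def Suc_le_eq intro!: gr0I dest: dvd_imp_le)
  have "nm (fps_nth (Gn 1) 0 - 1) \<le> pe 1"
  proof -
    have "fps_nth (Gn 1) 0 = (\<Sum>a\<in>{1..<p}. mu 1 a / of_nat a)"
      unfolding Gn_def fps_sum_nth R1[symmetric] by (intro sum.cong) (auto simp: ser_0 Rn_D)
    also have "\<dots> = (\<Sum>a\<in>{1..<p}. of_nat p * (1 / 2 / of_nat a) - 1)"
    proof (rule sum.cong)
      fix a assume a: "a \<in> {1..<p}"
      have "int a = minv 1 a" by (rule minv_unique) (use a in \<open>auto simp: algebra_simps\<close>)
      hence "quo 1 a = int a" unfolding quo_def using p_gt_1 by (simp add: algebra_simps)
      thus "mu 1 a / of_nat a = of_nat p * (1 / 2 / of_nat a) - 1" using a by (simp add: mu_eq diff_divide_distrib)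
    qed auto
    also have "\<dots> = of_nat p * (\<Sum>a\<in>{1..<p}. 1 / 2 / of_nat a) - of_nat (p - 1)"
      by (simp add: sum_subtractf sum_distrib_left)
    finally have "fps_nth (Gn 1) 0 - 1 = of_nat p * ((\<Sum>a\<in>{1..<p}. 1 / 2 / of_nat a) - 1)"
      using p_gt_1 by (simp add: of_nat_diff algebra_simps)
    moreover have "(\<Sum>a\<in>{1..<p}. 1 / 2 / of_nat a) - 1 \<in> Zc"
    proof (intro Zp_diff Zp_sum Zp_divide[OF Zp_half] Zp_1 Zp_of_nat nm_coprime_nat)
      fix a assume "a \<in> {1..<p}"
      thus "\<not> p dvd a" by (auto dest: dvd_imp_le)
    qed
    ultimately show ?thesis by (simp add: nm_mult_le1 Zp_nm nm_p pe_def)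
  qed
  moreover have "nm (fps_nth (Gs - Gn 1) 0) \<le> pe 1" using Gs(2)[of 1] unfolding mI_def by (metis (mono_tags, lifting) diff_zero mem_Collect_eq order_refl)
  ultimately have 1: "nm (fps_nth Gs 0 - 1) \<le> pe 1" using nm_trans by simp
  have "1 \<le> max (nm (fps_nth Gs 0)) (nm (fps_nth Gs 0 - 1))" using nm_diff[of "fps_nth Gs 0" "fps_nth Gs 0 - 1"] by simp
  thus ?thesis using 1 pe_1_less Zq_nm[OF Gs(1), of 0] by simp
qed

end

section \<open>The \<open>p\<close>-adic zeta function\<close>

text \<open>Comparison of coefficients in X (1 + e^X + ... + e^((N-1)X)) = (X / (e^X - 1)) (e^(NX) -
  1).\<close>

lemma sum_powers_bernoulli:
  "(\<Sum>a<N. of_nat a ^ j) = fact j * (\<Sum>i=1..Suc j. fps_nth bernoulli_fps (Suc j - i) * of_nat N ^ i / fact i :: 'a :: field_char_0)"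
proof -
  have g: "(\<Sum>a<N. fps_exp (of_nat a)) * (fps_exp 1 - 1) = (fps_exp (of_nat N) - 1 :: 'a fps)"
  proof (induction N)
    case (Suc N)
    have e: "fps_exp (of_nat (Suc N)) = fps_exp (of_nat N) * (fps_exp 1 :: 'a fps)"
      by (simp add: fps_exp_add_mult[symmetric] add.commute)
    have "(\<Sum>a<Suc N. fps_exp (of_nat a)) * (fps_exp 1 - 1) =
       (\<Sum>a<N. fps_exp (of_nat a)) * (fps_exp 1 - 1) + fps_exp (of_nat N) * (fps_exp 1 - 1 :: 'a fps)"
      by (simp only: sum.lessThan_Suc distrib_right)
    also have "\<dots> = fps_exp (of_nat N) * fps_exp 1 - 1" unfolding Suc by (simp add: right_diff_distrib)
    finally show ?case unfolding e .
  qed simp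
  have "fps_X * (\<Sum>a<N. fps_exp (of_nat a)) = bernoulli_fps * ((\<Sum>a<N. fps_exp (of_nat a)) * (fps_exp 1 - 1) :: 'a fps)"
    unfolding bernoulli_fps_mult[symmetric] by (simp only: ac_simps)
  also have "\<dots> = bernoulli_fps * (fps_exp (of_nat N) - 1)" unfolding g ..
  finally have "fps_nth (fps_X * (\<Sum>a<N. fps_exp (of_nat a))) (Suc j) = fps_nth (bernoulli_fps * (fps_exp (of_nat N) - 1) :: 'a fps) (Suc j)"
    by simp
  hence "(\<Sum>a<N. of_nat a ^ j / fact j) = fps_nth ((fps_exp (of_nat N) - 1) * bernoulli_fps :: 'a fps) (Suc j)"
    by (simp add: fps_sum_nth mult.commute)
  also have "\<dots> = (\<Sum>i=0..Suc j. fps_nth (fps_exp (of_nat N) - 1) i * fps_nth bernoulli_fps (Suc j - i))"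
    by (rule fps_mult_nth)
  also have "\<dots> = fps_nth (fps_exp (of_nat N) - 1) 0 * fps_nth bernoulli_fps (Suc j - 0) + (\<Sum>i=Suc 0..Suc j. fps_nth (fps_exp (of_nat N) - 1) i * fps_nth bernoulli_fps (Suc j - i))"
    by (rule sum.atLeast_Suc_atMost) simp
  also have "(\<Sum>i=Suc 0..Suc j. fps_nth (fps_exp (of_nat N) - 1) i * fps_nth bernoulli_fps (Suc j - i)) =
      (\<Sum>i=1..Suc j. fps_nth bernoulli_fps (Suc j - i) * of_nat N ^ i / fact i :: 'a)"
    unfolding One_nat_def by (rule sum.cong) (auto simp: mult.commute)
  finally have "(\<Sum>a<N. of_nat a ^ j) / fact j = (\<Sum>i=1..Suc j. fps_nth bernoulli_fps (Suc j - i) * of_nat N ^ i / fact i :: 'a)"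
    unfolding sum_divide_distrib by (simp only: fps_sub_nth fps_exp_nth) simp
  thus ?thesis by (simp only: divide_eq_eq fact_nonzero not_False_eq_True if_True mult.commute)
qed

lemma V_op_nth: "p > 0 \<Longrightarrow> fps_nth (V_op p f) n = (if p dvd n then fps_nth f (n div p) else 0)"
proof -
  assume p: "p > 0"
  have "fps_nth (V_op p f) n = (\<Sum>i=0..n. fps_nth f i * (if n = p * i then 1 else 0))"
    unfolding V_op_def fps_compose_nth by (intro sum.cong refl) (auto simp: power_mult[symmetric] fps_X_power_nth)
  also have "\<dots> = (\<Sum>i\<in>{i. i \<le> n \<and> n = p * i}. fps_nth f i)"
    by (rule sum.mono_neutral_cong_right) auto
  also have "\<dots> = (if p dvd n then fps_nth f (n div p) else 0)"
  proof (cases "p dvd n")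
    case True
    then obtain m where m: "n = p * m" by blast
    hence "{i. i \<le> n \<and> n = p * i} = {m}" using p by auto
    thus ?thesis using p m by simp
  next
    case False
    hence "{i. i \<le> n \<and> n = p * i} = {}" by auto
    thus ?thesis using False by (simp only: sum.empty if_False)
  qed
  finally show ?thesis .
qed

context padic_field
begin

lemma evals_unit:
  assumes "nm w < 1" "evals w f x" "nm (fps_nth f 0) = 1"
  shows "nm x = 1"
proof -
  have "nm (x - (\<Sum>j<1. fps_nth f j * w ^ j)) \<le> nm w ^ 1" using assms(2) unfolding evals_def by blast
  hence 1: "nm (x - fps_nth f 0) < 1" using assms(1) by simp
  have "1 \<le> max (nm x) (nm (x - fps_nth f 0))" using nm_diff[of x "x - fps_nth f 0"] assms(3) by simp
  thus ?thesis using 1 evals_nm[OF assms(2)] by simp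
qed

lemma zeta_riemann_sum:
  "(\<Sum>a \<in> {a \<in> {0..<int p ^ n}. \<not> int p dvd a}. \<kappa> (of_int a) / of_int a * bernoulli_measure p (1 + int p) n a) =
   (\<Sum>a\<in>Rn n. \<kappa> (of_nat a) / of_nat a * mu n a)"
proof -
  have "{a \<in> {0..<int p ^ n}. \<not> int p dvd a} = int ` Rn n"
  proof safe
    fix a assume a: "a \<in> {0..<int p ^ n}" "\<not> int p dvd a"
    have "\<not> p dvd nat a" using a int_dvd_int_iff[of p "nat a"] by simp
    hence "nat a \<in> Rn n" using a by (simp add: Rn_def nat_less_iff)
    thus "a \<in> int ` Rn n" using a by (intro image_eqI[of _ _ "nat a"]) auto
  qed (auto simp: Rn_def simp flip: of_nat_power)
  thus ?thesis by (simp add: sum.reindex mu_def)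
qed

lemma zeta_value:
  assumes \<kappa>: "\<kappa> \<in> (weight_chars_B p :: ('c \<Rightarrow> 'c) set)"
  obtains g where "evals (wt p \<kappa>) Gs g" "nm g = 1"
    "(\<lambda>n. \<Sum>a\<in>Rn n. \<kappa> (of_nat a) / of_nat a * mu n a) \<longlonglongrightarrow> g" "padic_zeta p \<kappa> = g / wt p \<kappa>"
proof -
  define w where "w = wt p \<kappa>"
  have k: "\<kappa> \<in> weight_chars" using \<kappa> by (simp add: weight_chars_B_def)
  have w: "nm w < 1" unfolding w_def by (rule char_w_small(1)[OF k])
  obtain g where g: "evals w Gs g" using evals_ex[OF w Gs(1)] by blast
  have g1: "nm g = 1" by (rule evals_unit[OF w g Gs_0])
  define s where "s = (\<lambda>n. \<Sum>a\<in>Rn n. \<kappa> (of_nat a) / of_nat a * mu n a)"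
  have ev: "evals w (Gn n) (s n)" for n
  proof -
    have "evals w (Gn n) (\<Sum>a\<in>Rn n. (mu n a / of_nat a) * \<kappa> (of_nat a))" unfolding Gn_def
    proof (intro evals_sum evals_mult[OF w] Zq_const ser_Zq evals_const)
      fix a assume a: "a \<in> Rn n"
      show z: "mu n a / of_nat a \<in> Zc" by (intro Zp_divide mu_Zp Zp_of_nat nm_coprime_nat Rn_D[OF a])
      show "nm (mu n a / of_nat a) \<le> 1" by (rule Zp_nm[OF z])
      show "\<not> p dvd a" using Rn_D[OF a] by simp
      thus "evals w (ser a) (\<kappa> (of_nat a))" unfolding w_def by (rule ser_eval[OF \<kappa>])
    qed
    thus ?thesis unfolding s_def by (simp add: mult.commute)
  qed
  have lim: "s \<longlonglongrightarrow> g"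
  proof (rule LIMSEQ_offset[of _ 1], rule LIMSEQ_bound)
    define m where "m = max (1 / real p) (nm w)"
    show "nm (s (n + 1) - g) \<le> m ^ (n + 1)" for n
      using evals_mI[OF w Gs(2) evals_diff[OF g ev], of "n + 1"] by (simp add: m_def nm_minus_commute[of g])
    have "(\<lambda>n. m ^ n) \<longlonglongrightarrow> 0" using max_less_1[OF w] by (intro LIMSEQ_realpow_zero) (auto simp: m_def le_max_iff_disj)
    thus "(\<lambda>n. m ^ (n + 1)) \<longlonglongrightarrow> 0" by (rule LIMSEQ_ignore_initial_segment)
  qed
  have "padic_zeta p \<kappa> = g / w"
    unfolding padic_zeta_def zeta_riemann_sum w_def wt_def using limI[OF lim] by (simp add: s_def)
  thus ?thesis using that[of g] g g1 lim unfolding w_def s_def by blast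
qed

text \<open>The n-th coefficient of \<open>Eis_star\<close> as a power series in w: 2 divided by the
  zeta value becomes 2 w / Gs, and inverting Gs preserves integrality since its constant term is a
  unit.\<close>

definition EE :: "nat \<Rightarrow> 'c fps" where
  "EE n = (if n = 0 then 1 else fps_const 2 * fps_X * inverse Gs * (\<Sum>d | d dvd n \<and> \<not> p dvd d. fps_const (1 / of_nat d) * ser d))"

lemma EE_Zq: "EE n \<in> Zq"
proof (cases "n = 0")
  case False
  have "fps_const 2 \<in> Zq" using Zp_of_nat[of 2] by (intro Zq_const) simp
  thus ?thesis unfolding EE_def using False
    by (auto intro!: Zq_mult Zq_X Zq_inverse Gs Gs_0 Zq_sum Zq_const ser_Zq Zp_divide Zp_1 Zp_of_nat nm_coprime_nat)
qed (simp add: EE_def Zq_one)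

lemma EE_eval:
  assumes \<kappa>: "\<kappa> \<in> (weight_chars_B p :: ('c \<Rightarrow> 'c) set)"
  shows "evals (wt p \<kappa>) (EE n) (fps_nth (Eis_star p \<kappa>) n)"
proof (cases "n = 0")
  case True
  thus ?thesis by (simp add: EE_def Eis_star_def evals_one)
next
  case False
  define w where "w = wt p \<kappa>"
  have k: "\<kappa> \<in> weight_chars" using \<kappa> by (simp add: weight_chars_B_def)
  have w: "nm w < 1" unfolding w_def by (rule char_w_small(1)[OF k])
  obtain g where g: "evals w Gs g" "nm g = 1" "padic_zeta p \<kappa> = g / w" using zeta_value[OF \<kappa>] unfolding w_def by blast
  have iZ: "inverse Gs \<in> Zq" by (rule Zq_inverse[OF Gs(1) Gs_0])
  obtain h where h: "evals w (inverse Gs) h" using evals_ex[OF w iZ] by blast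
  have "fps_nth Gs 0 \<noteq> 0" using Gs_0 by auto
  hence "Gs * inverse Gs = 1" by (simp add: inverse_mult_eq_1')
  hence "evals w 1 (g * h)" using evals_mult[OF w Gs(1) iZ g(1) h] by simp
  hence "g * h = 1" using evals_unique[OF w] evals_one by blast
  moreover have "g \<noteq> 0" using g(2) by (metis nm_0 zero_neq_one)
  ultimately have gh: "h = 1 / g" by (simp add: eq_divide_eq mult.commute)
  have z2: "(2 :: 'c) \<in> Zp" using Zp_of_nat[of 2] by simp
  define D where "D = {d. d dvd n \<and> \<not> p dvd d}"
  have Zd: "1 / of_nat d \<in> Zc" if "d \<in> D" for d
    using that unfolding D_def by (intro Zp_divide Zp_1 Zp_of_nat nm_coprime_nat) auto
  have "evals w (\<Sum>d\<in>D. fps_const (1 / of_nat d) * ser d) (\<Sum>d\<in>D. 1 / of_nat d * \<kappa> (of_nat d))"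
  proof (intro evals_sum evals_mult[OF w] Zq_const ser_Zq evals_const)
    fix d assume d: "d \<in> D"
    show "1 / of_nat d \<in> Zc" by (rule Zd[OF d])
    thus "nm (1 / of_nat d) \<le> 1" by (rule Zp_nm)
    show "\<not> p dvd d" using d by (simp add: D_def)
    thus "evals w (ser d) (\<kappa> (of_nat d))" unfolding w_def by (rule ser_eval[OF \<kappa>])
  qed
  moreover have "(\<Sum>d\<in>D. fps_const (1 / of_nat d) * ser d) \<in> Zq"
    by (intro Zq_sum Zq_mult Zq_const Zd ser_Zq) (auto simp: D_def)
  ultimately have "evals w (fps_const 2 * fps_X * inverse Gs * (\<Sum>d\<in>D. fps_const (1 / of_nat d) * ser d))
     (2 * w * h * (\<Sum>d\<in>D. 1 / of_nat d * \<kappa> (of_nat d)))"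
    by (intro evals_mult[OF w] Zq_mult Zq_const z2 Zq_X iZ evals_const Zp_nm evals_X[OF w] h)
  moreover have "2 * w * h = 2 / padic_zeta p \<kappa>" unfolding gh g(3) by simp
  ultimately show ?thesis using False unfolding EE_def Eis_star_def D_def w_def by (simp add: mult.commute)
qed

section \<open>The quotient as a q-series with coefficients in Z_p[[w]]\<close>

definition Vq :: "'b :: zero fps \<Rightarrow> 'b fps" where "Vq f = Abs_fps (\<lambda>n. if p dvd n then fps_nth f (n div p) else 0)"

lemma V_op_Vq: "V_op p f = Vq f" using p_gt_1 by (intro fps_ext) (simp add: V_op_nth Vq_def)

definition evq :: "'c \<Rightarrow> 'c fps fps \<Rightarrow> 'c fps \<Rightarrow> bool" where
  "evq w A B \<longleftrightarrow> (\<forall>n. fps_nth A n \<in> Zq \<and> evals w (fps_nth A n) (fps_nth B n))"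

lemma evq_mult: "nm w < 1 \<Longrightarrow> evq w A B \<Longrightarrow> evq w C D \<Longrightarrow> evq w (A * C) (B * D)"
  unfolding evq_def fps_mult_nth by (auto intro!: Zq_sum Zq_mult evals_sum evals_mult)

lemma evq_unique: "nm w < 1 \<Longrightarrow> evq w A B \<Longrightarrow> evq w A C \<Longrightarrow> B = C"
  unfolding evq_def by (intro fps_ext) (blast intro: evals_unique)

definition EEq :: "'c fps fps" where "EEq = Abs_fps EE"
text \<open>The coefficients in q are themselves power series and form no field, so the inverse is
  taken as a right inverse belonging to the constant term 1.\<close>

definition RRq :: "'c fps fps" where "RRq = fps_right_inverse (Vq EEq) 1"
definition FFq :: "'c fps fps" where "FFq = EEq * RRq"

lemma EEq_0: "fps_nth EEq 0 = 1" by (simp add: EEq_def EE_def)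
lemma Vq_0: "fps_nth (Vq f) 0 = fps_nth f 0" by (simp add: Vq_def)

lemma RRq: "Vq EEq * RRq = 1" unfolding RRq_def by (rule fps_right_inverse) (simp add: Vq_0 EEq_0)

lemma VEEq_Zq: "fps_nth (Vq EEq) n \<in> Zq" by (simp add: Vq_def EEq_def EE_Zq Zq_zero)

lemma RRq_Zq: "fps_nth RRq n \<in> Zq"
proof (induction n rule: less_induct)
  case (less n)
  have "(\<Sum>i=0..n. fps_nth (Vq EEq) i * fps_nth RRq (n - i)) = fps_nth 1 n"
    unfolding fps_mult_nth[symmetric] RRq ..
  moreover have "(\<Sum>i=0..n. fps_nth (Vq EEq) i * fps_nth RRq (n - i)) =
      fps_nth (Vq EEq) 0 * fps_nth RRq (n - 0) + (\<Sum>i=Suc 0..n. fps_nth (Vq EEq) i * fps_nth RRq (n - i))"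
    by (rule sum.atLeast_Suc_atMost) simp
  ultimately have "fps_nth RRq n = fps_nth 1 n - (\<Sum>i=Suc 0..n. fps_nth (Vq EEq) i * fps_nth RRq (n - i))"
    by (simp add: Vq_0 EEq_0 algebra_simps)
  moreover have "(\<Sum>i=Suc 0..n. fps_nth (Vq EEq) i * fps_nth RRq (n - i)) \<in> Zq"
    by (intro Zq_sum Zq_mult VEEq_Zq less) auto
  moreover have "fps_nth (1 :: 'c fps fps) n \<in> Zq" by (cases n) (auto intro: Zq_one Zq_zero)
  ultimately show ?case using Zq_diff by simp
qed

lemma FFq_Zq: "fps_nth FFq n \<in> Zq"
  unfolding FFq_def fps_mult_nth by (intro Zq_sum Zq_mult RRq_Zq) (simp add: EEq_def EE_Zq)

lemma FFq_eval:
  assumes \<kappa>: "\<kappa> \<in> (weight_chars_B p :: ('c \<Rightarrow> 'c) set)"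
  shows "evals (wt p \<kappa>) (fps_nth FFq n) (fps_nth (Eis_star p \<kappa> / V_op p (Eis_star p \<kappa>)) n)"
proof -
  define w where "w = wt p \<kappa>"
  have k: "\<kappa> \<in> weight_chars" using \<kappa> by (simp add: weight_chars_B_def)
  have w: "nm w < 1" unfolding w_def by (rule char_w_small(1)[OF k])
  define e where "e = Eis_star p \<kappa>"
  have e0: "fps_nth e 0 = 1" by (simp add: e_def Eis_star_def)
  have 1: "evq w EEq e" unfolding evq_def EEq_def e_def w_def using EE_Zq EE_eval[OF \<kappa>] by simp
  have 2: "evq w (Vq EEq) (Vq e)" using 1 unfolding evq_def Vq_def by (auto simp: evals_zero Zq_zero)
  have "\<exists>x. evals w (fps_nth RRq n) x" for n by (rule evals_ex[OF w RRq_Zq])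
  then obtain r where "\<And>n. evals w (fps_nth RRq n) (r n)" by metis
  hence 3: "evq w RRq (Abs_fps r)" unfolding evq_def using RRq_Zq by simp
  have "evq w (1 :: 'c fps fps) 1" unfolding evq_def by (auto simp: evals_one evals_zero Zq_one Zq_zero)
  moreover have "evq w 1 (Vq e * Abs_fps r)" using evq_mult[OF w 2 3] unfolding RRq .
  ultimately have "Vq e * Abs_fps r = 1" using evq_unique[OF w] by blast
  moreover have "fps_nth (Vq e) 0 \<noteq> 0" using e0 by (simp add: Vq_0)
  ultimately have "Abs_fps r = inverse (Vq e)" by (metis fps_inverse_unique)
  moreover have "e / Vq e = e * inverse (Vq e)" using \<open>fps_nth (Vq e) 0 \<noteq> 0\<close> by (simp add: fps_divide_unit)
  ultimately have "evq w FFq (e / Vq e)" using evq_mult[OF w 1 3] unfolding FFq_def by simp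
  thus ?thesis unfolding evq_def e_def w_def V_op_Vq by blast
qed

text \<open>Convergence at rate O(p^(-n)). The metric is tied to the field operations only through
  \<open>padic_complex\<close>; with explicit rates, limits of products follow from plain
  estimates.\<close>

definition fast :: "(nat \<Rightarrow> 'c) \<Rightarrow> 'c \<Rightarrow> bool" where
  "fast X L \<longleftrightarrow> (\<exists>C\<ge>0. \<forall>n\<ge>1. nm (X n - L) \<le> C * pe n)"

lemma fast_diff: "fast X L \<Longrightarrow> fast Y M \<Longrightarrow> fast (\<lambda>n. X n - Y n) (L - M)"
proof -
  assume "fast X L" "fast Y M"
  then obtain C D where CD: "C \<ge> 0" "D \<ge> 0" "\<And>n. n \<ge> 1 \<Longrightarrow> nm (X n - L) \<le> C * pe n" "\<And>n. n \<ge> 1 \<Longrightarrow> nm (Y n - M) \<le> D * pe n"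
    unfolding fast_def by blast
  have "nm (X n - Y n - (L - M)) \<le> (C + D) * pe n" if "n \<ge> 1" for n
  proof -
    have "nm ((X n - L) - (Y n - M)) \<le> max (C * pe n) (D * pe n)"
      using nm_diff[of "X n - L" "Y n - M"] CD(3)[OF that] CD(4)[OF that] by linarith
    also have "\<dots> \<le> (C + D) * pe n" using CD by (simp add: distrib_right)
    finally show ?thesis by (simp add: algebra_simps)
  qed
  thus ?thesis unfolding fast_def using CD by (intro exI[of _ "C + D"]) auto
qed

lemma fast_mult: "fast X L \<Longrightarrow> fast Y M \<Longrightarrow> fast (\<lambda>n. X n * Y n) (L * M)"
proof -
  assume "fast X L" "fast Y M"
  then obtain C D where CD: "C \<ge> 0" "D \<ge> 0" "\<And>n. n \<ge> 1 \<Longrightarrow> nm (X n - L) \<le> C * pe n" "\<And>n. n \<ge> 1 \<Longrightarrow> nm (Y n - M) \<le> D * pe n"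
    unfolding fast_def by blast
  have "nm (X n * Y n - L * M) \<le> (C * (D + nm M) + nm L * D) * pe n" if "n \<ge> 1" for n
  proof -
    have "D * pe n \<le> D" using CD pe_le_1[of n] by (simp add: mult_left_le)
    hence "nm (Y n - M) \<le> D + nm M" "nm M \<le> D + nm M" using CD(4)[OF that] nm_ge_0[of M] CD(2) by linarith+
    moreover have "nm (Y n) \<le> max (nm (Y n - M)) (nm M)" using nm_add[of "Y n - M" M] by simp
    ultimately have Y: "nm (Y n) \<le> D + nm M" by linarith
    have "nm ((X n - L) * Y n) \<le> (C * pe n) * (D + nm M)" by (rule nm_mult_le[OF CD(3)[OF that] Y])
    moreover have "nm (L * (Y n - M)) \<le> nm L * (D * pe n)" by (rule nm_mult_le[OF order.refl CD(4)[OF that]])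
    moreover have "0 \<le> (C * pe n) * (D + nm M)" "0 \<le> nm L * (D * pe n)" using CD by auto
    ultimately have "nm ((X n - L) * Y n + L * (Y n - M)) \<le> (C * pe n) * (D + nm M) + nm L * (D * pe n)"
      using nm_add[of "(X n - L) * Y n" "L * (Y n - M)"] by linarith
    thus ?thesis by (simp add: algebra_simps)
  qed
  moreover have "C * (D + nm M) + nm L * D \<ge> 0" using CD by simp
  ultimately show ?thesis unfolding fast_def by blast
qed

lemma fast_const: "fast (\<lambda>_. c) c" unfolding fast_def by (intro exI[of _ 0]) auto

lemma fast_zero: "(\<And>n. n \<ge> 1 \<Longrightarrow> nm (X n) \<le> pe n) \<Longrightarrow> fast X 0" unfolding fast_def by (intro exI[of _ 1]) auto

lemma fast_cong: "fast X L \<Longrightarrow> (\<And>n. n \<ge> 1 \<Longrightarrow> X n = Y n) \<Longrightarrow> fast Y L"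
  unfolding fast_def by simp

lemma fast_LIMSEQ: "fast X L \<Longrightarrow> X \<longlonglongrightarrow> L"
proof -
  assume "fast X L"
  then obtain C where C: "\<And>n. n \<ge> 1 \<Longrightarrow> nm (X n - L) \<le> C * pe n" unfolding fast_def by blast
  show ?thesis
  proof (rule LIMSEQ_offset[of _ 1], rule LIMSEQ_bound)
    show "nm (X (n + 1) - L) \<le> C * pe (n + 1)" for n by (rule C) simp
    show "(\<lambda>n. C * pe (n + 1)) \<longlonglongrightarrow> 0"
      using tendsto_mult_left[OF LIMSEQ_ignore_initial_segment[OF pe_tendsto_0, of 1], of C] by simp
  qed
qed

lemma fast_p_power: "fast (\<lambda>n. of_nat p ^ n) 0" by (rule fast_zero) (simp add: nm_p_power)

text \<open>The power sum is a polynomial in N = p^n without constant term whose linear coefficient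
  is B_j; after division by N the remaining terms are O(N).\<close>

lemma sum_powers_fast: "\<exists>C\<ge>0. \<forall>n. nm ((\<Sum>a<p ^ n. of_nat a ^ j) / of_nat p ^ n - bernoulli_num j) \<le> C * pe n"
proof -
  define c :: "nat \<Rightarrow> 'c" where "c = (\<lambda>i. fact j * (fps_nth bernoulli_fps (Suc j - i) / fact i))"
  define C where "C = (\<Sum>i=2..Suc j. nm (c i))"
  have "nm ((\<Sum>a<p ^ n. of_nat a ^ j) / of_nat p ^ n - bernoulli_num j) \<le> C * pe n" for n
  proof -
    define N :: 'c where "N = of_nat p ^ n"
    have N0: "N \<noteq> 0" using p_gt_1 by (simp add: N_def)
    have "(\<Sum>a<p ^ n. of_nat a ^ j) = (\<Sum>i=1..Suc j. c i * N ^ i)"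
      unfolding sum_powers_bernoulli c_def N_def sum_distrib_left by (rule sum.cong) (auto simp: mult.assoc)
    also have "\<dots> = c 1 * N ^ 1 + (\<Sum>i=Suc 1..Suc j. c i * N ^ i)"
      by (rule sum.atLeast_Suc_atMost) simp
    also have "(\<Sum>i=Suc 1..Suc j. c i * N ^ i) = N * (\<Sum>i=2..Suc j. c i * N ^ (i - 1))"
      unfolding sum_distrib_left by (intro sum.cong) (auto simp: power_eq_if)
    also have "c 1 = bernoulli_num j" by (simp add: c_def bernoulli_num_fps)
    finally have "(\<Sum>a<p ^ n. of_nat a ^ j) / N - bernoulli_num j = (\<Sum>i=2..Suc j. c i * N ^ (i - 1))"
      using N0 by (simp add: add_divide_distrib)
    also have "nm \<dots> \<le> C * pe n"
    proof (rule nm_sum_le)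
      show "0 \<le> C * pe n" unfolding C_def by (intro mult_nonneg_nonneg sum_nonneg) auto
      fix i assume i: "i \<in> {2..Suc j}"
      have "nm (N ^ (i - 1)) = pe n ^ (i - 1)" by (simp add: nm_power N_def nm_p_power[symmetric])
      also have "\<dots> \<le> pe n ^ 1" using i pe_le_1 by (intro power_decreasing) auto
      finally have "nm (c i * N ^ (i - 1)) \<le> nm (c i) * pe n" unfolding nm_mult by (intro mult_left_mono) auto
      also have "\<dots> \<le> C * pe n" unfolding C_def using i by (intro mult_right_mono member_le_sum) auto
      finally show "nm (c i * N ^ (i - 1)) \<le> C * pe n" .
    qed
    finally show ?thesis by (simp add: N_def)
  qed
  moreover have "C \<ge> 0" unfolding C_def by (intro sum_nonneg) auto
  ultimately show ?thesis by blast
qed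

definition TT :: "nat \<Rightarrow> nat \<Rightarrow> 'c" where "TT j n = (\<Sum>a\<in>Rn n. of_nat a ^ j)"

lemma TT_split:
  assumes "n \<ge> 1"
  shows "TT j n = (\<Sum>a<p ^ n. of_nat a ^ j) - of_nat p ^ j * (\<Sum>a<p ^ (n - 1). of_nat a ^ j)"
proof -
  obtain m where m: "n = Suc m" using assms by (cases n) auto
  have p0: "p > 0" using p_gt_1 by simp
  have "{..<p ^ n} = Rn n \<union> (\<lambda>a. p * a) ` {..<p ^ m}"
  proof safe
    fix a assume "a < p ^ n" "a \<notin> (\<lambda>a. p * a) ` {..<p ^ m}"
    thus "a \<in> Rn n" using p0 by (auto simp: Rn_def m elim!: dvdE)
  qed (use p0 in \<open>auto simp: Rn_def m\<close>)
  hence "(\<Sum>a<p ^ n. of_nat a ^ j) = TT j n + (\<Sum>a\<in>(\<lambda>a. p * a) ` {..<p ^ m}. of_nat a ^ j :: 'c)"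
    unfolding TT_def by (simp only:) (intro sum.union_disjoint, auto simp: Rn_def)
  also have "(\<Sum>a\<in>(\<lambda>a. p * a) ` {..<p ^ m}. of_nat a ^ j :: 'c) = of_nat p ^ j * (\<Sum>a<p ^ m. of_nat a ^ j)"
    using p0 by (subst sum.reindex) (auto simp: inj_on_def sum_distrib_left power_mult_distrib)
  finally show ?thesis by (simp add: m)
qed

text \<open>Removing the multiples of p subtracts p^j times the sum of level n - 1; after division
  by p^n this is p^(j-1) times a quotient with the same limit, which gives the Euler factor.\<close>

lemma TT_fast:
  assumes "j \<ge> 1"
  shows "fast (\<lambda>n. TT j n / of_nat p ^ n) ((1 - of_nat p ^ (j - 1)) * bernoulli_num j)"
proof -
  obtain C where C: "C \<ge> 0" "\<And>n. nm ((\<Sum>a<p ^ n. of_nat a ^ j) / of_nat p ^ n - bernoulli_num j) \<le> C * pe n"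
    using sum_powers_fast by blast
  have 1: "fast (\<lambda>n. (\<Sum>a<p ^ n. of_nat a ^ j) / of_nat p ^ n) (bernoulli_num j)"
    unfolding fast_def using C by blast
  have 2: "fast (\<lambda>n. (\<Sum>a<p ^ (n - 1). of_nat a ^ j) / of_nat p ^ (n - 1)) (bernoulli_num j)"
    unfolding fast_def
  proof (intro exI[of _ "C * real p"] conjI allI impI)
    fix n :: nat assume "n \<ge> 1"
    hence "pe (n - 1) = real p * pe n" using p_pos by (cases n) (auto simp: pe_def)
    thus "nm ((\<Sum>a<p ^ (n - 1). of_nat a ^ j) / of_nat p ^ (n - 1) - bernoulli_num j) \<le> C * real p * pe n"
      using C(2)[of "n - 1"] by simp
  qed (use C in simp)
  have "fast (\<lambda>n. (\<Sum>a<p ^ n. of_nat a ^ j) / of_nat p ^ n - of_nat p ^ (j - 1) * ((\<Sum>a<p ^ (n - 1). of_nat a ^ j) / of_nat p ^ (n - 1)))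
     (bernoulli_num j - of_nat p ^ (j - 1) * bernoulli_num j)"
    by (intro fast_diff fast_mult fast_const 1 2)
  hence "fast (\<lambda>n. TT j n / of_nat p ^ n) (bernoulli_num j - of_nat p ^ (j - 1) * bernoulli_num j)"
  proof (rule fast_cong)
    fix n :: nat assume n: "n \<ge> 1"
    obtain m i where mi: "n = Suc m" "j = Suc i" using n assms by (cases n; cases j) auto
    show "(\<Sum>a<p ^ n. of_nat a ^ j) / of_nat p ^ n - of_nat p ^ (j - 1) * ((\<Sum>a<p ^ (n - 1). of_nat a ^ j) / of_nat p ^ (n - 1)) = TT j n / of_nat p ^ n"
      unfolding TT_split[OF n] using p_gt_1 unfolding mi by (simp add: diff_divide_distrib)
  qed
  thus ?thesis by (simp add: left_diff_distrib)
qed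

lemma TT_fast_0: "j \<ge> 1 \<Longrightarrow> fast (TT j) 0"
  by (rule fast_cong[OF fast_mult[OF fast_p_power TT_fast, of j, simplified]]) (use p_gt_1 in auto)

lemma int_binomial_two: "\<exists>z. (a + q * l) ^ Suc k = a ^ Suc k + int (Suc k) * q * l * a ^ k + q\<^sup>2 * z" for a q l :: int
proof (induction k)
  case 0
  show ?case by (intro exI[of _ 0]) simp
next
  case (Suc k)
  then obtain z where z: "(a + q * l) ^ Suc k = a ^ Suc k + int (Suc k) * q * l * a ^ k + q\<^sup>2 * z" by blast
  have "(a + q * l) ^ Suc (Suc k) = (a + q * l) * (a ^ Suc k + int (Suc k) * q * l * a ^ k + q\<^sup>2 * z)"
    unfolding z[symmetric] by simp
  also have "\<dots> = a ^ Suc (Suc k) + int (Suc (Suc k)) * q * l * a ^ Suc k + q\<^sup>2 * (a * z + int (Suc k) * l * l * a ^ k + q * l * z)"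
    by (simp add: algebra_simps power2_eq_square)
  finally show ?case by blast
qed

lemma sum_minv:
  assumes "n \<ge> 1"
  shows "(\<Sum>a\<in>Rn n. of_int (minv n a) ^ j) = TT j n"
proof -
  define f where "f = (\<lambda>a. nat (minv n a))"
  have fi: "int (f a) = minv n a" for a using minv_range by (simp add: f_def)
  have pn: "int p dvd int p ^ n" using assms by (simp add: dvd_power)
  have "inj_on f (Rn n)"
  proof (rule inj_onI)
    fix a b assume ab: "a \<in> Rn n" "b \<in> Rn n" "f a = f b"
    hence "minv n a = minv n b" using fi by metis
    hence "int p ^ n dvd ((1 + int p) * minv n b - int b) - ((1 + int p) * minv n b - int a)"
      using minv_dvd[of n a] minv_dvd[of n b] by (metis dvd_diff)
    hence "int p ^ n dvd int a - int b" by simp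
    hence "int a mod int p ^ n = int b mod int p ^ n" by (simp add: mod_eq_dvd_iff)
    hence "int (a mod p ^ n) = int (b mod p ^ n)" by (simp add: zmod_int)
    thus "a = b" using Rn_D[OF ab(1)] Rn_D[OF ab(2)] by simp
  qed
  moreover have "f ` Rn n \<subseteq> Rn n"
  proof
    fix x assume "x \<in> f ` Rn n"
    then obtain a where a: "a \<in> Rn n" "x = f a" by blast
    have "f a < p ^ n" using minv_range[of n a] fi[of a] by (metis of_nat_less_iff of_nat_power)
    moreover have "\<not> p dvd f a"
    proof
      assume "p dvd f a"
      hence "int p dvd minv n a" unfolding fi[symmetric] by simp
      hence "int p dvd (1 + int p) * minv n a - ((1 + int p) * minv n a - int a)"
        using dvd_trans[OF pn minv_dvd[of n a]] by (rule dvd_diff[OF dvd_mult])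
      hence "int p dvd int a" by (simp only: diff_diff_eq2 add_diff_cancel_left')
      thus False using Rn_D[OF a(1)] by simp
    qed
    ultimately show "x \<in> Rn n" using a by (simp add: Rn_def)
  qed
  ultimately have "f ` Rn n = Rn n" by (intro endo_inj_surj) auto
  hence "TT j n = (\<Sum>a\<in>f ` Rn n. of_nat a ^ j)" by (simp add: TT_def)
  also have "\<dots> = (\<Sum>a\<in>Rn n. of_nat (f a) ^ j)" using \<open>inj_on f (Rn n)\<close> by (simp add: sum.reindex)
  also have "\<dots> = (\<Sum>a\<in>Rn n. of_int (minv n a) ^ j)" by (simp flip: fi)
  finally show ?thesis by simp
qed

text \<open>Raise (1+p) minv(a) = a + p^n quo(a) to the k-th power and sum over a. Since minv
  permutes the units modulo p^n, (1+p)^k - 1 times the k-th power sum equals k p^n times the sum of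
  quo(a) a^(k-1), up to p^(2n). Division by p^n yields the moment of p/2 - quo; the part with p/2
  tends to 0.\<close>

lemma bernoulli_integral:
  assumes k: "k \<ge> 2"
  shows "fast (\<lambda>n. of_nat k * (\<Sum>a\<in>Rn n. of_nat a ^ (k - 1) * mu n a))
     (- ((of_nat (1 + p) ^ k - 1) * ((1 - of_nat p ^ (k - 1)) * bernoulli_num k)))"
proof -
  define u :: 'c where "u = of_nat (1 + p)"
  obtain i where i: "k = Suc i" "i \<ge> 1" using k by (cases k) auto
  have "\<exists>z. ((1 + int p) * minv n a) ^ k = int a ^ k + int k * int p ^ n * quo n a * int a ^ i + (int p ^ n)\<^sup>2 * z" for n a
    unfolding minv_quo i(1) by (rule int_binomial_two)
  then obtain z where z: "\<And>n a. ((1 + int p) * minv n a) ^ k = int a ^ k + int k * int p ^ n * quo n a * int a ^ i + (int p ^ n)\<^sup>2 * z n a" by metis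
  define W :: "nat \<Rightarrow> 'c" where "W n = of_nat p ^ n * (\<Sum>a\<in>Rn n. of_int (z n a))" for n
  have main: "of_nat k * (\<Sum>a\<in>Rn n. of_nat a ^ i * mu n a) =
     (of_nat k * (of_nat p / 2)) * TT i n - (u ^ k - 1) * (TT k n / of_nat p ^ n) - (- W n)" if n: "n \<ge> 1" for n
  proof -
    define q :: 'c where "q = of_nat p ^ n"
    have q0: "q \<noteq> 0" using p_gt_1 by (simp add: q_def)
    define X :: 'c where "X = (\<Sum>a\<in>Rn n. of_int (quo n a) * of_nat a ^ i)"
    have "u ^ k * of_int (minv n a) ^ k = of_nat a ^ k + of_nat k * q * (of_int (quo n a) * of_nat a ^ i) + q * q * of_int (z n a)" for a
    proof -
      have "(of_int (((1 + int p) * minv n a) ^ k) :: 'c) = of_int (int a ^ k + int k * int p ^ n * quo n a * int a ^ i + (int p ^ n)\<^sup>2 * z n a)"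
        unfolding z ..
      thus ?thesis by (simp add: u_def q_def power_mult_distrib power2_eq_square mult.assoc)
    qed
    hence "(\<Sum>a\<in>Rn n. u ^ k * of_int (minv n a) ^ k) = (\<Sum>a\<in>Rn n. of_nat a ^ k + of_nat k * q * (of_int (quo n a) * of_nat a ^ i) + q * q * of_int (z n a))"
      by simp
    hence "u ^ k * TT k n = TT k n + of_nat k * q * X + q * W n"
      unfolding sum.distrib sum_distrib_left[symmetric] sum_minv[OF n] TT_def[symmetric] X_def W_def q_def by (simp add: mult.assoc)
    hence kX: "of_nat k * X = (u ^ k - 1) * (TT k n / q) - W n"
      using q0 by (simp add: field_simps)
    have "(\<Sum>a\<in>Rn n. of_nat a ^ i * mu n a) = (\<Sum>a\<in>Rn n. (of_nat p / 2) * of_nat a ^ i - of_int (quo n a) * of_nat a ^ i)"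
      by (intro sum.cong refl) (simp add: mu_eq Rn_D algebra_simps)
    also have "\<dots> = (of_nat p / 2) * TT i n - X" unfolding TT_def X_def by (simp only: sum_subtractf sum_distrib_left)
    finally have "of_nat k * (\<Sum>a\<in>Rn n. of_nat a ^ i * mu n a) = of_nat k * (of_nat p / 2) * TT i n - of_nat k * X"
      by (simp only: right_diff_distrib mult.assoc)
    thus ?thesis unfolding kX q_def by simp
  qed
  have W: "fast (\<lambda>n. - W n) 0"
    by (rule fast_zero) (auto simp: W_def intro!: nm_mult_le1 Zp_nm Zp_sum simp: nm_p_power)
  have "fast (\<lambda>n. (of_nat k * (of_nat p / 2)) * TT i n - (u ^ k - 1) * (TT k n / of_nat p ^ n) - (- W n))
     ((of_nat k * (of_nat p / 2)) * 0 - (u ^ k - 1) * ((1 - of_nat p ^ (k - 1)) * bernoulli_num k) - 0)"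
    by (intro fast_diff fast_mult fast_const TT_fast_0 TT_fast W) (use i in auto)
  hence "fast (\<lambda>n. of_nat k * (\<Sum>a\<in>Rn n. of_nat a ^ i * mu n a))
    ((of_nat k * (of_nat p / 2)) * 0 - (u ^ k - 1) * ((1 - of_nat p ^ (k - 1)) * bernoulli_num k) - 0)"
    by (rule fast_cong) (simp add: main)
  thus ?thesis unfolding u_def i by simp
qed

definition kap :: "nat \<Rightarrow> 'c \<Rightarrow> 'c" where "kap m = (\<lambda>x\<in>Zp_units. x ^ ((p - 1) * m))"

lemma nm_power_diff: "x \<in> Zp \<Longrightarrow> y \<in> Zp \<Longrightarrow> nm (x ^ k - y ^ k) \<le> nm (x - y)"
  using power_diff_sumr2[of x k y] by (auto intro!: nm_mult_le1 Zp_nm Zp_sum Zp_mult Zp_power)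

lemma kap_B: "kap m \<in> weight_chars_B p"
proof -
  have u: "x \<noteq> 0" if "x \<in> Zp_units" for x :: 'c using that by (auto simp: Zp_units_iff)
  have m: "x * y \<in> Zp_units" if "x \<in> Zp_units" "y \<in> Zp_units" for x y :: 'c
    using that by (auto simp: Zp_units_iff Zp_mult nm_mult)
  have "continuous_on Zp_units (kap m)" unfolding continuous_on_iff
  proof (intro ballI allI impI)
    fix x :: 'c and e :: real assume x: "x \<in> Zp_units" and e: "e > 0"
    show "\<exists>d>0. \<forall>y\<in>Zp_units. dist y x < d \<longrightarrow> dist (kap m y) (kap m x) < e"
    proof (intro exI[of _ e] conjI ballI impI e)
      fix y assume y: "y \<in> Zp_units" "dist y x < e"
      thus "dist (kap m y) (kap m x) < e"
        using x nm_power_diff[of y x "(p - 1) * m"] by (simp add: kap_def dist_nm Zp_units_iff)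
    qed
  qed
  moreover have "kap m x = 1" if "x \<in> Zp_units" "x ^ (p - 1) = 1" for x using that by (simp add: kap_def power_mult)
  moreover have "kap m \<in> Zp_units \<rightarrow>\<^sub>E (- {0})" using u by (auto simp: kap_def)
  moreover have "kap m (x * y) = kap m x * kap m y" if "x \<in> Zp_units" "y \<in> Zp_units" for x y
    using that m[OF that] by (simp add: kap_def power_mult_distrib)
  ultimately show ?thesis unfolding weight_chars_B_def weight_chars_def by blast
qed

lemma wt_kap: "wt p (kap m) = of_nat ((1 + p) ^ ((p - 1) * m)) - 1"
  using one_plus_unit[of 1] by (simp add: wt_def kap_def)

lemma zeta_classical:
  assumes "m \<ge> 1" and k: "k = (p - 1) * m"
  shows "of_nat k * padic_zeta p (kap m) = - ((1 - of_nat p ^ (k - 1)) * bernoulli_num k)"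
proof -
  have "4 * 1 \<le> (p - 1) * m" using assms(1) p_ge_5 by (intro mult_le_mono) auto
  hence k2: "k \<ge> 2" using k by linarith
  obtain g where g: "(\<lambda>n. \<Sum>a\<in>Rn n. kap m (of_nat a) / of_nat a * mu n a) \<longlonglongrightarrow> g" "padic_zeta p (kap m) = g / wt p (kap m)"
    using zeta_value[OF kap_B] by blast
  have "kap m (of_nat a) / of_nat a = of_nat a ^ (k - 1)" if "a \<in> Rn n" for a n
  proof -
    have n1: "nm (of_nat a) = 1" using Rn_D[OF that] nm_coprime_nat by blast
    hence "(of_nat a :: 'c) \<noteq> 0" by (metis nm_0 zero_neq_one)
    moreover have "(of_nat a :: 'c) ^ k = of_nat a * of_nat a ^ (k - 1)" using k2 by (cases k) auto
    moreover have "kap m (of_nat a) = of_nat a ^ k" using n1 unfolding k by (simp add: kap_def Zp_units_iff)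
    ultimately show ?thesis by (simp only: nonzero_mult_div_cancel_left not_False_eq_True)
  qed
  hence "(\<Sum>a\<in>Rn n. kap m (of_nat a) / of_nat a * mu n a) = (\<Sum>a\<in>Rn n. of_nat a ^ (k - 1) * mu n a)" for n
    by (intro sum.cong) auto
  hence g1: "(\<lambda>n. \<Sum>a\<in>Rn n. of_nat a ^ (k - 1) * mu n a) \<longlonglongrightarrow> g" using g(1) by simp
  have "(\<lambda>n. of_nat k * (\<Sum>a\<in>Rn n. of_nat a ^ (k - 1) * mu n a)) \<longlonglongrightarrow> of_nat k * g"
    unfolding LIMSEQ_nm_iff
  proof (intro allI impI)
    fix e :: real assume "e > 0"
    then obtain N where "\<And>n. n \<ge> N \<Longrightarrow> nm ((\<Sum>a\<in>Rn n. of_nat a ^ (k - 1) * mu n a) - g) < e"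
      using g1 unfolding LIMSEQ_nm_iff by blast
    moreover have "nm (of_nat k * x - of_nat k * g) \<le> nm (x - g)" for x
      unfolding right_diff_distrib[symmetric] by (rule nm_mult_le1'[OF order.refl nm_of_nat])
    ultimately show "\<exists>N. \<forall>n\<ge>N. nm (of_nat k * (\<Sum>a\<in>Rn n. of_nat a ^ (k - 1) * mu n a) - of_nat k * g) < e"
      by (intro exI[of _ N]) (blast intro: le_less_trans)
  qed
  from LIMSEQ_unique[OF this fast_LIMSEQ[OF bernoulli_integral[OF k2]]]
  have kg: "of_nat k * g = - ((of_nat (1 + p) ^ k - 1) * ((1 - of_nat p ^ (k - 1)) * bernoulli_num k))" .
  have w: "wt p (kap m) = of_nat (1 + p) ^ k - 1" unfolding wt_kap k of_nat_power ..
  have w0: "(of_nat (1 + p) ^ k - 1 :: 'c) \<noteq> 0"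
  proof -
    have "(1 + p) ^ k > 1" using k2 p_gt_1 by (intro one_less_power) auto
    hence "(of_nat ((1 + p) ^ k) :: 'c) \<noteq> of_nat 1" unfolding of_nat_eq_iff by linarith
    thus ?thesis by (simp only: of_nat_power of_nat_1 right_minus_eq not_False_eq_True)
  qed
  have kz: "of_nat k * padic_zeta p (kap m) = of_nat k * g / (of_nat (1 + p) ^ k - 1)" unfolding g(2) w by (rule times_divide_eq_right)
  have c: "- (W * B) / W = - B" if "W \<noteq> 0" for W B :: 'c using that by simp
  show ?thesis unfolding kz kg c[OF w0] ..
qed

end

section \<open>Modular forms over the \<open>p\<close>-adic integers\<close>

instance fps :: (ring_char_0) ring_char_0 ..

lemma of_nat_mult_fps_nth [simp]: "fps_nth (of_nat k * f) n = of_nat k * fps_nth f n" for f :: "'a :: comm_ring_1 fps"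
  by (simp add: fps_of_nat[symmetric] del: fps_of_nat)

lemma of_nat_power_mult_fps_nth [simp]: "fps_nth (of_nat k ^ m * f) n = of_nat k ^ m * fps_nth f n" for f :: "'a :: comm_ring_1 fps"
  by (simp add: fps_of_nat[symmetric] fps_const_power del: fps_of_nat)

lemma lin_span_base: "f \<in> T \<Longrightarrow> c \<in> R \<Longrightarrow> fps_const c * f \<in> lin_span R T"
  unfolding lin_span_def by (intro CollectI exI[of _ "{f}"] exI[of _ "\<lambda>_. c"]) auto

lemma lin_span_zero: "0 \<in> lin_span R T"
  unfolding lin_span_def by (intro CollectI exI[of _ "{}"]) auto

lemma lin_span_add:
  assumes R: "0 \<in> R" "\<And>x y. x \<in> R \<Longrightarrow> y \<in> R \<Longrightarrow> x + y \<in> R" and f: "f \<in> lin_span R T" and g: "g \<in> lin_span R T"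
  shows "f + g \<in> lin_span R T"
proof -
  obtain A c where A: "f = (\<Sum>f\<in>A. fps_const (c f) * f)" "finite A" "A \<subseteq> T" "\<forall>f\<in>A. c f \<in> R"
    using f unfolding lin_span_def by auto
  obtain B d where B: "g = (\<Sum>f\<in>B. fps_const (d f) * f)" "finite B" "B \<subseteq> T" "\<forall>f\<in>B. d f \<in> R"
    using g unfolding lin_span_def by auto
  define c' where "c' = (\<lambda>f. if f \<in> A then c f else 0)"
  define d' where "d' = (\<lambda>f. if f \<in> B then d f else 0)"
  have "f = (\<Sum>f\<in>A \<union> B. fps_const (c' f) * f)" unfolding A(1)
    using A(2) B(2) by (intro sum.mono_neutral_cong_left) (auto simp: c'_def)
  moreover have "g = (\<Sum>f\<in>A \<union> B. fps_const (d' f) * f)" unfolding B(1)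
    using A(2) B(2) by (intro sum.mono_neutral_cong_left) (auto simp: d'_def)
  ultimately have "f + g = (\<Sum>f\<in>A \<union> B. fps_const (c' f + d' f) * f)"
    by (simp add: sum.distrib[symmetric] distrib_right[symmetric])
  moreover have "c' f \<in> R" "d' f \<in> R" for f using A(4) B(4) R(1) by (auto simp: c'_def d'_def)
  ultimately show ?thesis unfolding lin_span_def using A(2,3) B(2,3)
    by (intro CollectI exI[of _ "A \<union> B"] exI[of _ "\<lambda>f. c' f + d' f"]) (auto intro: R)
qed

lemma lin_span_induct [consumes 1, case_names zero add]:
  assumes "x \<in> lin_span R T" "P 0"
    and "\<And>x c f. P x \<Longrightarrow> c \<in> R \<Longrightarrow> f \<in> T \<Longrightarrow> P (x + fps_const c * f)"
  shows "P x"
proof -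
  obtain A c where A: "x = (\<Sum>f\<in>A. fps_const (c f) * f)" "finite A" "A \<subseteq> T" "\<forall>f\<in>A. c f \<in> R"
    using assms(1) unfolding lin_span_def by auto
  from A(2-4) have "P (\<Sum>f\<in>A. fps_const (c f) * f)"
  proof (induction A)
    case (insert a A)
    thus ?case using assms(3)[of "\<Sum>f\<in>A. fps_const (c f) * f" "c a" a] by (simp add: add.commute)
  qed (simp add: assms(2))
  thus ?thesis by (simp add: A(1))
qed

definition emb :: "int fps \<Rightarrow> 'a :: comm_ring_1 fps" where "emb F = Abs_fps (\<lambda>n. of_int (fps_nth F n))"

lemma emb_nth [simp]: "fps_nth (emb F) n = of_int (fps_nth F n)" by (simp add: emb_def)
lemma emb_mult: "emb (F * G) = emb F * emb G" by (intro fps_ext) (simp add: fps_mult_nth)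
lemma emb_const: "emb (fps_const a) = fps_const (of_int a)" by (intro fps_ext) simp
lemma emb_one: "emb 1 = 1" by (intro fps_ext) simp

definition Uop :: "nat \<Rightarrow> 'a fps \<Rightarrow> 'a fps" where "Uop p f = Abs_fps (\<lambda>n. fps_nth f (p * n))"

lemma Uop_nth [simp]: "fps_nth (Uop p f) n = fps_nth f (p * n)" by (simp add: Uop_def)

lemma fdiff_fps_nth: "fps_nth (fdiff n f x) k = fdiff n (\<lambda>m. fps_nth (f m) k) x"
  by (induction n arbitrary: f) auto

context padic_field
begin

definition MF :: "nat \<Rightarrow> 'c fps set" where "MF k = modular_forms Zp k"

lemma MF_span: "MF k = lin_span Zc (emb ` int_modular_forms k)"
  by (simp add: MF_def modular_forms_def emb_def[abs_def])

lemma MF_base: "F \<in> int_modular_forms k \<Longrightarrow> c \<in> Zc \<Longrightarrow> fps_const c * emb F \<in> MF k"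
  unfolding MF_span by (intro lin_span_base) auto
lemma MF_emb: "F \<in> int_modular_forms k \<Longrightarrow> emb F \<in> MF k" using MF_base[of F k 1] by simp
lemma MF_zero: "0 \<in> MF k" unfolding MF_span by (rule lin_span_zero)
lemma MF_add: "f \<in> MF k \<Longrightarrow> g \<in> MF k \<Longrightarrow> f + g \<in> MF k"
  unfolding MF_span by (rule lin_span_add) (auto intro: Zp_add)

lemma MF_induct [consumes 1, case_names zero add]:
  assumes "x \<in> MF k" "P 0"
    and "\<And>x c F. P x \<Longrightarrow> c \<in> Zc \<Longrightarrow> F \<in> int_modular_forms k \<Longrightarrow> P (x + fps_const c * emb F)"
  shows "P x"
  using assms(1) unfolding MF_span
  by (induction rule: lin_span_induct) (use assms(2,3) in auto)

lemma MF_scale: "x \<in> MF k \<Longrightarrow> c \<in> Zc \<Longrightarrow> fps_const c * x \<in> MF k"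
proof (induction rule: MF_induct)
  case (add x d F)
  have "fps_const c * (x + fps_const d * emb F) = fps_const c * x + fps_const (c * d) * emb F"
    by (simp only: distrib_left mult.assoc fps_const_mult[symmetric])
  thus ?case using add by (simp only:) (intro MF_add MF_base Zp_mult, auto)
qed (simp add: MF_zero)

lemma MF_diff: "f \<in> MF k \<Longrightarrow> g \<in> MF k \<Longrightarrow> f - g \<in> MF k"
  using MF_add[of f k "fps_const (-1) * g"] MF_scale[of g k "-1"] Zp_of_int[of "-1"] by (simp add: fps_const_neg[symmetric] del: fps_const_neg)

lemma MF_mult_emb: "x \<in> MF k \<Longrightarrow> F \<in> int_modular_forms l \<Longrightarrow> x * emb F \<in> MF (k + l)"
proof (induction rule: MF_induct)
  case (add x d G)
  have "(x + fps_const d * emb G) * emb F = x * emb F + fps_const d * emb (G * F)"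
    by (simp only: distrib_right mult.assoc emb_mult)
  thus ?case using add by (simp only:) (intro MF_add MF_base int_modular_forms_mult, auto)
qed (simp add: MF_zero)

lemma MF_mult: "y \<in> MF l \<Longrightarrow> x \<in> MF k \<Longrightarrow> x * y \<in> MF (k + l)"
proof (induction rule: MF_induct)
  case (add y d F)
  have "x * (y + fps_const d * emb F) = x * y + fps_const d * (x * emb F)"
    by (simp only: distrib_left ac_simps)
  thus ?case using add by (simp only:) (intro MF_add MF_scale MF_mult_emb, auto)
qed (simp add: MF_zero)

lemma MF_one: "1 \<in> MF 0" using MF_emb[OF int_modular_forms_one] by (simp add: emb_one)

lemma MF_Zq: "x \<in> MF k \<Longrightarrow> x \<in> Zq"
proof (induction rule: MF_induct)
  case (add x c F)
  moreover have "emb F \<in> Zq" by (simp add: Zq_def)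
  ultimately show ?case by (intro Zq_add Zq_mult Zq_const)
qed (rule Zq_zero)

lemma MF_weight_0: "x \<in> MF 0 \<Longrightarrow> \<exists>c\<in>Zc. x = fps_const c"
proof (induction rule: MF_induct)
  case (add x c F)
  then obtain d where d: "d \<in> Zc" "x = fps_const d" by blast
  have "emb F = (fps_const (of_int (fps_nth F 0)) :: 'c fps)"
    by (subst int_modular_forms_weight_0[OF add.hyps(2)]) (rule emb_const)
  hence "x + fps_const c * emb F = fps_const (d + c * of_int (fps_nth F 0))" using d by simp
  thus ?case using d(1) add.hyps(1) by (intro bexI[of _ "d + c * of_int (fps_nth F 0)"] Zp_add Zp_mult) auto
qed (auto intro!: bexI[of _ 0])

text \<open>Rounding the coefficients of a linear combination to integers modulo p splits off a form
  with integer q-expansion.\<close>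

lemma MF_split: "x \<in> MF k \<Longrightarrow> \<exists>F\<in>int_modular_forms k. \<exists>h\<in>MF k. x = emb F + of_nat p * h"
proof (induction rule: MF_induct)
  case zero
  show ?case using int_modular_forms_zero MF_zero by (intro bexI[of _ 0]) (auto intro!: bexI[of _ 0] fps_ext)
next
  case (add x c F)
  then obtain G h where Gh: "G \<in> int_modular_forms k" "h \<in> MF k" "x = emb G + of_nat p * h" by blast
  obtain a where a: "nm (c - of_int a) \<le> pe 1" using Zp_approx add.hyps by blast
  obtain z where z: "z \<in> Zc" "c - of_int a = of_nat p ^ 1 * z" using Zp_divide_p[OF Zp_diff[OF add.hyps(1) Zp_of_int] a] by blast
  have c: "c = of_int a + of_nat p * z" using z by (simp add: algebra_simps)
  have "x + fps_const c * emb F = emb (G + fps_const a * F) + of_nat p * (h + fps_const z * emb F)"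
    unfolding Gh(3) c by (intro fps_ext) (simp add: algebra_simps)
  moreover have "G + fps_const a * F \<in> int_modular_forms k" by (intro int_modular_forms_add int_modular_forms_scale Gh add)
  moreover have "h + fps_const z * emb F \<in> MF k" by (intro MF_add MF_base Gh z add)
  ultimately show ?case by blast
qed

text \<open>Modulo p the form p x is an integral form F, whose q-expansion is then divisible by p. F
  / p still transforms like F and has integer coefficients, so it is an integral form; no basis of
  the space enters.\<close>

lemma MF_sat:
  assumes x: "x \<in> Zq" "of_nat p * x \<in> MF k"
  shows "x \<in> MF k"
proof -
  obtain F h where Fh: "F \<in> int_modular_forms k" "h \<in> MF k" "of_nat p * x = emb F + of_nat p * h"
    using MF_split[OF x(2)] by blast
  have "int p dvd fps_nth F n" for n
  proof -
    have "fps_nth (of_nat p * x) n = fps_nth (emb F + of_nat p * h) n" unfolding Fh(3) ..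
    hence "of_int (fps_nth F n) = of_nat p * (fps_nth x n - fps_nth h n)" by (simp add: algebra_simps)
    moreover have "nm (of_nat p * (fps_nth x n - fps_nth h n)) \<le> pe 1"
      using Zq_nm[OF Zq_diff[OF x(1) MF_Zq[OF Fh(2)]], of n] by (intro nm_mult_le1) (auto simp: nm_p pe_def)
    ultimately show ?thesis using nm_int_le_iff[of "fps_nth F n" 1] by simp
  qed
  then obtain G0 where G0: "\<And>n. fps_nth F n = int p * G0 n" unfolding dvd_def by metis
  define G where "G = Abs_fps G0"
  have F: "F = fps_const (int p) * G" by (intro fps_ext) (simp add: G_def G0)
  have G: "G \<in> int_modular_forms k" by (rule int_modular_forms_cancel[of "int p"]) (use Fh(1) F p_gt_1 in auto)
  have "of_nat p * x = of_nat p * (emb G + h)" unfolding Fh(3) F by (intro fps_ext) (simp add: algebra_simps)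
  hence "x = emb G + h" using p_gt_1 by (simp only: mult_cancel_left of_nat_eq_0_iff) auto
  thus ?thesis using MF_add[OF MF_emb[OF G] Fh(2)] by simp
qed

lemma MF_sat_int:
  assumes "x \<in> Zq" "fps_const (of_int D) * x \<in> MF k" "D \<noteq> 0"
  shows "x \<in> MF k"
  using assms
proof (induction "nat \<bar>D\<bar>" arbitrary: D rule: less_induct)
  case less
  show ?case
  proof (cases "int p dvd D")
    case True
    then obtain D' where D': "D = int p * D'" by blast
    have D0: "D' \<noteq> 0" using less.prems(3) D' by auto
    have "fps_const (of_int D) * x = of_nat p * (fps_const (of_int D') * x)" unfolding D' by (intro fps_ext) simp
    hence "of_nat p * (fps_const (of_int D') * x) \<in> MF k" using less.prems(2) by (simp only:)
    hence "fps_const (of_int D') * x \<in> MF k" by (rule MF_sat[OF Zq_mult[OF Zq_const[OF Zp_of_int] less.prems(1)]])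
    moreover have "nat \<bar>D'\<bar> < nat \<bar>D\<bar>"
    proof -
      have "1 * \<bar>D'\<bar> < int p * \<bar>D'\<bar>" using p_gt_1 D0 by (intro mult_strict_right_mono) auto
      thus ?thesis unfolding D' abs_mult by simp
    qed
    ultimately show ?thesis using less.hyps[of D'] less.prems(1) D0 by blast
  next
    case False
    have n: "nm (of_int D) = 1" by (rule nm_coprime[OF False])
    have "fps_const (inverse (of_int D)) * (fps_const (of_int D) * x) \<in> MF k"
      by (intro MF_scale less.prems Zp_inverse n Zp_of_int)
    moreover have "fps_const (inverse (of_int D)) * (fps_const (of_int D) * x) = x"
      using less.prems(3) by (simp add: mult.assoc[symmetric])
    ultimately show ?thesis by simp
  qed
qed

lemma V_nth: "fps_nth (V_op p f) n = (if p dvd n then fps_nth f (n div p) else 0)"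
  by (rule V_op_nth) (use p_gt_1 in simp)
lemma V_add: "V_op p (f + g) = V_op p f + V_op p g" for f g :: "'c fps" by (intro fps_ext) (simp add: V_nth)
lemma V_const: "V_op p (fps_const c) = fps_const c" for c :: 'c using p_gt_1 by (intro fps_ext) (auto simp: V_nth)
lemma V_mult: "V_op p (f * g) = V_op p f * V_op p g" for f g :: "'c fps"
  unfolding V_op_def using p_gt_1 by (intro fps_compose_mult_distrib) (simp add: fps_X_power_nth)
lemma V_Zq: "f \<in> Zq \<Longrightarrow> V_op p f \<in> Zq" by (simp add: Zq_def V_nth)

lemma U_add: "Uop p (f + g) = Uop p f + Uop p g" by (intro fps_ext) simp
lemma U_Zq: "f \<in> Zq \<Longrightarrow> Uop p f \<in> Zq" by (simp add: Zq_def)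
lemma U_V: "Uop p (V_op p x * y) = x * Uop p y" for x y :: "'c fps"
proof (rule fps_ext)
  fix n
  have p0: "p > 0" using p_gt_1 by simp
  have "fps_nth (Uop p (V_op p x * y)) n = (\<Sum>i=0..p*n. fps_nth (V_op p x) i * fps_nth y (p * n - i))"
    by (simp add: fps_mult_nth)
  also have "\<dots> = (\<Sum>i\<in>(\<lambda>j. p * j) ` {0..n}. fps_nth (V_op p x) i * fps_nth y (p * n - i))"
    using p0 by (intro sum.mono_neutral_right) (auto simp: V_nth elim!: dvdE)
  also have "\<dots> = (\<Sum>j=0..n. fps_nth x j * fps_nth y (p * n - p * j))"
    using p0 by (subst sum.reindex) (auto simp: inj_on_def V_nth)
  also have "\<dots> = fps_nth (x * Uop p y) n" by (simp add: fps_mult_nth right_diff_distrib')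
  finally show "fps_nth (Uop p (V_op p x * y)) n = fps_nth (x * Uop p y) n" .
qed

lemma MF_hecke: "x \<in> MF k \<Longrightarrow> k \<ge> 1 \<Longrightarrow> of_nat p ^ (k - 1) * V_op p x + Uop p x \<in> MF k"
proof (induction rule: MF_induct)
  case zero
  have "of_nat p ^ (k - 1) * V_op p 0 + Uop p 0 = (0 :: 'c fps)" by (intro fps_ext) (simp add: V_nth)
  thus ?case by (simp add: MF_zero)
next
  case (add x c F)
  have "of_nat p ^ (k - 1) * V_op p (x + fps_const c * emb F) + Uop p (x + fps_const c * emb F) =
     (of_nat p ^ (k - 1) * V_op p x + Uop p x) + fps_const c * emb (hecke p k F)"
    by (intro fps_ext) (simp add: V_nth hecke_def, simp add: algebra_simps)
  moreover have "fps_const c * emb (hecke p k F) \<in> MF k" by (intro MF_base hecke_int_modular_forms prime_p add)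
  ultimately show ?case using MF_add[OF add.IH[OF add.prems]] by (simp only:)
qed

lemma wt_kap_Zp: "wt p (kap m) \<in> Zc" unfolding wt_kap by (intro Zp_diff Zp_of_nat Zp_1)

lemma wt_kap_tau: "\<exists>t. wt p (kap m) = of_nat p * of_nat t" 
proof -
  obtain s where "(1 + p * 1) ^ ((p - 1) * m) = 1 + ((p - 1) * m) * p * 1 + p\<^sup>2 * s"
    using nat_pow_one_plus by blast
  hence "(1 + p) ^ ((p - 1) * m) = 1 + p * (((p - 1) * m) + p * s)" by (simp add: algebra_simps power2_eq_square)
  hence "(of_nat ((1 + p) ^ ((p - 1) * m)) :: 'c) = of_nat (1 + p * (((p - 1) * m) + p * s))" by (rule arg_cong)
  thus ?thesis unfolding wt_kap by (intro exI[of _ "((p - 1) * m) + p * s"]) simp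
qed

lemma nm_wt_kap: "nm (wt p (kap m)) \<le> pe 1"
  using wt_kap_tau[of m] by (auto intro!: nm_mult_le1 nm_of_nat simp: nm_p pe_def)

lemma evals_approx: "evals w f x \<Longrightarrow> nm w \<le> pe 1 \<Longrightarrow> nm (x - (\<Sum>j<J. fps_nth f j * w ^ j)) \<le> pe J"
proof -
  assume "evals w f x" "nm w \<le> pe 1"
  moreover have "nm w ^ J \<le> pe 1 ^ J" using \<open>nm w \<le> pe 1\<close> by (intro power_mono) auto
  moreover have "pe 1 ^ J = pe J" by (simp add: pe_def)
  ultimately show ?thesis unfolding evals_def by (metis order.trans)
qed

lemma evals_Zp:
  assumes "evals w f x" "f \<in> Zq" "w \<in> Zp" "nm w \<le> pe 1"
  shows "x \<in> Zp"
proof (rule Zp_closed)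
  fix J
  show "\<exists>y\<in>Zc. nm (x - y) \<le> pe J"
    by (rule bexI[of _ "\<Sum>j<J. fps_nth f j * w ^ j"])
      (intro evals_approx[OF assms(1,4)] Zp_sum Zp_mult Zp_power assms Zq_D)+
qed

definition Es :: "nat \<Rightarrow> 'c fps" where "Es m = Eis_star p (kap m)"

lemma Es_eval: "evals (wt p (kap m)) (EE n) (fps_nth (Es m) n)"
  unfolding Es_def by (rule EE_eval[OF kap_B])

lemma Es_Zq: "Es m \<in> Zq"
  using evals_Zp[OF Es_eval EE_Zq wt_kap_Zp nm_wt_kap] by (simp add: Zq_def)

text \<open>For m = 0 the denominator of \<open>padic_zeta\<close> is 0; by the convention x / 0 =
  0, applied also to 2 / \<open>padic_zeta\<close>, all higher coefficients vanish. This agrees with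
  putting w = 0 in 2 w / Gs.\<close>

lemma Es_0: "Es 0 = 1"
proof -
  have "padic_zeta p (kap 0) = 0" using wt_kap[of 0] by (simp add: padic_zeta_def wt_def)
  thus ?thesis unfolding Es_def Eis_star_def by (intro fps_ext) simp
qed

lemma Es_nth_0: "fps_nth (Es m) 0 = 1" by (simp add: Es_def Eis_star_def)

definition zc :: "nat \<Rightarrow> 'c" where "zc m = 2 / padic_zeta p (kap m)"

lemma Es_nth: "n > 0 \<Longrightarrow> m \<ge> 1 \<Longrightarrow> fps_nth (Es m) n = zc m * (\<Sum>d | d dvd n \<and> \<not> p dvd d. of_nat d ^ ((p - 1) * m - 1))"
proof -
  assume n: "n > 0" and m: "m \<ge> 1"
  have k: "(p - 1) * m \<ge> 1" using m p_gt_1 by (simp add: Suc_le_eq)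
  have "kap m (of_nat d) / of_nat d = of_nat d ^ ((p - 1) * m - 1)" if "\<not> p dvd d" for d
  proof -
    have n1: "nm (of_nat d) = 1" by (rule nm_coprime_nat[OF that])
    hence "(of_nat d :: 'c) \<noteq> 0" by (metis nm_0 zero_neq_one)
    moreover have "(of_nat d :: 'c) ^ ((p - 1) * m) = of_nat d * of_nat d ^ ((p - 1) * m - 1)" using k by (cases "(p - 1) * m") auto
    moreover have "kap m (of_nat d) = of_nat d ^ ((p - 1) * m)" using n1 by (simp add: kap_def Zp_units_iff)
    ultimately show ?thesis by (simp only: nonzero_mult_div_cancel_left not_False_eq_True)
  qed
  thus ?thesis using n unfolding Es_def Eis_star_def zc_def by (auto intro!: sum.cong)
qed

text \<open>\<open>zc m\<close> is 2 w / g with a unit g and w divisible by p. This divisibility is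
  the source of E_k \<equiv> 1 modulo p for k divisible by p - 1; the relation to -2k / B_k is the
  classical zeta value.\<close>

lemma zc_eq:
  assumes "m \<ge> 1" "k = (p - 1) * m"
  shows "- (2 * of_nat k / bernoulli_num k) = (1 - of_nat p ^ (k - 1)) * zc m" and "zc m \<in> Zc" and "nm (zc m) \<le> pe 1"
proof -
  obtain g where g: "nm g = 1" "padic_zeta p (kap m) = g / wt p (kap m)" using zeta_value[OF kap_B] by blast
  have "zc m = 2 * wt p (kap m) / g" unfolding zc_def g(2) by simp
  hence "nm (zc m) = nm (of_nat 2 * wt p (kap m))" using g(1) by (simp add: nm_divide)
  also have "\<dots> \<le> pe 1" by (intro nm_mult_le1' nm_of_nat nm_wt_kap)
  finally show "nm (zc m) \<le> pe 1" .
  have "{d. d dvd 1 \<and> \<not> p dvd d} = {1 :: nat}" using p_gt_1 by auto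
  hence "fps_nth (Es m) 1 = zc m" using Es_nth[of 1 m] assms by simp
  thus "zc m \<in> Zc" using Zq_D[OF Es_Zq] by metis
  define B :: 'c where "B = bernoulli_num k"
  define Q :: 'c where "Q = 1 - of_nat p ^ (k - 1)"
  define zt where "zt = padic_zeta p (kap m)"
  have kz: "of_nat k * zt = - (Q * B)" unfolding Q_def zt_def B_def by (rule zeta_classical[OF assms])
  have "4 * 1 \<le> (p - 1) * m" using assms(1) p_ge_5 by (intro mult_le_mono) auto
  hence k4: "k \<ge> 4" using assms by simp
  have "even k" using assms(2) prime_p p_ge_5 prime_odd_nat by auto
  hence "(bernoulli_num k :: rat) \<noteq> 0" by (rule Eis_int_modular_form(2)[OF _ k4])
  hence B0: "B \<noteq> 0" unfolding B_def by (subst bernoulli_num_of_rat) simp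
  have "(1 - int p ^ (k - 1)) mod int p = 1"
  proof -
    have "int p dvd int p ^ (k - 1)" using k4 by (intro dvd_power) auto
    thus ?thesis using p_gt_1 by (simp add: mod_diff_right_eq[symmetric, of 1] dvd_imp_mod_0)
  qed
  hence "\<not> int p dvd 1 - int p ^ (k - 1)" by (metis dvd_imp_mod_0 zero_neq_one)
  from nm_coprime[OF this] have "nm Q = 1" by (simp add: Q_def)
  hence Q0: "Q \<noteq> 0" by (metis nm_0 zero_neq_one)
  have k0: "(of_nat k :: 'c) \<noteq> 0" using k4 by simp
  have z0: "zt \<noteq> 0" using kz B0 Q0 by auto
  have "(- (2 * of_nat k)) * zt = (2 * Q) * B" using kz by (simp add: mult.assoc)
  hence "(- (2 * of_nat k)) / B = (2 * Q) / zt" using B0 z0 by (simp only: frac_eq_eq not_False_eq_True)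
  hence "- (2 * of_nat k / B) = Q * (2 / zt)" by simp
  thus "- (2 * of_nat k / bernoulli_num k) = (1 - of_nat p ^ (k - 1)) * zc m" unfolding B_def Q_def zc_def zt_def .
qed

definition Ek :: "nat \<Rightarrow> 'c fps" where "Ek m = Eis ((p - 1) * m)"

lemma Ek_nth: "m \<ge> 1 \<Longrightarrow> k = (p - 1) * m \<Longrightarrow> n > 0 \<Longrightarrow> fps_nth (Ek m) n = (1 - of_nat p ^ (k - 1)) * zc m * (\<Sum>d | d dvd n. of_nat d ^ (k - 1))"
  unfolding Ek_def Eis_def using zc_eq(1)[of m k] by simp

lemma Ek_nth_0: "fps_nth (Ek m) 0 = 1" by (simp add: Ek_def Eis_def)

lemma Ek_cong:
  assumes "m \<ge> 1"
  shows "\<exists>z\<in>Zq. Ek m = 1 + of_nat p * z"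
proof -
  have "\<exists>y. y \<in> Zc \<and> fps_nth (Ek m) n = fps_nth 1 n + of_nat p * y" for n
  proof (cases "n = 0")
    case True
    thus ?thesis by (intro exI[of _ 0]) (simp add: Ek_nth_0)
  next
    case False
    obtain z where z: "z \<in> Zc" "zc m = of_nat p ^ 1 * z" using Zp_divide_p[OF zc_eq(2,3)[OF assms refl]] by blast
    define y where "y = (1 - of_nat p ^ ((p - 1) * m - 1)) * z * (\<Sum>d | d dvd n. of_nat d ^ ((p - 1) * m - 1))"
    have "fps_nth (Ek m) n = of_nat p * y" using Ek_nth[OF assms refl, of n] False z by (simp add: y_def)
    moreover have "y \<in> Zc" unfolding y_def by (intro Zp_mult Zp_diff Zp_sum Zp_power z Zp_of_nat Zp_1)
    ultimately show ?thesis using False by (intro exI[of _ y]) simp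
  qed
  then obtain y where y: "\<And>n. y n \<in> Zc" "\<And>n. fps_nth (Ek m) n = fps_nth 1 n + of_nat p * y n" by metis
  show ?thesis by (intro bexI[of _ "Abs_fps y"] fps_ext) (auto simp: y Zq_def)
qed

lemma Ek_Zq:
  assumes "m \<ge> 1"
  shows "Ek m \<in> Zq"
proof -
  obtain z where "z \<in> Zq" "Ek m = 1 + of_nat p * z" using Ek_cong[OF assms] by blast
  thus ?thesis by (simp add: Zq_def Zp_add Zp_mult)
qed

lemma Eis_of_rat: "fps_nth (Eis k :: 'c fps) n = of_rat (fps_nth (Eis k) n)"
proof (cases "n = 0")
  case False
  have "(bernoulli_num k :: 'c) = of_rat (bernoulli_num k)" by (rule bernoulli_num_of_rat)
  thus ?thesis using False
    by (simp add: Eis_def of_rat_mult of_rat_minus of_rat_divide of_rat_sum of_rat_power)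
qed (simp add: Eis_def)

text \<open>A nonzero integer multiple of E_k is an integral form, and E_k has p-integral
  coefficients, so saturation removes the multiplier.\<close>

lemma Ek_MF:
  assumes "m \<ge> 1"
  shows "Ek m \<in> MF ((p - 1) * m)"
proof -
  have "4 * 1 \<le> (p - 1) * m" using assms(1) p_ge_5 by (intro mult_le_mono) auto
  hence k4: "(p - 1) * m \<ge> 4" by simp
  have "even ((p - 1) * m)" using prime_p p_ge_5 prime_odd_nat by auto
  then obtain D F where DF: "D \<noteq> 0" "F \<in> int_modular_forms ((p - 1) * m)"
     "\<And>n. (of_int (fps_nth F n) :: rat) = of_int D * fps_nth (Eis ((p - 1) * m)) n"
    using Eis_int_modular_form(1)[OF _ k4] by blast
  have "fps_nth (emb F) n = fps_nth (fps_const (of_int D) * Ek m) n" for n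
  proof -
    have "fps_nth (emb F :: 'c fps) n = of_rat (of_int (fps_nth F n))" by simp
    also have "\<dots> = of_int D * fps_nth (Ek m) n" unfolding DF(3) Ek_def Eis_of_rat of_rat_mult by simp
    finally show ?thesis by simp
  qed
  hence "fps_const (of_int D) * Ek m = emb F" by (intro fps_ext) simp
  hence "fps_const (of_int D) * Ek m \<in> MF ((p - 1) * m)" using MF_emb[OF DF(2)] by simp
  thus ?thesis by (rule MF_sat_int[OF Ek_Zq[OF assms] _ DF(1)])
qed

text \<open>The divisors of n that are multiples of p are p times the divisors of n / p; on
  coefficients this is the effect of 1 - p^{k-1} V.\<close>

lemma divisor_sum_split:
  assumes "n > 0"
  shows "(\<Sum>d | d dvd n. of_nat d ^ j) = (\<Sum>d | d dvd n \<and> \<not> p dvd d. of_nat d ^ j :: 'c) +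
     of_nat p ^ j * (if p dvd n then (\<Sum>d | d dvd n div p. of_nat d ^ j) else 0)"
proof -
  have p0: "p > 0" using p_gt_1 by simp
  have fin: "finite {d. d dvd n}" using assms by simp
  have un: "{d. d dvd n} = {d. d dvd n \<and> \<not> p dvd d} \<union> {d. d dvd n \<and> p dvd d}" by auto
  have "(\<Sum>d | d dvd n. of_nat d ^ j) = (\<Sum>d\<in>{d. d dvd n \<and> \<not> p dvd d} \<union> {d. d dvd n \<and> p dvd d}. of_nat d ^ j :: 'c)"
    by (rule sum.cong[OF un refl])
  also have "\<dots> = (\<Sum>d | d dvd n \<and> \<not> p dvd d. of_nat d ^ j) + (\<Sum>d | d dvd n \<and> p dvd d. of_nat d ^ j)"
    using fin by (intro sum.union_disjoint) auto
  also have "(\<Sum>d | d dvd n \<and> p dvd d. of_nat d ^ j :: 'c) = of_nat p ^ j * (if p dvd n then (\<Sum>d | d dvd n div p. of_nat d ^ j) else 0)"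
  proof (cases "p dvd n")
    case True
    then obtain l where l: "n = p * l" by blast
    have "{d. d dvd n \<and> p dvd d} = (\<lambda>d. p * d) ` {d. d dvd l}" using p0 l by auto
    hence "(\<Sum>d | d dvd n \<and> p dvd d. of_nat d ^ j :: 'c) = (\<Sum>d | d dvd l. of_nat (p * d) ^ j)"
      using p0 by (simp add: sum.reindex inj_on_def)
    thus ?thesis using True p0 l by (simp add: power_mult_distrib sum_distrib_left)
  next
    case False
    hence "{d. d dvd n \<and> p dvd d} = {}" using dvd_trans by blast
    thus ?thesis using False by (simp only: sum.empty if_False mult_zero_right)
  qed
  finally show ?thesis .
qed

lemma Es_Ek:
  assumes "m \<ge> 1" "P = of_nat p ^ ((p - 1) * m - 1)"
  shows "(1 - P) * Es m = Ek m - P * V_op p (Ek m)"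
proof (rule fps_ext)
  fix n
  define Pc :: 'c where "Pc = of_nat p ^ ((p - 1) * m - 1)"
  have P: "P = fps_const Pc" unfolding assms Pc_def by (simp add: fps_of_nat[symmetric] fps_const_power del: fps_of_nat)
  have L: "fps_nth ((1 - P) * Es m) n = (1 - Pc) * fps_nth (Es m) n"
    and R: "fps_nth (Ek m - P * V_op p (Ek m)) n = fps_nth (Ek m) n - Pc * fps_nth (V_op p (Ek m)) n"
    unfolding P by (simp_all add: algebra_simps)
  show "fps_nth ((1 - P) * Es m) n = fps_nth (Ek m - P * V_op p (Ek m)) n"
  proof (cases "n = 0")
    case True
    thus ?thesis unfolding L R by (simp add: Es_nth_0 V_nth Ek_nth_0)
  next
    case False
    define s where "s = (\<lambda>n. (\<Sum>d | d dvd n. of_nat d ^ ((p - 1) * m - 1) :: 'c))"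
    define s' where "s' = (\<Sum>d | d dvd n \<and> \<not> p dvd d. of_nat d ^ ((p - 1) * m - 1) :: 'c)"
    have n: "n > 0" using False by simp
    have sp: "s n = s' + Pc * (if p dvd n then s (n div p) else 0)"
      unfolding s_def s'_def Pc_def by (rule divisor_sum_split[OF n])
    have 1: "fps_nth (Es m) n = zc m * s'" unfolding s'_def by (rule Es_nth[OF n assms(1)])
    have 2: "fps_nth (Ek m) i = (1 - Pc) * zc m * s i" if "i > 0" for i
      unfolding s_def Pc_def by (rule Ek_nth[OF assms(1) refl that])
    have 3: "fps_nth (V_op p (Ek m)) n = (1 - Pc) * zc m * (if p dvd n then s (n div p) else 0)"
    proof (cases "p dvd n")
      case True
      hence "n div p > 0" using n by (auto elim!: dvdE)
      thus ?thesis using True 2 by (simp add: V_nth)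
    qed (simp add: V_nth)
    show ?thesis unfolding L R 1 2[OF n] 3 sp by (simp add: algebra_simps)
  qed
qed

sublocale R: padic_ring p Zc
  by unfold_locales (auto intro: prime_p p_ge_5 Zp_diff Zp_mult)

lemma R_pI_iff: "x \<in> R.pI n \<longleftrightarrow> x \<in> Zc \<and> nm x \<le> pe n"
proof
  assume "x \<in> R.pI n"
  thus "x \<in> Zc \<and> nm x \<le> pe n" unfolding R.pI_def
    by (auto intro!: Zp_mult Zp_power nm_mult_le1 Zp_nm simp: nm_p_power)
next
  assume "x \<in> Zc \<and> nm x \<le> pe n"
  thus "x \<in> R.pI n" using Zp_divide_p[of x n] unfolding R.pI_def by blast
qed

text \<open>The weight parameter is u^m - 1 with u \<equiv> 1 modulo p, whose n-th difference for n
  \<ge> 1 is u^x (u - 1)^n; powers follow by the Leibniz rule.\<close>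

lemma fdiff_wt_kap_power: "fdiff n (\<lambda>m. wt p (kap m) ^ j) x \<in> R.pI (n + 0)"
proof (induction j arbitrary: n x)
  case 0
  show ?case
  proof (cases n)
    case (Suc n')
    have "fdiff n' (\<lambda>_. 0) x = (0 :: 'c)" by (induction n' arbitrary: x) auto
    thus ?thesis by (simp add: Suc R.pI_zero)
  qed (simp add: R.pI_0)
next
  case (Suc j)
  define u :: 'c where "u = of_nat ((1 + p) ^ (p - 1))"
  have w: "wt p (kap m) = u ^ m - 1" for m unfolding wt_kap u_def by (simp add: power_mult)
  have u1: "u - 1 \<in> R.pI 1" using w[of 1] nm_wt_kap[of 1] wt_kap_Zp[of 1] by (simp add: R_pI_iff)
  have uZ: "u \<in> Zc" unfolding u_def by (rule Zp_of_nat)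
  have 1: "fdiff n (\<lambda>m. wt p (kap m)) x \<in> R.pI (n + 0)" for n x
  proof (cases n)
    case 0
    thus ?thesis using wt_kap_Zp by (simp add: R.pI_0)
  next
    case (Suc n')
    have "fdiff n (\<lambda>m. wt p (kap m)) x = fdiff n (\<lambda>m. u ^ m) x" unfolding Suc w by simp
    also have "\<dots> = u ^ x * (u - 1) ^ n" by (rule fdiff_power)
    also have "\<dots> \<in> R.pI n" by (intro R.pI_mult_left R.pI_power1 u1 Zp_power uZ)
    finally show ?thesis by simp
  qed
  show ?case using R.fdiff_mult[OF 1 Suc, of n x] by simp
qed

text \<open>As p divides w, the coefficient is modulo p^n a polynomial in w of degree below n, and
  differences of the remainder stay divisible by p^n.\<close>

lemma Es_fdiff_nth: "fdiff n (\<lambda>m. fps_nth (Es m) k) x \<in> R.pI n"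
proof -
  define g where "g = (\<lambda>m. \<Sum>j<n. fps_nth (EE k) j * wt p (kap m) ^ j)"
  define r where "r = (\<lambda>m. fps_nth (Es m) k - g m)"
  have "fdiff n (\<lambda>m. g m + r m) x \<in> R.pI n" unfolding fdiff_add
  proof (rule R.pI_add)
    have "fdiff n (\<lambda>m. \<Sum>j<J. fps_nth (EE k) j * wt p (kap m) ^ j) x \<in> R.pI n" for J
    proof (induction J)
      case 0
      have "fdiff n (\<lambda>_. 0) x = (0 :: 'c)" by (induction n arbitrary: x) auto
      thus ?case by (simp add: R.pI_zero)
    next
      case (Suc J)
      show ?case unfolding sum.lessThan_Suc fdiff_add fdiff_scale
        using fdiff_wt_kap_power[of n J x] by (intro R.pI_add Suc R.pI_mult_left Zq_D EE_Zq) simp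
    qed
    thus "fdiff n g x \<in> R.pI n" unfolding g_def .
    show "fdiff n r x \<in> R.pI n"
    proof (rule fdiff_closed[OF R.pI_diff])
      fix m
      show "r m \<in> R.pI n" unfolding R_pI_iff r_def g_def
        by (intro conjI Zp_diff Zp_sum Zp_mult Zp_power Zq_D EE_Zq Es_Zq wt_kap_Zp evals_approx[OF Es_eval nm_wt_kap])
    qed
  qed
  thus ?thesis by (simp add: r_def)
qed

lemma Es_fdiff: "\<exists>z\<in>Zq. fdiff n Es x = of_nat p ^ n * z"
proof -
  have "\<exists>z\<in>Zc. fps_nth (fdiff n Es x) k = of_nat p ^ n * z" for k
    using Es_fdiff_nth[of n k x] unfolding fdiff_fps_nth R.pI_def by auto
  then obtain z where z: "\<And>k. z k \<in> Zc" "\<And>k. fps_nth (fdiff n Es x) k = of_nat p ^ n * z k" by metis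
  show ?thesis by (intro bexI[of _ "Abs_fps z"] fps_ext) (auto simp: z Zq_def)
qed

end

section \<open>Overconvergence of the coefficients\<close>

lemma c_const_alt:
  assumes "p \<ge> 5"
  shows "c_const p = 2 * (real p ^ 2 - 3 * real p + 1) / (3 * (real p - 1)\<^sup>2 * (real p + 1))"
proof -
  have "(real p - 1)\<^sup>2 \<noteq> 0" using assms by simp
  moreover have "real p ^ 2 - 3 * real p + 1 = (real p - 1)\<^sup>2 - real p" by (simp add: power2_eq_square algebra_simps)
  ultimately have "1 - real p / (real p - 1)\<^sup>2 = (real p ^ 2 - 3 * real p + 1) / (real p - 1)\<^sup>2"
    by (simp only: diff_divide_distrib divide_self not_False_eq_True)
  thus ?thesis by (simp add: c_const_def)
qed

text \<open>In terms of t = p - 5 \<ge> 0 each inequality says that a polynomial with nonnegative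
  coefficients, possibly times t + 4, is nonnegative or positive. The last two bounds are the
  conditions of \<open>quotient_PP\<close>.\<close>

lemma c_const_bounds:
  assumes p: "p \<ge> 5"
  shows "0 < c_const p" "c_const p < 1"
    and "real p * c_const p \<le> (real p - 2) / real p * (real p - 2) / (real p - 1)"
    and "c_const p \<le> 1 / (real p + 2) * (real p - 2) / (real p - 1)"
proof -
  define t where "t = real p - 5"
  have t: "t \<ge> 0" and x: "real p = 5 + t" using p by (auto simp: t_def)
  have q: "real p ^ 2 - 3 * real p + 1 = t ^ 2 + 7 * t + 11" unfolding x by (simp add: power2_eq_square algebra_simps)
  have c: "c_const p = 2 * (t ^ 2 + 7 * t + 11) / (3 * (t + 4)\<^sup>2 * (t + 6))"
    unfolding c_const_alt[OF p] q unfolding x by (simp add: algebra_simps)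
  have pos: "3 * (t + 4)\<^sup>2 * (t + 6) > 0" using t by simp
  show "0 < c_const p" unfolding c using t pos by (intro divide_pos_pos) (auto intro!: add_nonneg_pos)
  have "2 * (t ^ 2 + 7 * t + 11) < 3 * (t + 4)\<^sup>2 * (t + 6)"
  proof -
    have "3 * (t + 4)\<^sup>2 * (t + 6) - 2 * (t ^ 2 + 7 * t + 11) = 3 * t ^ 3 + 40 * t ^ 2 + 178 * t + 266"
      by (simp add: power2_eq_square power3_eq_cube algebra_simps)
    moreover have "\<dots> > 0" using t by (intro add_nonneg_pos) auto
    ultimately show ?thesis by linarith
  qed
  thus "c_const p < 1" unfolding c using pos by (simp add: divide_less_eq_1)
  have "(5 + t) * (2 * (t ^ 2 + 7 * t + 11)) * ((5 + t) * (t + 4)) \<le> (t + 3) * (t + 3) * (3 * (t + 4)\<^sup>2 * (t + 6))"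
  proof -
    have "(t + 3) * (t + 3) * (3 * (t + 4)\<^sup>2 * (t + 6)) - (5 + t) * (2 * (t ^ 2 + 7 * t + 11)) * ((5 + t) * (t + 4)) =
      (t + 4) * (t ^ 4 + 14 * t ^ 3 + 67 * t ^ 2 + 132 * t + 98)"
      by (simp add: power2_eq_square power3_eq_cube power4_eq_xxxx algebra_simps)
    moreover have "\<dots> \<ge> 0" using t by (intro mult_nonneg_nonneg add_nonneg_nonneg) auto
    ultimately show ?thesis by linarith
  qed
  moreover have "(5 + t) * (t + 4) > 0" using t by simp
  ultimately have "(5 + t) * (2 * (t ^ 2 + 7 * t + 11)) / (3 * (t + 4)\<^sup>2 * (t + 6)) \<le> (t + 3) * (t + 3) / ((5 + t) * (t + 4))"
    using pos by (simp only: pos_divide_le_eq pos_le_divide_eq times_divide_eq_left)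
  moreover have "real p * c_const p = (5 + t) * (2 * (t ^ 2 + 7 * t + 11)) / (3 * (t + 4)\<^sup>2 * (t + 6))" unfolding c x by simp
  moreover have "(real p - 2) / real p * (real p - 2) / (real p - 1) = (t + 3) * (t + 3) / ((5 + t) * (t + 4))"
    unfolding x by (simp add: add.commute)
  ultimately show "real p * c_const p \<le> (real p - 2) / real p * (real p - 2) / (real p - 1)" by (simp only:)
  have "(2 * (t ^ 2 + 7 * t + 11)) * ((t + 7) * (t + 4)) \<le> (t + 3) * (3 * (t + 4)\<^sup>2 * (t + 6))"
  proof -
    have "(t + 3) * (3 * (t + 4)\<^sup>2 * (t + 6)) - (2 * (t ^ 2 + 7 * t + 11)) * ((t + 7) * (t + 4)) =
      (t + 4) * (t ^ 3 + 11 * t ^ 2 + 42 * t + 62)"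
      by (simp add: power2_eq_square power3_eq_cube algebra_simps)
    moreover have "\<dots> \<ge> 0" using t by (intro mult_nonneg_nonneg add_nonneg_nonneg) auto
    ultimately show ?thesis by linarith
  qed
  moreover have "(t + 7) * (t + 4) > 0" using t by simp
  ultimately have "2 * (t ^ 2 + 7 * t + 11) / (3 * (t + 4)\<^sup>2 * (t + 6)) \<le> (t + 3) / ((t + 7) * (t + 4))"
    using pos by (simp only: pos_divide_le_eq pos_le_divide_eq times_divide_eq_left)
  moreover have "1 / (real p + 2) * (real p - 2) / (real p - 1) = (t + 3) / ((t + 7) * (t + 4))"
    unfolding x by (simp add: add.commute)
  ultimately show "c_const p \<le> 1 / (real p + 2) * (real p - 2) / (real p - 1)" unfolding c by (simp only:)
qed

context padic_field
begin

lemma Ek_1: "Eis (p - 1) = Ek 1" by (simp add: Ek_def)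

lemma Eis_Zq: "Eis (p - 1) \<in> Zq" unfolding Ek_1 by (rule Ek_Zq) simp
lemma Eis_0: "fps_nth (Eis (p - 1)) 0 = (1 :: 'c)" unfolding Ek_1 by (rule Ek_nth_0)
lemma Eis_inverse: "Eis (p - 1) * inverse (Eis (p - 1)) = (1 :: 'c fps)"
  by (rule inverse_mult_eq_1', unfold Eis_0) simp

sublocale K: katz_algebra p Zq "fps_const ` Zc" "\<lambda>i. MF (i * (p - 1))" "Eis (p - 1)" "inverse (Eis (p - 1))"
  "V_op p" "Uop p" Ek Es
proof unfold_locales
  show "prime p" "5 \<le> p" by (rule prime_p, rule p_ge_5)
  show "1 \<in> Zq" by (rule Zq_one)
  show "x - y \<in> Zq" "x * y \<in> Zq" if "x \<in> Zq" "y \<in> Zq" for x y using that by (auto intro: Zq_diff Zq_mult)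
  show "fps_const ` Zc \<subseteq> Zq" by (auto intro: Zq_const)
  show "1 \<in> fps_const ` Zc" by (rule image_eqI[of _ _ 1]) auto
  show "x - y \<in> fps_const ` Zc" if "x \<in> fps_const ` Zc" "y \<in> fps_const ` Zc" for x y
    using that by (auto intro!: imageI Zp_diff)
  show "x * y \<in> fps_const ` Zc" if "x \<in> fps_const ` Zc" "y \<in> fps_const ` Zc" for x y
    using that by (auto intro!: imageI Zp_mult)
  show "\<exists>z\<in>fps_const ` Zc. of_nat n * z = 1" if "\<not> p dvd n" for n
  proof -
    have n1: "nm (of_nat n) = 1" by (rule nm_coprime_nat[OF that])
    hence "(of_nat n :: 'c) \<noteq> 0" by (metis nm_0 zero_neq_one)
    hence "of_nat n * fps_const (inverse (of_nat n :: 'c)) = 1"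
      by (simp add: fps_of_nat[symmetric] del: fps_of_nat)
    thus ?thesis using Zp_inverse[OF Zp_of_nat n1] by blast
  qed
  show "MF (i * (p - 1)) \<subseteq> Zq" for i using MF_Zq by blast
  show "0 \<in> MF (i * (p - 1))" for i by (rule MF_zero)
  show "x - y \<in> MF (i * (p - 1))" if "x \<in> MF (i * (p - 1))" "y \<in> MF (i * (p - 1))" for x y i
    using that by (rule MF_diff)
  show "s * x \<in> MF (i * (p - 1))" if "s \<in> fps_const ` Zc" "x \<in> MF (i * (p - 1))" for s x i
    using that by (auto intro: MF_scale)
  show "x * y \<in> MF ((i + j) * (p - 1))" if "x \<in> MF (i * (p - 1))" "y \<in> MF (j * (p - 1))" for x y i j
    using MF_mult[OF that(2,1)] by (simp add: distrib_right)
  show "1 \<in> MF (0 * (p - 1))" using MF_one by simp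
  show "x \<in> MF (i * (p - 1))" if "x \<in> Zq" "of_nat p * x \<in> MF (i * (p - 1))" for x i
    using that by (rule MF_sat)
  show "Eis (p - 1) \<in> MF (1 * (p - 1))" using Ek_MF[of 1] unfolding Ek_1 mult_1 mult_1_right by simp
  show "inverse (Eis (p - 1)) \<in> Zq" by (rule Zq_inverse[OF Eis_Zq], unfold Eis_0) simp
  show "Eis (p - 1) * inverse (Eis (p - 1)) = (1 :: 'c fps)" by (rule Eis_inverse)
  show "\<exists>z\<in>Zq. Eis (p - 1) = 1 + of_nat p * z" using Ek_cong[of 1] unfolding Ek_1 by simp
  show "V_op p (x + y) = V_op p x + V_op p y" "V_op p (x * y) = V_op p x * V_op p y" for x y :: "'c fps"
    by (rule V_add, rule V_mult)
  show "V_op p 1 = (1 :: 'c fps)" using V_const[of 1] by simp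
  show "V_op p x \<in> Zq" "Uop p x \<in> Zq" if "x \<in> Zq" for x using that by (rule V_Zq, rule U_Zq)
  show "V_op p x = x" if "x \<in> MF (0 * (p - 1))" for x using MF_weight_0[of x] that by (auto simp: V_const)
  show "Uop p (x + y) = Uop p x + Uop p y" for x y :: "'c fps" by (rule U_add)
  show "Uop p (V_op p x * y) = x * Uop p y" for x y :: "'c fps" by (rule U_V)
  show "of_nat p ^ ((p - 1) * i - 1) * V_op p x + Uop p x \<in> MF (i * (p - 1))" if "1 \<le> i" "x \<in> MF (i * (p - 1))" for i x
  proof -
    have "(p - 1) * i \<ge> 1" using that(1) p_gt_1 by (simp add: Suc_le_eq)
    thus ?thesis using MF_hecke[of x "(p - 1) * i"] that(2) by (simp only: mult.commute[of i])
  qed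
  show "Ek i \<in> MF (i * (p - 1))" if "1 \<le> i" for i using Ek_MF[OF that] by (simp only: mult.commute[of i])
  show "Es 0 = 1" by (rule Es_0)
  show "Es m \<in> Zq" for m by (rule Es_Zq)
  show "(1 - of_nat p ^ ((p - 1) * m - 1)) * Es m = Ek m - of_nat p ^ ((p - 1) * m - 1) * V_op p (Ek m)" if "1 \<le> m" for m
    by (rule Es_Ek[OF that refl])
  show "\<exists>z\<in>Zq. fdiff n Es k = of_nat p ^ n * z" for n k by (rule Es_fdiff)
qed

lemma K_pI_iff: "x \<in> K.pI N \<longleftrightarrow> x \<in> Zq \<and> (\<forall>n. nm (fps_nth x n) \<le> pe N)"
proof
  assume "x \<in> K.pI N"
  then obtain z where "z \<in> Zq" "x = of_nat p ^ N * z" unfolding K.pI_def by blast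
  thus "x \<in> Zq \<and> (\<forall>n. nm (fps_nth x n) \<le> pe N)"
    by (auto simp: Zq_def nm_p_power intro!: Zp_mult Zp_power nm_mult_le1 Zp_nm)
next
  assume x: "x \<in> Zq \<and> (\<forall>n. nm (fps_nth x n) \<le> pe N)"
  have "\<exists>z\<in>Zc. fps_nth x n = of_nat p ^ N * z" for n
    using Zp_divide_p[of "fps_nth x n" N] x by (auto simp: Zq_def)
  then obtain z where z: "\<And>n. z n \<in> Zc" "\<And>n. fps_nth x n = of_nat p ^ N * z n" by metis
  have "x = of_nat p ^ N * Abs_fps z" by (intro fps_ext) (simp add: z)
  moreover have "Abs_fps z \<in> Zq" by (simp add: Zq_def z)
  ultimately show "x \<in> K.pI N" unfolding K.pI_def by blast
qed

lemma K_pI_eq_0: "(\<And>N. x \<in> K.pI N) \<Longrightarrow> x = 0"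
  unfolding K_pI_iff by (intro fps_ext) (auto intro: nm_zeroI)

lemma wt_kap_eq: "wt p (kap m) = of_nat p * of_nat (K.tau m)"
  unfolding wt_kap K.tau_nat by simp

text \<open>The coefficient of w^j in the quotient, as a q-series: the transpose of
  \<open>FFq\<close>, whose coefficients are taken in q before w.\<close>

definition Fj :: "nat \<Rightarrow> 'c fps" where "Fj j = Abs_fps (\<lambda>n. fps_nth (fps_nth FFq n) j)"

lemma Fj_Zq: "Fj j \<in> Zq" using FFq_Zq by (simp add: Zq_def Fj_def)

lemma Es_quotient: "Es m / V_op p (Es m) = Es m * V_op p (inverse (Es m))"
proof -
  have "Es m * inverse (Es m) = 1" by (rule inverse_mult_eq_1') (simp add: Es_nth_0)
  hence "V_op p (Es m) * V_op p (inverse (Es m)) = V_op p 1" by (simp only: V_mult[symmetric])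
  hence "V_op p (inverse (Es m)) = inverse (V_op p (Es m))" using V_const[of 1] by (metis fps_inverse_unique fps_const_1_eq_1)
  moreover have "fps_nth (V_op p (Es m)) 0 \<noteq> 0" by (simp add: V_nth Es_nth_0)
  ultimately show ?thesis by (simp add: fps_divide_unit)
qed

theorem Fj_A: "of_nat p ^ j * Fj j \<in> K.A (c_const p)"
proof (rule K.PP_coeff)
  show "(\<lambda>m. Es m * V_op p (inverse (Es m))) \<in> K.PP (c_const p)"
  proof (rule K.quotient_PP)
    show "0 \<le> c_const p" "real p * c_const p \<le> K.drate ((real p - 2) / real p)" "c_const p \<le> K.drate (1 / (real p + 2))"
      using c_const_bounds[OF p_ge_5] by (auto simp: K.drate_def)
    show "inverse (Es m) \<in> Zq" for m by (rule Zq_inverse[OF Es_Zq]) (simp add: Es_nth_0)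
    show "Es m * inverse (Es m) = 1" for m by (rule inverse_mult_eq_1') (simp add: Es_nth_0)
  qed
  show "Fj j \<in> Zq" for j by (rule Fj_Zq)
  fix m J
  define w where "w = wt p (kap m)"
  have w: "of_nat p * of_nat (K.tau m) = fps_const w" unfolding w_def wt_kap_eq by (simp add: fps_of_nat[symmetric] del: fps_of_nat)
  have n: "fps_nth (Fj j * fps_const w ^ j) n = fps_nth (fps_nth FFq n) j * w ^ j" for n j by (simp add: Fj_def fps_const_power)
  show "Es m * V_op p (inverse (Es m)) - (\<Sum>j<J. Fj j * (of_nat p * of_nat (K.tau m)) ^ j) \<in> K.pI J"
    unfolding K_pI_iff w
  proof (intro conjI allI)
    show "Es m * V_op p (inverse (Es m)) - (\<Sum>j<J. Fj j * fps_const w ^ j) \<in> Zq"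
      by (intro Zq_diff Zq_mult Zq_sum Zq_power Zq_const V_Zq Es_Zq Fj_Zq Zq_inverse) (auto simp: Es_nth_0 w_def wt_kap_Zp)
    fix n
    have "nm (fps_nth (Es m / V_op p (Es m)) n - (\<Sum>j<J. fps_nth (fps_nth FFq n) j * w ^ j)) \<le> pe J"
      using evals_approx[OF FFq_eval[OF kap_B] nm_wt_kap] unfolding w_def Es_def .
    thus "nm (fps_nth (Es m * V_op p (inverse (Es m)) - (\<Sum>j<J. Fj j * fps_const w ^ j)) n) \<le> pe J"
      unfolding Es_quotient fps_sub_nth fps_sum_nth n .
  qed
qed

end

section \<open>Katz expansions\<close>

locale katz_setup = padic_field p ty for p :: nat and ty :: "'c :: {field_char_0, complete_space} itself" +
  fixes g :: "nat \<Rightarrow> nat \<Rightarrow> 'c fps"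
  assumes basis: "katz_basis p g"
begin

abbreviation E :: "'c fps" where "E \<equiv> Eis (p - 1)"
abbreviation Ei :: "'c fps" where "Ei \<equiv> inverse (Eis (p - 1))"
abbreviation M :: "nat \<Rightarrow> 'c fps set" where "M i \<equiv> MF (i * (p - 1))"
abbreviation B :: "nat \<Rightarrow> 'c fps set" where "B \<equiv> katz_B p g Zp"

lemma finite_ind: "finite (katz_index TYPE('c) p i)" by (simp add: katz_index_def)

lemma basis_D:
  assumes "i \<ge> 1"
  shows "\<And>j. j \<in> katz_index TYPE('c) p i \<Longrightarrow> g i j \<in> M i \<and> (\<forall>n<j. fps_nth (g i j) n = 0) \<and> fps_nth (g i j) j = 1"
    and "M i = {E * f + h | f h. f \<in> M (i - 1) \<and> h \<in> B i}"
    and "(\<lambda>f. E * f) ` M (i - 1) \<inter> B i = {0}"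
proof -
  note a = basis[unfolded katz_basis_def, folded MF_def, rule_format, OF assms]
  note b = a[THEN conjunct2]
  show "g i j \<in> M i \<and> (\<forall>n<j. fps_nth (g i j) n = 0) \<and> fps_nth (g i j) j = 1" if "j \<in> katz_index TYPE('c) p i" for j
    using a[THEN conjunct1] that by (rule bspec)
  show "M i = {E * f + h | f h. f \<in> M (i - 1) \<and> h \<in> B i}" by (rule b[THEN conjunct1])
  show "(\<lambda>f. E * f) ` M (i - 1) \<inter> B i = {0}" by (rule b[THEN conjunct2])
qed

lemma g_props:
  assumes "i \<ge> 1" "j \<in> katz_index TYPE('c) p i"
  shows "g i j \<in> M i" "n < j \<Longrightarrow> fps_nth (g i j) n = 0" "fps_nth (g i j) j = 1"
  using basis_D(1)[OF assms] by simp_all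

lemma g_Zq: "i \<ge> 1 \<Longrightarrow> j \<in> katz_index TYPE('c) p i \<Longrightarrow> g i j \<in> Zq" by (rule MF_Zq[OF g_props(1)])

lemma M_split:
  assumes "i \<ge> 1" "x \<in> M i"
  shows "\<exists>f\<in>M (i - 1). \<exists>h\<in>B i. x = E * f + h"
proof -
  have "x \<in> {E * f + h | f h. f \<in> M (i - 1) \<and> h \<in> B i}" using assms(2) unfolding basis_D(2)[OF assms(1)] .
  thus ?thesis by blast
qed

lemma M_direct:
  assumes "i \<ge> 1" "f \<in> M (i - 1)" "E * f \<in> B i"
  shows "E * f = 0"
proof -
  have "E * f \<in> (\<lambda>f. E * f) ` M (i - 1) \<inter> B i" using assms by (intro IntI imageI)
  thus ?thesis unfolding basis_D(3)[OF assms(1)] by simp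
qed

text \<open>Coordinates in the basis g_ij by triangular elimination, possible because g_ij starts
  with q^j. The recursion makes sense for every power series and is linear and norm-nonincreasing,
  so membership in B_i becomes being fixed by a projection, a condition that passes to limits and to
  larger coefficient rings.\<close>

fun co :: "nat \<Rightarrow> 'c fps \<Rightarrow> nat \<Rightarrow> 'c" where
  "co i x j = fps_nth x j - (\<Sum>k<j. if k \<in> katz_index TYPE('c) p i then co i x k * fps_nth (g i k) j else 0)"

declare co.simps [simp del]

lemma co_diff: "co i (x - y) j = co i x j - co i y j"
proof (induction j rule: less_induct)
  case (less j)
  have "(\<Sum>k<j. if k \<in> katz_index TYPE('c) p i then co i (x - y) k * fps_nth (g i k) j else 0) =
     (\<Sum>k<j. (if k \<in> katz_index TYPE('c) p i then co i x k * fps_nth (g i k) j else 0) - (if k \<in> katz_index TYPE('c) p i then co i y k * fps_nth (g i k) j else 0))"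
    by (intro sum.cong refl) (simp add: less left_diff_distrib)
  thus ?case unfolding co.simps[of i "x - y" j] co.simps[of i x j] co.simps[of i y j] by (simp add: sum_subtractf)
qed

lemma co_scale: "co i (fps_const c * x) j = c * co i x j"
proof (induction j rule: less_induct)
  case (less j)
  have "(\<Sum>k<j. if k \<in> katz_index TYPE('c) p i then co i (fps_const c * x) k * fps_nth (g i k) j else 0) =
     c * (\<Sum>k<j. (if k \<in> katz_index TYPE('c) p i then co i x k * fps_nth (g i k) j else 0))"
    unfolding sum_distrib_left by (intro sum.cong refl) (simp add: less)
  thus ?case unfolding co.simps[of i "fps_const c * x" j] co.simps[of i x j] by (simp add: right_diff_distrib)
qed

lemma co_bound:
  assumes "i \<ge> 1" "\<And>n. nm (fps_nth x n) \<le> e"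
  shows "nm (co i x j) \<le> e"
proof (induction j rule: less_induct)
  case (less j)
  have e: "0 \<le> e" using assms(2)[of 0] nm_ge_0 order.trans by blast
  show ?case unfolding co.simps[of i x j]
    by (intro nm_diff_le assms nm_sum_le e) (auto intro!: nm_mult_le1 less Zq_nm g_Zq assms e)
qed

definition sring :: "'c set \<Rightarrow> bool" where
  "sring R \<longleftrightarrow> Zp \<subseteq> R \<and> (\<forall>x\<in>R. \<forall>y\<in>R. x - y \<in> R \<and> x * y \<in> R)"

lemma sring_D: "sring R \<Longrightarrow> x \<in> R \<Longrightarrow> y \<in> R \<Longrightarrow> x - y \<in> R" "sring R \<Longrightarrow> x \<in> R \<Longrightarrow> y \<in> R \<Longrightarrow> x * y \<in> R"
  "sring R \<Longrightarrow> x \<in> Zp \<Longrightarrow> x \<in> R" "sring R \<Longrightarrow> 0 \<in> R"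
  using Zp_0 unfolding sring_def by blast+

lemma sring_add: "sring R \<Longrightarrow> x \<in> R \<Longrightarrow> y \<in> R \<Longrightarrow> x + y \<in> R"
  using sring_D(1)[of R x "0 - y"] sring_D(1)[of R 0 y] sring_D(4)[of R] by simp

lemma sring_sum: "sring R \<Longrightarrow> (\<And>i. i \<in> A \<Longrightarrow> f i \<in> R) \<Longrightarrow> sum f A \<in> R"
  by (rule sum_closed) (auto intro: sring_add sring_D)

lemma sring_Zp: "sring Zp" unfolding sring_def by (auto intro: Zp_diff Zp_mult)

lemma co_ring:
  assumes "i \<ge> 1" "sring R" "\<And>n. fps_nth x n \<in> R"
  shows "co i x j \<in> R"
proof (induction j rule: less_induct)
  case (less j)
  show ?case unfolding co.simps[of i x j]
  proof (intro sring_D(1) sring_sum assms)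
    fix k assume k: "k \<in> {..<j}"
    show "(if k \<in> katz_index TYPE('c) p i then co i x k * fps_nth (g i k) j else 0) \<in> R"
    proof (cases "k \<in> katz_index TYPE('c) p i")
      case True
      have "fps_nth (g i k) j \<in> R" by (rule sring_D(3)[OF assms(2) Zq_D[OF g_Zq[OF assms(1) True]]])
      thus ?thesis using True less k sring_D(2)[OF assms(2)] by simp
    qed (simp add: sring_D(4)[OF assms(2)])
  qed
qed

lemma co_g:
  assumes "i \<ge> 1" "k \<in> katz_index TYPE('c) p i"
  shows "j \<in> katz_index TYPE('c) p i \<Longrightarrow> co i (g i k) j = (if j = k then 1 else 0)"
proof (induction j rule: less_induct)
  case (less j)
  have "(\<Sum>l<j. if l \<in> katz_index TYPE('c) p i then co i (g i k) l * fps_nth (g i l) j else 0) =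
    (\<Sum>l<j. if l = k then fps_nth (g i k) j else 0)"
    by (intro sum.cong refl) (use less assms in auto)
  also have "\<dots> = (if k < j then fps_nth (g i k) j else 0)" by simp
  finally show ?case unfolding co.simps[of i "g i k" j] using g_props(2)[OF assms, of j] g_props(3)[OF assms]
    by (cases j k rule: linorder_cases) auto
qed

definition pr :: "nat \<Rightarrow> 'c fps \<Rightarrow> 'c fps" where
  "pr i x = (if i = 0 then fps_const (fps_nth x 0) else (\<Sum>j\<in>katz_index TYPE('c) p i. fps_const (co i x j) * g i j))"

lemma pr_diff: "pr i (x - y) = pr i x - pr i y"
  by (auto simp: pr_def co_diff fps_const_sub[symmetric] left_diff_distrib sum_subtractf simp del: fps_const_sub)

lemma pr_scale: "pr i (fps_const c * x) = fps_const c * pr i x"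
  by (auto simp: pr_def co_scale fps_const_mult[symmetric] mult.assoc sum_distrib_left simp del: fps_const_mult)

lemma pr_zero: "pr i 0 = 0" using pr_scale[of i 0 0] by simp

lemma pr_add: "pr i (x + y) = pr i x + pr i y"
  using pr_diff[of i x "0 - y"] pr_diff[of i 0 y] by (simp add: pr_zero)

lemma pr_sum: "pr i (sum f A) = (\<Sum>a\<in>A. pr i (f a))"
  by (induction A rule: infinite_finite_induct) (auto simp: pr_zero pr_add)

lemma pr_bound:
  assumes "\<And>n. nm (fps_nth x n) \<le> e"
  shows "nm (fps_nth (pr i x) n) \<le> e"
proof -
  have e: "0 \<le> e" using assms[of 0] nm_ge_0 order.trans by blast
  show ?thesis
  proof (cases "i = 0")
    case True
    thus ?thesis using assms e by (cases n) (auto simp: pr_def)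
  next
    case False
    hence "i \<ge> 1" by simp
    thus ?thesis using False unfolding pr_def
      by (auto simp: fps_sum_nth intro!: nm_sum_le e nm_mult_le1 co_bound assms Zq_nm g_Zq)
  qed
qed

lemma pr_g: "i \<ge> 1 \<Longrightarrow> k \<in> katz_index TYPE('c) p i \<Longrightarrow> pr i (g i k) = g i k"
proof -
  assume k: "i \<ge> 1" "k \<in> katz_index TYPE('c) p i"
  have "pr i (g i k) = (\<Sum>j\<in>katz_index TYPE('c) p i. if j = k then g i k else 0)" unfolding pr_def using k
    by (auto intro!: sum.cong simp: co_g)
  thus ?thesis using k finite_ind by simp
qed

lemma katz_B_iff:
  assumes R: "sring R"
  shows "x \<in> katz_B p g R i \<longleftrightarrow> pr i x = x \<and> (\<forall>n. fps_nth x n \<in> R)"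
proof (cases "i = 0")
  case True
  have 0: "0 \<in> R" using sring_D(4)[OF R] .
  show ?thesis
  proof
    assume "x \<in> katz_B p g R i"
    then obtain c where c: "c \<in> R" "x = fps_const c" using True by (auto simp: katz_B_def)
    thus "pr i x = x \<and> (\<forall>n. fps_nth x n \<in> R)" using 0 True by (simp add: pr_def)
  next
    assume x: "pr i x = x \<and> (\<forall>n. fps_nth x n \<in> R)"
    hence "fps_const (fps_nth x 0) = x" using True by (simp add: pr_def)
    moreover have "fps_const (fps_nth x 0) \<in> fps_const ` R" using x by blast
    ultimately show "x \<in> katz_B p g R i" using True by (simp add: katz_B_def)
  qed
next
  case False
  hence i: "i \<ge> 1" by simp
  show ?thesis
  proof
    assume "x \<in> katz_B p g R i"
    hence "x \<in> lin_span R (g i ` katz_index TYPE('c) p i)" using False by (simp add: katz_B_def)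
    thus "pr i x = x \<and> (\<forall>n. fps_nth x n \<in> R)"
    proof (induction rule: lin_span_induct)
      case zero
      show ?case using sring_D(4)[OF R] by (simp add: pr_zero)
    next
      case (add x c f)
      then obtain j where j: "j \<in> katz_index TYPE('c) p i" "f = g i j" by blast
      have "pr i (x + fps_const c * f) = x + fps_const c * f"
        using add.IH pr_g[OF i j(1)] by (simp add: pr_add pr_scale j(2))
      moreover have "fps_nth (x + fps_const c * f) n \<in> R" for n
        using add.IH add.hyps(1) sring_D(3)[OF R Zq_D[OF g_Zq[OF i j(1)]]] by (simp add: j(2) sring_add[OF R] sring_D(2)[OF R])
      ultimately show ?case by blast
    qed
  next
    assume x: "pr i x = x \<and> (\<forall>n. fps_nth x n \<in> R)"
    have "(\<Sum>j\<in>katz_index TYPE('c) p i. fps_const (co i x j) * g i j) \<in> lin_span R (g i ` katz_index TYPE('c) p i)"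
    proof (rule sum_closed)
      show "0 \<in> lin_span R (g i ` katz_index TYPE('c) p i)" by (rule lin_span_zero)
      show "u + v \<in> lin_span R (g i ` katz_index TYPE('c) p i)" if "u \<in> lin_span R (g i ` katz_index TYPE('c) p i)" "v \<in> lin_span R (g i ` katz_index TYPE('c) p i)" for u v
        by (rule lin_span_add[OF sring_D(4)[OF R] sring_add[OF R] that])
      show "fps_const (co i x j) * g i j \<in> lin_span R (g i ` katz_index TYPE('c) p i)" if "j \<in> katz_index TYPE('c) p i" for j
        using that x by (intro lin_span_base co_ring i R) auto
    qed
    hence "pr i x \<in> katz_B p g R i" using False by (simp add: pr_def katz_B_def)
    thus "x \<in> katz_B p g R i" using x by simp
  qed
qed

lemma B_iff: "x \<in> B i \<longleftrightarrow> pr i x = x \<and> x \<in> Zq"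
  unfolding katz_B_iff[OF sring_Zp] Zq_def by simp

lemma B_Zq: "x \<in> B i \<Longrightarrow> x \<in> Zq" by (simp add: B_iff)
lemma B_zero: "0 \<in> B i" by (simp add: B_iff pr_zero Zq_zero)
lemma B_diff: "x \<in> B i \<Longrightarrow> y \<in> B i \<Longrightarrow> x - y \<in> B i" by (simp add: B_iff pr_diff Zq_diff)
lemma B_scale: "x \<in> B i \<Longrightarrow> c \<in> Zp \<Longrightarrow> fps_const c * x \<in> B i" by (simp add: B_iff pr_scale Zq_mult Zq_const)

lemma p_power_fps: "of_nat p ^ e * x = fps_const (of_nat p ^ e) * x" for x :: "'c fps" by (intro fps_ext) simp

lemma B_p_power: "x \<in> B i \<Longrightarrow> of_nat p ^ e * x \<in> B i"
  unfolding p_power_fps by (rule B_scale) (auto intro: Zp_power)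

lemma B_divide:
  assumes "x \<in> B i" "x \<in> K.pI N"
  shows "\<exists>y\<in>B i. x = of_nat p ^ N * y"
proof -
  obtain y where y: "y \<in> Zq" "x = of_nat p ^ N * y" using assms(2) unfolding K.pI_def by blast
  have "of_nat p ^ N * pr i y = of_nat p ^ N * y" using assms(1) unfolding y(2) B_iff p_power_fps pr_scale by simp
  hence "pr i y = y" using p_gt_1 by simp
  thus ?thesis using y by (auto simp: B_iff)
qed

text \<open>The projection does not increase norms, so its fixed points are p-adically
  closed.\<close>

lemma B_closed:
  assumes "x \<in> Zq" "\<And>N. \<exists>y\<in>B i. x - y \<in> K.pI N"
  shows "x \<in> B i"
proof -
  have "pr i x - x \<in> K.pI N" for N
  proof -
    obtain y where y: "y \<in> B i" "x - y \<in> K.pI N" using assms(2) by blast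
    have e: "pr i x - x = pr i (x - y) - (x - y)" using y(1) by (simp add: pr_diff B_iff)
    have "nm (fps_nth (pr i (x - y)) n) \<le> pe N" for n by (rule pr_bound) (use y(2) in \<open>auto simp: K_pI_iff\<close>)
    moreover have "pr i (x - y) \<in> Zq"
    proof (cases "i = 0")
      case True
      have "fps_nth (x - y) 0 \<in> Zc" using y(2) unfolding K_pI_iff by (auto simp: Zq_def)
      thus ?thesis using Zq_const True by (simp add: pr_def)
    next
      case False
      hence i: "i \<ge> 1" by simp
      have "fps_nth (x - y) n \<in> Zc" for n using y(2) unfolding K_pI_iff by (auto simp: Zq_def)
      thus ?thesis unfolding pr_def using False by (auto intro!: Zq_sum Zq_mult Zq_const co_ring i sring_Zp g_Zq)
    qed
    ultimately have "pr i (x - y) \<in> K.pI N" unfolding K_pI_iff by blast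
    thus ?thesis unfolding e by (rule K.pI_diff[OF _ y(2)])
  qed
  hence "pr i x - x = 0" by (rule K_pI_eq_0)
  thus ?thesis using assms(1) by (simp add: B_iff)
qed

lemma B_0: "x \<in> M 0 \<Longrightarrow> x \<in> B 0" using MF_weight_0[of x] by (auto simp: katz_B_def)
lemma B_M: "x \<in> B i \<Longrightarrow> x \<in> M i"
proof (cases "i = 0")
  case True
  assume "x \<in> B i"
  then obtain c where "c \<in> Zp" "x = fps_const c" using True by (auto simp: katz_B_def)
  thus ?thesis using MF_scale[OF MF_one, of c] True by simp
next
  case False
  hence i: "i \<ge> 1" by simp
  assume "x \<in> B i"
  hence "x \<in> lin_span Zp (g i ` katz_index TYPE('c) p i)" using False by (simp add: katz_B_def)
  thus ?thesis
  proof (induction rule: lin_span_induct)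
    case (add x c f)
    then obtain j where j: "j \<in> katz_index TYPE('c) p i" "f = g i j" by blast
    show ?case unfolding j(2) by (intro MF_add MF_scale add g_props(1)[OF i j(1)])
  qed (rule MF_zero)
qed

lemma horner_sum: "(\<Sum>l\<le>Suc i. b l * e ^ (Suc i - l)) = e * (\<Sum>l\<le>i. b l * e ^ (i - l)) + b (Suc i)" for e :: "'a :: comm_ring_1"
proof -
  have "(\<Sum>l\<le>i. b l * e ^ (Suc i - l)) = (\<Sum>l\<le>i. e * (b l * e ^ (i - l)))"
    by (intro sum.cong refl) (simp add: Suc_diff_le mult.left_commute)
  thus ?thesis by (simp add: sum_distrib_left)
qed

lemma M_expand: "x \<in> M i \<Longrightarrow> \<exists>b. (\<forall>l. b l \<in> B l) \<and> x = (\<Sum>l\<le>i. b l * E ^ (i - l))"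
proof (induction i arbitrary: x)
  case 0
  show ?case using B_0[OF 0] B_zero by (intro exI[of _ "\<lambda>l. if l = 0 then x else 0"]) auto
next
  case (Suc i)
  obtain f h where fh: "f \<in> M i" "h \<in> B (Suc i)" "x = E * f + h" using M_split[OF _ Suc.prems] by auto
  obtain b where b: "\<forall>l. b l \<in> B l" "f = (\<Sum>l\<le>i. b l * E ^ (i - l))" using Suc.IH[OF fh(1)] by blast
  have "(\<Sum>l\<le>i. (b (Suc i := h)) l * E ^ (i - l)) = f" unfolding b(2) by (intro sum.cong) auto
  hence "x = (\<Sum>l\<le>Suc i. (b (Suc i := h)) l * E ^ (Suc i - l))"
    unfolding fh(3) horner_sum by (simp only: fun_upd_same)
  moreover have "\<forall>l. (b (Suc i := h)) l \<in> B l" using b fh by auto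
  ultimately show ?case by blast
qed

text \<open>The decomposition stays direct modulo p^N: the sum divided by p^N is a form by
  saturation, this form decomposes as well, and directness compares the two decompositions.\<close>

lemma M_cancel:
  assumes "i \<ge> 1" "f \<in> M (i - 1)" "h \<in> B i" "E * f + h \<in> K.pI N"
  shows "f \<in> K.pI N \<and> h \<in> K.pI N"
proof -
  have Mi: "E * f + h \<in> M i"
  proof (rule MF_add[OF _ B_M[OF assms(3)]])
    have "E \<in> M 1" using K.E_in by simp
    from MF_mult[OF assms(2) this] have "E * f \<in> MF ((1 + (i - 1)) * (p - 1))" by (simp only: distrib_right)
    thus "E * f \<in> M i" using assms(1) by simp
  qed
  obtain y where y: "y \<in> Zq" "E * f + h = of_nat p ^ N * y" using assms(4) unfolding K.pI_def by blast
  have "y \<in> M i" if "of_nat p ^ n * y \<in> M i" for n using that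
  proof (induction n)
    case (Suc n)
    have "of_nat p ^ n * y \<in> Zq" using y(1) by (auto simp: Zq_def intro!: Zp_mult Zp_power)
    thus ?case using Suc MF_sat[of "of_nat p ^ n * y"] by (simp add: mult.assoc)
  qed simp
  hence "y \<in> M i" using Mi y(2) by simp
  then obtain f' h' where fh: "f' \<in> M (i - 1)" "h' \<in> B i" "y = E * f' + h'" using M_split[OF assms(1)] by blast
  have e: "E * (f - of_nat p ^ N * f') = of_nat p ^ N * h' - h"
    using y(2) unfolding fh(3) by (simp add: algebra_simps)
  have "of_nat p ^ N * h' - h \<in> B i" by (intro B_diff B_p_power fh assms)
  moreover have "f - of_nat p ^ N * f' \<in> M (i - 1)"
    unfolding p_power_fps by (intro MF_diff MF_scale assms fh Zp_power Zp_of_nat)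
  ultimately have 0: "E * (f - of_nat p ^ N * f') = 0" using M_direct[OF assms(1)] e by metis
  moreover have "E \<noteq> 0" using Eis_0 by (metis fps_zero_nth zero_neq_one)
  ultimately have "f = of_nat p ^ N * f'" by simp
  moreover have "h = of_nat p ^ N * h'" using e 0 by simp
  ultimately show ?thesis using K.pI_I MF_Zq[OF fh(1)] B_Zq[OF fh(2)] by metis
qed

lemma M_expand_pI:
  assumes "\<And>l. b l \<in> B l"
  shows "(\<Sum>l\<le>i. b l * E ^ (i - l)) \<in> K.pI N \<Longrightarrow> l \<le> i \<Longrightarrow> b l \<in> K.pI N"
proof (induction i)
  case (Suc i)
  define f where "f = (\<Sum>l\<le>i. b l * E ^ (i - l))"
  have e: "(\<Sum>l\<le>Suc i. b l * E ^ (Suc i - l)) = E * f + b (Suc i)"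
    unfolding f_def by (rule horner_sum)
  have "f \<in> M i" unfolding f_def
  proof (rule sum_closed)
    fix l assume l: "l \<in> {..i}"
    have En: "E ^ n \<in> M n" for n
    proof (induction n)
      case (Suc n)
      have "E \<in> M 1" using K.E_in by simp
      from MF_mult[OF Suc this] show ?case by (simp only: power_Suc mult_Suc mult_1)
    qed (use MF_one in simp)
    from MF_mult[OF En[of "i - l"] B_M[OF assms[of l]]] have "b l * E ^ (i - l) \<in> MF ((l + (i - l)) * (p - 1))"
      by (simp only: distrib_right)
    thus "b l * E ^ (i - l) \<in> M i" using l by simp
  qed (auto intro: MF_zero MF_add)
  hence c: "f \<in> K.pI N \<and> b (Suc i) \<in> K.pI N" using M_cancel[of "Suc i" f "b (Suc i)" N] assms Suc.prems(1) unfolding e by simp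
  show ?case
  proof (cases "l = Suc i")
    case False
    hence "l \<le> i" using Suc.prems(2) by simp
    thus ?thesis using Suc.IH c unfolding f_def by blast
  qed (use c in simp)
qed simp

end

context katz_setup
begin

lemma E_Ei_power: "E ^ n * Ei ^ n = 1" unfolding power_mult_distrib[symmetric] Eis_inverse by simp

lemma Ei_Zq: "Ei ^ n \<in> Zq" by (intro Zq_power K.Ei_in)

text \<open>\<open>b\<close> is a finite Katz expansion of y. Its length is hidden behind all large
  L, so that expansions of different lengths can be added.\<close>

definition kz :: "'c fps \<Rightarrow> (nat \<Rightarrow> 'c fps) \<Rightarrow> bool" where
  "kz y b \<longleftrightarrow> (\<forall>l. b l \<in> B l) \<and> (\<exists>I. \<forall>L\<ge>I. y = (\<Sum>l<L. b l * Ei ^ l))"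

lemma kz_zero: "kz 0 (\<lambda>_. 0)" by (simp add: kz_def B_zero)

lemma kz_diff: "kz x a \<Longrightarrow> kz y b \<Longrightarrow> kz (x - y) (\<lambda>l. a l - b l)"
proof -
  assume "kz x a" "kz y b"
  then obtain I J where IJ: "\<And>L. L \<ge> I \<Longrightarrow> x = (\<Sum>l<L. a l * Ei ^ l)" "\<And>L. L \<ge> J \<Longrightarrow> y = (\<Sum>l<L. b l * Ei ^ l)"
    and B: "\<forall>l. a l \<in> B l" "\<forall>l. b l \<in> B l" unfolding kz_def by blast
  have "x - y = (\<Sum>l<L. (a l - b l) * Ei ^ l)" if "L \<ge> max I J" for L
    using IJ(1)[of L] IJ(2)[of L] that by (simp add: left_diff_distrib sum_subtractf)
  thus ?thesis using B B_diff unfolding kz_def by blast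
qed

lemma kz_add: "kz x a \<Longrightarrow> kz y b \<Longrightarrow> kz (x + y) (\<lambda>l. a l + b l)"
  using kz_diff[of x a "0 - y" "\<lambda>l. 0 - b l"] kz_diff[OF kz_zero, of y b] by simp

lemma kz_p_power: "kz x a \<Longrightarrow> kz (of_nat p ^ e * x) (\<lambda>l. of_nat p ^ e * a l)"
proof -
  assume "kz x a"
  then obtain I where I: "\<And>L. L \<ge> I \<Longrightarrow> x = (\<Sum>l<L. a l * Ei ^ l)" and B: "\<forall>l. a l \<in> B l" unfolding kz_def by blast
  have "of_nat p ^ e * x = (\<Sum>l<L. of_nat p ^ e * a l * Ei ^ l)" if "L \<ge> I" for L
    using I[OF that] by (simp add: sum_distrib_left mult.assoc)
  thus ?thesis using B B_p_power unfolding kz_def by blast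
qed

lemma kz_pI:
  assumes "kz y b" "y \<in> K.pI N"
  shows "b l \<in> K.pI N"
proof -
  obtain I where I: "\<And>L. L \<ge> I \<Longrightarrow> y = (\<Sum>l<L. b l * Ei ^ l)" and B: "\<And>l. b l \<in> B l"
    using assms(1) unfolding kz_def by blast
  define i where "i = I + l"
  have "y * E ^ i = (\<Sum>l\<le>i. b l * E ^ (i - l))"
  proof -
    have "y * E ^ i = (\<Sum>l<Suc i. b l * Ei ^ l) * E ^ i" using I[of "Suc i"] by (simp add: i_def)
    also have "\<dots> = (\<Sum>l<Suc i. b l * E ^ (i - l))"
      unfolding sum_distrib_right
    proof (intro sum.cong refl)
      fix l assume "l \<in> {..<Suc i}"
      hence "i = l + (i - l)" by simp
      hence "E ^ i = E ^ l * E ^ (i - l)" by (metis power_add)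
      hence "b l * Ei ^ l * E ^ i = b l * (E ^ l * Ei ^ l) * E ^ (i - l)" by (simp only: ac_simps)
      thus "b l * Ei ^ l * E ^ i = b l * E ^ (i - l)" unfolding E_Ei_power by simp
    qed
    finally show ?thesis by (simp only: lessThan_Suc_atMost)
  qed
  moreover have "y * E ^ i \<in> K.pI N" by (rule K.pI_mult_right[OF assms(2) Zq_power[OF Eis_Zq]])
  ultimately show ?thesis using M_expand_pI[OF B, of i N l] by (simp add: i_def)
qed

lemma Fil_kz: "x \<in> K.Fil i \<Longrightarrow> \<exists>b. kz x b \<and> (\<forall>l>i. b l = 0)"
proof -
  assume "x \<in> K.Fil i"
  hence "x * E ^ i \<in> M i" unfolding K.Fil_def by simp
  then obtain b where b: "\<forall>l. b l \<in> B l" "x * E ^ i = (\<Sum>l\<le>i. b l * E ^ (i - l))" using M_expand by blast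
  define b' where "b' = (\<lambda>l. if l \<le> i then b l else 0)"
  have "x = x * (E ^ i * Ei ^ i)" unfolding E_Ei_power by simp
  also have "\<dots> = (\<Sum>l\<le>i. b l * E ^ (i - l)) * Ei ^ i" by (simp only: b(2)[symmetric] mult.assoc)
  also have "\<dots> = (\<Sum>l\<le>i. b l * Ei ^ l)" unfolding sum_distrib_right
  proof (intro sum.cong refl)
    fix l assume "l \<in> {..i}"
    hence "i = (i - l) + l" by simp
    hence "Ei ^ i = Ei ^ (i - l) * Ei ^ l" by (metis power_add)
    hence "b l * E ^ (i - l) * Ei ^ i = b l * (E ^ (i - l) * Ei ^ (i - l)) * Ei ^ l" by (simp only: ac_simps)
    thus "b l * E ^ (i - l) * Ei ^ i = b l * Ei ^ l" unfolding E_Ei_power by simp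
  qed
  finally have x: "x = (\<Sum>l\<le>i. b l * Ei ^ l)" .
  have "x = (\<Sum>l<L. b' l * Ei ^ l)" if "L \<ge> Suc i" for L
    unfolding x using that by (intro sum.mono_neutral_cong_left) (auto simp: b'_def)
  moreover have "\<forall>l. b' l \<in> B l" using b(1) B_zero by (auto simp: b'_def)
  ultimately have "kz x b'" unfolding kz_def by blast
  thus ?thesis by (intro exI[of _ b']) (auto simp: b'_def)
qed

text \<open>An element of \<open>Fil i\<close> expands in degrees at most i, so a factor p^e with e
  \<ge> c i bounds all of its coefficients.\<close>

lemma A0_kz: "x \<in> K.A0 c 0 \<Longrightarrow> 0 \<le> c \<Longrightarrow> \<exists>b. kz x b \<and> (\<forall>l. b l \<in> K.pI (nat \<lceil>c * real l\<rceil>))"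
proof (induction rule: K.A0.induct)
  case A0_zero
  show ?case using kz_zero K.pI_zero by blast
next
  case (A0_step x y i e)
  obtain a where a: "kz x a" "\<forall>l. a l \<in> K.pI (nat \<lceil>c * real l\<rceil>)" using A0_step by blast
  obtain b where b: "kz y b" "\<forall>l>i. b l = 0" using Fil_kz A0_step by blast
  have "of_nat p ^ e * b l \<in> K.pI (nat \<lceil>c * real l\<rceil>)" for l
  proof (cases "l \<le> i")
    case True
    have "c * real l \<le> c * real i" using True A0_step by (intro mult_left_mono) auto
    hence "nat \<lceil>c * real l\<rceil> \<le> e" using A0_step by (simp add: ceiling_le_iff nat_le_iff)
    moreover have "of_nat p ^ e * b l \<in> K.pI e" using b(1) B_Zq unfolding kz_def by (intro K.pI_I) blast
    ultimately show ?thesis using K.pI_mono by blast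
  next
    case False
    thus ?thesis using b(2) K.pI_zero by simp
  qed
  thus ?case using kz_add[OF a(1) kz_p_power[OF b(1), of e]] a(2) K.pI_add by blast
qed

lemma K_pI_limit:
  assumes "\<And>N. X N \<in> Zq" "\<And>N. X (Suc N) - X N \<in> K.pI N"
  shows "\<exists>L\<in>Zq. \<forall>N. L - X N \<in> K.pI N"
proof -
  have "\<exists>L. \<forall>N. nm (L - fps_nth (X N) n) \<le> pe N" for n
    by (rule seq_conv[OF _ pe_mono pe_tendsto_0]) (use assms(2) in \<open>auto simp: K_pI_iff\<close>)
  then obtain L where L: "\<And>n N. nm (L n - fps_nth (X N) n) \<le> pe N" by metis
  have "L n \<in> Zc" for n
  proof (rule Zp_closed)
    fix N
    show "\<exists>y\<in>Zc. nm (L n - y) \<le> pe N" using L[of n N] Zq_D[OF assms(1)] by blast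
  qed
  hence "Abs_fps L \<in> Zq" by (simp add: Zq_def)
  moreover have "Abs_fps L - X N \<in> K.pI N" for N
    using Zq_diff[OF \<open>Abs_fps L \<in> Zq\<close> assms(1)] L by (simp add: K_pI_iff)
  ultimately show ?thesis by blast
qed

text \<open>The coefficients of the finite approximations converge because \<open>kz_pI\<close>
  turns congruences of sums into congruences of coefficients. The bound by \<open>m\<close> is
  recorded for a later division by p^m, the bound by c l controls the tails.\<close>

lemma A_kz:
  assumes x: "x \<in> K.A c" "x \<in> K.pI m" and c: "0 < c"
  shows "\<exists>b. (\<forall>l. b l \<in> B l) \<and> (\<forall>l. b l \<in> K.pI m) \<and> (\<forall>l. b l \<in> K.pI (nat \<lceil>c * real l\<rceil>)) \<and>
     (\<forall>N L. real N \<le> c * real L \<longrightarrow> x - (\<Sum>l<L. b l * Ei ^ l) \<in> K.pI N)"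
proof -
  have "\<exists>y b. x - y \<in> K.pI N \<and> kz y b \<and> (\<forall>l. b l \<in> K.pI (nat \<lceil>c * real l\<rceil>))" for N
  proof -
    obtain y where y: "y \<in> K.A0 c 0" "x - y \<in> K.pI N" using K.A_ex[OF x(1)] by blast
    moreover obtain b where "kz y b" "\<forall>l. b l \<in> K.pI (nat \<lceil>c * real l\<rceil>)" using A0_kz[OF y(1) less_imp_le[OF c]] by blast
    ultimately show ?thesis by blast
  qed
  then obtain y b where yb: "\<And>N. x - y N \<in> K.pI N" "\<And>N. kz (y N) (b N)" "\<And>N l. b N l \<in> K.pI (nat \<lceil>c * real l\<rceil>)" by metis
  have bB: "b N l \<in> B l" for N l using yb(2)[of N] unfolding kz_def by blast
  have step: "b (Suc N) l - b N l \<in> K.pI N" for N l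
  proof (rule kz_pI[OF kz_diff[OF yb(2) yb(2)]])
    have "x - y (Suc N) \<in> K.pI N" using K.pI_mono[OF yb(1)[of "Suc N"]] by simp
    from K.pI_diff[OF yb(1)[of N] this] show "y (Suc N) - y N \<in> K.pI N" by simp
  qed
  have "\<exists>L\<in>Zq. \<forall>N. L - b N l \<in> K.pI N" for l
    by (rule K_pI_limit[of "\<lambda>N. b N l"]) (rule B_Zq[OF bB], rule step)
  then obtain d where d: "\<And>l. d l \<in> Zq" "\<And>l N. d l - b N l \<in> K.pI N" by metis
  have dB: "d l \<in> B l" for l using d bB by (intro B_closed) blast+
  have lim: "d l \<in> K.pI n" if "\<And>N. N \<ge> n \<Longrightarrow> b N l \<in> K.pI n" for l n
    using K.pI_add[OF d(2)[of l n] that[of n]] by simp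
  have dm: "d l \<in> K.pI m" for l
  proof (rule lim)
    fix N assume "N \<ge> m"
    hence "x - y N \<in> K.pI m" using K.pI_mono yb(1) by blast
    from K.pI_diff[OF x(2) this] have "y N \<in> K.pI m" by simp
    thus "b N l \<in> K.pI m" by (rule kz_pI[OF yb(2)])
  qed
  have dc: "d l \<in> K.pI (nat \<lceil>c * real l\<rceil>)" for l by (rule lim) (rule yb(3))
  have "x - (\<Sum>l<L. d l * Ei ^ l) \<in> K.pI N" if NL: "real N \<le> c * real L" for N L
  proof -
    obtain I where I: "\<And>L. L \<ge> I \<Longrightarrow> y N = (\<Sum>l<L. b N l * Ei ^ l)" using yb(2)[of N] unfolding kz_def by blast
    define L' where "L' = max L I"
    have "y N - (\<Sum>l<L'. d l * Ei ^ l) = (\<Sum>l<L'. (b N l - d l) * Ei ^ l)"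
      using I[of L'] by (simp add: L'_def sum_subtractf left_diff_distrib)
    also have "\<dots> \<in> K.pI N" by (intro K.pI_sum K.pI_mult_right Ei_Zq K.pI_sym[OF d(2)])
    finally have 1: "x - (\<Sum>l<L'. d l * Ei ^ l) \<in> K.pI N" by (rule K.pI_trans[OF yb(1)])
    have "(\<Sum>l<L'. d l * Ei ^ l) - (\<Sum>l<L. d l * Ei ^ l) = (\<Sum>l\<in>{..<L'} - {..<L}. d l * Ei ^ l)"
      by (subst sum_diff) (auto simp: L'_def)
    also have "\<dots> \<in> K.pI N"
    proof (intro K.pI_sum K.pI_mult_right Ei_Zq)
      fix l assume "l \<in> {..<L'} - {..<L}"
      hence "c * real L \<le> c * real l" using c by (intro mult_left_mono) auto
      hence "real N \<le> c * real l" using NL by linarith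
      hence "N \<le> nat \<lceil>c * real l\<rceil>" by linarith
      thus "d l \<in> K.pI N" using K.pI_mono dc by blast
    qed
    finally show ?thesis by (rule K.pI_trans[OF 1])
  qed
  thus ?thesis using dB dm dc by blast
qed

text \<open>p^j F_j is in A(c_p) and divisible by p^j, so all its Katz coefficients are divisible by
  p^j; the quotients are the b_ij. The growth bound survives for p^j b_ij.\<close>

theorem Fj_kz:
  "\<exists>b. (\<forall>i j. b i j \<in> B i) \<and> (\<forall>i j. of_nat p ^ j * b i j \<in> K.pI (nat \<lceil>c_const p * real i\<rceil>)) \<and>
    (\<forall>j N L. real N \<le> c_const p * real L \<longrightarrow> of_nat p ^ j * (Fj j - (\<Sum>i<L. b i j * Ei ^ i)) \<in> K.pI N)"
proof -
  have c: "0 < c_const p" using c_const_bounds(1)[OF p_ge_5] .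
  define P where "P = (\<lambda>j b. (\<forall>i. b i \<in> B i) \<and> (\<forall>i. of_nat p ^ j * b i \<in> K.pI (nat \<lceil>c_const p * real i\<rceil>)) \<and>
     (\<forall>N L. real N \<le> c_const p * real L \<longrightarrow> of_nat p ^ j * (Fj j - (\<Sum>i<L. b i * Ei ^ i)) \<in> K.pI N))"
  have "\<exists>b. P j b" for j
  proof -
    obtain d where d: "\<forall>l. d l \<in> B l" "\<forall>l. d l \<in> K.pI j" "\<forall>l. d l \<in> K.pI (nat \<lceil>c_const p * real l\<rceil>)"
      "\<forall>N L. real N \<le> c_const p * real L \<longrightarrow> of_nat p ^ j * Fj j - (\<Sum>l<L. d l * Ei ^ l) \<in> K.pI N"
      using A_kz[OF Fj_A K.pI_I[OF Fj_Zq] c, of j] by auto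
    have "\<exists>y\<in>B l. d l = of_nat p ^ j * y" for l using d(1,2) by (intro B_divide) auto
    then obtain b where b: "\<And>l. b l \<in> B l" "\<And>l. d l = of_nat p ^ j * b l" by metis
    have "of_nat p ^ j * Fj j - (\<Sum>l<L. d l * Ei ^ l) = of_nat p ^ j * (Fj j - (\<Sum>i<L. b i * Ei ^ i))" for L
      unfolding b(2) by (simp only: right_diff_distrib sum_distrib_left mult.assoc)
    thus ?thesis using d(3,4) b unfolding P_def by (intro exI[of _ b]) simp
  qed
  then obtain b where b: "\<And>j. P j (b j)" by metis
  show ?thesis
  proof (intro exI[of _ "\<lambda>i j. b j i"] conjI allI impI)
    show "b j i \<in> B i" "of_nat p ^ j * b j i \<in> K.pI (nat \<lceil>c_const p * real i\<rceil>)" for i j using b[of j] by (simp_all add: P_def)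
    show "of_nat p ^ j * (Fj j - (\<Sum>i<L. b j i * Ei ^ i)) \<in> K.pI N" if "real N \<le> c_const p * real L" for j N L
      using b[of j] that by (simp add: P_def)
  qed
qed

end

section \<open>The theorem\<close>

context padic_field
begin

lemma pe_powr: "pe n = real p powr (- real n)"
  using p_pos by (simp add: pe_def powr_minus powr_realpow power_one_over inverse_eq_divide)

lemma vp_ge_iff: "ereal t \<le> vp p x \<longleftrightarrow> nm x \<le> real p powr (- t)"
proof (cases "x = 0")
  case False
  have p1: "1 < real p" using p_gt_1 by simp
  have "ereal t \<le> vp p x \<longleftrightarrow> log (real p) (nm x) \<le> - t" using False by (auto simp: vp_def nm_def)
  also have "\<dots> \<longleftrightarrow> nm x \<le> real p powr (- t)" using p1 False by (intro log_le_iff) auto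
  finally show ?thesis .
qed (simp add: vp_def)

lemma vp_fps_ge_iff: "ereal t \<le> vp_fps p f \<longleftrightarrow> (\<forall>n. nm (fps_nth f n) \<le> real p powr (- t))"
  unfolding vp_fps_def le_INF_iff vp_ge_iff by simp

lemma nm_zero_power: "nm w < 1 \<Longrightarrow> (\<And>J. nm x \<le> nm w ^ J) \<Longrightarrow> x = 0"
proof (rule ccontr)
  assume w: "nm w < 1" "\<And>J. nm x \<le> nm w ^ J" and "x \<noteq> 0"
  then obtain J where "nm w ^ J < nm x" using power_small[of "nm w" "nm x"] by auto
  thus False using w(2)[of J] by simp
qed

lemma nm_fps_mult_le:
  assumes "\<And>n. nm (fps_nth x n) \<le> e" "y \<in> Zq"
  shows "nm (fps_nth (x * y) n) \<le> e"
proof -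
  have "0 \<le> e" using assms(1)[of 0] nm_ge_0 order.trans by blast
  thus ?thesis unfolding fps_mult_nth by (intro nm_sum_le nm_mult_le1 assms Zq_nm)
qed

end

context katz_setup
begin

section \<open>Specialisation at a character and growth of the coefficients\<close>

definition gen_field :: "('c \<Rightarrow> 'c) \<Rightarrow> 'c set" where
  "gen_field \<kappa> = \<Inter>{K. is_subfield K \<and> Qp \<subseteq> K \<and> \<kappa> ` Zp_units \<subseteq> K}"

lemma gen_field_ring:
  "x \<in> gen_field \<kappa> \<Longrightarrow> y \<in> gen_field \<kappa> \<Longrightarrow> x - y \<in> gen_field \<kappa>"
  "x \<in> gen_field \<kappa> \<Longrightarrow> y \<in> gen_field \<kappa> \<Longrightarrow> x * y \<in> gen_field \<kappa>"
  "x \<in> Zp \<Longrightarrow> x \<in> gen_field \<kappa>" "x \<in> Zp_units \<Longrightarrow> \<kappa> x \<in> gen_field \<kappa>"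
proof -
  have ZQ: "(Zp :: 'c set) \<subseteq> Qp" unfolding Zp_def Qp_def by (intro closure_mono Ints_subset_Rats)
  show "x \<in> gen_field \<kappa> \<Longrightarrow> y \<in> gen_field \<kappa> \<Longrightarrow> x - y \<in> gen_field \<kappa>"
    and "x \<in> gen_field \<kappa> \<Longrightarrow> y \<in> gen_field \<kappa> \<Longrightarrow> x * y \<in> gen_field \<kappa>"
    unfolding gen_field_def is_subfield_def by blast+
  show "x \<in> Zp \<Longrightarrow> x \<in> gen_field \<kappa>" "x \<in> Zp_units \<Longrightarrow> \<kappa> x \<in> gen_field \<kappa>"
    using ZQ unfolding gen_field_def by blast+
qed

lemma gen_field_sring: "sring (gen_field \<kappa>)"
  unfolding sring_def using gen_field_ring by blast

lemma value_ring_iff: "x \<in> value_ring p \<kappa> \<longleftrightarrow> (\<forall>e>0. \<exists>y\<in>gen_field \<kappa>. nm (x - y) < e) \<and> nm x \<le> 1"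
proof -
  have "0 \<le> vp p x \<longleftrightarrow> nm x \<le> 1" using vp_ge_iff[of 0 x] p_gt_1 by (simp add: zero_ereal_def)
  moreover have "x \<in> value_field \<kappa> \<longleftrightarrow> (\<forall>e>0. \<exists>y\<in>gen_field \<kappa>. nm (x - y) < e)"
    unfolding value_field_def gen_field_def[symmetric] closure_approachable dist_nm by (simp only: nm_minus_commute[of x])
  ultimately show ?thesis by (simp add: value_ring_def)
qed

lemma value_ring_sring: "sring (value_ring p \<kappa>)"
  unfolding sring_def
proof (intro conjI subsetI ballI)
  fix x :: 'c assume x: "x \<in> Zp"
  show "x \<in> value_ring p \<kappa>" unfolding value_ring_iff
    using gen_field_ring(3)[OF x] Zp_nm[OF x] by (auto intro!: bexI[of _ x])
next
  fix x y assume xy: "x \<in> value_ring p \<kappa>" "y \<in> value_ring p \<kappa>"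
  hence n: "nm x \<le> 1" "nm y \<le> 1" unfolding value_ring_iff by auto
  show "x - y \<in> value_ring p \<kappa>" unfolding value_ring_iff
  proof (intro conjI allI impI nm_diff_le n)
    fix e :: real assume "e > 0"
    then obtain x' y' where a: "x' \<in> gen_field \<kappa>" "y' \<in> gen_field \<kappa>" "nm (x - x') < e" "nm (y - y') < e"
      using xy unfolding value_ring_iff by blast
    have "nm ((x - x') - (y - y')) < e" using nm_diff[of "x - x'" "y - y'"] a(3,4) by linarith
    moreover have "(x - x') - (y - y') = x - y - (x' - y')" by simp
    ultimately have "nm (x - y - (x' - y')) < e" "x' - y' \<in> gen_field \<kappa>" using gen_field_ring(1)[OF a(1,2)] by (simp_all only:)
    thus "\<exists>z\<in>gen_field \<kappa>. nm (x - y - z) < e" by blast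
  qed
  show "x * y \<in> value_ring p \<kappa>" unfolding value_ring_iff
  proof (intro conjI allI impI nm_mult_le1 n)
    fix e :: real assume e: "e > 0"
    hence "min e 1 > 0" by simp
    then obtain x' y' where a: "x' \<in> gen_field \<kappa>" "y' \<in> gen_field \<kappa>" "nm (x - x') < min e 1" "nm (y - y') < min e 1"
      using xy unfolding value_ring_iff by blast
    have "nm y' \<le> max (nm y) (nm (y - y'))" using nm_diff[of y "y - y'"] by simp
    hence y': "nm y' \<le> 1" using n(2) a(4) by linarith
    have "nm (x * (y - y')) \<le> nm (y - y')" "nm ((x - x') * y') \<le> nm (x - x')"
      by (intro nm_mult_le1' n order.refl) (intro nm_mult_le1 y' order.refl)
    hence "nm (x * (y - y') + (x - x') * y') < e"
      using nm_add[of "x * (y - y')" "(x - x') * y'"] a(3,4) by linarith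
    moreover have "x * y - x' * y' = x * (y - y') + (x - x') * y'" by (simp add: algebra_simps)
    ultimately show "\<exists>z\<in>gen_field \<kappa>. nm (x * y - z) < e"
      using gen_field_ring(2)[OF a(1,2)] by (intro bexI[of _ "x' * y'"]) simp_all
  qed
qed

lemma beta_evals:
  assumes "\<And>j. b j \<in> Zq" "nm w < 1"
  shows "evals w (Abs_fps (\<lambda>j. fps_nth (b j) n)) (fps_nth (katz_beta b w) n)"
proof -
  have "Abs_fps (\<lambda>j. fps_nth (b j) n) \<in> Zq" using Zq_D[OF assms(1)] by (simp add: Zq_def)
  then obtain x where x: "evals w (Abs_fps (\<lambda>j. fps_nth (b j) n)) x" using evals_ex[OF assms(2)] by blast
  from evals_sums[OF assms(2) x] have "x = fps_nth (katz_beta b w) n" by (simp add: katz_beta_def sums_iff)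
  thus ?thesis using x by simp
qed

lemma beta_approx:
  assumes "\<And>j. b j \<in> Zq" "nm w < 1"
  shows "nm (fps_nth (katz_beta b w - (\<Sum>j<J. fps_const (w ^ j) * b j)) n) \<le> nm w ^ J"
  using beta_evals[where b = b and w = w and n = n, OF assms] unfolding evals_def by (simp add: fps_sum_nth mult.commute)

lemma beta_pr:
  assumes "\<And>j. b j \<in> B i" "nm w < 1"
  shows "pr i (katz_beta b w) = katz_beta b w"
proof (rule fps_ext)
  fix n
  have Z: "\<And>j. b j \<in> Zq" using assms(1) B_Zq by blast
  have "fps_nth (pr i (katz_beta b w)) n - fps_nth (katz_beta b w) n = 0"
  proof (rule nm_zero_power[OF assms(2)])
    fix J
    define s where "s = (\<Sum>j<J. fps_const (w ^ j) * b j)"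
    have "pr i s = s" using assms(1) by (simp add: s_def pr_sum pr_scale B_iff)
    hence e: "pr i (katz_beta b w) - katz_beta b w = pr i (katz_beta b w - s) - (katz_beta b w - s)" by (simp add: pr_diff)
    have n: "\<And>n. nm (fps_nth (katz_beta b w - s) n) \<le> nm w ^ J" unfolding s_def by (rule beta_approx[OF Z assms(2)])
    have "nm (fps_nth (pr i (katz_beta b w) - katz_beta b w) n) \<le> nm w ^ J"
      unfolding e fps_sub_nth[of "pr i (katz_beta b w - s)"] by (intro nm_diff_le pr_bound n)
    thus "nm (fps_nth (pr i (katz_beta b w)) n - fps_nth (katz_beta b w) n) \<le> nm w ^ J" by simp
  qed
  thus "fps_nth (pr i (katz_beta b w)) n = fps_nth (katz_beta b w) n" by simp
qed

text \<open>w and the partial sums lie in the field generated by the values of kappa, but the value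
  of the series in general only in its closure, which is why \<open>value_field\<close> is
  closed.\<close>

lemma beta_katz_B:
  assumes b: "\<And>j. b j \<in> B i" and \<kappa>: "\<kappa> \<in> weight_chars_B p"
  shows "katz_beta b (wt p \<kappa>) \<in> katz_B p g (value_ring p \<kappa>) i"
proof -
  define w where "w = wt p \<kappa>"
  have w: "nm w < 1" using \<kappa> char_w_small(1) unfolding w_def weight_chars_B_def by blast
  have Z: "\<And>j. b j \<in> Zq" using b B_Zq by blast
  have "1 + of_nat p \<in> (Zp_units :: 'c set)" using one_plus_unit[of 1] by simp
  hence wF: "w \<in> gen_field \<kappa>" unfolding w_def wt_def by (intro gen_field_ring(1) gen_field_ring(4) gen_field_ring(3)[OF Zp_1])
  have wF': "w ^ j \<in> gen_field \<kappa>" for j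
    by (induction j) (auto intro: gen_field_ring(2) wF gen_field_ring(3)[OF Zp_1])
  have "fps_nth (katz_beta b w) n \<in> value_ring p \<kappa>" for n
    unfolding value_ring_iff
  proof (intro conjI allI impI)
    show "nm (fps_nth (katz_beta b w) n) \<le> 1" by (rule evals_nm[OF beta_evals[OF Z w]])
    fix e :: real assume "e > 0"
    then obtain J where J: "nm w ^ J < e" using power_small[of "nm w" e] w by auto
    have "nm (fps_nth (katz_beta b w) n - (\<Sum>j<J. w ^ j * fps_nth (b j) n)) \<le> nm w ^ J"
      using beta_approx[where b = b and w = w and J = J and n = n, OF Z w] by (simp add: fps_sum_nth)
    moreover have "(\<Sum>j<J. w ^ j * fps_nth (b j) n) \<in> gen_field \<kappa>"
      by (intro sring_sum[OF gen_field_sring] gen_field_ring(2) wF' gen_field_ring(3) Zq_D Z)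
    ultimately show "\<exists>y\<in>gen_field \<kappa>. nm (fps_nth (katz_beta b w) n - y) < e" using J by (meson le_less_trans)
  qed
  thus ?thesis unfolding katz_B_iff[OF value_ring_sring] using beta_pr[OF b w] by (simp add: w_def)
qed

text \<open>Split at j = t/2. Up to there the coefficient has norm at most p^(-(t-j)) \<le>
  p^(-t/2); beyond it the factor |w|^j suffices. Both bounds are expressed through m = max(1/p,
  |w|).\<close>

lemma beta_growth_bound:
  assumes bZ: "\<And>j. b j \<in> Zq" and bc: "\<And>j. of_nat p ^ j * b j \<in> K.pI (nat \<lceil>t\<rceil>)" and t: "t \<ge> 0"
    and w: "nm w < 1" and m: "m = max (1 / real p) (nm w)"
  shows "nm (fps_nth (katz_beta b w) n) \<le> m powr (t / 2)"
proof -
  have m0: "m > 0" "m \<le> 1" "nm w \<le> m" "1 / real p \<le> m" using p_gt_1 w unfolding m by (auto simp: less_max_iff_disj)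
  have tm: "nm (w ^ j * fps_nth (b j) n) \<le> m powr (t / 2)" for j
  proof (cases "real j \<le> t / 2")
    case True
    have "nm (of_nat p ^ j * fps_nth (b j) n) \<le> pe (nat \<lceil>t\<rceil>)" using bc[of j] unfolding K_pI_iff by simp
    hence "pe j * nm (fps_nth (b j) n) \<le> pe (nat \<lceil>t\<rceil>)" by (simp add: nm_mult nm_p_power)
    hence "nm (fps_nth (b j) n) \<le> pe (nat \<lceil>t\<rceil>) / pe j" by (simp add: pos_le_divide_eq mult.commute)
    also have "\<dots> = real p powr (- real (nat \<lceil>t\<rceil>) - (- real j))" unfolding pe_powr powr_diff ..
    also have "\<dots> \<le> real p powr (- (t / 2))"
    proof (rule powr_mono)
      have "t \<le> real (nat \<lceil>t\<rceil>)" by linarith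
      thus "- real (nat \<lceil>t\<rceil>) - (- real j) \<le> - (t / 2)" using True by linarith
      show "1 \<le> real p" using p_gt_1 by simp
    qed
    also have "\<dots> = (1 / real p) powr (t / 2)" using p_pos by (simp add: powr_minus powr_divide inverse_eq_divide)
    also have "\<dots> \<le> m powr (t / 2)" using m0 t by (intro powr_mono2) auto
    finally have 1: "nm (fps_nth (b j) n) \<le> m powr (t / 2)" .
    have "nm (w ^ j) \<le> 1" using w by (simp add: nm_power power_le_one)
    thus ?thesis by (rule nm_mult_le1'[OF 1])
  next
    case False
    have "nm (w ^ j) \<le> m ^ j" unfolding nm_power using m0 by (intro power_mono) auto
    also have "\<dots> = m powr real j" using m0 by (simp add: powr_realpow)
    also have "\<dots> \<le> m powr (t / 2)" using False m0 by (intro powr_mono') auto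
    finally show ?thesis by (rule nm_mult_le1[OF _ Zq_nm[OF bZ]])
  qed
  have mp: "m powr (t / 2) > 0" using m0 by simp
  then obtain J where J: "nm w ^ J < m powr (t / 2)" using power_small[of "nm w" "m powr (t / 2)"] w by auto
  define s where "s = (\<Sum>j<J. w ^ j * fps_nth (b j) n)"
  have "nm (fps_nth (katz_beta b w) n - s) \<le> nm w ^ J"
    using beta_approx[where b = b and w = w and J = J and n = n, OF bZ w] unfolding s_def by (simp add: fps_sum_nth)
  hence 1: "nm (fps_nth (katz_beta b w) n - s) \<le> m powr (t / 2)" using J by linarith
  have "nm s \<le> m powr (t / 2)" unfolding s_def using mp by (intro nm_sum_le tm) auto
  from nm_add_le[OF 1 this] show ?thesis by simp
qed

lemma beta_growth:
  assumes bZ: "\<And>i j. b i j \<in> Zq" and bc: "\<And>i j. of_nat p ^ j * b i j \<in> K.pI (nat \<lceil>c * real i\<rceil>)" and c: "c > 0"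
    and w: "nm w < 1"
  shows "\<exists>\<rho>>0. (\<lambda>i. vp_fps p (katz_beta (b i) w) - ereal (\<rho> * real i)) \<longlonglongrightarrow> \<infinity>"
proof -
  define m where "m = max (1 / real p) (nm w)"
  have m0: "m > 0" "m < 1" using p_gt_1 w unfolding m_def by (auto simp: less_max_iff_disj)
  have p1: "real p > 1" using p_gt_1 by simp
  define v where "v = - log (real p) m"
  have v: "v > 0" unfolding v_def using m0 p1 by simp
  \<comment> \<open>Half of the rate c v / 2 that \<open>beta_growth_bound\<close> provides; the
    other half makes the difference tend to infinity.\<close>
  define \<rho> where "\<rho> = c * v / 4"
  have \<rho>: "\<rho> > 0" using c v by (simp add: \<rho>_def)
  have ge: "ereal (2 * \<rho> * real i) \<le> vp_fps p (katz_beta (b i) w)" for i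
    unfolding vp_fps_ge_iff
  proof
    fix n
    have "nm (fps_nth (katz_beta (b i) w) n) \<le> m powr (c * real i / 2)"
      by (rule beta_growth_bound[OF bZ bc _ w m_def]) (use c in auto)
    also have "m = real p powr (- v)" using m0 p1 by (simp add: v_def)
    also have "(real p powr (- v)) powr (c * real i / 2) = real p powr (- (2 * \<rho> * real i))"
      unfolding powr_powr by (simp add: \<rho>_def mult_ac)
    finally show "nm (fps_nth (katz_beta (b i) w) n) \<le> real p powr (- (2 * \<rho> * real i))" .
  qed
  have "(\<lambda>i. vp_fps p (katz_beta (b i) w) - ereal (\<rho> * real i)) \<longlonglongrightarrow> \<infinity>"
    unfolding tendsto_PInfty
  proof
    fix r :: real
    have "eventually (\<lambda>i. r / \<rho> < real i) sequentially"
      using filterlim_real_sequentially unfolding filterlim_at_top_dense by blast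
    thus "eventually (\<lambda>i. ereal r < vp_fps p (katz_beta (b i) w) - ereal (\<rho> * real i)) sequentially"
    proof eventually_elim
      case (elim i)
      have "r < \<rho> * real i" using elim \<rho> by (simp add: pos_divide_less_eq mult.commute)
      hence "ereal r < ereal (2 * \<rho> * real i) - ereal (\<rho> * real i)" by simp
      also have "\<dots> \<le> vp_fps p (katz_beta (b i) w) - ereal (\<rho> * real i)" by (intro ereal_minus_mono ge order.refl)
      finally show ?case .
    qed
  qed
  thus ?thesis using \<rho> by blast
qed

lemma divide_E_power: "x / E ^ i = x * Ei ^ i"
  by (subst fps_divide_unit) (simp_all add: fps_inverse_power fps_power_zeroth Eis_0[unfolded One_nat_def])

text \<open>Three errors: \<open>T1\<close> truncates the quotient at w^J, \<open>T2\<close>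
  truncates the Katz expansions of the F_j with j < J, and \<open>T3\<close> truncates the
  coefficients beta_i at w^J.\<close>

lemma beta_sums:
  assumes bB: "\<And>i j. b i j \<in> B i"
    and s: "\<And>j N L. real N \<le> c * real L \<Longrightarrow> of_nat p ^ j * (Fj j - (\<Sum>i<L. b i j * Ei ^ i)) \<in> K.pI N"
    and c: "c > 0" and \<kappa>: "\<kappa> \<in> weight_chars_B p"
  shows "(\<lambda>i. fps_nth (katz_beta (b i) (wt p \<kappa>) / E ^ i) n) sums fps_nth (Eis_star p \<kappa> / V_op p (Eis_star p \<kappa>)) n"
  unfolding sums_def LIMSEQ_nm_iff divide_E_power
proof (intro allI impI)
  fix e :: real assume e: "e > 0"
  define w where "w = wt p \<kappa>"
  have w: "nm w < 1" using \<kappa> char_w_small(1) unfolding w_def weight_chars_B_def by blast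
  have bZ: "\<And>i j. b i j \<in> Zq" using bB B_Zq by blast
  define H where "H = fps_nth (Eis_star p \<kappa> / V_op p (Eis_star p \<kappa>)) n"
  obtain J where J: "nm w ^ J < e" using power_small[of "nm w" e] w e by auto
  \<comment> \<open>The Katz expansion of F_j is controlled only after multiplication by p^j, so the
    precision p^N has to absorb p^J.\<close>
  obtain N where N: "pe N < e * pe J" using pe_small[of "e * pe J"] e by auto
  show "\<exists>L0. \<forall>L\<ge>L0. nm ((\<Sum>i<L. fps_nth (katz_beta (b i) (wt p \<kappa>) * Ei ^ i) n) - fps_nth (Eis_star p \<kappa> / V_op p (Eis_star p \<kappa>)) n) < e"
    unfolding w_def[symmetric] H_def[symmetric]
  proof (intro exI[of _ "nat \<lceil>real N / c\<rceil>"] allI impI)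
    fix L assume "L \<ge> nat \<lceil>real N / c\<rceil>"
    hence "real N / c \<le> real L" by linarith
    hence NL: "real N \<le> c * real L" using c by (simp add: pos_divide_le_eq mult.commute)
    define T1 where "T1 = H - (\<Sum>j<J. fps_nth (Fj j) n * w ^ j)"
    define D where "D = (\<lambda>j. Fj j - (\<Sum>i<L. b i j * Ei ^ i))"
    define T2 where "T2 = (\<Sum>j<J. fps_nth (D j) n * w ^ j)"
    define R where "R = (\<lambda>i. katz_beta (b i) w - (\<Sum>j<J. fps_const (w ^ j) * b i j))"
    define T3 where "T3 = (\<Sum>i<L. fps_nth (R i * Ei ^ i) n)"
    have 1: "nm T1 < e"
    proof -
      have "evals w (fps_nth FFq n) H" unfolding w_def H_def by (rule FFq_eval[OF \<kappa>])
      hence "nm T1 \<le> nm w ^ J" unfolding evals_def T1_def Fj_def by simp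
      thus ?thesis using J by simp
    qed
    have 2: "nm T2 \<le> pe N / pe J" unfolding T2_def
    proof (rule nm_sum_le)
      fix j assume j: "j \<in> {..<J}"
      have "nm (of_nat p ^ j * fps_nth (D j) n) \<le> pe N"
        using s[OF NL, of j] unfolding K_pI_iff D_def of_nat_power_mult_fps_nth by blast
      hence "pe j * nm (fps_nth (D j) n) \<le> pe N" by (simp add: nm_mult nm_p_power)
      moreover have "pe J * nm (fps_nth (D j) n) \<le> pe j * nm (fps_nth (D j) n)"
        using j by (intro mult_right_mono pe_mono) auto
      ultimately have "nm (fps_nth (D j) n) \<le> pe N / pe J" by (simp add: pos_le_divide_eq mult.commute)
      moreover have "nm (w ^ j) \<le> 1" using w by (simp add: nm_power power_le_one)
      ultimately show "nm (fps_nth (D j) n * w ^ j) \<le> pe N / pe J" by (rule nm_mult_le1)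
    qed simp
    have "pe N / pe J < e" using N by (simp add: pos_divide_less_eq)
    hence 2: "nm T2 < e" using 2 by simp
    have "nm T3 \<le> nm w ^ J" unfolding T3_def R_def
      by (intro nm_sum_le nm_fps_mult_le Ei_Zq beta_approx bZ w) simp
    hence 3: "nm T3 < e" using J by simp
    have "(\<Sum>j<J. (\<Sum>i<L. fps_nth (b i j * Ei ^ i) n) * w ^ j) = (\<Sum>i<L. fps_nth ((\<Sum>j<J. fps_const (w ^ j) * b i j) * Ei ^ i) n)"
      unfolding sum_distrib_right by (subst sum.swap) (simp add: fps_sum_nth mult.assoc mult.commute[of _ "w ^ _"])
    hence "(\<Sum>i<L. fps_nth (katz_beta (b i) w * Ei ^ i) n) - H = T3 - T2 - T1"
      unfolding T1_def T2_def T3_def D_def R_def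
      by (simp add: sum_subtractf left_diff_distrib fps_sum_nth)
    moreover have "nm (T3 - T2 - T1) < e" using nm_diff[of "T3 - T2" T1] nm_diff[of T3 T2] 1 2 3 by linarith
    ultimately show "nm ((\<Sum>i<L. fps_nth (katz_beta (b i) w * Ei ^ i) n) - H) < e" by simp
  qed
qed

theorem family_exists:
  "\<exists>b. eis_katz_family p g b \<and> (\<forall>i j. of_nat p ^ j * b i j \<in> K.pI (nat \<lceil>c_const p * real i\<rceil>))"
proof -
  have c: "0 < c_const p" using c_const_bounds(1)[OF p_ge_5] .
  obtain b where b': "(\<forall>i j. b i j \<in> B i) \<and> (\<forall>i j. of_nat p ^ j * b i j \<in> K.pI (nat \<lceil>c_const p * real i\<rceil>)) \<and>
    (\<forall>j N L. real N \<le> c_const p * real L \<longrightarrow> of_nat p ^ j * (Fj j - (\<Sum>i<L. b i j * Ei ^ i)) \<in> K.pI N)"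
    using Fj_kz by (rule exE)
  have b: "b i j \<in> B i" "of_nat p ^ j * b i j \<in> K.pI (nat \<lceil>c_const p * real i\<rceil>)"
    "real N \<le> c_const p * real L \<Longrightarrow> of_nat p ^ j * (Fj j - (\<Sum>i<L. b i j * Ei ^ i)) \<in> K.pI N" for i j N L
    using b' by simp_all
  have "eis_katz_family p g b" unfolding eis_katz_family_def is_katz_expansion_def
  proof (intro conjI allI ballI b(1))
    fix \<kappa> :: "'c \<Rightarrow> 'c" assume "\<kappa> \<in> weight_chars_B p - {trivial_char}"
    hence \<kappa>: "\<kappa> \<in> weight_chars_B p" by simp
    have w: "nm (wt p \<kappa>) < 1" using \<kappa> char_w_small(1) unfolding weight_chars_B_def by blast
    show "katz_beta (b i) (wt p \<kappa>) \<in> katz_B p g (value_ring p \<kappa>) i" for i by (rule beta_katz_B[OF b(1) \<kappa>])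
    show "\<exists>\<rho>>0. (\<lambda>i. vp_fps p (katz_beta (b i) (wt p \<kappa>)) - ereal (\<rho> * real i)) \<longlonglongrightarrow> \<infinity>"
      by (rule beta_growth[OF B_Zq[OF b(1)] b(2) c w])
    show "(\<lambda>i. fps_nth (katz_beta (b i) (wt p \<kappa>) / E ^ i) n) sums fps_nth (Eis_star p \<kappa> / V_op p (Eis_star p \<kappa>)) n" for n
      by (rule beta_sums[OF b(1) b(3) c \<kappa>])
  qed
  thus ?thesis using b(2) by blast
qed

section \<open>Uniqueness of Katz expansions and of the family\<close>

lemma growth_pI:
  assumes "(\<lambda>i. vp_fps p (x i) - ereal (\<rho> * real i)) \<longlonglongrightarrow> \<infinity>" "\<rho> > 0" "\<And>i. x i \<in> Zq"
  shows "\<exists>I. \<forall>i\<ge>I. x i \<in> K.pI N"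
proof -
  have "eventually (\<lambda>i. ereal (real N) < vp_fps p (x i) - ereal (\<rho> * real i)) sequentially"
    using assms(1) unfolding tendsto_PInfty by blast
  then obtain I where I: "\<And>i. i \<ge> I \<Longrightarrow> ereal (real N) < vp_fps p (x i) - ereal (\<rho> * real i)"
    unfolding eventually_sequentially by blast
  have "x i \<in> K.pI N" if "i \<ge> I" for i
  proof -
    have "vp_fps p (x i) - ereal (\<rho> * real i) \<le> vp_fps p (x i) - 0"
      using assms(2) by (intro ereal_minus_mono) auto
    hence "ereal (real N) \<le> vp_fps p (x i)" using I[OF that] by simp
    thus ?thesis unfolding vp_fps_ge_iff K_pI_iff pe_powr using assms(3) by blast
  qed
  thus ?thesis by blast
qed

text \<open>Modulo p^N only finitely many terms remain, and their sum is divisible by p^N because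
  the whole series is 0; \<open>kz_pI\<close> passes this to each coefficient.\<close>

lemma katz_unique:
  assumes d: "\<And>i. d i \<in> B i" and small: "\<And>N. \<exists>I. \<forall>i\<ge>I. d i \<in> K.pI N"
    and s: "\<And>n. (\<lambda>i. fps_nth (d i * Ei ^ i) n) sums 0"
  shows "d i = 0"
proof (rule K_pI_eq_0)
  fix N
  obtain I where I: "\<And>i. i \<ge> I \<Longrightarrow> d i \<in> K.pI N" using small by blast
  define y where "y = (\<Sum>i<I. d i * Ei ^ i)"
  have yZ: "y \<in> Zq" unfolding y_def by (intro Zq_sum Zq_mult Ei_Zq B_Zq[OF d])
  have "nm (fps_nth y n) \<le> pe N" for n
  proof -
    have lim: "(\<lambda>L. \<Sum>i<L. fps_nth (d i * Ei ^ i) n) \<longlonglongrightarrow> 0" using s[of n] unfolding sums_def .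
    have "nm (0 - fps_nth y n) \<le> pe N"
    proof (rule LIMSEQ_nm_le[OF lim])
      fix L assume L: "L \<ge> I"
      have "(\<Sum>i<L. d i * Ei ^ i) - y = (\<Sum>i\<in>{..<L} - {..<I}. d i * Ei ^ i)"
        unfolding y_def by (subst sum_diff) (use L in auto)
      also have "\<dots> \<in> K.pI N" by (intro K.pI_sum K.pI_mult_right Ei_Zq I) auto
      finally have "nm (fps_nth ((\<Sum>i<L. d i * Ei ^ i) - y) n) \<le> pe N" unfolding K_pI_iff by blast
      thus "nm ((\<Sum>i<L. fps_nth (d i * Ei ^ i) n) - fps_nth y n) \<le> pe N" by (simp add: fps_sum_nth)
    qed
    thus ?thesis by simp
  qed
  hence yN: "y \<in> K.pI N" using yZ unfolding K_pI_iff by blast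
  define d' where "d' = (\<lambda>i. if i < I then d i else 0)"
  have "y = (\<Sum>i<L. d' i * Ei ^ i)" if "L \<ge> I" for L
    unfolding y_def using that by (intro sum.mono_neutral_cong_left) (auto simp: d'_def)
  moreover have "\<forall>l. d' l \<in> B l" using d B_zero by (auto simp: d'_def)
  ultimately have "kz y d'" unfolding kz_def by blast
  from kz_pI[OF this yN, of i] show "d i \<in> K.pI N" using I[of i] by (cases "i < I") (auto simp: d'_def)
qed

lemma wt_kap_small: "\<exists>m\<ge>1. nm (wt p (kap m)) = pe (Suc N)"
proof -
  obtain k where k: "\<not> p dvd k" "K.tau (p ^ N) = p ^ N * k" using K.tau_p_power by blast
  have "wt p (kap (p ^ N)) = of_nat p ^ Suc N * of_nat k" unfolding wt_kap_eq k(2) by simp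
  hence "nm (wt p (kap (p ^ N))) = pe (Suc N)" by (simp only: nm_mult nm_p_power nm_coprime_nat[OF k(1)] mult_1_right)
  moreover have "p ^ N \<ge> 1" using p_gt_1 by simp
  ultimately show ?thesis by blast
qed

text \<open>There are zeros w of arbitrarily small nonzero norm; if the coefficients below j vanish,
  the j-th one has norm at most |w|.\<close>

lemma evals_zero_unique:
  assumes "r \<in> Zq" "\<And>m. m \<ge> 1 \<Longrightarrow> evals (wt p (kap m)) r 0"
  shows "fps_nth r j = 0"
proof (induction j rule: less_induct)
  case (less j)
  show ?case
  proof (rule nm_zeroI)
    fix N
    obtain m where m: "m \<ge> 1" "nm (wt p (kap m)) = pe (Suc N)" using wt_kap_small by blast
    define w where "w = wt p (kap m)"
    have "nm (0 - (\<Sum>i<Suc j. fps_nth r i * w ^ i)) \<le> nm w ^ Suc j"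
      using assms(2)[OF m(1)] unfolding evals_def w_def by blast
    moreover have "(\<Sum>i<Suc j. fps_nth r i * w ^ i) = fps_nth r j * w ^ j" using less by simp
    ultimately have "nm (fps_nth r j) * nm w ^ j \<le> nm w * nm w ^ j" by (simp add: nm_mult nm_power)
    moreover have "nm w > 0" using m(2) by (simp add: w_def del: nm_pos)
    ultimately have "nm (fps_nth r j) \<le> nm w" by simp
    also have "\<dots> \<le> pe N" unfolding w_def m(2) by (rule pe_mono) simp
    finally show "nm (fps_nth r j) \<le> pe N" .
  qed
qed

text \<open>At a classical character w lies in p Z_p, so the specialised coefficients belong to B_i
  over Z_p and Katz uniqueness applies without extension of scalars.\<close>

theorem family_unique:
  assumes "eis_katz_family p g b" "eis_katz_family p g b'"
  shows "b i j = b' i j"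
proof -
  have B: "b i j \<in> B i" "b' i j \<in> B i" for i j using assms unfolding eis_katz_family_def by auto
  have Z: "b i j \<in> Zq" "b' i j \<in> Zq" for i j using B B_Zq by blast+
  have eq: "katz_beta (b i) (wt p (kap m)) = katz_beta (b' i) (wt p (kap m))" if m: "m \<ge> 1" for m i
  proof -
    define w where "w = wt p (kap m)"
    have w1: "nm w \<le> pe 1" unfolding w_def by (rule nm_wt_kap)
    hence w: "nm w < 1" using pe_1_less by linarith
    have wZ: "w \<in> Zc" unfolding w_def by (rule wt_kap_Zp)
    have "kap m \<noteq> trivial_char"
    proof
      assume "kap m = trivial_char"
      hence "wt p (kap m) = 0" using one_plus_unit[of 1] by (simp add: wt_def trivial_char_def)
      hence "(of_nat ((1 + p) ^ ((p - 1) * m)) :: 'c) = of_nat 1" unfolding wt_kap by simp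
      hence "(1 + p) ^ ((p - 1) * m) = 1" unfolding of_nat_eq_iff .
      moreover have "(1 + p) ^ ((p - 1) * m) > 1" by (rule one_less_power) (use m p_gt_1 in simp_all)
      ultimately show False by linarith
    qed
    hence \<kappa>: "kap m \<in> weight_chars_B p - {trivial_char}" using kap_B by blast
    define H where "H = Eis_star p (kap m) / V_op p (Eis_star p (kap m))"
    have ke: "is_katz_expansion p g (value_ring p (kap m)) H (\<lambda>i. katz_beta (a i) w)"
      if "eis_katz_family p g a" for a using that \<kappa> unfolding eis_katz_family_def w_def H_def by blast
    have bB: "katz_beta (a i) w \<in> B i" if a: "\<And>j. a i j \<in> B i" for a i
    proof -
      have aZ: "\<And>j. a i j \<in> Zq" using a B_Zq by blast
      have "fps_nth (katz_beta (a i) w) n \<in> Zc" for n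
        by (rule evals_Zp[OF beta_evals[OF aZ w] _ wZ w1]) (use Zq_D[OF aZ] in \<open>simp add: Zq_def\<close>)
      thus ?thesis unfolding B_iff using beta_pr[OF a w] by (simp add: Zq_def)
    qed
    have pI: "\<exists>I. \<forall>i\<ge>I. katz_beta (a i) w \<in> K.pI N"
      if a: "eis_katz_family p g a" and aB: "\<And>i j. a i j \<in> B i" for a N
    proof -
      obtain \<rho> where "\<rho> > 0" "(\<lambda>i. vp_fps p (katz_beta (a i) w) - ereal (\<rho> * real i)) \<longlonglongrightarrow> \<infinity>"
        using ke[OF a] unfolding is_katz_expansion_def by blast
      thus ?thesis by (intro growth_pI[of _ \<rho>] B_Zq[OF bB] aB)
    qed
    have "katz_beta (b i) w - katz_beta (b' i) w = 0"
    proof (rule katz_unique[of "\<lambda>i. katz_beta (b i) w - katz_beta (b' i) w"])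
      show "katz_beta (b i) w - katz_beta (b' i) w \<in> B i" for i by (intro B_diff bB B)
      show "\<exists>I. \<forall>i\<ge>I. katz_beta (b i) w - katz_beta (b' i) w \<in> K.pI N" for N
      proof -
        obtain I where "\<forall>i\<ge>I. katz_beta (b i) w \<in> K.pI N" using pI[OF assms(1) B(1)] by blast
        moreover obtain I' where "\<forall>i\<ge>I'. katz_beta (b' i) w \<in> K.pI N" using pI[OF assms(2) B(2)] by blast
        ultimately show ?thesis by (intro exI[of _ "max I I'"]) (auto intro: K.pI_diff)
      qed
      fix n
      have "(\<lambda>i. fps_nth (katz_beta (b i) w * Ei ^ i) n) sums fps_nth H n"
        and "(\<lambda>i. fps_nth (katz_beta (b' i) w * Ei ^ i) n) sums fps_nth H n"
        using ke[OF assms(1)] ke[OF assms(2)] unfolding is_katz_expansion_def divide_E_power by simp_all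
      hence l: "(\<lambda>L. \<Sum>i<L. fps_nth (katz_beta (b i) w * Ei ^ i) n) \<longlonglongrightarrow> fps_nth H n"
        "(\<lambda>L. \<Sum>i<L. fps_nth (katz_beta (b' i) w * Ei ^ i) n) \<longlonglongrightarrow> fps_nth H n" unfolding sums_def by auto
      show "(\<lambda>i. fps_nth ((katz_beta (b i) w - katz_beta (b' i) w) * Ei ^ i) n) sums 0"
        unfolding sums_def LIMSEQ_nm_iff
      proof (intro allI impI)
        fix e :: real assume "e > 0"
        obtain L1 where L1: "\<And>L. L \<ge> L1 \<Longrightarrow> nm ((\<Sum>i<L. fps_nth (katz_beta (b i) w * Ei ^ i) n) - fps_nth H n) < e"
          using l(1) \<open>e > 0\<close> unfolding LIMSEQ_nm_iff by blast
        obtain L2 where L2: "\<And>L. L \<ge> L2 \<Longrightarrow> nm ((\<Sum>i<L. fps_nth (katz_beta (b' i) w * Ei ^ i) n) - fps_nth H n) < e"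
          using l(2) \<open>e > 0\<close> unfolding LIMSEQ_nm_iff by blast
        have "nm ((\<Sum>i<L. fps_nth ((katz_beta (b i) w - katz_beta (b' i) w) * Ei ^ i) n) - 0) < e" if "L \<ge> max L1 L2" for L
        proof -
          define X where "X = (\<Sum>i<L. fps_nth (katz_beta (b i) w * Ei ^ i) n)"
          define Y where "Y = (\<Sum>i<L. fps_nth (katz_beta (b' i) w * Ei ^ i) n)"
          have "nm (X - fps_nth H n) < e" "nm (Y - fps_nth H n) < e" unfolding X_def Y_def using that by (intro L1 L2; simp)+
          hence "nm ((X - fps_nth H n) - (Y - fps_nth H n)) < e"
            using nm_diff[of "X - fps_nth H n" "Y - fps_nth H n"] by linarith
          moreover have "(\<Sum>i<L. fps_nth ((katz_beta (b i) w - katz_beta (b' i) w) * Ei ^ i) n) = X - Y"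
            unfolding X_def Y_def by (simp add: left_diff_distrib sum_subtractf)
          ultimately show ?thesis by simp
        qed
        thus "\<exists>L0. \<forall>L\<ge>L0. nm ((\<Sum>i<L. fps_nth ((katz_beta (b i) w - katz_beta (b' i) w) * Ei ^ i) n) - 0) < e" by blast
      qed
    qed
    thus ?thesis by (simp add: w_def)
  qed
  show ?thesis
  proof (rule fps_ext)
    fix n
    define r where "r = Abs_fps (\<lambda>j. fps_nth (b i j) n) - Abs_fps (\<lambda>j. fps_nth (b' i j) n)"
    have "r \<in> Zq" unfolding r_def using Zq_D[OF Z(1)] Zq_D[OF Z(2)] by (intro Zq_diff) (simp_all add: Zq_def)
    moreover have "evals (wt p (kap m)) r 0" if "m \<ge> 1" for m
    proof -
      have w: "nm (wt p (kap m)) < 1" using nm_wt_kap[of m] pe_1_less by linarith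
      have "evals (wt p (kap m)) r (fps_nth (katz_beta (b i) (wt p (kap m))) n - fps_nth (katz_beta (b' i) (wt p (kap m))) n)"
        unfolding r_def by (intro evals_diff beta_evals Z w)
      thus ?thesis using eq[OF that] by simp
    qed
    ultimately have "fps_nth r j = 0" by (rule evals_zero_unique)
    thus "fps_nth (b i j) n = fps_nth (b' i j) n" by (simp add: r_def)
  qed
qed

lemma pI_vp_fps:
  assumes "of_nat p ^ j * x \<in> K.pI (nat \<lceil>t\<rceil>)"
  shows "ereal (t - real j) \<le> vp_fps p x"
  unfolding vp_fps_ge_iff
proof
  fix n
  have "nm (of_nat p ^ j * fps_nth x n) \<le> pe (nat \<lceil>t\<rceil>)" using assms unfolding K_pI_iff by simp
  hence "pe j * nm (fps_nth x n) \<le> pe (nat \<lceil>t\<rceil>)" by (simp add: nm_mult nm_p_power)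
  hence "nm (fps_nth x n) \<le> pe (nat \<lceil>t\<rceil>) / pe j" by (simp add: pos_le_divide_eq mult.commute)
  also have "\<dots> = real p powr (- real (nat \<lceil>t\<rceil>) - (- real j))" unfolding pe_powr powr_diff ..
  also have "\<dots> \<le> real p powr (- (t - real j))"
  proof (rule powr_mono)
    show "- real (nat \<lceil>t\<rceil>) - (- real j) \<le> - (t - real j)" by linarith
    show "1 \<le> real p" using p_gt_1 by simp
  qed
  finally show "nm (fps_nth x n) \<le> real p powr (- (t - real j))" .
qed

end

theorem theoremB:
  fixes p :: nat
    and g :: "nat \<Rightarrow> nat \<Rightarrow> 'c :: {field_char_0, complete_space} fps"
  assumes "prime p" and "p \<ge> 5"
    and "padic_complex p TYPE('c)"
    and "katz_basis p g"
  shows "(\<exists>b. eis_katz_family p g b) \<and>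
         0 < c_const p \<and> c_const p < 1 \<and>
         (\<forall>b. eis_katz_family p g b \<longrightarrow>
            (\<forall>i j. vp_fps p (b i j) \<ge> ereal (c_const p * real i - real j)))"
proof -
  interpret katz_setup p "TYPE('c)" g by unfold_locales (fact assms)+
  obtain a where a: "eis_katz_family p g a"
    "\<And>i j. of_nat p ^ j * a i j \<in> K.pI (nat \<lceil>c_const p * real i\<rceil>)"
    using family_exists by blast
  have "ereal (c_const p * real i - real j) \<le> vp_fps p (b i j)" if "eis_katz_family p g b" for b i j
    unfolding family_unique[OF that a(1)] by (rule pI_vp_fps[OF a(2)])
  thus ?thesis using a(1) c_const_bounds(1,2)[OF assms(2)] by blast
qed

end
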